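(* If $\Gamma$ is a filtered formal finitely generated group, then the Hopf algebra $(\mathbb C\Gamma)'$ is filtered formal.
   Context: The base field is $\mathbb C$. Filtered formal Hopf algebras: for a Hopf algebra $O$, let $pr_O:O\to O/\mathbb C1$ be the projection, $\Delta_O^{(n+1)}:O\to O^{\otimes n+1}$ the iterated coproduct, and $F_nO:=\mathrm{Ker}(pr_O^{\otimes n+1}\circ\Delta_O^{(n+1)})$ for $n\ge0$, $F_{-1}O=0$; this is a Hopf algebra filtration. $\mathrm{gr}(O):=\oplus_{n\ge0}F_nO/F_{n-1}O$ is a graded Hopf algebra, which satisfies $F_n(\mathrm{gr}(O))=\oplus_{k\le n}\mathrm{gr}_k(O)$, so that $\mathrm{gr}(\mathrm{gr}(O))$ is identified with $\mathrm{gr}(O)$. $O$ is filtered formal if there is an isomorphism of Hopf algebras $O\to\mathrm{gr}(O)$ (automatically compatible with the filtrations $F_\bullet$) whose associated graded is the identity. Let $\Gamma$ be a finitely generated group, $(\mathbb C\Gamma)_+$ the augmentation ideal of its group algebra. $(\mathbb C\Gamma)'\subset(\mathbb C\Gamma)^*$ is the set of linear forms vanishing on $(\mathbb C\Gamma)_+^{n+1}$ for some $n\ge0$; it is a commutative Hopf algebra with product dual to the coproduct of $\mathbb C\Gamma$ and coproduct determined by $\Delta(\alpha)(h\otimes h')=\alpha(hh')$. Filtered formal groups: a Malcev Lie algebra (MLA) is a Lie algebra $\mathfrak g$ with a decreasing filtration $\mathfrak g=F^1\mathfrak g\supset F^2\mathfrak g\supset\cdots$, $[F^i\mathfrak g,F^j\mathfrak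 g]\subset F^{i+j}\mathfrak g$, for which it is complete and Hausdorff, and such that $\mathrm{gr}\,\mathfrak g$ is generated by $\mathrm{gr}^1\mathfrak g$; morphisms are filtration-compatible Lie algebra morphisms. Let $(\mathbb C\Gamma)^\wedge:=\varprojlim_m\mathbb C\Gamma/(\mathbb C\Gamma)_+^m$ with its natural complete filtration $F^n$ and topological coproduct $\hat\Delta:(\mathbb C\Gamma)^\wedge\to(\mathbb C\Gamma)^\wedge\hat\otimes(\mathbb C\Gamma)^\wedge$ extending that of $\mathbb C\Gamma$. $\mathrm{Lie}(\Gamma)$ is the MLA of primitive elements $\{a\in(\mathbb C\Gamma)^\wedge\mid\hat\Delta(a)=a\otimes1+1\otimes a\}$ with the induced filtration. For an MLA $\mathfrak g$, $\hat{\mathrm{gr}}(\mathfrak g):=\prod_{i\ge1}F^i\mathfrak g/F^{i+1}\mathfrak g$ with filtration $F^n=\prod_{i\ge n}$ is an MLA, with $\mathrm{gr}(\hat{\mathrm{gr}}(\mathfrak g))\simeq\mathrm{gr}(\mathfrak g)$. $\Gamma$ is filtered formal if there is an isomorphism of MLAs $\mathrm{Lie}(\Gamma)\to\hat{\mathrm{gr}}\,\mathrm{Lie}(\Gamma)$ whose associated graded is the identity. *)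

theory Defs
  imports Complex_Main "HOL-Library.Poly_Mapping" "HOL-Algebra.Module" "HOL-Algebra.QuotRing" "HOL-Algebra.Ideal_Product" "HOL-Algebra.Generated_Groups"
begin

section \<open>Linear algebra over the complex numbers\<close>

text \<open>
  Vector spaces are modules in the sense of \<^locale>\<open>module\<close> over the following ring, which is at the
  same time regarded as a one-dimensional vector space. A record of type \<open>(complex, 'a) module\<close>
  also has the fields \<^const>\<open>mult\<close> and \<^const>\<open>one\<close>; they are meaningless when only a vector space
  is under consideration.
\<close>

definition CC :: "(complex, complex) module" where
  "CC = \<lparr>carrier = UNIV, mult = (*), one = 1, zero = 0, add = (+), smult = (*)\<rparr>"

definition linear_maps ::
    "(complex, 'a, 'm) module_scheme \<Rightarrow> (complex, 'b, 'n) module_scheme \<Rightarrow> ('a \<Rightarrow> 'b) set" where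
  "linear_maps V W = {f \<in> carrier V \<rightarrow> carrier W.
     (\<forall>x\<in>carrier V. \<forall>y\<in>carrier V. f (x \<oplus>\<^bsub>V\<^esub> y) = f x \<oplus>\<^bsub>W\<^esub> f y) \<and>
     (\<forall>c. \<forall>x\<in>carrier V. f (c \<odot>\<^bsub>V\<^esub> x) = c \<odot>\<^bsub>W\<^esub> f x)}"

text \<open>The linear extension to formal linear combinations of a map defined on the basis.\<close>

definition lin_ext ::
    "(complex, 'b, 'm) module_scheme \<Rightarrow> ('k \<Rightarrow> 'b) \<Rightarrow> ('k \<Rightarrow>\<^sub>0 complex) \<Rightarrow> 'b" where
  "lin_ext W \<phi> p = (\<Oplus>\<^bsub>W\<^esub>k\<in>Poly_Mapping.keys p. Poly_Mapping.lookup p k \<odot>\<^bsub>W\<^esub> \<phi> k)"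

text \<open>
  The map to \<open>W / M\<close> induced by \<open>f\<close> on a coset \<open>X\<close>: if \<open>f\<close> is linear and maps the subspace of
  which \<open>X\<close> is a coset into \<open>M\<close>, all the cosets in the union coincide.
\<close>

definition coset_map ::
    "(complex, 'b, 'm) module_scheme \<Rightarrow> 'b set \<Rightarrow> ('a \<Rightarrow> 'b) \<Rightarrow> 'a set \<Rightarrow> 'b set" where
  "coset_map W M f X = (\<Union>x\<in>X. M +>\<^bsub>W\<^esub> f x)"

text \<open>The quotient of \<open>V\<close> by a subspace \<open>M\<close>; an algebra if \<open>V\<close> is one and \<open>M\<close> is a two-sided ideal.\<close>

definition quot_mod ::
    "(complex, 'a, 'm) module_scheme \<Rightarrow> 'a set \<Rightarrow> (complex, 'a set) module" where
  "quot_mod V M = ring.extend (V Quot M) (module.fields (\<lambda>c. coset_map V M (smult V c)))"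

text \<open>
  Convolution with respect to a binary operation on the basis, and scaling, of formal linear
  combinations.
\<close>

definition pm_conv ::
    "('k \<Rightarrow> 'k \<Rightarrow> 'k) \<Rightarrow> ('k \<Rightarrow>\<^sub>0 complex) \<Rightarrow> ('k \<Rightarrow>\<^sub>0 complex) \<Rightarrow> ('k \<Rightarrow>\<^sub>0 complex)" where
  "pm_conv m p q = (\<Sum>a\<in>Poly_Mapping.keys p. \<Sum>b\<in>Poly_Mapping.keys q.
     Poly_Mapping.single (m a b) (Poly_Mapping.lookup p a * Poly_Mapping.lookup q b))"

abbreviation pm_scale :: "complex \<Rightarrow> ('k \<Rightarrow>\<^sub>0 complex) \<Rightarrow> ('k \<Rightarrow>\<^sub>0 complex)" where
  "pm_scale c \<equiv> Poly_Mapping.map ((*) c)"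

abbreviation pm_unit :: "'k \<Rightarrow> ('k \<Rightarrow>\<^sub>0 complex)" where
  "pm_unit k \<equiv> Poly_Mapping.single k 1"


section \<open>Tensor powers\<close>

text \<open>
  \<open>V\<^sup>\<otimes>\<^sup>n\<close> is the free vector space on the lists of length \<open>n\<close> of elements of \<open>V\<close>, modulo the
  subspace generated by the multilinearity relations. Lists (rather than iterated pairs) give all
  tensor powers the same type. If \<open>V\<close> is an algebra, so is \<open>V\<^sup>\<otimes>\<^sup>n\<close>, with factorwise product.
\<close>

definition free_tensor ::
    "(complex, 'a, 'm) module_scheme \<Rightarrow> nat \<Rightarrow> (complex, 'a list \<Rightarrow>\<^sub>0 complex) module" where
  "free_tensor V n =
     \<lparr>carrier = {p. \<forall>xs\<in>Poly_Mapping.keys p. length xs = n \<and> set xs \<subseteq> carrier V},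
      mult = pm_conv (map2 (mult V)),
      one = pm_unit (replicate n \<one>\<^bsub>V\<^esub>),
      zero = 0, add = (+), smult = pm_scale\<rparr>"

inductive_set tensor_rel ::
    "(complex, 'a, 'm) module_scheme \<Rightarrow> nat \<Rightarrow> ('a list \<Rightarrow>\<^sub>0 complex) set"
  for V n where
  zero: "0 \<in> tensor_rel V n"
| add: "\<lbrakk>p \<in> tensor_rel V n; q \<in> tensor_rel V n\<rbrakk> \<Longrightarrow> p + q \<in> tensor_rel V n"
| scale: "p \<in> tensor_rel V n \<Longrightarrow> pm_scale c p \<in> tensor_rel V n"
| additivity: "\<lbrakk>x \<in> carrier V; y \<in> carrier V; set xs \<subseteq> carrier V; set ys \<subseteq> carrier V;
     Suc (length xs + length ys) = n\<rbrakk> \<Longrightarrow>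
     pm_unit (xs @ [x \<oplus>\<^bsub>V\<^esub> y] @ ys) - pm_unit (xs @ [x] @ ys) - pm_unit (xs @ [y] @ ys)
       \<in> tensor_rel V n"
| homogeneity: "\<lbrakk>x \<in> carrier V; set xs \<subseteq> carrier V; set ys \<subseteq> carrier V;
     Suc (length xs + length ys) = n\<rbrakk> \<Longrightarrow>
     pm_unit (xs @ [c \<odot>\<^bsub>V\<^esub> x] @ ys) - pm_scale c (pm_unit (xs @ [x] @ ys)) \<in> tensor_rel V n"

type_synonym 'a tensor = "('a list \<Rightarrow>\<^sub>0 complex) set"

definition tensor_pow ::
    "(complex, 'a, 'm) module_scheme \<Rightarrow> nat \<Rightarrow> (complex, 'a tensor) module" where
  "tensor_pow V n = quot_mod (free_tensor V n) (tensor_rel V n)"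

definition pure_tensor :: "(complex, 'a, 'm) module_scheme \<Rightarrow> 'a list \<Rightarrow> 'a tensor" where
  "pure_tensor V xs =
     tensor_rel V (length xs) +>\<^bsub>free_tensor V (length xs)\<^esub> pm_unit xs"

text \<open>
  The universal property: the linear map to \<open>W\<close> induced by a multilinear map \<open>\<phi>\<close>. By
  multilinearity the value does not depend on the representative of the tensor \<open>X\<close>.
\<close>

definition tensor_lift ::
    "(complex, 'b, 'm) module_scheme \<Rightarrow> ('a list \<Rightarrow> 'b) \<Rightarrow> 'a tensor \<Rightarrow> 'b" where
  "tensor_lift W \<phi> X = the_elem (lin_ext W \<phi> ` X)"

text \<open>\<open>f\<^sup>\<otimes>\<^sup>n\<close>, for a linear map \<open>f\<close> with values in \<open>W\<close>.\<close>

definition tensor_map ::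
    "(complex, 'b, 'm) module_scheme \<Rightarrow> nat \<Rightarrow> ('a \<Rightarrow> 'b) \<Rightarrow> 'a tensor \<Rightarrow> 'b tensor" where
  "tensor_map W n f = tensor_lift (tensor_pow W n) (\<lambda>xs. pure_tensor W (map f xs))"


section \<open>Hopf algebras\<close>

record 'a hopf = "(complex, 'a) module" +
  comult :: "'a \<Rightarrow> 'a tensor"
  counit :: "'a \<Rightarrow> complex"

text \<open>The coproduct applied to the factor with index \<open>i\<close> of a tensor in \<open>H\<^sup>\<otimes>\<^sup>n\<close>.\<close>

definition comult_at ::
    "('a, 'm) hopf_scheme \<Rightarrow> nat \<Rightarrow> nat \<Rightarrow> 'a tensor \<Rightarrow> 'a tensor" where
  "comult_at H n i = tensor_lift (tensor_pow H (Suc n)) (\<lambda>xs.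
     tensor_lift (tensor_pow H (Suc n))
       (\<lambda>ys. pure_tensor H (take i xs @ ys @ drop (Suc i) xs)) (comult H (xs ! i)))"

text \<open>No antipode is included in the signature: it is unique if it exists, and bialgebra morphisms
  between Hopf algebras preserve it.\<close>

locale hopf_algebra =
  fixes H :: "('a, 'm) hopf_scheme" (structure)
  assumes is_module: "module CC H"
    and is_ring: "ring H"
    and smult_mult_left:
      "\<lbrakk>x \<in> carrier H; y \<in> carrier H\<rbrakk> \<Longrightarrow> (c \<odot> x) \<otimes> y = c \<odot> (x \<otimes> y)"
    and smult_mult_right:
      "\<lbrakk>x \<in> carrier H; y \<in> carrier H\<rbrakk> \<Longrightarrow> x \<otimes> (c \<odot> y) = c \<odot> (x \<otimes> y)"
    and comult_linear: "comult H \<in> linear_maps H (tensor_pow H 2)"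
    and comult_hom: "comult H \<in> ring_hom H (tensor_pow H 2)"
    and counit_linear: "counit H \<in> linear_maps H CC"
    and counit_hom: "counit H \<in> ring_hom H CC"
    and coassoc:
      "x \<in> carrier H \<Longrightarrow> comult_at H 2 0 (comult H x) = comult_at H 2 1 (comult H x)"
    and counit_left:
      "x \<in> carrier H \<Longrightarrow> tensor_lift H (\<lambda>xs. counit H (xs ! 0) \<odot> xs ! 1) (comult H x) = x"
    and counit_right:
      "x \<in> carrier H \<Longrightarrow> tensor_lift H (\<lambda>xs. counit H (xs ! 1) \<odot> xs ! 0) (comult H x) = x"
    and antipode:
      "\<exists>S\<in>linear_maps H H. \<forall>x\<in>carrier H.
         tensor_lift H (\<lambda>xs. S (xs ! 0) \<otimes> xs ! 1) (comult H x) = counit H x \<odot> \<one> \<and>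
         tensor_lift H (\<lambda>xs. xs ! 0 \<otimes> S (xs ! 1)) (comult H x) = counit H x \<odot> \<one>"

definition hopf_iso ::
    "('a, 'm) hopf_scheme \<Rightarrow> ('b, 'n) hopf_scheme \<Rightarrow> ('a \<Rightarrow> 'b) set" where
  "hopf_iso H K = {f. bij_betw f (carrier H) (carrier K) \<and>
     f \<in> linear_maps H K \<and> f \<in> ring_hom H K \<and>
     (\<forall>x\<in>carrier H. comult K (f x) = tensor_map K 2 f (comult H x)) \<and>
     (\<forall>x\<in>carrier H. counit K (f x) = counit H x)}"


section \<open>Filtered formal Hopf algebras\<close>

text \<open>\<open>iter_comult H n\<close> is the iterated coproduct \<open>\<Delta>\<^sup>(\<^sup>n\<^sup>+\<^sup>1\<^sup>) : H \<rightarrow> H\<^sup>\<otimes>\<^sup>n\<^sup>+\<^sup>1\<close>.\<close>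

primrec iter_comult :: "('a, 'm) hopf_scheme \<Rightarrow> nat \<Rightarrow> 'a \<Rightarrow> 'a tensor" where
  "iter_comult H 0 x = pure_tensor H [x]"
| "iter_comult H (Suc n) x = comult_at H (Suc n) 0 (iter_comult H n x)"

definition unit_line :: "('a, 'm) hopf_scheme \<Rightarrow> 'a set" where
  "unit_line H = {c \<odot>\<^bsub>H\<^esub> \<one>\<^bsub>H\<^esub> | c. True}"

definition hopf_fil :: "('a, 'm) hopf_scheme \<Rightarrow> int \<Rightarrow> 'a set" where
  "hopf_fil H k =
     (if k < 0 then {\<zero>\<^bsub>H\<^esub>}
      else let n = nat k; Q = quot_mod H (unit_line H); pr = (\<lambda>x. unit_line H +>\<^bsub>H\<^esub> x)
           in {x \<in> carrier H.
                tensor_map Q (Suc n) pr (iter_comult H n x) = \<zero>\<^bsub>tensor_pow Q (Suc n)\<^esub>})"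

definition gr_comp :: "('a, 'm) hopf_scheme \<Rightarrow> nat \<Rightarrow> (complex, 'a set) module" where
  "gr_comp H n = quot_mod (H\<lparr>carrier := hopf_fil H (int n)\<rparr>) (hopf_fil H (int n - 1))"

definition gr_incl :: "('a, 'm) hopf_scheme \<Rightarrow> nat \<Rightarrow> 'a set \<Rightarrow> nat \<Rightarrow> 'a set" where
  "gr_incl H n X = (\<lambda>k. if k = n then X else \<zero>\<^bsub>gr_comp H k\<^esub>)"

definition gr_alg :: "('a, 'm) hopf_scheme \<Rightarrow> (complex, nat \<Rightarrow> 'a set) module" where
  "gr_alg H =
     \<lparr>carrier = {\<xi>. (\<forall>n. \<xi> n \<in> carrier (gr_comp H n)) \<and> finite {n. \<xi> n \<noteq> \<zero>\<^bsub>gr_comp H n\<^esub>}},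
      mult = (\<lambda>\<xi> \<eta> n. \<Oplus>\<^bsub>gr_comp H n\<^esub>i\<in>{..n}.
        rcoset_mult H (hopf_fil H (int n - 1)) (\<xi> i) (\<eta> (n - i))),
      one = gr_incl H 0 (hopf_fil H (- 1) +>\<^bsub>H\<^esub> \<one>\<^bsub>H\<^esub>),
      zero = (\<lambda>n. \<zero>\<^bsub>gr_comp H n\<^esub>),
      add = (\<lambda>\<xi> \<eta> n. \<xi> n \<oplus>\<^bsub>gr_comp H n\<^esub> \<eta> n),
      smult = (\<lambda>c \<xi> n. c \<odot>\<^bsub>gr_comp H n\<^esub> \<xi> n)\<rparr>"

text \<open>
  The coproduct of \<open>gr H\<close> in degree \<open>n\<close>: for \<open>x \<in> F\<^sub>n H\<close>, write
  \<open>\<Delta>(x) = \<Sum> c u \<otimes> v\<close> with \<open>u \<in> F\<^sub>i H\<close>, \<open>v \<in> F\<^sub>j H\<close>, \<open>i + j = n\<close>; the image of the class of \<open>x\<close>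
  is then \<open>\<Sum> c [u]\<^sub>i \<otimes> [v]\<^sub>j\<close>. The formal combination \<open>P\<close> records such a decomposition.
\<close>

definition gr_comult_comp ::
    "('a, 'm) hopf_scheme \<Rightarrow> nat \<Rightarrow> 'a set \<Rightarrow> (nat \<Rightarrow> 'a set) tensor" where
  "gr_comult_comp H n X = (THE t. \<exists>x\<in>X. \<exists>P :: ((nat \<times> 'a) \<times> (nat \<times> 'a)) \<Rightarrow>\<^sub>0 complex.
     Poly_Mapping.keys P \<subseteq> {((i, u), (j, v)). i + j = n \<and> u \<in> hopf_fil H (int i) \<and>
                                               v \<in> hopf_fil H (int j)} \<and>
     comult H x =
       lin_ext (tensor_pow H 2) (\<lambda>((i, u), (j, v)). pure_tensor H [u, v]) P \<and>
     t = lin_ext (tensor_pow (gr_alg H) 2)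
       (\<lambda>((i, u), (j, v)). pure_tensor (gr_alg H)
          [gr_incl H i (hopf_fil H (int i - 1) +>\<^bsub>H\<^esub> u),
           gr_incl H j (hopf_fil H (int j - 1) +>\<^bsub>H\<^esub> v)]) P)"

definition gr_hopf :: "('a, 'm) hopf_scheme \<Rightarrow> (nat \<Rightarrow> 'a set) hopf" where
  "gr_hopf H = module.extend (gr_alg H) (hopf.fields
     (\<lambda>\<xi>. \<Oplus>\<^bsub>tensor_pow (gr_alg H) 2\<^esub>n\<in>{n. \<xi> n \<noteq> \<zero>\<^bsub>gr_comp H n\<^esub>}. gr_comult_comp H n (\<xi> n))
     (\<lambda>\<xi>. the_elem (counit H ` \<xi> 0)))"

text \<open>
  In the last condition the left-hand side is \<open>gr\<^sub>n(f)\<close> applied to \<open>X \<in> gr\<^sub>n(H)\<close>, an element of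
  \<open>gr\<^sub>n(gr(H)) = F\<^sub>n(gr(H)) / F\<^sub>n\<^sub>-\<^sub>1(gr(H))\<close>; the right-hand side is the image of \<open>X\<close> under the canonical
  identification of \<open>gr\<^sub>n(H)\<close> with \<open>gr\<^sub>n(gr(H))\<close>.
\<close>

definition filtered_formal_hopf :: "('a, 'm) hopf_scheme \<Rightarrow> bool" where
  "filtered_formal_hopf H \<longleftrightarrow> hopf_algebra H \<and>
     (\<exists>f\<in>hopf_iso H (gr_hopf H). \<forall>n. \<forall>X\<in>carrier (gr_comp H n).
        coset_map (gr_hopf H) (hopf_fil (gr_hopf H) (int n - 1)) f X =
        hopf_fil (gr_hopf H) (int n - 1) +>\<^bsub>gr_hopf H\<^esub> gr_incl H n X)"


section \<open>The group algebra and its restricted dual\<close>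

definition group_alg :: "('g, 'm) monoid_scheme \<Rightarrow> (complex, 'g \<Rightarrow>\<^sub>0 complex) module" where
  "group_alg G =
     \<lparr>carrier = {p. Poly_Mapping.keys p \<subseteq> carrier G},
      mult = pm_conv (mult G), one = pm_unit \<one>\<^bsub>G\<^esub>,
      zero = 0, add = (+), smult = pm_scale\<rparr>"

definition group_hopf :: "('g, 'm) monoid_scheme \<Rightarrow> ('g \<Rightarrow>\<^sub>0 complex) hopf" where
  "group_hopf G = module.extend (group_alg G) (hopf.fields
     (lin_ext (tensor_pow (group_alg G) 2)
        (\<lambda>g. pure_tensor (group_alg G) [pm_unit g, pm_unit g]))
     (lin_ext CC (\<lambda>g. 1)))"

definition aug_ideal :: "('g, 'm) monoid_scheme \<Rightarrow> ('g \<Rightarrow>\<^sub>0 complex) set" where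
  "aug_ideal G = {p \<in> carrier (group_hopf G). counit (group_hopf G) p = 0}"

primrec aug_power :: "('g, 'm) monoid_scheme \<Rightarrow> nat \<Rightarrow> ('g \<Rightarrow>\<^sub>0 complex) set" where
  "aug_power G 0 = carrier (group_hopf G)"
| "aug_power G (Suc n) = ideal_prod (group_hopf G) (aug_power G n) (aug_ideal G)"

text \<open>
  Linear forms on the group algebra are taken extensional, so that they are determined by their
  values on its carrier.
\<close>

definition dual_alg ::
    "('g, 'm) monoid_scheme \<Rightarrow> (complex, ('g \<Rightarrow>\<^sub>0 complex) \<Rightarrow> complex) module" where
  "dual_alg G = (let A = group_hopf G in
     \<lparr>carrier = {\<alpha> \<in> linear_maps A CC \<inter> extensional (carrier A).
                   \<exists>n. \<forall>x\<in>aug_power G (Suc n). \<alpha> x = 0},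
      mult = (\<lambda>\<alpha> \<beta>. \<lambda>x\<in>carrier A. tensor_lift CC (\<lambda>xs. \<alpha> (xs ! 0) * \<beta> (xs ! 1)) (comult A x)),
      one = (\<lambda>x\<in>carrier A. counit A x),
      zero = (\<lambda>x\<in>carrier A. 0),
      add = (\<lambda>\<alpha> \<beta>. \<lambda>x\<in>carrier A. \<alpha> x + \<beta> x),
      smult = (\<lambda>c \<alpha>. \<lambda>x\<in>carrier A. c * \<alpha> x)\<rparr>)"

definition dual_hopf ::
    "('g, 'm) monoid_scheme \<Rightarrow> (('g \<Rightarrow>\<^sub>0 complex) \<Rightarrow> complex) hopf" where
  "dual_hopf G = (let A = group_hopf G in module.extend (dual_alg G) (hopf.fields
     (\<lambda>\<alpha>. THE t. t \<in> carrier (tensor_pow (dual_alg G) 2) \<and>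
        (\<forall>h\<in>carrier A. \<forall>h'\<in>carrier A.
           tensor_lift CC (\<lambda>\<beta>s. (\<beta>s ! 0) h * (\<beta>s ! 1) h') t = \<alpha> (h \<otimes>\<^bsub>A\<^esub> h')))
     (\<lambda>\<alpha>. \<alpha> \<one>\<^bsub>A\<^esub>)))"


section \<open>Completions\<close>

text \<open>
  The inverse limit of the quotients \<open>V / F m\<close>, for a decreasing sequence \<open>F\<close> of subspaces
  (two-sided ideals if \<open>V\<close> is an algebra).
\<close>

definition completion ::
    "(complex, 'a, 'm) module_scheme \<Rightarrow> (nat \<Rightarrow> 'a set) \<Rightarrow> (complex, nat \<Rightarrow> 'a set) module" where
  "completion V F =
     \<lparr>carrier = {a. (\<forall>m. a m \<in> carrier (quot_mod V (F m))) \<and>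
                    (\<forall>m k. k \<le> m \<longrightarrow> coset_map V (F k) (\<lambda>x. x) (a m) = a k)},
      mult = (\<lambda>a b m. a m \<otimes>\<^bsub>quot_mod V (F m)\<^esub> b m),
      one = (\<lambda>m. \<one>\<^bsub>quot_mod V (F m)\<^esub>),
      zero = (\<lambda>m. \<zero>\<^bsub>quot_mod V (F m)\<^esub>),
      add = (\<lambda>a b m. a m \<oplus>\<^bsub>quot_mod V (F m)\<^esub> b m),
      smult = (\<lambda>c a m. c \<odot>\<^bsub>quot_mod V (F m)\<^esub> a m)\<rparr>"

definition completion_fil ::
    "(complex, 'a, 'm) module_scheme \<Rightarrow> (nat \<Rightarrow> 'a set) \<Rightarrow> nat \<Rightarrow> (nat \<Rightarrow> 'a set) set" where
  "completion_fil V F n = {a \<in> carrier (completion V F). a n = \<zero>\<^bsub>quot_mod V (F n)\<^esub>}"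

definition to_completion ::
    "(complex, 'a, 'm) module_scheme \<Rightarrow> (nat \<Rightarrow> 'a set) \<Rightarrow> 'a \<Rightarrow> nat \<Rightarrow> 'a set" where
  "to_completion V F x = (\<lambda>m. F m +>\<^bsub>V\<^esub> x)"

text \<open>
  The filtration \<open>\<Sum>\<^sub>i\<^sub>+\<^sub>j\<^sub>=\<^sub>m F i \<otimes> F j\<close> of \<open>V \<otimes> V\<close>; the completed tensor square is the completion of
  \<open>V \<otimes> V\<close> with respect to it.
\<close>

definition tensor_fil ::
    "(complex, 'a, 'm) module_scheme \<Rightarrow> (nat \<Rightarrow> 'a set) \<Rightarrow> nat \<Rightarrow> 'a tensor set" where
  "tensor_fil V F m =
     {lin_ext (tensor_pow V 2) (\<lambda>(u, v). pure_tensor V [u, v]) P | P.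
        Poly_Mapping.keys P \<subseteq> (\<Union>i\<le>m. F i \<times> F (m - i))}"

definition ctensor ::
    "(complex, 'a, 'm) module_scheme \<Rightarrow> (nat \<Rightarrow> 'a set) \<Rightarrow> (complex, nat \<Rightarrow> 'a tensor set) module" where
  "ctensor V F = completion (tensor_pow V 2) (tensor_fil V F)"

definition pure_ctensor ::
    "(complex, 'a, 'm) module_scheme \<Rightarrow> (nat \<Rightarrow> 'a set) \<Rightarrow> 'a \<Rightarrow> 'a \<Rightarrow> nat \<Rightarrow> 'a tensor set" where
  "pure_ctensor V F u v = to_completion (tensor_pow V 2) (tensor_fil V F) (pure_tensor V [u, v])"

definition cgroup_alg ::
    "('g, 'm) monoid_scheme \<Rightarrow> (complex, nat \<Rightarrow> ('g \<Rightarrow>\<^sub>0 complex) set) module" where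
  "cgroup_alg G = completion (group_hopf G) (aug_power G)"

definition cgroup_fil ::
    "('g, 'm) monoid_scheme \<Rightarrow> nat \<Rightarrow> (nat \<Rightarrow> ('g \<Rightarrow>\<^sub>0 complex) set) set" where
  "cgroup_fil G = completion_fil (group_hopf G) (aug_power G)"

text \<open>
  The continuous extension of the coproduct of the group algebra to its completion: its component
  of index \<open>m\<close> at \<open>a\<close> is the class of the image of \<open>\<Delta>(x)\<close>, for any \<open>x\<close> in the group algebra
  representing the component \<open>a m\<close>.
\<close>

definition cgroup_comult ::
    "('g, 'm) monoid_scheme \<Rightarrow> (nat \<Rightarrow> ('g \<Rightarrow>\<^sub>0 complex) set) \<Rightarrow>
     nat \<Rightarrow> (nat \<Rightarrow> ('g \<Rightarrow>\<^sub>0 complex) set) tensor set" where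
  "cgroup_comult G a = (\<lambda>m.
     coset_map (tensor_pow (cgroup_alg G) 2) (tensor_fil (cgroup_alg G) (cgroup_fil G) m)
       (\<lambda>x. tensor_map (cgroup_alg G) 2 (to_completion (group_hopf G) (aug_power G))
              (comult (group_hopf G) x))
       (a m))"


section \<open>Malcev Lie algebras and filtered formal groups\<close>

text \<open>
  Signature of filtered Lie algebras. The field \<^const>\<open>mult\<close> holds the Lie bracket, \<^const>\<open>one\<close> is
  unused, and only \<open>lfil g n\<close> with \<open>n \<ge> 1\<close> is relevant.
\<close>

record 'a mla = "(complex, 'a) module" +
  lfil :: "nat \<Rightarrow> 'a set"

definition lie_group_alg ::
    "('g, 'm) monoid_scheme \<Rightarrow> (nat \<Rightarrow> ('g \<Rightarrow>\<^sub>0 complex) set) mla" where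
  "lie_group_alg G = (let
     C = cgroup_alg G;
     F = cgroup_fil G;
     L = {a \<in> carrier C. cgroup_comult G a =
            pure_ctensor C F a \<one>\<^bsub>C\<^esub> \<oplus>\<^bsub>ctensor C F\<^esub> pure_ctensor C F \<one>\<^bsub>C\<^esub> a}
     in \<lparr>carrier = L, mult = (\<lambda>a b. a \<otimes>\<^bsub>C\<^esub> b \<ominus>\<^bsub>C\<^esub> b \<otimes>\<^bsub>C\<^esub> a), one = undefined,
         zero = \<zero>\<^bsub>C\<^esub>, add = add C, smult = smult C, lfil = (\<lambda>n. L \<inter> F n)\<rparr>)"

definition lgr_comp :: "('a, 'm) mla_scheme \<Rightarrow> nat \<Rightarrow> (complex, 'a set) module" where
  "lgr_comp g n = quot_mod (g\<lparr>carrier := lfil g n\<rparr>) (lfil g (Suc n))"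

definition cgr :: "('a, 'm) mla_scheme \<Rightarrow> (nat \<Rightarrow> 'a set) mla" where
  "cgr g = (let C = (\<Pi>\<^sub>E n\<in>{1..}. carrier (lgr_comp g n)) in
     \<lparr>carrier = C,
      mult = (\<lambda>\<xi> \<eta>. \<lambda>n\<in>{1..}. \<Oplus>\<^bsub>lgr_comp g n\<^esub>i\<in>{1..<n}.
        rcoset_mult g (lfil g (Suc n)) (\<xi> i) (\<eta> (n - i))),
      one = undefined,
      zero = (\<lambda>n\<in>{1..}. \<zero>\<^bsub>lgr_comp g n\<^esub>),
      add = (\<lambda>\<xi> \<eta>. \<lambda>n\<in>{1..}. \<xi> n \<oplus>\<^bsub>lgr_comp g n\<^esub> \<eta> n),
      smult = (\<lambda>c \<xi>. \<lambda>n\<in>{1..}. c \<odot>\<^bsub>lgr_comp g n\<^esub> \<xi> n),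
      lfil = (\<lambda>n. {\<xi> \<in> C. \<forall>i\<in>{1..<n}. \<xi> i = \<zero>\<^bsub>lgr_comp g i\<^esub>})\<rparr>)"

definition lgr_incl :: "('a, 'm) mla_scheme \<Rightarrow> nat \<Rightarrow> 'a set \<Rightarrow> nat \<Rightarrow> 'a set" where
  "lgr_incl g n X = (\<lambda>k\<in>{1..}. if k = n then X else \<zero>\<^bsub>lgr_comp g k\<^esub>)"

text \<open>Isomorphisms of filtered Lie algebras; both the map and its inverse respect the filtrations.\<close>

definition mla_iso :: "('a, 'm) mla_scheme \<Rightarrow> ('b, 'n) mla_scheme \<Rightarrow> ('a \<Rightarrow> 'b) set" where
  "mla_iso g h = {f. bij_betw f (carrier g) (carrier h) \<and> f \<in> linear_maps g h \<and>
     (\<forall>x\<in>carrier g. \<forall>y\<in>carrier g. f (x \<otimes>\<^bsub>g\<^esub> y) = f x \<otimes>\<^bsub>h\<^esub> f y) \<and>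
     (\<forall>n\<ge>1. f ` lfil g n = lfil h n)}"

text \<open>
  As for Hopf algebras, the last condition compares \<open>gr\<^sup>n(f)\<close> with the canonical identification of
  \<open>gr\<^sup>n\<close> of \<open>g\<close> with \<open>gr\<^sup>n\<close> of its completed associated graded Lie algebra.
\<close>

definition filtered_formal_mla :: "('a, 'm) mla_scheme \<Rightarrow> bool" where
  "filtered_formal_mla g \<longleftrightarrow>
     (\<exists>f\<in>mla_iso g (cgr g). \<forall>n\<ge>1. \<forall>X\<in>carrier (lgr_comp g n).
        coset_map (cgr g) (lfil (cgr g) (Suc n)) f X =
        lfil (cgr g) (Suc n) +>\<^bsub>cgr g\<^esub> lgr_incl g n X)"

definition filtered_formal_group :: "('g, 'm) monoid_scheme \<Rightarrow> bool" where
  "filtered_formal_group G \<longleftrightarrow> filtered_formal_mla (lie_group_alg G)"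

definition finitely_generated :: "('g, 'm) monoid_scheme \<Rightarrow> bool" where
  "finitely_generated G \<longleftrightarrow> (\<exists>S. finite S \<and> S \<subseteq> carrier G \<and> generate G S = carrier G)"

end

(*
Multiplication by 2^n in degree n, transported along the isomorphism of Lie(Gamma) with its completed
associated graded, is an automorphism sigma of the filtered Lie algebra Lie(Gamma) that acts as 2^n
on gr^n. By the Baker-Campbell-Hausdorff theorem g |-> exp (sigma (log g)) is multiplicative modulo
every power of the augmentation ideal I, with group-like values. Dually this gives a Hopf algebra
endomorphism S of the restricted dual. The n-th step of its coradical filtration is the annihilator
of I^(n+1), which is finite dimensional since Gamma is finitely generated, and S acts as 2^n on gr_n.
The eigenspaces of S therefore split the filtration, compatibly with product and coproduct, and this
splitting is the isomorphism with the associated graded. Identities between tensors of linear forms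
are tested by evaluation at group elements.
*)
theory Submission
  imports Defs "HOL-Computational_Algebra.Formal_Power_Series"
begin

text \<open>Transporting the grading of the Lie algebra directly would require identifying the
  completed group algebra with an enveloping algebra. One operator replaces the whole grading:
  eigenvalues multiply, 2^i 2^j = 2^(i+j), so compatibility with products and coproducts passes from
  \<open>S\<close> to its eigenspaces. The constant 2 enters only through its powers being pairwise
  distinct. The action of sigma need be known only in degree 1, because the powers of I are
  generated by I. The Lie algebra lives in the completion and the forms on the group algebra itself.
  As each form kills some I^(N+1), exponentials are cut at order N and every identity is a
  congruence modulo I^(N+1). Power series with noncommuting coefficients need a type that is an
  algebra, whereas the group algebra is a carrier set; it is therefore embedded into a type of
  operators. Baker-Campbell-Hausdorff is used without a formula: the exponent solves a recursion
  made of brackets, so a relation closed under brackets, such as the graph of sigma, contains the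
  pair formed by the two solutions.\<close>

abbreviation pkeys where "pkeys \<equiv> Poly_Mapping.keys"
abbreviation plookup where "plookup \<equiv> Poly_Mapping.lookup"

section \<open>Finitely supported sums and their pairing with functions\<close>

section \<open>Formal linear combinations\<close>

lemma lookup_pm_scale [simp]: "plookup (pm_scale c p) k = c * plookup p k"
 by (simp add: Poly_Mapping.map.rep_eq when_def)

lemma keys_pm_scale: "pkeys (pm_scale c p) <= pkeys p"
 by (auto simp: in_keys_iff)

lemma pm_scale_add [simp]: "pm_scale c (p + q) = pm_scale c p + pm_scale c q"
 by (rule poly_mapping_eqI) (simp add: lookup_add distrib_left)

lemma pm_scale_diff: "pm_scale c (p - q) = pm_scale c p - pm_scale c q"
 by (rule poly_mapping_eqI) (simp add: lookup_minus right_diff_distrib)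

lemma pm_scale_sum: "pm_scale c (sum f S) = (\<Sum>x\<in>S. pm_scale c (f x))"
 by (rule poly_mapping_eqI) (simp add: lookup_sum sum_distrib_left)

lemma pm_scale_left_add: "pm_scale (c + d) p = pm_scale c p + pm_scale d p"
 by (rule poly_mapping_eqI) (simp add: lookup_add distrib_right)

lemma pm_scale_scale [simp]: "pm_scale c (pm_scale d p) = pm_scale (c * d) p"
 by (rule poly_mapping_eqI) simp

lemma pm_scale_one [simp]: "pm_scale 1 p = p"
 by (rule poly_mapping_eqI) simp

lemma pm_scale_zero_left [simp]: "pm_scale 0 p = 0"
 by (rule poly_mapping_eqI) simp

lemma pm_scale_zero_right [simp]: "pm_scale c 0 = 0"
 by (rule poly_mapping_eqI) simp

lemma pm_scale_minus_one: "pm_scale (- 1) p = - p"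
 by (rule poly_mapping_eqI) simp

text \<open>The linear form on the free vector space that extends \<open>F\<close>, evaluated at
  \<open>p\<close>.\<close>

definition pm_pair :: "('k \<Rightarrow>\<^sub>0 complex) => ('k => complex) => complex" where
 "pm_pair p F = (\<Sum>k\<in>pkeys p. plookup p k * F k)"

lemma pm_pair_superset:
 assumes "finite S" "pkeys p <= S"
 shows "pm_pair p F = (\<Sum>k\<in>S. plookup p k * F k)"
 unfolding pm_pair_def
 by (rule sum.mono_neutral_left) (use assms in "auto simp: in_keys_iff")

lemma pm_pair_zero [simp]: "pm_pair 0 F = 0"
 by (simp add: pm_pair_def)

lemma pm_pair_add [simp]: "pm_pair (p + q) F = pm_pair p F + pm_pair q F"
proof -
 let ?S = "pkeys p \<union> pkeys q"
 have "pkeys (p + q) <= ?S" by (rule keys_add)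
 then show ?thesis
  by (simp add: pm_pair_superset[of ?S] lookup_add distrib_right sum.distrib)
qed

lemma pm_pair_scale [simp]: "pm_pair (pm_scale c p) F = c * pm_pair p F"
 by (simp add: pm_pair_superset[of "pkeys p"] keys_pm_scale sum_distrib_left mult.assoc)

lemma pm_pair_uminus [simp]: "pm_pair (- p) F = - pm_pair p F"
 using pm_pair_scale[of "-1" p F] by (simp only: pm_scale_minus_one) simp

lemma pm_pair_diff [simp]: "pm_pair (p - q) F = pm_pair p F - pm_pair q F"
 using pm_pair_add[of p "- q" F] by simp

lemma pm_pair_sum [simp]: "pm_pair (sum f S) F = (\<Sum>x\<in>S. pm_pair (f x) F)"
 by (induction S rule: infinite_finite_induct) auto

lemma pm_pair_single [simp]: "pm_pair (Poly_Mapping.single k c) F = c * F k"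
 by (cases "c = 0") (auto simp: pm_pair_def)

lemma pm_pair_cong: "(!!k. k \<in> pkeys p ==> F k = F' k) ==> pm_pair p F = pm_pair p F'"
 by (simp add: pm_pair_def)

lemma pm_pair_add_right: "pm_pair p (%k. F k + F' k) = pm_pair p F + pm_pair p F'"
 by (simp add: pm_pair_def distrib_left sum.distrib)

lemma pm_pair_diff_right: "pm_pair p (%k. F k - F' k) = pm_pair p F - pm_pair p F'"
 by (simp add: pm_pair_def right_diff_distrib sum_subtractf)

lemma pm_pair_mult_right: "pm_pair p (%k. c * F k) = c * pm_pair p F"
 by (simp add: pm_pair_def sum_distrib_left mult.left_commute)

lemma pm_pair_mult_right': "pm_pair p (%k. F k * c) = pm_pair p F * c"
 by (simp add: pm_pair_def sum_distrib_right mult.assoc)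

lemma pm_pair_zero_right [simp]: "pm_pair p (%k. 0) = 0"
 by (simp add: pm_pair_def)

lemma pm_pair_commute:
 "pm_pair p (%a. pm_pair q (%b. F a b)) = pm_pair q (%b. pm_pair p (%a. F a b))"
 unfolding pm_pair_def sum_distrib_left
 by (subst sum.swap) (simp add: mult.left_commute)

lemma pm_pair_indicator: "pm_pair p (%k. if k = a then 1 else 0) = plookup p a"
 unfolding pm_pair_def by (simp add: if_distrib in_keys_iff cong: if_cong)

text \<open>Indicator functions recover the coefficients. Testing with functions is convenient
  because \<open>pm_pair\<close> turns convolution and substitution into nested pairings, without
  any bookkeeping of supports.\<close>

lemma pm_pair_eqI: "(!!F. pm_pair p F = pm_pair q F) ==> p = q"
 by (rule poly_mapping_eqI) (metis pm_pair_indicator)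

text \<open>Substitution of \<open>F k\<close> for the basis element \<open>k\<close>. Convolution,
  the maps induced by group homomorphisms and the operator \<open>DD\<close> are instances.\<close>

definition pm_bind :: "('k \<Rightarrow>\<^sub>0 complex) => ('k => ('l \<Rightarrow>\<^sub>0 complex)) => ('l \<Rightarrow>\<^sub>0 complex)" where
 "pm_bind p F = (\<Sum>k\<in>pkeys p. pm_scale (plookup p k) (F k))"

lemma pm_pair_bind [simp]: "pm_pair (pm_bind p F) H = pm_pair p (%k. pm_pair (F k) H)"
 by (simp add: pm_bind_def) (simp add: pm_pair_def)

lemma pm_conv_bind: "pm_conv m p q = pm_bind p (%a. pm_bind q (%b. pm_unit (m a b)))"
 by (simp add: pm_conv_def pm_bind_def pm_scale_sum)

lemma pm_pair_conv [simp]: "pm_pair (pm_conv m p q) H = pm_pair p (%a. pm_pair q (%b. H (m a b)))"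
 by (simp add: pm_conv_bind)

lemma pm_bind_zero [simp]: "pm_bind 0 F = 0"
 by (simp add: pm_bind_def)

lemma pm_bind_add [simp]: "pm_bind (p + q) F = pm_bind p F + pm_bind q F"
 by (rule pm_pair_eqI) simp

lemma pm_bind_scale [simp]: "pm_bind (pm_scale c p) F = pm_scale c (pm_bind p F)"
 by (rule pm_pair_eqI) simp

lemma pm_bind_diff [simp]: "pm_bind (p - q) F = pm_bind p F - pm_bind q F"
 by (rule pm_pair_eqI) simp

lemma pm_bind_single [simp]: "pm_bind (Poly_Mapping.single k c) F = pm_scale c (F k)"
 by (rule pm_pair_eqI) simp

lemma pm_bind_unit_self: "pm_bind p pm_unit = p"
 by (rule pm_pair_eqI) simp

lemma keys_sum_subset:
 fixes f :: "'a => ('k \<Rightarrow>\<^sub>0 'b::comm_monoid_add)"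
 assumes "!!x. x \<in> S ==> pkeys (f x) <= K"
 shows "pkeys (sum f S) <= K"
 using assms
proof (induction S rule: infinite_finite_induct)
 case (insert x F)
 have "pkeys (f x + sum f F) <= pkeys (f x) \<union> pkeys (sum f F)"
  by (rule keys_add)
 then show ?case using insert by auto
qed auto

lemma keys_diff_subset:
 fixes p q :: "'k \<Rightarrow>\<^sub>0 'b::ab_group_add"
 shows "pkeys (p - q) <= pkeys p \<union> pkeys q"
 by (auto simp: in_keys_iff lookup_minus)

lemma keys_pm_bind:
 assumes "!!k. k \<in> pkeys p ==> pkeys (F k) <= K"
 shows "pkeys (pm_bind p F) <= K"
 unfolding pm_bind_def
 by (rule keys_sum_subset) (meson assms keys_pm_scale subset_trans)

lemma keys_pm_conv:
 assumes "!!a b. a \<in> pkeys p ==> b \<in> pkeys q ==> m a b \<in> K"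
 shows "pkeys (pm_conv m p q) <= K"
 unfolding pm_conv_bind by (intro keys_pm_bind) (use assms in auto)

lemma pm_conv_add_left: "pm_conv m (p + p') q = pm_conv m p q + pm_conv m p' q"
 by (rule pm_pair_eqI) simp

lemma pm_conv_add_right: "pm_conv m p (q + q') = pm_conv m p q + pm_conv m p q'"
 by (rule pm_pair_eqI) (simp add: pm_pair_add_right)

lemma pm_conv_diff_left: "pm_conv m (p - p') q = pm_conv m p q - pm_conv m p' q"
 by (rule pm_pair_eqI) simp

lemma pm_conv_diff_right: "pm_conv m p (q - q') = pm_conv m p q - pm_conv m p q'"
 by (rule pm_pair_eqI) (simp add: pm_pair_diff_right)

lemma pm_conv_scale_left: "pm_conv m (pm_scale c p) q = pm_scale c (pm_conv m p q)"
 by (rule pm_pair_eqI) simp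

lemma pm_conv_scale_right: "pm_conv m p (pm_scale c q) = pm_scale c (pm_conv m p q)"
 by (rule pm_pair_eqI) (simp add: pm_pair_mult_right)

lemma pm_conv_zero [simp]: "pm_conv m 0 q = 0" "pm_conv m p 0 = 0"
 by (rule pm_pair_eqI; simp)+

lemma pm_conv_unit: "pm_conv m (pm_unit a) (pm_unit b) = pm_unit (m a b)"
 by (rule pm_pair_eqI) simp

text \<open>Induction over finite subsets of the support: each partial sum keeps its support in
  \<open>K\<close>, and the full sum is \<open>p\<close>.\<close>

lemma pm_induct [consumes 1, case_names zero add]:
 assumes "pkeys p <= K"
  and "P 0"
  and "!!p k c. pkeys p <= K ==> P p ==> k \<in> K ==> P (p + pm_scale c (pm_unit k))"
 shows "P p"
proof -
 have "P (\<Sum>k\<in>S. pm_scale (plookup p k) (pm_unit k)) &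
   pkeys (\<Sum>k\<in>S. pm_scale (plookup p k) (pm_unit k)) <= K"
  if "finite S" "S <= K" for S
  using that
 proof (induction S rule: finite_induct)
  case empty
  then show ?case by (simp add: assms(2))
 next
  case (insert x F)
  let ?s = "\<Sum>k\<in>F. pm_scale (plookup p k) (pm_unit k)"
  have "P (?s + pm_scale (plookup p x) (pm_unit x))"
   using insert assms(3) by auto
  moreover have "pkeys (?s + pm_scale (plookup p x) (pm_unit x)) <= K"
   using keys_add[of ?s "pm_scale (plookup p x) (pm_unit x)"] insert
    keys_pm_scale[of "plookup p x" "pm_unit x"] by auto
  ultimately show ?case using insert by (simp add: add.commute)
 qed
 from this[OF finite_keys assms(1)] show ?thesis
  using pm_bind_unit_self[of p] by (simp add: pm_bind_def)
qed

section \<open>Vector spaces, linear maps, quotients and free spaces over the complex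
  numbers\<close>

section \<open>Complex vector spaces\<close>

lemma CC_simps [simp]: "carrier CC = UNIV" "x \<oplus>\<^bsub>CC\<^esub> y = x + y" "x \<otimes>\<^bsub>CC\<^esub> y = x * y"
 "\<zero>\<^bsub>CC\<^esub> = 0" "\<one>\<^bsub>CC\<^esub> = 1" "x \<odot>\<^bsub>CC\<^esub> y = x * y"
 by (simp_all add: CC_def)

lemma cring_CC: "cring CC"
proof (rule cringI)
 show "abelian_group CC"
  by (rule abelian_groupI) (auto simp: add.assoc intro: exI[of _ "- _"] simp: add.commute ab_left_minus)
 show "comm_monoid CC" by (rule comm_monoidI) (auto simp: mult.assoc mult.commute)
qed (auto simp: distrib_right)

text \<open>The scalars fill their type, so inside this locale the module laws can be restated
  without carrier conditions on scalars.\<close>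

locale vspace = module CC V for V (structure)
begin

lemma smult_in [simp, intro]: "x \<in> carrier V ==> c \<odot> x \<in> carrier V"
 using smult_closed[of c x] by simp

lemma smult_add_left: "x \<in> carrier V ==> (c + d) \<odot> x = c \<odot> x \<oplus> d \<odot> x"
 using smult_l_distr[of c d x] by simp

lemma smult_add_right: "x \<in> carrier V ==> y \<in> carrier V ==> c \<odot> (x \<oplus> y) = c \<odot> x \<oplus> c \<odot> y"
 using smult_r_distr[of c x y] by simp

lemma smult_smult: "x \<in> carrier V ==> c \<odot> (d \<odot> x) = (c * d) \<odot> x"
 using smult_assoc1[of c d x] by simp

lemma smult_1 [simp]: "x \<in> carrier V ==> 1 \<odot> x = x"
 using smult_one[of x] by simp

lemma smult_0 [simp]: "x \<in> carrier V ==> 0 \<odot> x = \<zero>"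
 using smult_l_null[of x] by simp

lemma smult_zero_right [simp]: "c \<odot> \<zero> = \<zero>"
 using smult_r_null[of c] by simp

lemma smult_m1: "x \<in> carrier V ==> (- 1) \<odot> x = \<ominus> x"
proof -
 assume x: "x \<in> carrier V"
 have "(- 1) \<odot> x \<oplus> x = (- 1 + 1) \<odot> x" using x smult_add_left[of x "-1" 1] by simp
 also have "... = \<zero>" using x by simp
 finally show ?thesis using x by (metis M.minus_equality smult_in)
qed

lemma smult_minus_left: "x \<in> carrier V ==> (c - d) \<odot> x = c \<odot> x \<ominus> d \<odot> x"
proof -
 assume x: "x \<in> carrier V"
 have "(c - d) \<odot> x = c \<odot> x \<oplus> (- d) \<odot> x" using smult_add_left[OF x, of c "- d"] by simp
 also have "(- d) \<odot> x = \<ominus> (d \<odot> x)" using smult_smult[OF x, of "-1" d] smult_m1[of "d \<odot> x"] x by simp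
 finally show ?thesis by (simp add: a_minus_def)
qed

lemma minus_eq_zero_iff: "x \<in> carrier V ==> y \<in> carrier V ==> x \<ominus> y = \<zero> \<longleftrightarrow> x = y"
 by (metis M.minus_eq M.minus_equality M.minus_minus M.a_inv_closed M.r_neg)

lemma finsum_smult: "f \<in> S \<rightarrow> carrier V ==> c \<odot> (\<Oplus>x\<in>S. f x) = (\<Oplus>x\<in>S. c \<odot> f x)"
proof (induction S rule: infinite_finite_induct)
 case (insert x F)
 then show ?case by (simp add: smult_add_right Pi_def)
qed (auto simp: finsum_infinite)

lemma finsum_smult_left: "x \<in> carrier V ==> (\<Sum>i\<in>S. f i) \<odot> x = (\<Oplus>i\<in>S. f i \<odot> x)"
proof (induction S rule: infinite_finite_induct)
 case (insert i F)
 then show ?case by (simp add: smult_add_left Pi_def)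
qed (auto simp: finsum_infinite)

end

lemma vspaceI:
 fixes V (structure)
 assumes ab: "abelian_group V"
  and "!!c x. x \<in> carrier V ==> c \<odot> x \<in> carrier V"
  and "!!c d x. x \<in> carrier V ==> (c + d) \<odot> x = c \<odot> x \<oplus> d \<odot> x"
  and "!!c x y. x \<in> carrier V ==> y \<in> carrier V ==> c \<odot> (x \<oplus> y) = c \<odot> x \<oplus> c \<odot> y"
  and "!!c d x. x \<in> carrier V ==> (c * d) \<odot> x = c \<odot> (d \<odot> x)"
  and "!!x. x \<in> carrier V ==> 1 \<odot> x = x"
 shows "vspace V"
 unfolding vspace_def
 by (rule moduleI[OF cring_CC ab]) (use assms in auto)

lemma vspace_CC: "vspace CC"
 by (rule vspaceI) (use cring_CC in "auto simp: cring_def ring_def algebra_simps")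

lemma finsum_CC: "finsum CC f S = sum f S"
proof -
 interpret C: vspace CC by (rule vspace_CC)
 show ?thesis
  by (induction S rule: infinite_finite_induct) (auto simp: C.finsum_infinite)
qed

lemma a_inv_CC [simp]: "\<ominus>\<^bsub>CC\<^esub> x = - x"
proof -
 interpret C: vspace CC by (rule vspace_CC)
 show ?thesis using C.smult_m1[of x] by simp
qed

lemma a_minus_CC [simp]: "x \<ominus>\<^bsub>CC\<^esub> y = x - y"
 by (simp add: a_minus_def)

section \<open>Linear maps\<close>

lemma linI:
 assumes "!!x. x \<in> carrier V ==> f x \<in> carrier W"
  and "!!x y. x \<in> carrier V ==> y \<in> carrier V ==> f (x \<oplus>\<^bsub>V\<^esub> y) = f x \<oplus>\<^bsub>W\<^esub> f y"
  and "!!c x. x \<in> carrier V ==> f (c \<odot>\<^bsub>V\<^esub> x) = c \<odot>\<^bsub>W\<^esub> f x"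
 shows "f \<in> linear_maps V W"
 using assms by (simp add: linear_maps_def)

lemma linD:
 assumes "f \<in> linear_maps V W"
 shows "x \<in> carrier V ==> f x \<in> carrier W"
  and "x \<in> carrier V ==> y \<in> carrier V ==> f (x \<oplus>\<^bsub>V\<^esub> y) = f x \<oplus>\<^bsub>W\<^esub> f y"
  and "x \<in> carrier V ==> f (c \<odot>\<^bsub>V\<^esub> x) = c \<odot>\<^bsub>W\<^esub> f x"
 using assms by (auto simp: linear_maps_def)

lemma lin_zero:
 assumes "f \<in> linear_maps V W" "vspace V" "vspace W"
 shows "f \<zero>\<^bsub>V\<^esub> = \<zero>\<^bsub>W\<^esub>"
proof -
 interpret V: vspace V by fact
 interpret W: vspace W by fact
 show ?thesis
  using linD(3)[OF assms(1), of "\<zero>\<^bsub>V\<^esub>" 0] linD(1)[OF assms(1), of "\<zero>\<^bsub>V\<^esub>"] by simp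
qed

lemma lin_minus:
 assumes "f \<in> linear_maps V W" "vspace V" "vspace W" "x \<in> carrier V" "y \<in> carrier V"
 shows "f (x \<ominus>\<^bsub>V\<^esub> y) = f x \<ominus>\<^bsub>W\<^esub> f y"
proof -
 interpret V: vspace V by fact
 interpret W: vspace W by fact
 have "f (x \<oplus>\<^bsub>V\<^esub> (- 1) \<odot>\<^bsub>V\<^esub> y) = f x \<oplus>\<^bsub>W\<^esub> (- 1) \<odot>\<^bsub>W\<^esub> f y"
  using assms linD[OF assms(1)] by auto
 then show ?thesis
  using assms linD(1)[OF assms(1)] by (simp add: V.smult_m1 W.smult_m1 a_minus_def)
qed

lemma lin_finsum:
 assumes "f \<in> linear_maps V W" "vspace V" "vspace W" "g \<in> S \<rightarrow> carrier V"
 shows "f (finsum V g S) = finsum W (%x. f (g x)) S"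
proof -
 interpret V: vspace V by fact
 interpret W: vspace W by fact
 show ?thesis using assms(4)
 proof (induction S rule: infinite_finite_induct)
  case (insert x F)
  moreover have "(%x. f (g x)) \<in> F \<rightarrow> carrier W" "f (g x) \<in> carrier W"
   using insert linD(1)[OF assms(1)] by auto
  moreover have "finsum V g F \<in> carrier V" using insert by auto
  ultimately show ?case using insert linD(2)[OF assms(1)] by auto
 qed (auto simp: V.finsum_infinite W.finsum_infinite lin_zero[OF assms(1-3)])
qed

lemma lin_comp:
 assumes "f \<in> linear_maps U V" "g \<in> linear_maps V W"
 shows "(%x. g (f x)) \<in> linear_maps U W"
 using assms by (auto simp: linear_maps_def Pi_def)

section \<open>Linear extension\<close>

context vspace
begin

lemma lin_ext_superset:
 assumes "finite S" "pkeys p <= S" "!!k. k \<in> S ==> \<phi> k \<in> carrier V"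
 shows "lin_ext V \<phi> p = (\<Oplus>k\<in>S. plookup p k \<odot> \<phi> k)"
 unfolding lin_ext_def
 by (rule add.finprod_mono_neutral_cong_left) (use assms in "auto simp: in_keys_iff")

lemma lin_ext_closed:
 assumes "!!k. k \<in> pkeys p ==> \<phi> k \<in> carrier V"
 shows "lin_ext V \<phi> p \<in> carrier V"
 unfolding lin_ext_def using assms by (intro M.finsum_closed) auto

lemma lin_ext_zero [simp]: "lin_ext V \<phi> 0 = \<zero>"
 by (simp add: lin_ext_def)

lemma lin_ext_add:
 assumes "!!k. k \<in> pkeys p \<union> pkeys q ==> \<phi> k \<in> carrier V"
 shows "lin_ext V \<phi> (p + q) = lin_ext V \<phi> p \<oplus> lin_ext V \<phi> q"
proof -
 let ?S = "pkeys p \<union> pkeys q"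
 have "lin_ext V \<phi> (p + q) = (\<Oplus>k\<in>?S. plookup p k \<odot> \<phi> k \<oplus> plookup q k \<odot> \<phi> k)"
 proof -
  have "lin_ext V \<phi> (p + q) = (\<Oplus>k\<in>?S. plookup (p + q) k \<odot> \<phi> k)"
   by (rule lin_ext_superset) (use assms keys_add[of p q] in auto)
  also have "... = (\<Oplus>k\<in>?S. plookup p k \<odot> \<phi> k \<oplus> plookup q k \<odot> \<phi> k)"
   by (rule add.finprod_cong') (use assms in "auto simp: lookup_add smult_add_left")
  finally show ?thesis .
 qed
 also have "... = (\<Oplus>k\<in>?S. plookup p k \<odot> \<phi> k) \<oplus> (\<Oplus>k\<in>?S. plookup q k \<odot> \<phi> k)"
  by (rule M.finsum_addf) (use assms in auto)
 also have "... = lin_ext V \<phi> p \<oplus> lin_ext V \<phi> q"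
 proof -
  have "lin_ext V \<phi> r = (\<Oplus>k\<in>?S. plookup r k \<odot> \<phi> k)"
   if "pkeys r <= ?S" for r
   by (rule lin_ext_superset) (use assms that in auto)
  then show ?thesis by simp
 qed
 finally show ?thesis .
qed

lemma lin_ext_scale:
 assumes "!!k. k \<in> pkeys p ==> \<phi> k \<in> carrier V"
 shows "lin_ext V \<phi> (pm_scale c p) = c \<odot> lin_ext V \<phi> p"
proof -
 have "lin_ext V \<phi> (pm_scale c p) = (\<Oplus>k\<in>pkeys p. (c * plookup p k) \<odot> \<phi> k)"
  by (subst lin_ext_superset[of "pkeys p"]) (use assms keys_pm_scale[of c p] in auto)
 also have "... = c \<odot> lin_ext V \<phi> p"
  unfolding lin_ext_def
  by (subst finsum_smult) (use assms in "auto simp: smult_smult intro!: add.finprod_cong'")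
 finally show ?thesis .
qed

lemma lin_ext_unit [simp]: "\<phi> k \<in> carrier V ==> lin_ext V \<phi> (pm_unit k) = \<phi> k"
 by (simp add: lin_ext_def)

lemma lin_ext_cong:
 assumes "!!k. k \<in> pkeys p ==> \<phi> k = \<psi> k" "!!k. k \<in> pkeys p ==> \<phi> k \<in> carrier V"
 shows "lin_ext V \<phi> p = lin_ext V \<psi> p"
 unfolding lin_ext_def by (rule add.finprod_cong') (use assms in auto)

lemma lin_ext_bind:
 assumes "!!k. k \<in> pkeys p ==> pkeys (F k) <= K"
  and "!!l. l \<in> K ==> \<phi> l \<in> carrier V"
 shows "lin_ext V \<phi> (pm_bind p F) = lin_ext V (%k. lin_ext V \<phi> (F k)) p"
proof -
 have "lin_ext V \<phi> (\<Sum>k\<in>S. pm_scale (plookup p k) (F k)) =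
   (\<Oplus>k\<in>S. plookup p k \<odot> lin_ext V \<phi> (F k))"
  if "finite S" "S <= pkeys p" for S
  using that
 proof (induction S rule: finite_induct)
  case (insert x S)
  have k1: "pkeys (pm_scale (plookup p x) (F x)) <= K"
   using insert assms(1) keys_pm_scale by fastforce
  have k2: "pkeys (\<Sum>k\<in>S. pm_scale (plookup p k) (F k)) <= K"
   by (rule keys_sum_subset) (use insert assms(1) keys_pm_scale in fastforce)
  have "lin_ext V \<phi> (F k) \<in> carrier V" if "k \<in> pkeys p" for k
   by (rule lin_ext_closed) (use that assms in auto)
  then have c: "(%k. plookup p k \<odot> lin_ext V \<phi> (F k)) \<in> S \<rightarrow> carrier V"
   "plookup p x \<odot> lin_ext V \<phi> (F x) \<in> carrier V" using insert by auto
  have "lin_ext V \<phi> (\<Sum>k\<in>insert x S. pm_scale (plookup p k) (F k)) =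
   lin_ext V \<phi> (pm_scale (plookup p x) (F x)) \<oplus>
   lin_ext V \<phi> (\<Sum>k\<in>S. pm_scale (plookup p k) (F k))"
  proof -
   have "lin_ext V \<phi> (pm_scale (plookup p x) (F x) + (\<Sum>k\<in>S. pm_scale (plookup p k) (F k))) =
    lin_ext V \<phi> (pm_scale (plookup p x) (F x)) \<oplus>
    lin_ext V \<phi> (\<Sum>k\<in>S. pm_scale (plookup p k) (F k))"
    by (rule lin_ext_add) (use k1 k2 assms(2) in blast)
   then show ?thesis using insert by simp
  qed
  also have "... = plookup p x \<odot> lin_ext V \<phi> (F x) \<oplus>
    (\<Oplus>k\<in>S. plookup p k \<odot> lin_ext V \<phi> (F k))"
   using insert assms by (subst lin_ext_scale) auto
  finally show ?case using insert c by simp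
 qed auto
 from this[OF finite_keys subset_refl] show ?thesis by (simp add: pm_bind_def lin_ext_def)
qed

end

lemma lin_lin_ext:
 assumes "f \<in> linear_maps V W" "vspace V" "vspace W"
  and "!!k. k \<in> pkeys p ==> \<phi> k \<in> carrier V"
 shows "f (lin_ext V \<phi> p) = lin_ext W (%k. f (\<phi> k)) p"
proof -
 interpret V: vspace V by fact
 interpret W: vspace W by fact
 have "f (lin_ext V \<phi> p) = finsum W (%k. f (plookup p k \<odot>\<^bsub>V\<^esub> \<phi> k)) (pkeys p)"
  unfolding lin_ext_def by (rule lin_finsum[OF assms(1-3)]) (use assms in auto)
 also have "... = lin_ext W (%k. f (\<phi> k)) p"
  unfolding lin_ext_def
  by (rule W.add.finprod_cong') (use assms linD[OF assms(1)] in auto)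
 finally show ?thesis .
qed

lemma lin_ext_CC: "lin_ext CC \<phi> p = pm_pair p \<phi>"
 by (simp add: lin_ext_def pm_pair_def finsum_CC)

section \<open>Quotients\<close>

definition subspace :: "(complex, 'a, 'm) module_scheme => 'a set => bool" where
 "subspace V M \<longleftrightarrow> M <= carrier V & \<zero>\<^bsub>V\<^esub> \<in> M & (\<forall>x\<in>M. \<forall>y\<in>M. x \<oplus>\<^bsub>V\<^esub> y \<in> M) &
   (ALL c. \<forall>x\<in>M. c \<odot>\<^bsub>V\<^esub> x \<in> M)"

lemma subspaceD:
 assumes "subspace V M"
 shows "x \<in> M ==> x \<in> carrier V" "\<zero>\<^bsub>V\<^esub> \<in> M" "x \<in> M ==> y \<in> M ==> x \<oplus>\<^bsub>V\<^esub> y \<in> M"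
  "x \<in> M ==> c \<odot>\<^bsub>V\<^esub> x \<in> M"
 using assms by (auto simp: subspace_def)

context vspace
begin

lemma subspace_minus: "subspace V M ==> x \<in> M ==> y \<in> M ==> x \<ominus> y \<in> M"
 using subspaceD[of V M] smult_m1[of y] by (auto simp: a_minus_def) metis

lemma subspace_uminus: "subspace V M ==> x \<in> M ==> \<ominus> x \<in> M"
 using subspaceD[of V M] smult_m1[of x] by metis

lemma subspace_finsum: "subspace V M ==> (!!i. i \<in> S ==> f i \<in> M) ==> (\<Oplus>i\<in>S. f i) \<in> M"
proof (induction S rule: infinite_finite_induct)
 case (insert x F)
 then show ?case using subspaceD[of V M] by (auto simp: Pi_def)
qed (auto simp: finsum_infinite subspaceD)

lemma minus_telescope:
 "x \<in> carrier V ==> y \<in> carrier V ==> z \<in> carrier V ==> (x \<ominus> y) \<oplus> (y \<ominus> z) = x \<ominus> z"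
 by (simp add: M.minus_eq M.a_assoc M.r_neg1)

lemma minus_swap: "x \<in> carrier V ==> y \<in> carrier V ==> \<ominus> (x \<ominus> y) = y \<ominus> x"
 by (simp add: M.minus_eq M.minus_add M.a_comm)

lemma minus_self [simp]: "x \<in> carrier V ==> x \<ominus> x = \<zero>"
 by (simp add: M.minus_eq M.r_neg)

lemma minus_zero [simp]: "x \<in> carrier V ==> x \<ominus> \<zero> = x"
 by (simp add: M.minus_eq)

lemma add_minus_cancel: "x \<in> carrier V ==> y \<in> carrier V ==> (x \<ominus> y) \<oplus> y = x"
 by (simp add: M.minus_eq M.a_assoc M.l_neg)

lemma minus_add_cancel: "x \<in> carrier V ==> y \<in> carrier V ==> (x \<oplus> y) \<ominus> y = x"
 by (simp add: M.minus_eq M.a_assoc M.r_neg)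

lemma minus_add_distrib:
 "a \<in> carrier V ==> b \<in> carrier V ==> c \<in> carrier V ==> d \<in> carrier V ==>
  (a \<oplus> b) \<ominus> (c \<oplus> d) = (a \<ominus> c) \<oplus> (b \<ominus> d)"
 by (simp add: M.minus_eq M.minus_add M.a_ac)

lemma coset_set: "M +> x = {m \<oplus> x | m. m \<in> M}"
 by (auto simp: a_r_coset_def')

lemma mem_coset:
 assumes "subspace V M" "x \<in> carrier V"
 shows "y \<in> M +> x \<longleftrightarrow> y \<in> carrier V & y \<ominus> x \<in> M"
proof
 assume "y \<in> M +> x"
 then obtain m where "m \<in> M" "y = m \<oplus> x" by (auto simp: coset_set)
 then show "y \<in> carrier V & y \<ominus> x \<in> M"
  using assms subspaceD(1)[OF assms(1)] by (auto simp: minus_add_cancel)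
next
 assume y: "y \<in> carrier V & y \<ominus> x \<in> M"
 then have "y = (y \<ominus> x) \<oplus> x" using assms by (simp add: add_minus_cancel)
 with y show "y \<in> M +> x" by (auto simp: coset_set)
qed

lemma coset_self: "subspace V M ==> x \<in> carrier V ==> x \<in> M +> x"
 by (simp add: mem_coset subspaceD)

lemma coset_eq:
 assumes "subspace V M" "x \<in> carrier V" "y \<in> carrier V"
 shows "M +> x = M +> y \<longleftrightarrow> x \<ominus> y \<in> M"
proof
 assume "M +> x = M +> y"
 then show "x \<ominus> y \<in> M" using coset_self[OF assms(1,2)] assms mem_coset by auto
next
 assume xy: "x \<ominus> y \<in> M"
 then have yx: "y \<ominus> x \<in> M" using subspace_uminus[OF assms(1) xy] assms minus_swap by auto
 show "M +> x = M +> y"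
 proof (intro Set.set_eqI)
  fix z
  have "z \<ominus> y \<in> M" if "z \<in> carrier V" "z \<ominus> x \<in> M"
   using subspaceD(3)[OF assms(1) that(2) xy] minus_telescope[OF that(1) assms(2,3)] by simp
  moreover have "z \<ominus> x \<in> M" if "z \<in> carrier V" "z \<ominus> y \<in> M"
   using subspaceD(3)[OF assms(1) that(2) yx] minus_telescope[OF that(1) assms(3,2)] by simp
  ultimately show "z \<in> M +> x \<longleftrightarrow> z \<in> M +> y" using assms by (auto simp: mem_coset)
 qed
qed

lemma coset_zero: "subspace V M ==> M +> \<zero> = M"
 using subspaceD(1)[of V M] by (force simp: coset_set)

lemma coset_eq_self: "subspace V M ==> x \<in> carrier V ==> M +> x = M \<longleftrightarrow> x \<in> M"
 using coset_eq[of M x \<zero>] by (simp add: coset_zero)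

lemma set_add_coset:
 assumes "subspace V M" "x \<in> carrier V" "y \<in> carrier V"
 shows "set_add V (M +> x) (M +> y) = M +> (x \<oplus> y)"
proof (intro Set.set_eqI iffI)
 fix z assume "z \<in> set_add V (M +> x) (M +> y)"
 then obtain m n where mn: "m \<in> M" "n \<in> M" "z = (m \<oplus> x) \<oplus> (n \<oplus> y)"
  by (auto simp: set_add_def' coset_set)
 then have "z = (m \<oplus> n) \<oplus> (x \<oplus> y)"
  using assms subspaceD(1)[OF assms(1)] by (simp add: M.a_ac)
 then show "z \<in> M +> (x \<oplus> y)" using mn subspaceD[OF assms(1)] by (auto simp: coset_set)
next
 fix z assume "z \<in> M +> (x \<oplus> y)"
 then obtain m where "m \<in> M" "z = m \<oplus> (x \<oplus> y)" by (auto simp: coset_set)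
 then have "z = (m \<oplus> x) \<oplus> (\<zero> \<oplus> y)" using assms subspaceD(1)[OF assms(1)] by (simp add: M.a_ac)
 then show "z \<in> set_add V (M +> x) (M +> y)"
  using \<open>m \<in> M\<close> subspaceD[OF assms(1)] by (auto simp: set_add_def' coset_set)
qed

end

lemma subspace_kernel:
 assumes V: "vspace V" and W: "vspace W" and f: "f \<in> linear_maps V W"
 shows "subspace V {x \<in> carrier V. f x = \<zero>\<^bsub>W\<^esub>}"
proof -
 interpret V: vspace V by fact
 interpret W: vspace W by fact
 show ?thesis by (auto simp: subspace_def linD[OF f] lin_zero[OF f V W])
qed

lemma subspace_image:
 assumes V: "vspace V" and W: "vspace W" and f: "f \<in> linear_maps V W"
 shows "subspace W (f ` carrier V)"
proof -
 interpret V: vspace V by fact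
 show ?thesis
  using image_eqI[where f = f, OF _ V.M.zero_closed] lin_zero[OF f V W]
  by (auto simp: subspace_def linD[OF f] simp flip: linD(2,3)[OF f])
qed

text \<open>The union in the definition of \<open>coset_map\<close> runs over a constant family, and
  the given element shows that the index set is not empty.\<close>

lemma coset_map_eqI:
 assumes "x \<in> X" "!!y. y \<in> X ==> M +>\<^bsub>W\<^esub> f y = C"
 shows "coset_map W M f X = C"
 using assms by (auto simp: coset_map_def)

lemma rcoset_mult_eqI:
 assumes "x \<in> X" "y \<in> Y" "!!a b. a \<in> X ==> b \<in> Y ==> M +>\<^bsub>W\<^esub> (a \<otimes>\<^bsub>W\<^esub> b) = C"
 shows "rcoset_mult W M X Y = C"
 using assms by (auto simp: rcoset_mult_def)

lemma coset_map_coset: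
 assumes "vspace V" "vspace W" "subspace V M" "subspace W N" "f \<in> linear_maps V W"
  and "!!m. m \<in> M ==> f m \<in> N" and x: "x \<in> carrier V"
 shows "coset_map W N f (M +>\<^bsub>V\<^esub> x) = N +>\<^bsub>W\<^esub> f x"
proof -
 interpret V: vspace V by fact
 interpret W: vspace W by fact
 show ?thesis
 proof (rule coset_map_eqI)
  show "x \<in> M +>\<^bsub>V\<^esub> x" using assms by (simp add: V.coset_self)
  fix y assume y: "y \<in> M +>\<^bsub>V\<^esub> x"
  then have yc: "y \<in> carrier V" "y \<ominus>\<^bsub>V\<^esub> x \<in> M" using assms by (auto simp: V.mem_coset)
  then have "f y \<ominus>\<^bsub>W\<^esub> f x \<in> N"
   using assms(6)[OF yc(2)] lin_minus[OF assms(5,1,2) yc(1) x] by simp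
  then show "N +>\<^bsub>W\<^esub> f y = N +>\<^bsub>W\<^esub> f x"
   using assms yc linD(1)[OF assms(5)] by (simp add: W.coset_eq)
 qed
qed

lemma quot_mod_simps [simp]:
 "carrier (quot_mod V M) = {M +>\<^bsub>V\<^esub> x | x. x \<in> carrier V}"
 "monoid.mult (quot_mod V M) = rcoset_mult V M"
 "monoid.one (quot_mod V M) = M +>\<^bsub>V\<^esub> \<one>\<^bsub>V\<^esub>"
 "ring.zero (quot_mod V M) = M"
 "ring.add (quot_mod V M) = set_add V"
 "module.smult (quot_mod V M) c = coset_map V M (smult V c)"
 by (auto simp: quot_mod_def FactRing_def ring.extend_def module.fields_def A_RCOSETS_def')

context vspace
begin

lemma smult_linear: "smult V c \<in> linear_maps V V"
 by (rule linI) (auto simp: smult_add_right smult_smult mult.commute)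

lemma smult_coset:
 assumes "subspace V M" "x \<in> carrier V"
 shows "coset_map V M (smult V c) (M +> x) = M +> (c \<odot> x)"
 by (rule coset_map_coset[OF vspace_axioms vspace_axioms])
  (use assms subspaceD[OF assms(1)] smult_linear in auto)

lemma vspace_quot:
 assumes M: "subspace V M"
 shows "vspace (quot_mod V M)"
proof -
 have inv: "\<exists>Y\<in>carrier (quot_mod V M). set_add V Y (M +> x) = M" if x: "x \<in> carrier V" for x
 proof (intro bexI)
  show "set_add V (M +> \<ominus> x) (M +> x) = M"
   using x set_add_coset[OF M, of "\<ominus> x" x] by (simp add: M.l_neg coset_zero M)
  show "M +> \<ominus> x \<in> carrier (quot_mod V M)" using x by auto
 qed
 have zero: "set_add V M (M +> x) = M +> x" if "x \<in> carrier V" for x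
  using set_add_coset[OF M M.zero_closed that] that by (simp add: coset_zero M)
 have "EX x. M = M +> x & x \<in> carrier V"
  using coset_zero[OF M] by (intro exI[of _ \<zero>]) auto
 note q = set_add_coset[OF M] smult_coset[OF M]
 show ?thesis
 proof (rule vspaceI, rule abelian_groupI)
  fix X assume "X \<in> carrier (quot_mod V M)"
  then obtain x where x: "x \<in> carrier V" "X = M +> x" by auto
  show "\<exists>Y\<in>carrier (quot_mod V M). Y \<oplus>\<^bsub>quot_mod V M\<^esub> X = \<zero>\<^bsub>quot_mod V M\<^esub>"
   using inv[OF x(1)] x(2) by simp
  show "\<zero>\<^bsub>quot_mod V M\<^esub> \<oplus>\<^bsub>quot_mod V M\<^esub> X = X" using zero x by simp
  show "1 \<odot>\<^bsub>quot_mod V M\<^esub> X = X" using x by (simp add: q)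
  fix c d
  show "c \<odot>\<^bsub>quot_mod V M\<^esub> X \<in> carrier (quot_mod V M)"
   using x(1) by (auto simp: x(2) q)
  show "(c + d) \<odot>\<^bsub>quot_mod V M\<^esub> X = c \<odot>\<^bsub>quot_mod V M\<^esub> X \<oplus>\<^bsub>quot_mod V M\<^esub> d \<odot>\<^bsub>quot_mod V M\<^esub> X"
   "(c * d) \<odot>\<^bsub>quot_mod V M\<^esub> X = c \<odot>\<^bsub>quot_mod V M\<^esub> (d \<odot>\<^bsub>quot_mod V M\<^esub> X)"
   using x(1) by (simp_all add: x(2) q smult_add_left smult_smult)
  fix Y assume "Y \<in> carrier (quot_mod V M)"
  then obtain y where y: "y \<in> carrier V" "Y = M +> y" by auto
  show "X \<oplus>\<^bsub>quot_mod V M\<^esub> Y \<in> carrier (quot_mod V M)"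
   using x(1) y(1) by (auto simp: x(2) y(2) q)
  show "X \<oplus>\<^bsub>quot_mod V M\<^esub> Y = Y \<oplus>\<^bsub>quot_mod V M\<^esub> X"
   using x(1) y(1) by (simp add: x(2) y(2) q M.a_comm)
  show "c \<odot>\<^bsub>quot_mod V M\<^esub> (X \<oplus>\<^bsub>quot_mod V M\<^esub> Y) =
    c \<odot>\<^bsub>quot_mod V M\<^esub> X \<oplus>\<^bsub>quot_mod V M\<^esub> c \<odot>\<^bsub>quot_mod V M\<^esub> Y"
   using x(1) y(1) by (simp add: x(2) y(2) q smult_add_right)
  fix Z assume "Z \<in> carrier (quot_mod V M)"
  then obtain z where z: "z \<in> carrier V" "Z = M +> z" by auto
  show "X \<oplus>\<^bsub>quot_mod V M\<^esub> Y \<oplus>\<^bsub>quot_mod V M\<^esub> Z = X \<oplus>\<^bsub>quot_mod V M\<^esub> (Y \<oplus>\<^bsub>quot_mod V M\<^esub> Z)"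
   using x(1) y(1) z(1) by (simp add: x(2) y(2) z(2) q M.a_assoc)
 qed (use \<open>EX x. M = M +> x & x \<in> carrier V\<close> in auto)
qed

lemma coset_linear: "subspace V M ==> (%x. M +> x) \<in> linear_maps V (quot_mod V M)"
 by (rule linI) (auto simp: set_add_coset smult_coset)

lemma vspace_subspace:
 assumes M: "subspace V M"
 shows "vspace (V\<lparr>carrier := M\<rparr>)"
proof (rule vspaceI, rule abelian_groupI)
 fix x assume "x \<in> carrier (V\<lparr>carrier := M\<rparr>)"
 then show "\<exists>y\<in>carrier (V\<lparr>carrier := M\<rparr>). y \<oplus>\<^bsub>V\<lparr>carrier := M\<rparr>\<^esub> x = \<zero>\<^bsub>V\<lparr>carrier := M\<rparr>\<^esub>"
  using subspace_uminus[OF M] subspaceD[OF M] by (auto intro!: bexI[of _ "\<ominus> x"] simp: M.l_neg)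
qed (use subspaceD[OF M] in "auto simp: M.a_ac smult_add_left smult_add_right smult_smult")

end

lemma coset_carrier_update [simp]: "M +>\<^bsub>V\<lparr>carrier := F\<rparr>\<^esub> x = M +>\<^bsub>V\<^esub> x"
 by (simp add: a_r_coset_def')

lemma subspace_carrier_update:
 "subspace V M ==> M <= F ==> subspace (V\<lparr>carrier := F\<rparr>) M"
 by (auto simp: subspace_def)

text \<open>The axioms pass along a bijection that preserves the operations. The associated graded
  of a Hopf algebra obtains its vector space structure in this way, without a computation with
  families of cosets.\<close>

lemma vspace_transport:
 fixes V (structure) and W (structure)
 assumes "vspace V" "bij_betw f (carrier V) (carrier W)" "f \<in> linear_maps V W" "\<zero>\<^bsub>W\<^esub> = f \<zero>\<^bsub>V\<^esub>"
 shows "vspace W"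
proof -
 interpret V: vspace V by fact
 have im: "carrier W = f ` carrier V" using assms(2) by (simp add: bij_betw_def)
 note f = linD(2)[OF assms(3), symmetric] linD(3)[OF assms(3), symmetric]
 show ?thesis
 proof (rule vspaceI, rule abelian_groupI)
  fix x assume "x \<in> carrier W"
  then obtain y where y: "y \<in> carrier V" "x = f y" by (auto simp: im)
  then have "f (\<ominus>\<^bsub>V\<^esub> y) \<oplus>\<^bsub>W\<^esub> x = \<zero>\<^bsub>W\<^esub>" by (simp add: f assms(4) V.M.l_neg)
  then show "\<exists>y\<in>carrier W. y \<oplus>\<^bsub>W\<^esub> x = \<zero>\<^bsub>W\<^esub>"
   using y im by blast
 qed (auto simp: im f assms(4) V.M.a_ac V.smult_add_left V.smult_add_right V.smult_smult)
qed

section \<open>Free vector spaces\<close>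

text \<open>The common interface of the spaces of formal sums that occur: the free space above a
  tensor power, and the group algebra with or without its Hopf structure.\<close>

locale free_space =
 fixes U :: "(complex, 'k \<Rightarrow>\<^sub>0 complex, 'm) module_scheme" and K :: "'k set"
 assumes carr [simp]: "carrier U = {p. pkeys p <= K}"
  and zero [simp]: "\<zero>\<^bsub>U\<^esub> = 0"
  and add [simp]: "ring.add U = (+)"
  and smult [simp]: "smult U = pm_scale"
begin

sublocale vspace U
proof (rule vspaceI, rule abelian_groupI)
 fix p assume "p \<in> carrier U"
 then show "\<exists>q\<in>carrier U. q \<oplus>\<^bsub>U\<^esub> p = \<zero>\<^bsub>U\<^esub>"
  by (auto intro!: exI[of _ "- p"] simp: in_keys_iff subset_iff)
next
 fix p q assume "p \<in> carrier U" "q \<in> carrier U"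
 then show "p \<oplus>\<^bsub>U\<^esub> q \<in> carrier U" using keys_add[of p q] by auto
next
 fix c p assume "p \<in> carrier U"
 then show "c \<odot>\<^bsub>U\<^esub> p \<in> carrier U" using keys_pm_scale[of c p] by auto
qed (auto simp: add.assoc add.commute pm_scale_left_add)

lemma a_inv_free [simp]: "p \<in> carrier U ==> \<ominus>\<^bsub>U\<^esub> p = - p"
 using smult_m1[of p] by (simp add: pm_scale_minus_one del: carr)

lemma a_minus_free [simp]: "q \<in> carrier U ==> p \<ominus>\<^bsub>U\<^esub> q = p - q"
 by (simp add: a_minus_def del: carr)

end

lemma lin_ext_linear_maps:
 assumes "free_space U K" "vspace V" "!!k. k \<in> K ==> \<phi> k \<in> carrier V"
 shows "lin_ext V \<phi> \<in> linear_maps U V"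
proof -
 interpret U: free_space U K by fact
 interpret V: vspace V by fact
 show ?thesis
  by (rule linI)
   (use assms(3) in "auto intro!: V.lin_ext_closed V.lin_ext_add V.lin_ext_scale")
qed

lemma free_linear_eqI:
 assumes U: "free_space U K" and W: "vspace W" and f: "f \<in> linear_maps U W" and g: "g \<in> linear_maps U W"
  and eq: "!!k. k \<in> K ==> f (pm_unit k) = g (pm_unit k)" and p: "p \<in> carrier U"
 shows "f p = g p"
proof -
 interpret U: free_space U K by fact
 have "pkeys p <= K" using p by simp
 then show ?thesis
 proof (induction rule: pm_induct)
  case zero
  then show ?case using lin_zero[OF f U.vspace_axioms W] lin_zero[OF g U.vspace_axioms W] by simp
 next
  case (add p k c)
  then have c: "p \<in> carrier U" "pm_unit k \<in> carrier U" by simp_all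
  have "h (p + pm_scale c (pm_unit k)) = h p \<oplus>\<^bsub>W\<^esub> c \<odot>\<^bsub>W\<^esub> h (pm_unit k)" if h: "h \<in> linear_maps U W" for h
   using linD(2)[OF h c(1) U.smult_in[OF c(2), of c]] linD(3)[OF h c(2), of c] by (simp del: map_single)
  from this[OF f] this[OF g] show ?case using add eq by simp
 qed
qed

lemma free_space_free_tensor:
 "free_space (free_tensor V n) {xs. length xs = n & set xs <= carrier V}"
 by standard (auto simp: free_tensor_def)

section \<open>Tensor powers: universal property, functoriality, multiplication\<close>

section \<open>Multilinear maps and tensor powers\<close>

text \<open>Linearity in a slot is expressed by updating a list at that slot, so that all tensor
  powers are treated uniformly.\<close>

definition multilin ::
  "(complex, 'a, 'm) module_scheme => (complex, 'b, 'n) module_scheme => nat => ('a list => 'b) => bool" where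
 "multilin V W n \<phi> \<longleftrightarrow> (ALL xs. length xs = n & set xs <= carrier V -->
   \<phi> xs \<in> carrier W & (ALL i<n. (%z. \<phi> (xs[i := z])) \<in> linear_maps V W))"

lemma multilinI:
 assumes "!!xs. length xs = n ==> set xs <= carrier V ==> \<phi> xs \<in> carrier W"
  and "!!xs i. length xs = n ==> set xs <= carrier V ==> i < n ==> (%z. \<phi> (xs[i := z])) \<in> linear_maps V W"
 shows "multilin V W n \<phi>"
 unfolding multilin_def using assms by blast

lemma multilinD:
 assumes "multilin V W n \<phi>"
 shows "length xs = n ==> set xs <= carrier V ==> \<phi> xs \<in> carrier W"
  and "length xs = n ==> set xs <= carrier V ==> i < n ==> (%z. \<phi> (xs[i := z])) \<in> linear_maps V W"
 using assms unfolding multilin_def by blast+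

lemma set_list_update_subset: "set xs <= A ==> x \<in> A ==> set (xs[i := x]) <= A"
 using set_update_subset_insert[of xs i x] by auto

lemma multilin_linear_comp:
 assumes "multilin V W n \<phi>" "f \<in> linear_maps W W'"
 shows "multilin V W' n (%xs. f (\<phi> xs))"
 by (rule multilinI) (rule linD(1)[OF assms(2)] lin_comp[OF _ assms(2)], rule multilinD[OF assms(1)]; assumption)+

lemma set_map_linear: "f \<in> linear_maps U V ==> set xs <= carrier U ==> set (map f xs) <= carrier V"
 using linD(1)[of f U V] by auto

lemma multilin_map:
 assumes \<phi>: "multilin V W n \<phi>" and f: "f \<in> linear_maps U V"
 shows "multilin U W n (%xs. \<phi> (map f xs))"
proof (rule multilinI)
 fix xs assume xs: "length xs = n" "set xs <= carrier U"
 have fx: "length (map f xs) = n" "set (map f xs) <= carrier V"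
  using xs set_map_linear[OF f xs(2)] by auto
 show "\<phi> (map f xs) \<in> carrier W" by (rule multilinD(1)[OF \<phi> fx])
 show "(%z. \<phi> (map f (xs[i := z]))) \<in> linear_maps U W" if "i < n" for i
  unfolding map_update by (rule lin_comp[OF f multilinD(2)[OF \<phi> fx that]])
qed

lemma multilin_2I:
 assumes W: "vspace W" and cl: "!!x y. x \<in> carrier V ==> y \<in> carrier V ==> f x y \<in> carrier W"
  and "!!x x' y. x \<in> carrier V ==> x' \<in> carrier V ==> y \<in> carrier V ==> f (x \<oplus>\<^bsub>V\<^esub> x') y = f x y \<oplus>\<^bsub>W\<^esub> f x' y"
  and "!!x y y'. x \<in> carrier V ==> y \<in> carrier V ==> y' \<in> carrier V ==> f x (y \<oplus>\<^bsub>V\<^esub> y') = f x y \<oplus>\<^bsub>W\<^esub> f x y'"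
  and "!!c x y. x \<in> carrier V ==> y \<in> carrier V ==> f (c \<odot>\<^bsub>V\<^esub> x) y = c \<odot>\<^bsub>W\<^esub> f x y"
  and "!!c x y. x \<in> carrier V ==> y \<in> carrier V ==> f x (c \<odot>\<^bsub>V\<^esub> y) = c \<odot>\<^bsub>W\<^esub> f x y"
 shows "multilin V W 2 (%xs. f (xs ! 0) (xs ! 1))"
proof -
 have 2: "EX x y. xs = [x, y] & x \<in> carrier V & y \<in> carrier V" if "length xs = 2" "set xs <= carrier V" for xs
  using that by (auto simp: length_Suc_conv numeral_2_eq_2)
 show ?thesis
 proof (rule multilinI)
  fix xs assume xs: "length xs = 2" "set xs <= carrier V"
  then obtain a b where ab: "xs = [a, b]" "a \<in> carrier V" "b \<in> carrier V" using 2 by blast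
  then show "f (xs ! 0) (xs ! 1) \<in> carrier W" using cl by simp
  fix i assume "i < (2::nat)"
  then have i: "i = 0 \<or> i = 1" by auto
  show "(%z. f (xs[i := z] ! 0) (xs[i := z] ! 1)) \<in> linear_maps V W"
   by (rule linI) (use i ab assms(2-) in auto)
 qed
qed

lemma tensor_rel_carrier:
 assumes V: "vspace V" and p: "p \<in> tensor_rel V n"
 shows "p \<in> carrier (free_tensor V n)"
proof -
 interpret V: vspace V by fact
 interpret F: free_space "free_tensor V n" "{xs. length xs = n & set xs <= carrier V}"
  by (rule free_space_free_tensor)
 show ?thesis using p
 proof (induction rule: tensor_rel.induct)
  case (add p q) then show ?case using F.M.a_closed[of p q] by simp
 next
  case (scale p c) then show ?case using F.smult_in[of p c] by simp
 next
  case (additivity x y xs ys)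
  then show ?case
   by (intro F.carr[THEN equalityD2, THEN subsetD] CollectI
    order_trans[OF keys_diff_subset] Un_least) auto
 next
  case (homogeneity x xs ys c)
  then show ?case
   by (intro F.carr[THEN equalityD2, THEN subsetD] CollectI
    order_trans[OF keys_diff_subset] Un_least order_trans[OF keys_pm_scale]) auto
 qed simp
qed

lemma subspace_tensor_rel: "vspace V ==> subspace (free_tensor V n) (tensor_rel V n)"
 using tensor_rel_carrier[of V] tensor_rel.zero[of V n] tensor_rel.add[of _ V n] tensor_rel.scale[of _ V n]
 by (auto simp: subspace_def free_space.zero[OF free_space_free_tensor]
  free_space.add[OF free_space_free_tensor] free_space.smult[OF free_space_free_tensor])

definition tensor_class ::
  "(complex, 'a, 'm) module_scheme => nat => ('a list \<Rightarrow>\<^sub>0 complex) => 'a tensor" where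
 "tensor_class V n p = tensor_rel V n +>\<^bsub>free_tensor V n\<^esub> p"

lemma pure_tensor_class: "pure_tensor V xs = tensor_class V (length xs) (pm_unit xs)"
 by (simp add: pure_tensor_def tensor_class_def)

text \<open>Additivity and homogeneity in one slot are exactly what the generating relations
  express, and the vanishing set is a subspace. This makes the lift to the quotient well
  defined.\<close>

lemma lin_ext_tensor_rel:
 assumes V: "vspace V" and W: "vspace W" and \<phi>: "multilin V W n \<phi>" and p: "p \<in> tensor_rel V n"
 shows "lin_ext W \<phi> p = \<zero>\<^bsub>W\<^esub>"
proof -
 interpret V: vspace V by fact
 interpret W: vspace W by fact
 interpret F: free_space "free_tensor V n" "{xs. length xs = n & set xs <= carrier V}"
  by (rule free_space_free_tensor)
 have lin: "lin_ext W \<phi> \<in> linear_maps (free_tensor V n) W"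
  by (rule lin_ext_linear_maps[OF F.free_space_axioms W]) (use multilinD[OF \<phi>] in auto)
 have u: "pm_unit l \<in> carrier (free_tensor V n)" "lin_ext W \<phi> (pm_unit l) = \<phi> l" "\<phi> l \<in> carrier W"
  if "length l = n" "set l <= carrier V" for l
  using that multilinD(1)[OF \<phi> that] by simp_all
 note minus = lin_minus[OF lin F.vspace_axioms W]
 show ?thesis using p
 proof (induction rule: tensor_rel.induct)
  case zero then show ?case by simp
 next
  case (add p q)
  then show ?case
   using linD(2)[OF lin tensor_rel_carrier[OF V add(1)] tensor_rel_carrier[OF V add(2)]] by simp
 next
  case (scale p c)
  then show ?case using linD(3)[OF lin tensor_rel_carrier[OF V scale(1)]] by simp
 next
  case (additivity x y xs ys)
  let ?l = "%z. xs @ [z] @ ys"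
  have in_c: "length (?l z) = n" "set (?l z) <= carrier V" if "z \<in> carrier V" for z
   using that additivity by auto
  note xy = V.M.a_closed[OF additivity(1,2)]
  note ux = u[OF in_c[OF additivity(1)]] and uy = u[OF in_c[OF additivity(2)]] and uxy = u[OF in_c[OF xy]]
  have "(%z. \<phi> (?l z)) \<in> linear_maps V W"
   using multilinD(2)[OF \<phi> in_c[OF additivity(1)], of "length xs"] additivity(5) by simp
  from linD(2)[OF this additivity(1,2)]
  have "\<phi> (?l (x \<oplus>\<^bsub>V\<^esub> y)) \<ominus>\<^bsub>W\<^esub> \<phi> (?l x) \<ominus>\<^bsub>W\<^esub> \<phi> (?l y) = \<zero>\<^bsub>W\<^esub>"
   using W.minus_add_cancel[OF uy(3) ux(3)] W.M.a_comm[OF ux(3) uy(3)] uy(3) by simp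
  then show ?case
   using minus[OF uxy(1) ux(1)] minus[OF F.M.minus_closed[OF uxy(1) ux(1)] uy(1)]
   by (simp only: F.a_minus_free[OF ux(1)] F.a_minus_free[OF uy(1)] ux(2) uy(2) uxy(2))
 next
  case (homogeneity x xs ys c)
  let ?l = "%z. xs @ [z] @ ys"
  have in_c: "length (?l z) = n" "set (?l z) <= carrier V" if "z \<in> carrier V" for z
   using that homogeneity by auto
  note ux = u[OF in_c[OF homogeneity(1)]] and uc = u[OF in_c[OF V.smult_in[OF homogeneity(1)]]]
  have "(%z. \<phi> (?l z)) \<in> linear_maps V W"
   using multilinD(2)[OF \<phi> in_c[OF homogeneity(1)], of "length xs"] homogeneity(4) by simp
  note l = linD(3)[OF this homogeneity(1)] and sx = F.smult_in[OF ux(1), of c, unfolded F.smult]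
  show ?case
   using minus[OF uc(1)[of c] sx] linD(3)[OF lin ux(1), of c] W.smult_in[OF ux(3), of c]
   by (simp only: F.a_minus_free[OF sx] F.smult ux(2) uc(2) l W.minus_self)
 qed
qed

lemma vspace_free_tensor: "vspace (free_tensor V n)"
proof -
 interpret F: free_space "free_tensor V n" "{xs. length xs = n & set xs <= carrier V}"
  by (rule free_space_free_tensor)
 show ?thesis by (rule F.vspace_axioms)
qed

lemma vspace_tensor_pow: "vspace V ==> vspace (tensor_pow V n)"
 unfolding tensor_pow_def
 by (rule vspace.vspace_quot[OF vspace_free_tensor subspace_tensor_rel])

lemma tensor_class_linear: "vspace V ==> tensor_class V n \<in> linear_maps (free_tensor V n) (tensor_pow V n)"
 unfolding tensor_pow_def tensor_class_def[abs_def]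
 by (rule vspace.coset_linear[OF vspace_free_tensor subspace_tensor_rel])

lemma carrier_free_tensor:
 "p \<in> carrier (free_tensor V n) \<longleftrightarrow> pkeys p <= {xs. length xs = n & set xs <= carrier V}"
 by (simp add: free_space.carr[OF free_space_free_tensor])

lemma carrier_tensor_pow: "carrier (tensor_pow V n) = tensor_class V n ` carrier (free_tensor V n)"
 by (auto simp: tensor_pow_def tensor_class_def)

lemma pure_tensor_carrier:
 "length xs = n ==> set xs <= carrier V ==> pure_tensor V xs \<in> carrier (tensor_pow V n)"
 by (auto simp: pure_tensor_class carrier_tensor_pow carrier_free_tensor)

lemma tensor_class_lin_ext:
 assumes V: "vspace V" and p: "p \<in> carrier (free_tensor V n)"
 shows "tensor_class V n p = lin_ext (tensor_pow V n) (pure_tensor V) p"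
proof -
 note F = free_space_free_tensor[of V n] and T = vspace_tensor_pow[OF V, of n]
 interpret T: vspace "tensor_pow V n" by (rule T)
 note pc = pure_tensor_carrier[of _ n V]
 show ?thesis
  by (rule free_linear_eqI[OF F T tensor_class_linear[OF V] lin_ext_linear_maps[OF F T] _ p])
   (auto simp: pc pure_tensor_class[symmetric] T.lin_ext_unit)
qed

lemma tensor_cases:
 assumes V: "vspace V" and t: "t \<in> carrier (tensor_pow V n)"
 obtains p where "pkeys p <= {xs. length xs = n & set xs <= carrier V}"
  "t = lin_ext (tensor_pow V n) (pure_tensor V) p"
 using t tensor_class_lin_ext[OF V] by (auto simp: carrier_tensor_pow carrier_free_tensor)

text \<open>Every tensor is a finite combination of pure ones, by \<open>tensor_cases\<close>. Maps
  on tensor powers are usually compared in this way below.\<close>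

lemma tensor_map_eqI:
 assumes V: "vspace V" and W: "vspace W"
  and f: "f \<in> linear_maps (tensor_pow V n) W" and g: "g \<in> linear_maps (tensor_pow V n) W"
  and eq: "!!xs. length xs = n ==> set xs <= carrier V ==> f (pure_tensor V xs) = g (pure_tensor V xs)"
  and t: "t \<in> carrier (tensor_pow V n)"
 shows "f t = g t"
proof -
 obtain p where p: "pkeys p <= {xs. length xs = n & set xs <= carrier V}"
  "t = lin_ext (tensor_pow V n) (pure_tensor V) p"
  using tensor_cases[OF V t] .
 interpret W: vspace W by fact
 have pc: "pure_tensor V k \<in> carrier (tensor_pow V n)" if "k \<in> pkeys p" for k
  using p that by (auto intro!: pure_tensor_carrier)
 have "f t = lin_ext W (%k. f (pure_tensor V k)) p"
  unfolding p(2) by (rule lin_lin_ext[OF f vspace_tensor_pow[OF V] W pc])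
 also have "... = lin_ext W (%k. g (pure_tensor V k)) p"
  by (rule W.lin_ext_cong) (use p eq linD(1)[OF f pc] in auto)
 also have "... = g t"
  unfolding p(2) by (rule lin_lin_ext[OF g vspace_tensor_pow[OF V] W pc, symmetric])
 finally show ?thesis .
qed

lemma multilin_pure_tensor:
 assumes V: "vspace V"
 shows "multilin V (tensor_pow V n) n (pure_tensor V)"
proof -
 interpret V: vspace V by fact
 interpret F: free_space "free_tensor V n" "{xs. length xs = n & set xs <= carrier V}"
  by (rule free_space_free_tensor)
 note lin = tensor_class_linear[OF V, of n] and rel = subspace_tensor_rel[OF V, of n]
 have class_eqI: "tensor_class V n p = tensor_class V n q"
  if "p \<in> carrier (free_tensor V n)" "q \<in> carrier (free_tensor V n)" "p - q \<in> tensor_rel V n" for p q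
  unfolding tensor_class_def F.coset_eq[OF rel that(1,2)] F.a_minus_free[OF that(2)] by (rule that(3))
 show ?thesis
 proof (rule multilinI)
  fix xs i
  assume xs: "length xs = n" "set xs <= carrier V" and i: "i < n"
  have up: "xs[i := z] = take i xs @ [z] @ drop (Suc i) xs" for z
   using i xs by (simp add: upd_conv_take_nth_drop)
  have st: "set (take i xs) <= carrier V" "set (drop (Suc i) xs) <= carrier V"
   "Suc (length (take i xs) + length (drop (Suc i) xs)) = n"
   using xs i set_take_subset[of i xs] set_drop_subset[of "Suc i" xs] by auto
  have u: "pm_unit (xs[i := z]) \<in> carrier (free_tensor V n)" if "z \<in> carrier V" for z
   using xs that by (simp add: carrier_free_tensor set_list_update_subset)
  have pt: "pure_tensor V (xs[i := z]) = tensor_class V n (pm_unit (xs[i := z]))" for z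
   using xs by (simp add: pure_tensor_class)
  show "(%z. pure_tensor V (xs[i := z])) \<in> linear_maps V (tensor_pow V n)"
   unfolding pt
  proof (rule linI[OF linD(1)[OF lin u]])
   fix x assume x: "x \<in> carrier V"
   fix c
   note s = F.smult_in[OF u[OF x], of c, unfolded F.smult]
   have "pm_unit (xs[i := c \<odot>\<^bsub>V\<^esub> x]) - pm_scale c (pm_unit (xs[i := x])) \<in> tensor_rel V n"
    unfolding up by (rule tensor_rel.homogeneity[OF x st])
   from class_eqI[OF u[OF V.smult_in[OF x]] s this]
   show "tensor_class V n (pm_unit (xs[i := c \<odot>\<^bsub>V\<^esub> x])) = c \<odot>\<^bsub>tensor_pow V n\<^esub> tensor_class V n (pm_unit (xs[i := x]))"
    using linD(3)[OF lin u[OF x], of c] by (simp only: F.smult)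
  next
   fix x y assume x: "x \<in> carrier V" and y: "y \<in> carrier V"
   note s = F.M.a_closed[OF u[OF x] u[OF y], unfolded F.add]
   have "pm_unit (xs[i := x \<oplus>\<^bsub>V\<^esub> y]) - (pm_unit (xs[i := x]) + pm_unit (xs[i := y])) \<in> tensor_rel V n"
    unfolding up diff_diff_eq[symmetric] by (rule tensor_rel.additivity[OF x y st])
   from class_eqI[OF u[OF V.M.a_closed[OF x y]] s this]
   show "tensor_class V n (pm_unit (xs[i := x \<oplus>\<^bsub>V\<^esub> y])) =
     tensor_class V n (pm_unit (xs[i := x])) \<oplus>\<^bsub>tensor_pow V n\<^esub> tensor_class V n (pm_unit (xs[i := y]))"
    using linD(2)[OF lin u[OF x] u[OF y]] by (simp only: F.add)
  qed
 qed (use pure_tensor_carrier in blast)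
qed

lemma pure2_linear:
 assumes V: "vspace V" and x: "x \<in> carrier V"
 shows "(%y. pure_tensor V [y, x]) \<in> linear_maps V (tensor_pow V 2)" "(%y. pure_tensor V [x, y]) \<in> linear_maps V (tensor_pow V 2)"
 using multilinD(2)[OF multilin_pure_tensor[OF V], of "[x, x]" 2 0] multilinD(2)[OF multilin_pure_tensor[OF V], of "[x, x]" 2 1] x
 by simp_all

text \<open>Two representatives of a tensor differ by relations, which the linear extension kills;
  so the image of the coset is a singleton and \<open>the_elem\<close> returns its only
  element.\<close>

lemma tensor_lift_class:
 assumes V: "vspace V" and W: "vspace W" and \<phi>: "multilin V W n \<phi>" and p: "p \<in> carrier (free_tensor V n)"
 shows "tensor_lift W \<phi> (tensor_class V n p) = lin_ext W \<phi> p"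
proof -
 interpret F: free_space "free_tensor V n" "{xs. length xs = n & set xs <= carrier V}"
  by (rule free_space_free_tensor)
 interpret W: vspace W by fact
 have lin: "lin_ext W \<phi> \<in> linear_maps (free_tensor V n) W"
  by (rule lin_ext_linear_maps[OF F.free_space_axioms W]) (use multilinD[OF \<phi>] in auto)
 note sub = subspace_tensor_rel[OF V, of n]
 have "lin_ext W \<phi> q = lin_ext W \<phi> p" if "q \<in> tensor_class V n p" for q
 proof -
  have q: "q \<in> carrier (free_tensor V n)" "q \<ominus>\<^bsub>free_tensor V n\<^esub> p \<in> tensor_rel V n"
   using that p unfolding tensor_class_def by (auto simp: F.mem_coset[OF sub])
  have "lin_ext W \<phi> q \<ominus>\<^bsub>W\<^esub> lin_ext W \<phi> p = \<zero>\<^bsub>W\<^esub>"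
   by (rule trans[OF lin_minus[OF lin F.vspace_axioms W q(1) p, symmetric] lin_ext_tensor_rel[OF V W \<phi> q(2)]])
  then show ?thesis
   by (rule W.minus_eq_zero_iff[OF linD(1)[OF lin q(1)] linD(1)[OF lin p], THEN iffD1])
 qed
 moreover have "p \<in> tensor_class V n p" unfolding tensor_class_def by (rule F.coset_self[OF sub p])
 ultimately have "lin_ext W \<phi> ` tensor_class V n p = {lin_ext W \<phi> p}"
  by (intro Set.set_eqI) (metis (no_types) image_iff singleton_iff)
 then show ?thesis by (simp add: tensor_lift_def)
qed

lemma tensor_lift_pure:
 assumes "vspace V" "vspace W" "multilin V W n \<phi>" "length xs = n" "set xs <= carrier V"
 shows "tensor_lift W \<phi> (pure_tensor V xs) = \<phi> xs"
proof -
 interpret W: vspace W by fact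
 have "pm_unit xs \<in> carrier (free_tensor V n)" using assms by (simp add: carrier_free_tensor)
 from tensor_lift_class[OF assms(1-3) this] show ?thesis
  using assms multilinD(1)[OF assms(3)] by (simp add: pure_tensor_class)
qed

lemma tensor_lift_linear:
 assumes V: "vspace V" and W: "vspace W" and \<phi>: "multilin V W n \<phi>"
 shows "tensor_lift W \<phi> \<in> linear_maps (tensor_pow V n) W"
proof -
 interpret F: free_space "free_tensor V n" "{xs. length xs = n & set xs <= carrier V}"
  by (rule free_space_free_tensor)
 have lin: "lin_ext W \<phi> \<in> linear_maps (free_tensor V n) W"
  by (rule lin_ext_linear_maps[OF F.free_space_axioms W]) (use multilinD[OF \<phi>] in auto)
 note cl = tensor_class_linear[OF V, of n]
 note l = tensor_lift_class[OF V W \<phi>]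
 show ?thesis
 proof (rule linI)
  fix s assume "s \<in> carrier (tensor_pow V n)"
  then obtain p where p: "p \<in> carrier (free_tensor V n)" "s = tensor_class V n p"
   by (auto simp: carrier_tensor_pow)
  show "tensor_lift W \<phi> s \<in> carrier W" using l[OF p(1)] p(2) linD(1)[OF lin p(1)] by simp
  show "tensor_lift W \<phi> (c \<odot>\<^bsub>tensor_pow V n\<^esub> s) = c \<odot>\<^bsub>W\<^esub> tensor_lift W \<phi> s" for c
   using l[OF p(1)] l[OF F.smult_in[OF p(1), of c]] linD(3)[OF lin p(1), of c]
    linD(3)[OF cl p(1), of c] p(2) by simp
  fix t assume "t \<in> carrier (tensor_pow V n)"
  then obtain q where q: "q \<in> carrier (free_tensor V n)" "t = tensor_class V n q"
   by (auto simp: carrier_tensor_pow)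
  show "tensor_lift W \<phi> (s \<oplus>\<^bsub>tensor_pow V n\<^esub> t) = tensor_lift W \<phi> s \<oplus>\<^bsub>W\<^esub> tensor_lift W \<phi> t"
   using l[OF p(1)] l[OF q(1)] l[OF F.M.a_closed[OF p(1) q(1)]] linD(2)[OF lin p(1) q(1)]
    linD(2)[OF cl p(1) q(1)] p(2) q(2) by simp
 qed
qed

lemma multilin_tensor_map:
 assumes "vspace W" "f \<in> linear_maps V W"
 shows "multilin V (tensor_pow W n) n (%xs. pure_tensor W (map f xs))"
 by (rule multilin_map[OF multilin_pure_tensor[OF assms(1)] assms(2)])

lemma tensor_map_linear:
 assumes "vspace V" "vspace W" "f \<in> linear_maps V W"
 shows "tensor_map W n f \<in> linear_maps (tensor_pow V n) (tensor_pow W n)"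
 unfolding tensor_map_def
 by (rule tensor_lift_linear[OF assms(1) vspace_tensor_pow[OF assms(2)] multilin_tensor_map[OF assms(2,3)]])

lemma tensor_map_pure:
 assumes "vspace V" "vspace W" "f \<in> linear_maps V W" "length xs = n" "set xs <= carrier V"
 shows "tensor_map W n f (pure_tensor V xs) = pure_tensor W (map f xs)"
 unfolding tensor_map_def
 by (rule tensor_lift_pure[OF assms(1) vspace_tensor_pow[OF assms(2)] multilin_tensor_map[OF assms(2,3)] assms(4,5)])

lemma tensor_map_comp:
 assumes "vspace U" "vspace V" "vspace W" "f \<in> linear_maps U V" "g \<in> linear_maps V W"
  and "t \<in> carrier (tensor_pow U n)"
 shows "tensor_map W n g (tensor_map V n f t) = tensor_map W n (%x. g (f x)) t"
proof (rule tensor_map_eqI[OF assms(1) vspace_tensor_pow[OF assms(3)] _ _ _ assms(6)])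
 show "(%t. tensor_map W n g (tensor_map V n f t)) \<in> linear_maps (tensor_pow U n) (tensor_pow W n)"
  by (rule lin_comp[OF tensor_map_linear[OF assms(1,2,4)] tensor_map_linear[OF assms(2,3,5)]])
 show "tensor_map W n (%x. g (f x)) \<in> linear_maps (tensor_pow U n) (tensor_pow W n)"
  by (rule tensor_map_linear) (use assms lin_comp in auto)
 fix xs assume xs: "length xs = n" "set xs <= carrier U"
 show "tensor_map W n g (tensor_map V n f (pure_tensor U xs)) = tensor_map W n (%x. g (f x)) (pure_tensor U xs)"
  using xs tensor_map_pure[OF assms(1,2,4) xs] set_map_linear[OF assms(4) xs(2)]
   tensor_map_pure[OF assms(2,3,5), of "map f xs" n]
   tensor_map_pure[OF assms(1,3) lin_comp[OF assms(4,5)] xs] by (simp add: comp_def)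
qed

lemma lin_add:
 assumes W: "vspace W" and f: "f \<in> linear_maps V W" and g: "g \<in> linear_maps V W"
 shows "(%x. f x \<oplus>\<^bsub>W\<^esub> g x) \<in> linear_maps V W"
proof -
 interpret W: vspace W by fact
 note D = linD[OF f] linD[OF g]
 show ?thesis by (rule linI) (simp_all add: D W.smult_add_right W.M.a_ac)
qed

lemma lin_scale:
 assumes W: "vspace W" and f: "f \<in> linear_maps V W"
 shows "(%x. c \<odot>\<^bsub>W\<^esub> f x) \<in> linear_maps V W"
proof -
 interpret W: vspace W by fact
 note D = linD[OF f]
 show ?thesis by (rule linI) (simp_all add: D W.smult_add_right W.smult_smult mult.commute)
qed

lemma lin_cong:
 assumes V: "vspace V" and "f \<in> linear_maps V W" "!!x. x \<in> carrier V ==> g x = f x"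
 shows "g \<in> linear_maps V W"
proof -
 interpret V: vspace V by fact
 show ?thesis
  by (rule linI) (simp_all add: assms(3) linD[OF assms(2)])
qed

lemma lin_finsum_fun:
 assumes V: "vspace V" and W: "vspace W" and f: "!!i. i \<in> S ==> f i \<in> linear_maps V W"
 shows "(%x. \<Oplus>\<^bsub>W\<^esub>i\<in>S. f i x) \<in> linear_maps V W"
 using f
proof (induction S rule: infinite_finite_induct)
 case (infinite S)
 interpret W: vspace W by fact
 show ?case by (rule linI) (use infinite in "auto simp: W.finsum_infinite")
next
 case empty
 interpret W: vspace W by fact
 show ?case by (rule linI) auto
next
 case (insert i S)
 interpret W: vspace W by fact
 have "(%x. f i x \<oplus>\<^bsub>W\<^esub> (\<Oplus>\<^bsub>W\<^esub>i\<in>S. f i x)) \<in> linear_maps V W"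
  by (rule lin_add[OF W]) (use insert in auto)
 moreover have "(\<Oplus>\<^bsub>W\<^esub>i\<in>insert i S. f i x) = f i x \<oplus>\<^bsub>W\<^esub> (\<Oplus>\<^bsub>W\<^esub>i\<in>S. f i x)" if "x \<in> carrier V" for x
  by (rule W.M.finsum_insert) (use insert that in "auto intro: linD(1)")
 ultimately show ?case by (rule lin_cong[OF V])
qed

lemma tensor_lift_add:
 assumes V: "vspace V" and W: "vspace W" and \<phi>: "multilin V W n \<phi>" and \<psi>: "multilin V W n \<psi>"
  and \<chi>: "multilin V W n \<chi>"
  and eq: "!!xs. length xs = n ==> set xs <= carrier V ==> \<chi> xs = \<phi> xs \<oplus>\<^bsub>W\<^esub> \<psi> xs"
  and t: "t \<in> carrier (tensor_pow V n)"
 shows "tensor_lift W \<chi> t = tensor_lift W \<phi> t \<oplus>\<^bsub>W\<^esub> tensor_lift W \<psi> t"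
 by (rule tensor_map_eqI[OF V W tensor_lift_linear[OF V W \<chi>]
   lin_add[OF W tensor_lift_linear[OF V W \<phi>] tensor_lift_linear[OF V W \<psi>]] _ t])
  (simp add: tensor_lift_pure[OF V W \<phi>] tensor_lift_pure[OF V W \<psi>] tensor_lift_pure[OF V W \<chi>] eq)

lemma tensor_lift_scale:
 assumes V: "vspace V" and W: "vspace W" and \<phi>: "multilin V W n \<phi>" and \<chi>: "multilin V W n \<chi>"
  and eq: "!!xs. length xs = n ==> set xs <= carrier V ==> \<chi> xs = c \<odot>\<^bsub>W\<^esub> \<phi> xs"
  and t: "t \<in> carrier (tensor_pow V n)"
 shows "tensor_lift W \<chi> t = c \<odot>\<^bsub>W\<^esub> tensor_lift W \<phi> t"
 by (rule tensor_map_eqI[OF V W tensor_lift_linear[OF V W \<chi>]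
   lin_scale[OF W tensor_lift_linear[OF V W \<phi>]] _ t])
  (simp add: tensor_lift_pure[OF V W \<phi>] tensor_lift_pure[OF V W \<chi>] eq)

lemma tensor_lift_linear_comp:
 assumes V: "vspace V" and W: "vspace W" and W': "vspace W'" and \<phi>: "multilin V W n \<phi>"
  and f: "f \<in> linear_maps W W'" and t: "t \<in> carrier (tensor_pow V n)"
 shows "f (tensor_lift W \<phi> t) = tensor_lift W' (%xs. f (\<phi> xs)) t"
 by (rule tensor_map_eqI[OF V W' lin_comp[OF tensor_lift_linear[OF V W \<phi>] f]
   tensor_lift_linear[OF V W' multilin_linear_comp[OF \<phi> f]] _ t])
  (simp add: tensor_lift_pure[OF V W \<phi>] tensor_lift_pure[OF V W' multilin_linear_comp[OF \<phi> f]])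

lemma tensor_lift_map:
 assumes U: "vspace U" and V: "vspace V" and W: "vspace W" and \<phi>: "multilin V W n \<phi>"
  and f: "f \<in> linear_maps U V" and t: "t \<in> carrier (tensor_pow U n)"
 shows "tensor_lift W \<phi> (tensor_map V n f t) = tensor_lift W (%xs. \<phi> (map f xs)) t"
proof (rule tensor_map_eqI[OF U W lin_comp[OF tensor_map_linear[OF U V f] tensor_lift_linear[OF V W \<phi>]]
   tensor_lift_linear[OF U W multilin_map[OF \<phi> f]] _ t])
 fix xs assume xs: "length xs = n" "set xs <= carrier U"
 then have "length (map f xs) = n" "set (map f xs) <= carrier V"
  using set_map_linear[OF f] by auto
 with xs show "tensor_lift W \<phi> (tensor_map V n f (pure_tensor U xs)) = tensor_lift W (%xs. \<phi> (map f xs)) (pure_tensor U xs)"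
  by (simp add: tensor_map_pure[OF U V f] tensor_lift_pure[OF V W \<phi>] tensor_lift_pure[OF U W multilin_map[OF \<phi> f]])
qed

lemma tensor_lift_cong:
 assumes V: "vspace V" and W: "vspace W" and \<phi>: "multilin V W n \<phi>" and \<psi>: "multilin V W n \<psi>"
  and eq: "!!xs. length xs = n ==> set xs <= carrier V ==> \<phi> xs = \<psi> xs"
  and t: "t \<in> carrier (tensor_pow V n)"
 shows "tensor_lift W \<phi> t = tensor_lift W \<psi> t"
 by (rule tensor_map_eqI[OF V W tensor_lift_linear[OF V W \<phi>] tensor_lift_linear[OF V W \<psi>] _ t])
  (simp add: tensor_lift_pure[OF V W \<phi>] tensor_lift_pure[OF V W \<psi>] eq)

text \<open>When slot \<open>i\<close> is replaced by the block \<open>ys\<close>, positions in the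
  block are shifted by \<open>i\<close>, earlier positions stay, and later ones move by
  \<open>length ys - 1\<close>.\<close>

lemma insert_list_update:
 assumes "i < length xs"
 shows "j < length ys ==> take i xs @ ys[j := x] @ drop (Suc i) xs = (take i xs @ ys @ drop (Suc i) xs)[i + j := x]"
  and "j < i ==> take i (xs[j := x]) @ ys @ drop (Suc i) (xs[j := x]) =
   (take i xs @ ys @ drop (Suc i) xs)[j := x]"
  and "i < j ==> j < length xs ==> take i (xs[j := x]) @ ys @ drop (Suc i) (xs[j := x]) =
   (take i xs @ ys @ drop (Suc i) xs)[j + length ys - 1 := x]"
proof -
 show "j < length ys ==> take i xs @ ys[j := x] @ drop (Suc i) xs = (take i xs @ ys @ drop (Suc i) xs)[i + j := x]"
  "j < i ==> take i (xs[j := x]) @ ys @ drop (Suc i) (xs[j := x]) =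
   (take i xs @ ys @ drop (Suc i) xs)[j := x]"
  using assms by (simp_all add: list_update_append take_update_swap)
 assume "i < j" "j < length xs"
 then have "\<not> j + length ys - 1 < i" "\<not> j + length ys - 1 - i < length ys"
  "j + length ys - 1 - i - length ys = j - Suc i" "length (take i xs) = i"
  using assms by auto
 then show "take i (xs[j := x]) @ ys @ drop (Suc i) (xs[j := x]) =
   (take i xs @ ys @ drop (Suc i) xs)[j + length ys - 1 := x]"
  using \<open>i < j\<close> by (simp only: list_update_append if_False) (simp add: drop_update_swap)
qed

lemma insert_list_subset:
 assumes "i < n" "length xs = n" "set xs <= A" "length ys = 2" "set ys <= A"
 shows "length (take i xs @ ys @ drop (Suc i) xs) = Suc n" "set (take i xs @ ys @ drop (Suc i) xs) <= A"
 using assms set_take_subset[of i xs] set_drop_subset[of "Suc i" xs] by auto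

lemma multilin_insert:
 assumes V: "vspace V" and i: "i < n" and xs: "length xs = n" "set xs <= carrier V"
 shows "multilin V (tensor_pow V (Suc n)) 2 (%ys. pure_tensor V (take i xs @ ys @ drop (Suc i) xs))"
proof (rule multilinI)
 note M = multilin_pure_tensor[OF V, of "Suc n"]
 fix ys assume ys: "length ys = 2" "set ys <= carrier V"
 note zs = insert_list_subset[OF i xs ys]
 show "pure_tensor V (take i xs @ ys @ drop (Suc i) xs) \<in> carrier (tensor_pow V (Suc n))"
  by (rule multilinD(1)[OF M zs])
 fix j :: nat assume j: "j < 2"
 have ij: "i + j < Suc n" using i j by simp
 have up: "take i xs @ ys[j := z] @ drop (Suc i) xs = (take i xs @ ys @ drop (Suc i) xs)[i + j := z]" for z
  by (rule insert_list_update) (use i xs ys j in auto)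
 show "(%z. pure_tensor V (take i xs @ ys[j := z] @ drop (Suc i) xs)) \<in> linear_maps V (tensor_pow V (Suc n))"
  unfolding up by (rule multilinD(2)[OF M zs ij])
qed

text \<open>In slot \<open>i\<close> linearity comes from \<open>D\<close> followed by a linear
  lift. Any other slot enters the map that is lifted, and there the linearity of
  \<open>tensor_lift\<close> in its multilinear argument is used.\<close>

lemma multilin_comult_at:
 assumes V: "vspace V" and D: "D \<in> linear_maps V (tensor_pow V 2)" and i: "i < n"
 shows "multilin V (tensor_pow V (Suc n)) n
  (%xs. tensor_lift (tensor_pow V (Suc n)) (%ys. pure_tensor V (take i xs @ ys @ drop (Suc i) xs)) (D (xs ! i)))"
  (is "multilin V ?T n (%xs. tensor_lift ?T (?\<phi> xs) (D (xs ! i)))")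
proof (rule multilinI)
 have T: "vspace ?T" by (rule vspace_tensor_pow[OF V])
 note M = multilin_pure_tensor[OF V, of "Suc n"]
 fix xs assume xs: "length xs = n" "set xs <= carrier V"
 have ml: "multilin V ?T 2 (?\<phi> xs)" by (rule multilin_insert[OF V i xs])
 have xi: "xs ! i \<in> carrier V" using xs i by auto
 note lin = tensor_lift_linear[OF V T ml]
 show "tensor_lift ?T (?\<phi> xs) (D (xs ! i)) \<in> carrier ?T"
  by (rule linD(1)[OF lin linD(1)[OF D xi]])
 fix j assume j: "j < n"
 have up: "multilin V ?T 2 (?\<phi> (xs[j := z]))" if "z \<in> carrier V" for z
  by (rule multilin_insert[OF V i]) (use xs that in "auto simp: set_list_update_subset")
 show "(%z. tensor_lift ?T (?\<phi> (xs[j := z])) (D (xs[j := z] ! i))) \<in> linear_maps V ?T"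
 proof (cases "j = i")
  case True
  then show ?thesis using lin_comp[OF D lin] xs i by simp
 next
  case False
  note Dx = linD(1)[OF D xi]
  have sl: "(%z. ?\<phi> (xs[j := z]) ys) \<in> linear_maps V ?T" if ys: "length ys = 2" "set ys <= carrier V" for ys
  proof -
   obtain k where k: "k < Suc n" "!!z. take i (xs[j := z]) @ ys @ drop (Suc i) (xs[j := z]) =
     (take i xs @ ys @ drop (Suc i) xs)[k := z]"
   proof (cases "j < i")
    case True
    then show ?thesis using insert_list_update(2)[of i xs j] i j xs that(1) that[of j] by auto
   next
    case j': False
    then show ?thesis using insert_list_update(3)[of i xs j] i j xs ys False that[of "j + 1"] by auto
   qed
   show ?thesis unfolding k(2) by (rule multilinD(2)[OF M insert_list_subset[OF i xs ys] k(1)])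
  qed
  have "(%z. tensor_lift ?T (?\<phi> (xs[j := z])) (D (xs ! i))) \<in> linear_maps V ?T"
  proof (rule linI)
   fix x assume x: "x \<in> carrier V"
   show "tensor_lift ?T (?\<phi> (xs[j := x])) (D (xs ! i)) \<in> carrier ?T"
    by (rule linD(1)[OF tensor_lift_linear[OF V T up[OF x]] Dx])
   show "tensor_lift ?T (?\<phi> (xs[j := c \<odot>\<^bsub>V\<^esub> x])) (D (xs ! i)) = c \<odot>\<^bsub>?T\<^esub> tensor_lift ?T (?\<phi> (xs[j := x])) (D (xs ! i))" for c
    by (rule tensor_lift_scale[OF V T up[OF x] up[OF vspace.smult_in[OF V x]] linD(3)[OF sl x] Dx])
   fix y assume y: "y \<in> carrier V"
   have xy: "x \<oplus>\<^bsub>V\<^esub> y \<in> carrier V" using V x y by (simp add: vspace_def module_def abelian_group_def abelian_monoid.a_closed)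
   show "tensor_lift ?T (?\<phi> (xs[j := x \<oplus>\<^bsub>V\<^esub> y])) (D (xs ! i)) =
     tensor_lift ?T (?\<phi> (xs[j := x])) (D (xs ! i)) \<oplus>\<^bsub>?T\<^esub> tensor_lift ?T (?\<phi> (xs[j := y])) (D (xs ! i))"
    by (rule tensor_lift_add[OF V T up[OF x] up[OF y] up[OF xy] linD(2)[OF sl x y] Dx])
  qed
  with False show ?thesis by simp
 qed
qed

lemma comult_at_linear:
 assumes "vspace H" "comult H \<in> linear_maps H (tensor_pow H 2)" "i < n"
 shows "comult_at H n i \<in> linear_maps (tensor_pow H n) (tensor_pow H (Suc n))"
 unfolding comult_at_def
 by (rule tensor_lift_linear[OF assms(1) vspace_tensor_pow[OF assms(1)] multilin_comult_at[OF assms]])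

lemma comult_at_pure:
 assumes "vspace H" "comult H \<in> linear_maps H (tensor_pow H 2)" "i < n" "length xs = n" "set xs <= carrier H"
 shows "comult_at H n i (pure_tensor H xs) =
  tensor_lift (tensor_pow H (Suc n)) (%ys. pure_tensor H (take i xs @ ys @ drop (Suc i) xs)) (comult H (xs ! i))"
 unfolding comult_at_def
 by (rule tensor_lift_pure[OF assms(1) vspace_tensor_pow[OF assms(1)] multilin_comult_at[OF assms(1-3)] assms(4,5)])

lemma multilin_head_linear:
 assumes M: "multilin V W (Suc n) \<phi>" and V: "vspace V" and xs: "length xs = n" "set xs <= carrier V"
 shows "(%x. \<phi> (x # xs)) \<in> linear_maps V W"
proof -
 have "\<zero>\<^bsub>V\<^esub> \<in> carrier V" using V by (simp add: vspace_def module_def abelian_group_def abelian_monoid.zero_closed)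
 then show ?thesis using multilinD(2)[OF M, of "\<zero>\<^bsub>V\<^esub> # xs" 0] xs by simp
qed

lemma pure_tensor_linear:
 assumes V: "vspace V"
 shows "(%x. pure_tensor V [x]) \<in> linear_maps V (tensor_pow V 1)"
 using multilin_head_linear[OF multilin_pure_tensor[OF V] V, of "[]"] by simp

lemma iter_comult_linear:
 assumes V: "vspace H" and D: "comult H \<in> linear_maps H (tensor_pow H 2)"
 shows "iter_comult H n \<in> linear_maps H (tensor_pow H (Suc n))"
proof (induction n)
 case 0
 have "iter_comult H 0 = (%x. pure_tensor H [x])" by auto
 then show ?case using pure_tensor_linear[OF V] by simp
next
 case (Suc n)
 have "iter_comult H (Suc n) = (%x. comult_at H (Suc n) 0 (iter_comult H n x))" by auto
 with lin_comp[OF Suc comult_at_linear[OF V D, of 0 "Suc n"]] show ?case by (simp only: zero_less_Suc)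
qed

subsection \<open>Multiplication of tensors\<close>

locale calg = vspace H + ring H for H :: "(complex, 'a, 'm) module_scheme" (structure) +
 assumes smult_mult_left: "[|x \<in> carrier H; y \<in> carrier H|] ==> (c \<odot> x) \<otimes> y = c \<odot> (x \<otimes> y)"
  and smult_mult_right: "[|x \<in> carrier H; y \<in> carrier H|] ==> x \<otimes> (c \<odot> y) = c \<odot> (x \<otimes> y)"
begin

lemma map2_mult_carrier:
 assumes "set xs <= carrier H" "set ys <= carrier H"
 shows "set (map2 (\<otimes>) xs ys) <= carrier H"
proof
 fix z assume "z \<in> set (map2 (\<otimes>) xs ys)"
 then obtain a b where "(a, b) \<in> set (zip xs ys)" "z = a \<otimes> b" by auto
 then show "z \<in> carrier H" using set_zip_leftD[of a b xs ys] set_zip_rightD[of a b xs ys] assms by auto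
qed

lemma map2_mult_closed:
 "[|length xs = n; length ys = n; set xs <= carrier H; set ys <= carrier H|] ==>
  length (map2 (\<otimes>) xs ys) = n & set (map2 (\<otimes>) xs ys) <= carrier H"
 using map2_mult_carrier by simp

lemma tensor_conv_closed:
 "p \<in> carrier (free_tensor H n) ==> q \<in> carrier (free_tensor H n) ==>
   pm_conv (map2 (\<otimes>)) p q \<in> carrier (free_tensor H n)"
 unfolding carrier_free_tensor
proof (rule keys_pm_conv)
 fix a b
 assume "pkeys p <= {xs. length xs = n & set xs <= carrier H}" "a \<in> pkeys p"
  "pkeys q <= {xs. length xs = n & set xs <= carrier H}" "b \<in> pkeys q"
 then show "map2 (\<otimes>) a b \<in> {xs. length xs = n & set xs <= carrier H}"
  using map2_mult_closed[of a n b] by (simp only: mem_Collect_eq) (blast dest: subsetD)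
qed

text \<open>Slotwise multiplication by a list turns a generating relation into another one of the
  same kind, by distributivity at the distinguished slot. Hence the relations form a two-sided
  ideal.\<close>

lemma tensor_rel_conv:
 assumes p: "p \<in> tensor_rel H n" and zs: "length zs = n" "set zs <= carrier H"
 shows "pm_conv (map2 (\<otimes>)) p (pm_unit zs) \<in> tensor_rel H n & pm_conv (map2 (\<otimes>)) (pm_unit zs) p \<in> tensor_rel H n"
 using p
proof (induction rule: tensor_rel.induct)
 case zero then show ?case by (simp add: tensor_rel.zero)
next
 case (add p q) then show ?case by (simp add: pm_conv_add_left pm_conv_add_right tensor_rel.add)
next
 case (scale p c) then show ?case by (simp add: pm_conv_scale_left pm_conv_scale_right tensor_rel.scale)
next
 case (additivity x y xs ys)
 obtain us w vs where z: "zs = us @ [w] @ vs" "length us = length xs" "length vs = length ys"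
 proof
  have "length xs < length zs" using additivity zs by simp
  then show "zs = take (length xs) zs @ [zs ! length xs] @ drop (Suc (length xs)) zs"
   by (simp add: id_take_nth_drop)
 qed (use additivity zs in auto)
 then have w: "w \<in> carrier H" "set us <= carrier H" "set vs <= carrier H" using zs by auto
 have cl: "set (map2 (\<otimes>) xs us) <= carrier H" "set (map2 (\<otimes>) ys vs) <= carrier H"
  "set (map2 (\<otimes>) us xs) <= carrier H" "set (map2 (\<otimes>) vs ys) <= carrier H"
  by (rule map2_mult_carrier; use additivity w in simp)+
 show ?case
  using tensor_rel.additivity[of "x \<otimes> w" H "y \<otimes> w" "map2 (\<otimes>) xs us" "map2 (\<otimes>) ys vs" n]
   tensor_rel.additivity[of "w \<otimes> x" H "w \<otimes> y" "map2 (\<otimes>) us xs" "map2 (\<otimes>) vs ys" n] additivity w cl z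
  by (simp add: pm_conv_diff_left pm_conv_diff_right pm_conv_unit l_distr r_distr)
next
 case (homogeneity x xs ys c)
 obtain us w vs where z: "zs = us @ [w] @ vs" "length us = length xs" "length vs = length ys"
 proof
  have "length xs < length zs" using homogeneity zs by simp
  then show "zs = take (length xs) zs @ [zs ! length xs] @ drop (Suc (length xs)) zs"
   by (simp add: id_take_nth_drop)
 qed (use homogeneity zs in auto)
 then have w: "w \<in> carrier H" "set us <= carrier H" "set vs <= carrier H" using zs by auto
 have cl: "set (map2 (\<otimes>) xs us) <= carrier H" "set (map2 (\<otimes>) ys vs) <= carrier H"
  "set (map2 (\<otimes>) us xs) <= carrier H" "set (map2 (\<otimes>) vs ys) <= carrier H"
  by (rule map2_mult_carrier; use homogeneity w in simp)+
 show ?case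
  using tensor_rel.homogeneity[of "x \<otimes> w" H "map2 (\<otimes>) xs us" "map2 (\<otimes>) ys vs" n c]
   tensor_rel.homogeneity[of "w \<otimes> x" H "map2 (\<otimes>) us xs" "map2 (\<otimes>) vs ys" n c] homogeneity w cl z
  by (simp add: pm_conv_diff_left pm_conv_diff_right pm_conv_scale_left pm_conv_scale_right pm_conv_unit
   smult_mult_left smult_mult_right del: map_single)
qed

lemma tensor_rel_ideal:
 assumes p: "p \<in> tensor_rel H n" and q: "q \<in> carrier (free_tensor H n)"
 shows "pm_conv (map2 (\<otimes>)) p q \<in> tensor_rel H n" "pm_conv (map2 (\<otimes>)) q p \<in> tensor_rel H n"
proof -
 have "pm_conv (map2 (\<otimes>)) p q \<in> tensor_rel H n & pm_conv (map2 (\<otimes>)) q p \<in> tensor_rel H n"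
  using q unfolding carrier_free_tensor
 proof (induction rule: pm_induct)
  case (add q k c)
  then show ?case
   using tensor_rel_conv[OF p, of k]
   by (auto simp: pm_conv_add_left pm_conv_add_right pm_conv_scale_left pm_conv_scale_right
    simp del: map_single intro!: tensor_rel.add tensor_rel.scale)
 qed (auto intro: tensor_rel.zero)
 then show "pm_conv (map2 (\<otimes>)) p q \<in> tensor_rel H n" "pm_conv (map2 (\<otimes>)) q p \<in> tensor_rel H n" by auto
qed

lemma tensor_class_mult:
 assumes p: "p \<in> carrier (free_tensor H n)" and q: "q \<in> carrier (free_tensor H n)"
 shows "tensor_class H n p \<otimes>\<^bsub>tensor_pow H n\<^esub> tensor_class H n q = tensor_class H n (pm_conv (map2 (\<otimes>)) p q)"
proof -
 interpret F: free_space "free_tensor H n" "{xs. length xs = n & set xs <= carrier H}"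
  by (rule free_space_free_tensor)
 note sub = subspace_tensor_rel[OF vspace_axioms, of n]
 have m: "x \<otimes>\<^bsub>free_tensor H n\<^esub> y = pm_conv (map2 (\<otimes>)) x y" for x y by (simp add: free_tensor_def)
 show ?thesis unfolding tensor_pow_def quot_mod_simps
 proof (rule rcoset_mult_eqI)
  show "p \<in> tensor_class H n p" "q \<in> tensor_class H n q"
   using F.coset_self[OF sub p] F.coset_self[OF sub q] by (simp_all add: tensor_class_def)
  fix a b assume "a \<in> tensor_class H n p" "b \<in> tensor_class H n q"
  then have a: "a \<in> carrier (free_tensor H n)" "a \<ominus>\<^bsub>free_tensor H n\<^esub> p \<in> tensor_rel H n"
   and b: "b \<in> carrier (free_tensor H n)" "b \<ominus>\<^bsub>free_tensor H n\<^esub> q \<in> tensor_rel H n"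
   unfolding tensor_class_def using F.mem_coset[OF sub p] F.mem_coset[OF sub q] by auto
  have "pm_conv (map2 (\<otimes>)) (a - p) b + pm_conv (map2 (\<otimes>)) p (b - q) \<in> tensor_rel H n"
   using tensor_rel_ideal(1)[OF a(2) b(1)] tensor_rel_ideal(2)[OF b(2) p] p q
   by (simp add: tensor_rel.add del: F.carr)
  then have "pm_conv (map2 (\<otimes>)) a b - pm_conv (map2 (\<otimes>)) p q \<in> tensor_rel H n"
   by (simp add: pm_conv_diff_left pm_conv_diff_right)
  then show "tensor_rel H n +>\<^bsub>free_tensor H n\<^esub> (a \<otimes>\<^bsub>free_tensor H n\<^esub> b) =
    tensor_class H n (pm_conv (map2 (\<otimes>)) p q)"
   unfolding tensor_class_def m
   using F.coset_eq[OF sub tensor_conv_closed[OF a(1) b(1)] tensor_conv_closed[OF p q]]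
    F.a_minus_free[OF tensor_conv_closed[OF p q]] by (simp del: F.carr)
 qed
qed

lemma tensor_mult_closed:
 assumes "s \<in> carrier (tensor_pow H n)" "t \<in> carrier (tensor_pow H n)"
 shows "s \<otimes>\<^bsub>tensor_pow H n\<^esub> t \<in> carrier (tensor_pow H n)"
 using assms tensor_class_mult tensor_conv_closed by (auto simp: carrier_tensor_pow)

end

section \<open>Detecting zero tensors by products of linear forms\<close>

subsection \<open>Separation of tensors by evaluation\<close>

text \<open>Every separating set of linear forms is reproducing; only this consequence is needed.\<close>

definition reproducing :: "(complex, 'a, 'm) module_scheme => ('a => complex) set => bool" where
 "reproducing V E \<longleftrightarrow> E <= linear_maps V CC & (ALL X. finite X & X <= carrier V -->
   (EX (I :: nat set) e b. finite I & (\<forall>i\<in>I. e i \<in> E & b i \<in> carrier V) &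
    (\<forall>v\<in>X. v = (\<Oplus>\<^bsub>V\<^esub>i\<in>I. e i v \<odot>\<^bsub>V\<^esub> b i))))"

definition eval_prod :: "('a => complex) list => 'a list => complex" where
 "eval_prod es xs = (\<Prod>i<length es. (es ! i) (xs ! i))"

lemma eval_prod_Cons [simp]: "eval_prod (e # es) (x # xs) = e x * eval_prod es xs"
 by (simp add: eval_prod_def prod.lessThan_Suc_shift del: prod.lessThan_Suc)

lemma eval_prod_Nil [simp]: "eval_prod [] xs = 1"
 by (simp add: eval_prod_def)

lemma multilin_eval_prod:
 assumes "set es <= linear_maps V CC" "length es = n" and V: "vspace V"
 shows "multilin V CC n (eval_prod es)"
proof (rule multilinI)
 interpret V: vspace V by fact
 fix xs i assume xs: "length xs = n" "set xs <= carrier V" and i: "i < n"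
 have e: "es ! i \<in> linear_maps V CC" using assms i by auto
 have sp: "eval_prod es (xs[i := z]) = (es ! i) z * (\<Prod>j\<in>{..<n} - {i}. (es ! j) (xs ! j))" for z
 proof -
  have "eval_prod es (xs[i := z]) = (es ! i) (xs[i := z] ! i) * (\<Prod>j\<in>{..<n} - {i}. (es ! j) (xs[i := z] ! j))"
   unfolding eval_prod_def using i assms by (simp add: prod.remove)
  also have "(\<Prod>j\<in>{..<n} - {i}. (es ! j) (xs[i := z] ! j)) = (\<Prod>j\<in>{..<n} - {i}. (es ! j) (xs ! j))"
   by (rule prod.cong) auto
  finally show ?thesis using xs i by simp
 qed
 show "(%z. eval_prod es (xs[i := z])) \<in> linear_maps V CC"
  unfolding sp by (rule linI) (simp_all add: linD[OF e] distrib_right)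
qed simp

lemma multilin_Cons:
 assumes "multilin V W (Suc n) \<phi>" "b \<in> carrier V"
 shows "multilin V W n (%xs. \<phi> (b # xs))"
proof (rule multilinI)
 note M = multilinD[OF assms(1)]
 fix xs assume xs: "length xs = n" "set xs <= carrier V"
 then show "\<phi> (b # xs) \<in> carrier W" using M(1)[of "b # xs"] assms(2) by simp
 show "(%z. \<phi> (b # xs[i := z])) \<in> linear_maps V W" if "i < n" for i
  using M(2)[of "b # xs" "Suc i"] xs assms(2) that by simp
qed

text \<open>Induction on the number of slots: the head of each list is expanded by the reproducing
  formula, and its coordinate is absorbed into the coefficient. This is why \<open>c\<close> and
  \<open>xs\<close> are arbitrary in the induction.\<close>

lemma multilin_vanish:
 fixes I :: "nat set"
 assumes V: "vspace V" and W: "vspace W" and I: "finite I"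
  and e: "!!i. i \<in> I ==> e i \<in> E & b i \<in> carrier V"
  and K: "finite K"
 shows "[|multilin V W n \<phi>; !!k. k \<in> K ==> length (xs k) = n & set (xs k) <= carrier V &
    (\<forall>v\<in>set (xs k). v = (\<Oplus>\<^bsub>V\<^esub>i\<in>I. e i v \<odot>\<^bsub>V\<^esub> b i));
   !!es. length es = n ==> set es <= E ==> (\<Sum>k\<in>K. c k * eval_prod es (xs k)) = 0|]
  ==> (\<Oplus>\<^bsub>W\<^esub>k\<in>K. c k \<odot>\<^bsub>W\<^esub> \<phi> (xs k)) = \<zero>\<^bsub>W\<^esub>"
proof (induction n arbitrary: \<phi> xs c)
 case 0
 interpret W: vspace W by fact
 have "\<phi> [] \<in> carrier W" using multilinD(1)[OF 0(1), of "[]"] by simp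
 moreover have "(\<Oplus>\<^bsub>W\<^esub>k\<in>K. c k \<odot>\<^bsub>W\<^esub> \<phi> (xs k)) = (\<Oplus>\<^bsub>W\<^esub>k\<in>K. c k \<odot>\<^bsub>W\<^esub> \<phi> [])"
  by (rule W.add.finprod_cong') (use 0(2) calculation in auto)
 ultimately show ?case using 0(3)[of "[]"] by (simp flip: W.finsum_smult_left)
next
 case (Suc n)
 interpret V: vspace V by fact
 interpret W: vspace W by fact
 note M = Suc.prems(1)
 have xs: "xs k = hd (xs k) # tl (xs k)" "length (tl (xs k)) = n" "set (tl (xs k)) <= carrier V"
  "hd (xs k) \<in> carrier V" "hd (xs k) = (\<Oplus>\<^bsub>V\<^esub>i\<in>I. e i (hd (xs k)) \<odot>\<^bsub>V\<^esub> b i)"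
  "\<forall>v\<in>set (tl (xs k)). v = (\<Oplus>\<^bsub>V\<^esub>i\<in>I. e i v \<odot>\<^bsub>V\<^esub> b i)" if "k \<in> K" for k
  using Suc.prems(2)[OF that] by (cases "xs k"; simp)+
 have cl: "\<phi> (b i # tl (xs k)) \<in> carrier W" if "k \<in> K" "i \<in> I" for k i
  by (rule multilinD(1)[OF M]) (use xs[OF that(1)] e[OF that(2)] in auto)
 have "(\<Oplus>\<^bsub>W\<^esub>k\<in>K. c k \<odot>\<^bsub>W\<^esub> \<phi> (xs k)) =
   (\<Oplus>\<^bsub>W\<^esub>k\<in>K. \<Oplus>\<^bsub>W\<^esub>i\<in>I. (c k * e i (hd (xs k))) \<odot>\<^bsub>W\<^esub> \<phi> (b i # tl (xs k)))"
 proof (rule W.add.finprod_cong')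
  fix k assume k: "k \<in> K"
  note lin = multilin_head_linear[OF M V xs(2,3)[OF k]]
  have "\<phi> (xs k) = \<phi> ((\<Oplus>\<^bsub>V\<^esub>i\<in>I. e i (hd (xs k)) \<odot>\<^bsub>V\<^esub> b i) # tl (xs k))"
   using xs(1,5)[OF k] by metis
  also have "... = (\<Oplus>\<^bsub>W\<^esub>i\<in>I. \<phi> ((e i (hd (xs k)) \<odot>\<^bsub>V\<^esub> b i) # tl (xs k)))"
   by (rule lin_finsum[OF lin V W]) (use e in auto)
  also have "... = (\<Oplus>\<^bsub>W\<^esub>i\<in>I. e i (hd (xs k)) \<odot>\<^bsub>W\<^esub> \<phi> (b i # tl (xs k)))"
   by (rule W.add.finprod_cong') (use linD(3)[OF lin] e cl[OF k] in auto)
  also have "c k \<odot>\<^bsub>W\<^esub> ... = (\<Oplus>\<^bsub>W\<^esub>i\<in>I. c k \<odot>\<^bsub>W\<^esub> (e i (hd (xs k)) \<odot>\<^bsub>W\<^esub> \<phi> (b i # tl (xs k))))"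
   by (rule W.finsum_smult) (use cl[OF k] in auto)
  also have "... = (\<Oplus>\<^bsub>W\<^esub>i\<in>I. (c k * e i (hd (xs k))) \<odot>\<^bsub>W\<^esub> \<phi> (b i # tl (xs k)))"
   by (rule W.add.finprod_cong') (use cl[OF k] in "auto simp: W.smult_smult")
  finally show "c k \<odot>\<^bsub>W\<^esub> \<phi> (xs k) = (\<Oplus>\<^bsub>W\<^esub>i\<in>I. (c k * e i (hd (xs k))) \<odot>\<^bsub>W\<^esub> \<phi> (b i # tl (xs k)))" .
 qed (use cl in "auto intro!: W.M.finsum_closed")
 \<comment> \<open>The two sums are interchanged: for fixed \<open>i\<close> the inner sum has the
   form of the induction hypothesis, with \<open>\<phi>\<close> partially applied to
   \<open>b i\<close>.\<close>
 also have "... = (\<Oplus>\<^bsub>W\<^esub>i\<in>I. \<Oplus>\<^bsub>W\<^esub>k\<in>K. (c k * e i (hd (xs k))) \<odot>\<^bsub>W\<^esub> \<phi> (b i # tl (xs k)))"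
  using K I cl
 proof (induction K rule: finite_induct)
  case empty
  then show ?case by simp
 next
  case (insert k K)
  then have "(\<Oplus>\<^bsub>W\<^esub>i\<in>I. \<Oplus>\<^bsub>W\<^esub>k\<in>insert k K. (c k * e i (hd (xs k))) \<odot>\<^bsub>W\<^esub> \<phi> (b i # tl (xs k))) =
   (\<Oplus>\<^bsub>W\<^esub>i\<in>I. (c k * e i (hd (xs k))) \<odot>\<^bsub>W\<^esub> \<phi> (b i # tl (xs k)) \<oplus>\<^bsub>W\<^esub>
    (\<Oplus>\<^bsub>W\<^esub>k\<in>K. (c k * e i (hd (xs k))) \<odot>\<^bsub>W\<^esub> \<phi> (b i # tl (xs k))))"
   by (intro W.add.finprod_cong') (auto simp: Pi_def)
  also have "... = (\<Oplus>\<^bsub>W\<^esub>i\<in>I. (c k * e i (hd (xs k))) \<odot>\<^bsub>W\<^esub> \<phi> (b i # tl (xs k))) \<oplus>\<^bsub>W\<^esub>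
    (\<Oplus>\<^bsub>W\<^esub>i\<in>I. \<Oplus>\<^bsub>W\<^esub>k\<in>K. (c k * e i (hd (xs k))) \<odot>\<^bsub>W\<^esub> \<phi> (b i # tl (xs k)))"
   by (rule W.M.finsum_addf) (use insert in "auto simp: Pi_def intro!: W.M.finsum_closed")
  finally show ?case using insert by (simp add: Pi_def)
 qed
 also have "... = (\<Oplus>\<^bsub>W\<^esub>i\<in>I. \<zero>\<^bsub>W\<^esub>)"
 proof (rule W.add.finprod_cong')
  fix i assume i: "i \<in> I"
  show "(\<Oplus>\<^bsub>W\<^esub>k\<in>K. (c k * e i (hd (xs k))) \<odot>\<^bsub>W\<^esub> \<phi> (b i # tl (xs k))) = \<zero>\<^bsub>W\<^esub>"
  proof (rule Suc.IH[where \<phi> = "%xs. \<phi> (b i # xs)" and xs = "%k. tl (xs k)"])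
   show "multilin V W n (%xs. \<phi> (b i # xs))" using multilin_Cons[OF M] e[OF i] by auto
   show "length (tl (xs k)) = n & set (tl (xs k)) <= carrier V &
     (\<forall>v\<in>set (tl (xs k)). v = (\<Oplus>\<^bsub>V\<^esub>i\<in>I. e i v \<odot>\<^bsub>V\<^esub> b i))" if "k \<in> K" for k
    using xs[OF that] by simp
   fix es :: "('a => complex) list" assume es: "length es = n" "set es <= E"
   have "(\<Sum>k\<in>K. c k * e i (hd (xs k)) * eval_prod es (tl (xs k))) = (\<Sum>k\<in>K. c k * eval_prod (e i # es) (xs k))"
   proof (rule sum.cong[OF refl])
    fix k assume "k \<in> K"
    then have "eval_prod (e i # es) (xs k) = e i (hd (xs k)) * eval_prod es (tl (xs k))"
     by (metis eval_prod_Cons xs(1))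
    then show "c k * e i (hd (xs k)) * eval_prod es (tl (xs k)) = c k * eval_prod (e i # es) (xs k)"
     by (simp only: mult.assoc)
   qed
   also have "... = 0" by (rule Suc.prems(3)) (use es e[OF i] in auto)
   finally show "(\<Sum>k\<in>K. c k * e i (hd (xs k)) * eval_prod es (tl (xs k))) = 0" .
  qed
 qed auto
 finally show ?case by simp
qed

text \<open>A representative of the tensor involves finitely many vectors. The reproducing formula
  for these vectors makes \<open>multilin_vanish\<close> applicable to the universal multilinear map
  \<open>pure_tensor\<close>.\<close>

theorem tensor_eq_zeroI:
 assumes V: "vspace V" and E: "reproducing V E" and t: "t \<in> carrier (tensor_pow V n)"
  and 0: "!!es. length es = n ==> set es <= E ==> tensor_lift CC (eval_prod es) t = 0"
 shows "t = \<zero>\<^bsub>tensor_pow V n\<^esub>"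
proof -
 obtain p where p: "pkeys p <= {xs. length xs = n & set xs <= carrier V}"
  "t = lin_ext (tensor_pow V n) (pure_tensor V) p"
  using tensor_cases[OF V t] .
 have pc: "p \<in> carrier (free_tensor V n)" using p by (simp add: carrier_free_tensor)
 define X where "X = (\<Union>xs\<in>pkeys p. set xs)"
 have "finite X" "X <= carrier V" using p by (auto simp: X_def)
 then have "EX (I :: nat set) e b. finite I & (\<forall>i\<in>I. e i \<in> E & b i \<in> carrier V) &
    (\<forall>v\<in>X. v = (\<Oplus>\<^bsub>V\<^esub>i\<in>I. e i v \<odot>\<^bsub>V\<^esub> b i))"
  using E unfolding reproducing_def by (elim conjE allE[of _ X]) simp
 then obtain I :: "nat set" and e b where "finite I & (\<forall>i\<in>I. e i \<in> E & b i \<in> carrier V) &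
    (\<forall>v\<in>X. v = (\<Oplus>\<^bsub>V\<^esub>i\<in>I. e i v \<odot>\<^bsub>V\<^esub> b i))"
  by (elim exE)
 then have I: "finite I" "!!i. i \<in> I ==> e i \<in> E & b i \<in> carrier V"
   "!!v. v \<in> X ==> v = (\<Oplus>\<^bsub>V\<^esub>i\<in>I. e i v \<odot>\<^bsub>V\<^esub> b i)" by simp_all
 have "(\<Oplus>\<^bsub>tensor_pow V n\<^esub>k\<in>pkeys p. plookup p k \<odot>\<^bsub>tensor_pow V n\<^esub> pure_tensor V k) =
   \<zero>\<^bsub>tensor_pow V n\<^esub>"
 proof (rule multilin_vanish[where xs = "%k. k" and c = "plookup p", OF V vspace_tensor_pow[OF V] I(1,2) finite_keys multilin_pure_tensor[OF V]])
  fix es assume es: "length es = n" "set es <= E"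
  have "set es <= linear_maps V CC" using es E by (auto simp: reproducing_def)
  from multilin_eval_prod[OF this es(1) V]
  have "tensor_lift CC (eval_prod es) t = lin_ext CC (eval_prod es) p"
   using tensor_lift_class[OF V vspace_CC _ pc] p(2) tensor_class_lin_ext[OF V pc] by simp
  then show "(\<Sum>k\<in>pkeys p. plookup p k * eval_prod es k) = 0"
   using 0[OF es] by (simp add: lin_ext_CC pm_pair_def)
 next
  fix k assume k: "k \<in> pkeys p"
  then have "set k <= X" by (auto simp: X_def)
  then show "length k = n & set k <= carrier V & (\<forall>v\<in>set k. v = (\<Oplus>\<^bsub>V\<^esub>i\<in>I. e i v \<odot>\<^bsub>V\<^esub> b i))"
   using I(3) k p(1) by blast
 qed
 then show ?thesis by (simp add: p(2) lin_ext_def)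
qed

section \<open>Truncated exponentials and logarithms modulo a step of a filtration\<close>

section \<open>Exponentials in filtered algebras\<close>

unbundle fps_syntax

text \<open>For an argument of filtration 1 the omitted terms have filtration above
  \<open>N\<close>, so the truncation is exact modulo step \<open>N + 1\<close>.\<close>

definition expN :: "nat => 'a::real_algebra_1 => 'a" where
 "expN N x = (\<Sum>k\<le>N. (1 / fact k) *\<^sub>R x ^ k)"

text \<open>\<open>fps_ln 1\<close> is the series of log(1 + X); this is therefore the truncated
  logarithm of 1 + u.\<close>

definition logN :: "nat => 'a::real_algebra_1 => 'a" where
 "logN N u = (\<Sum>k\<le>N. (fps_ln 1 $ k) *\<^sub>R u ^ k)"

text \<open>The model is the sequence of powers of an augmentation ideal, seen in an operator
  algebra.\<close>

locale filtration =
 fixes J :: "nat => 'a::real_algebra_1 set"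
 assumes zero: "0 \<in> J n"
  and add: "x \<in> J n ==> y \<in> J n ==> x + y \<in> J n"
  and scale: "x \<in> J n ==> c *\<^sub>R x \<in> J n"
  and mult: "x \<in> J m ==> y \<in> J n ==> x * y \<in> J (m + n)"
  and one: "1 \<in> J 0"
  and anti: "J (Suc n) <= J n"
begin

lemma mono: "m <= n ==> x \<in> J n ==> x \<in> J m"
 by (induction rule: dec_induct) (use anti in auto)

lemma diff: "x \<in> J n ==> y \<in> J n ==> x - y \<in> J n"
 using add[of x n "(- 1) *\<^sub>R y"] scale[of y n "-1"] by simp

lemma minus: "x \<in> J n ==> - x \<in> J n"
 using scale[of x n "-1"] by simp

lemma sum: "(!!i. i \<in> S ==> f i \<in> J n) ==> sum f S \<in> J n"
 by (induction S rule: infinite_finite_induct) (auto simp: zero add)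

lemma power: "x \<in> J 1 ==> x ^ k \<in> J k"
 by (induction k) (use mult[of x 1] one in auto)

lemma cong_trans: "x - y \<in> J n ==> y - z \<in> J n ==> x - z \<in> J n"
 using add[of "x - y" n "y - z"] by simp

lemma cong_sym: "x - y \<in> J n ==> y - x \<in> J n"
 using minus[of "x - y" n] by simp

text \<open>Telescoping, with one factor split off at a time: x x^(k+1) - y y^(k+1) = x (x^(k+1) -
  y^(k+1)) + (x - y) y^(k+1). Each remaining factor contributes one step.\<close>

lemma power_diff:
 assumes "x \<in> J 1" "y \<in> J 1" "x - y \<in> J m"
 shows "x ^ Suc k - y ^ Suc k \<in> J (m + k)"
proof (induction k)
 case (Suc k)
 have "x * (x ^ Suc k - y ^ Suc k) \<in> J (Suc (m + k))" using mult[OF assms(1) Suc] by simp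
 moreover have "(x - y) * y ^ Suc k \<in> J (m + Suc k)" using mult[OF assms(3) power[OF assms(2), of "Suc k"]] .
 ultimately have "x * (x ^ Suc k - y ^ Suc k) + (x - y) * y ^ Suc k \<in> J (m + Suc k)" by (simp add: add)
 then show ?case by (simp add: algebra_simps)
qed (use assms in simp)

lemma logN_in: "u \<in> J 1 ==> logN N u \<in> J 1"
proof -
 assume u: "u \<in> J 1"
 have "(fps_ln 1 $ k) *\<^sub>R u ^ k \<in> J 1" for k
  by (cases k) (use zero in simp, intro scale mono[OF _ power[OF u]], simp)
 then show ?thesis unfolding logN_def by (intro sum)
qed

lemma expN_cong:
 assumes "x \<in> J 1" "y \<in> J 1" "x - y \<in> J m"
 shows "expN N x - expN N y \<in> J m"
proof -
 have "x ^ k - y ^ k \<in> J m" for k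
  by (cases k) (use zero power_diff[OF assms] mono[of m "m + _"] in auto)
 then have "(\<Sum>k\<le>N. (1 / fact k) *\<^sub>R (x ^ k - y ^ k)) \<in> J m" by (intro sum scale)
 then show ?thesis by (simp add: expN_def sum_subtractf scaleR_diff_right)
qed

text \<open>Successive approximation: if x - y has filtration m + 1, the differences of the powers
  from the second on have filtration m + 2, so the linear terms agree one step further than
  before.\<close>

lemma expN_inj:
 assumes x: "x \<in> J 1" and y: "y \<in> J 1" and e: "expN N x - expN N y \<in> J (Suc N)"
 shows "x - y \<in> J (Suc N)"
proof -
 have "x - y \<in> J (Suc m)" if "m <= N" for m
  using that
 proof (induction m)
  case (Suc m)
  then have d: "x - y \<in> J (Suc m)" by simp
  have "{..N} = {0, 1} \<union> {2..N}" using Suc by auto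
  then have s: "expN N w = 1 + w + (\<Sum>k\<in>{2..N}. (1 / fact k) *\<^sub>R w ^ k)" for w :: 'a
   by (simp add: expN_def sum.union_disjoint)
  have "(\<Sum>k\<in>{2..N}. (1 / fact k) *\<^sub>R (x ^ k - y ^ k)) \<in> J (Suc (Suc m))"
  proof (intro sum scale)
   fix k assume "k \<in> {2..N}"
   then obtain l where l: "k = Suc l" "1 <= l" by (cases k) auto
   show "x ^ k - y ^ k \<in> J (Suc (Suc m))"
    by (rule mono[OF _ power_diff[OF x y d, of l, folded l(1)]]) (use l in simp)
  qed
  moreover have "expN N x - expN N y \<in> J (Suc (Suc m))" by (rule mono[OF _ e]) (use Suc in simp)
  ultimately have "expN N x - expN N y - (\<Sum>k\<in>{2..N}. (1 / fact k) *\<^sub>R (x ^ k - y ^ k)) \<in> J (Suc (Suc m))"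
   by (rule diff[rotated])
  then show ?case by (simp add: s sum_subtractf scaleR_diff_right)
 qed (use diff[OF x y] in simp)
 then show ?thesis by blast
qed

text \<open>Power series are evaluated at 1, their coefficient of index \<open>n\<close> being of filtration \<open>n\<close>.\<close>

definition ev1 :: "nat => 'a fps => 'a" where
 "ev1 N w = (\<Sum>n\<le>N. w $ n)"

definition filtered_fps :: "nat => 'a fps => bool" where
 "filtered_fps N w \<longleftrightarrow> (ALL n<=N. w $ n \<in> J n)"

lemma ev1_in: "filtered_fps N w ==> ev1 N w \<in> J 0"
 unfolding ev1_def filtered_fps_def by (intro sum) (auto intro: mono[OF le0])

lemma filtered_fps_mult: "filtered_fps N v ==> filtered_fps N w ==> filtered_fps N (v * w)"
 unfolding filtered_fps_def fps_mult_nth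
proof (intro allI impI sum)
 fix n i assume a: "ALL n<=N. v $ n \<in> J n" "ALL n<=N. w $ n \<in> J n" "n <= N" "i \<in> {0..n}"
 then have "v $ i * w $ (n - i) \<in> J (i + (n - i))" by (intro mult) auto
 with a show "v $ i * w $ (n - i) \<in> J n" by simp
qed

lemma filtered_fps_power: "filtered_fps N w ==> filtered_fps N (w ^ k)"
 by (induction k) (auto simp: filtered_fps_mult, auto simp: filtered_fps_def one zero)

text \<open>The two sides differ by the products of coefficients of indices i and j with i + j > N,
  and these have filtration at least N + 1.\<close>

lemma ev1_mult:
 assumes v: "filtered_fps N v" and w: "filtered_fps N w"
 shows "ev1 N (v * w) - ev1 N v * ev1 N w \<in> J (Suc N)"
proof -
 let ?T = "{(i, j). i + j <= N}" and ?S = "{..N} \<times> {..N}"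
 have "ev1 N (v * w) = (\<Sum>(i, j)\<in>?T. v $ i * w $ j)"
  unfolding ev1_def fps_mult_nth atLeast0AtMost by (rule sum.triangle_reindex_eq[symmetric])
 moreover have "ev1 N v * ev1 N w = (\<Sum>(i, j)\<in>?S. v $ i * w $ j)"
  unfolding ev1_def by (simp add: sum_product sum.cartesian_product)
 moreover have "(\<Sum>(i, j)\<in>?S. v $ i * w $ j) = (\<Sum>(i, j)\<in>?T. v $ i * w $ j) + (\<Sum>(i, j)\<in>?S - ?T. v $ i * w $ j)"
  by (subst add.commute, rule sum.subset_diff) auto
 moreover have "(\<Sum>(i, j)\<in>?S - ?T. v $ i * w $ j) \<in> J (Suc N)"
 proof (rule sum)
  fix p assume "p \<in> ?S - ?T"
  then obtain i j where p: "p = (i, j)" "i <= N" "j <= N" "Suc N <= i + j" by auto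
  then have "v $ i * w $ j \<in> J (i + j)" using v w by (intro mult) (auto simp: filtered_fps_def)
  with p show "(case p of (i, j) => v $ i * w $ j) \<in> J (Suc N)" by (simp add: mono)
 qed
 ultimately show ?thesis using minus by simp
qed

lemma ev1_power:
 assumes w: "filtered_fps N w"
 shows "ev1 N (w ^ k) - ev1 N w ^ k \<in> J (Suc N)"
proof (induction k)
 case 0
 then show ?case using zero by (simp add: ev1_def sum.delta' eq_commute[of 0] if_distrib cong: if_cong)
next
 case (Suc k)
 have "ev1 N (w * w ^ k) - ev1 N w * ev1 N (w ^ k) \<in> J (Suc N)"
  by (rule ev1_mult[OF w filtered_fps_power[OF w]])
 moreover have "ev1 N w * (ev1 N (w ^ k) - ev1 N w ^ k) \<in> J (Suc N)"
  using mult[OF ev1_in[OF w] Suc] by simp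
 ultimately show ?case using add by (force simp: algebra_simps dest: add)
qed

end

text \<open>The exponential of a series without constant term, over a noncommutative ring. In degree
  \<open>n\<close> the powers beyond the \<open>n\<close>-th do not contribute, which is why the sum
  may stop there.\<close>

definition fexp :: "'a::real_algebra_1 fps => 'a fps" where
 "fexp z = Abs_fps (%n. \<Sum>k\<le>n. (1 / fact k) *\<^sub>R (z ^ k) $ n)"

lemma fps_power_prefix:
 fixes z :: "'a::real_algebra_1 fps"
 assumes "z $ 0 = 0"
 shows "n < k ==> (z ^ k) $ n = 0"
proof (induction k arbitrary: n)
 case (Suc k)
 have "z $ i * (z ^ k) $ (n - i) = 0" if "i <= n" for i
  using Suc that assms by (cases i) auto
 then show ?case by (auto simp: fps_mult_nth intro!: sum.neutral)
qed simp

lemma fexp_nth: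
 assumes "z $ 0 = 0" "n <= N"
 shows "fexp z $ n = (\<Sum>k\<le>N. (1 / fact k) *\<^sub>R (z ^ k) $ n)"
 unfolding fexp_def fps_nth_Abs_fps
 by (rule sum.mono_neutral_left) (use assms fps_power_prefix[OF assms(1)] in auto)

text \<open>Evaluation at 1 is multiplicative up to step \<open>N + 1\<close>, hence commutes with
  each power. This transfers exact identities of power series to congruences in the filtered
  algebra.\<close>

lemma (in filtration) ev1_fexp:
 assumes z: "filtered_fps N z" "z $ 0 = 0"
 shows "ev1 N (fexp z) - expN N (ev1 N z) \<in> J (Suc N)"
proof -
 have "ev1 N (fexp z) = (\<Sum>n\<le>N. \<Sum>k\<le>N. (1 / fact k) *\<^sub>R (z ^ k) $ n)"
  by (simp add: ev1_def fexp_nth[OF z(2), of _ N])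
 also have "... = (\<Sum>k\<le>N. (1 / fact k) *\<^sub>R ev1 N (z ^ k))"
  by (subst sum.swap) (simp add: ev1_def scaleR_sum_right)
 finally have "ev1 N (fexp z) - expN N (ev1 N z) = (\<Sum>k\<le>N. (1 / fact k) *\<^sub>R (ev1 N (z ^ k) - ev1 N z ^ k))"
  by (simp add: expN_def sum_subtractf scaleR_diff_right)
 also have "... \<in> J (Suc N)" by (intro sum scale ev1_power z)
 finally show ?thesis .
qed

lemma fps_exp_compose_ln: "fps_exp (1::real) oo fps_ln 1 = 1 + fps_X"
proof -
 let ?e = "fps_exp (1::real) - 1"
 have "?e oo fps_inv ?e = fps_X" by (rule fps_inv_right) auto
 moreover have "fps_ln (1::real) = fps_inv ?e" by (rule fps_ln_fps_exp_inv) simp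
 ultimately have "?e oo fps_ln 1 = fps_X" by simp
 then have "(fps_exp (1::real) oo fps_ln 1) - 1 = fps_X" by (simp add: fps_compose_sub_distrib)
 then show ?thesis by (simp add: algebra_simps)
qed

text \<open>The series log(1 + u X) has commuting coefficients, so its powers are read off from
  those of the scalar series, and the scalar identity exp(log(1 + X)) = 1 + X gives the
  exponential.\<close>

lemma (in filtration) exp_log:
 assumes u: "u \<in> J 1"
 shows "expN N (logN N u) - (1 + u) \<in> J (Suc N)"
proof -
 let ?l = "fps_ln (1::real)"
 define z where "z = Abs_fps (%n. (?l $ n) *\<^sub>R u ^ n)"
 have zn: "z $ n = (?l $ n) *\<^sub>R u ^ n" for n by (simp add: z_def)
 have zk: "(z ^ k) $ n = ((?l ^ k) $ n) *\<^sub>R u ^ n" for k n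
 proof (induction k arbitrary: n)
  case (Suc k)
  have "(z ^ Suc k) $ n = (\<Sum>i=0..n. (?l $ i * (?l ^ k) $ (n - i)) *\<^sub>R (u ^ i * u ^ (n - i)))"
   unfolding power_Suc fps_mult_nth by (intro sum.cong) (auto simp: Suc zn)
  also have "... = (\<Sum>i=0..n. (?l $ i * (?l ^ k) $ (n - i)) *\<^sub>R u ^ n)"
   by (intro sum.cong) (auto simp flip: power_add)
  finally show ?case by (simp add: fps_mult_nth scaleR_sum_left)
 qed simp
 have z: "filtered_fps N z" "z $ 0 = 0"
  by (auto simp: z_def filtered_fps_def intro!: scale power[OF u])
 have "fexp z $ n = ((fps_exp 1 oo ?l) $ n) *\<^sub>R u ^ n" for n
  by (simp add: fexp_def zk fps_compose_nth scaleR_sum_left atLeast0AtMost)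
 then have fz: "fexp z $ n = (if n <= 1 then u ^ n else 0)" for n
  by (simp add: fps_exp_compose_ln fps_X_def)
 \<comment> \<open>For \<open>N = 0\<close> the term \<open>u\<close> is cut off, but then it lies
   in step \<open>Suc N\<close> itself.\<close>
 then have "ev1 N (fexp z) = (if N = 0 then 1 else 1 + u)"
 proof (cases N)
  case (Suc M)
  have "ev1 N (fexp z) = (\<Sum>n\<in>{0, 1}. fexp z $ n)"
   unfolding ev1_def
   by (rule sum.mono_neutral_right) (use Suc fz in auto)
  then show ?thesis using Suc fz by simp
 qed (simp add: ev1_def)
 then have "ev1 N (fexp z) - (1 + u) \<in> J (Suc N)" using zero minus[OF u] by auto
 moreover have "ev1 N z = logN N u" by (simp add: ev1_def logN_def z_def)
 ultimately show ?thesis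
  using ev1_fexp[OF z] cong_trans[OF cong_sym] by metis
qed

text \<open>The series e^(x t) in a formal variable t, for a constant exponent
  \<open>x\<close>.\<close>

definition expt :: "'a::real_algebra_1 => 'a fps" where
 "expt x = Abs_fps (%n. (1 / fact n) *\<^sub>R x ^ n)"

lemma expt_nth [simp]: "expt x $ n = (1 / fact n) *\<^sub>R x ^ n"
 by (simp add: expt_def)

lemma (in filtration) filtered_expt: "x \<in> J 1 ==> filtered_fps N (expt x)"
 by (auto simp: filtered_fps_def intro!: scale power)

lemma (in filtration) ev1_expt: "ev1 N (expt x) = expN N x"
 by (simp add: ev1_def expN_def)

lemma of_nat_scaleR: "of_nat n * (x :: 'a::real_algebra_1) = real n *\<^sub>R x"
 by (simp add: scaleR_conv_of_real)

lemma fps_deriv_scaleR: "fps_deriv w $ n = real (Suc n) *\<^sub>R (w :: 'a::real_algebra_1 fps) $ Suc n"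
 by (simp add: of_nat_scaleR del: of_nat_Suc)

lemma fps_deriv_expt: "fps_deriv (expt x) = fps_const x * expt x"
 by (rule fps_ext) (simp add: fps_deriv_scaleR field_simps del: of_nat_Suc fps_deriv_nth)

text \<open>Coefficient m of the equation F' = P F determines coefficient m + 1 of F from the
  earlier ones, since m + 1 is invertible.\<close>

lemma fps_ode_unique:
 fixes F G P :: "'a::real_algebra_1 fps"
 assumes "fps_deriv F = P * F" "fps_deriv G = P * G" "F $ 0 = G $ 0"
 shows "F = G"
proof (rule fps_ext)
 fix n show "F $ n = G $ n"
 proof (induction n rule: less_induct)
  case (less n)
  show ?case
  proof (cases n)
   case (Suc m)
   have "(P * F) $ m = (P * G) $ m"
    unfolding fps_mult_nth by (rule sum.cong) (use less Suc in auto)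
   then have "real (Suc m) *\<^sub>R F $ Suc m = real (Suc m) *\<^sub>R G $ Suc m"
    using assms(1,2) fps_deriv_scaleR[of F m] fps_deriv_scaleR[of G m] by simp
   then show ?thesis using Suc by (simp del: of_nat_Suc)
  qed (use assms in simp)
 qed
qed

text \<open>Both sides solve F' = (x + y) F with constant term 1; commutation moves \<open>y\<close>
  across \<open>expt x\<close> in the derivative of the product.\<close>

lemma expt_add_commuting:
 assumes "x * y = y * x"
 shows "expt (x + y) = expt x * expt y"
proof (rule fps_ode_unique)
 have "y * x ^ n = x ^ n * y" for n
 proof (induction n)
  case (Suc n)
  have "y * x ^ Suc n = x * (y * x ^ n)" by (simp add: mult.assoc[symmetric] assms)
  with Suc show ?case by (simp add: mult.assoc)
 qed simp
 then have c: "expt x * fps_const y = fps_const y * expt x"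
  by (intro fps_ext) simp
 show "fps_deriv (expt x * expt y) = fps_const (x + y) * (expt x * expt y)"
  by (simp add: fps_deriv_expt mult.assoc[symmetric] c)
   (simp add: distrib_right flip: fps_const_add mult.assoc)
qed (simp_all add: fps_deriv_expt)

lemma (in filtration) expN_add_commuting:
 assumes "x \<in> J 1" "y \<in> J 1" "x * y = y * x"
 shows "expN N (x + y) - expN N x * expN N y \<in> J (Suc N)"
 using ev1_mult[OF filtered_expt[OF assms(1)] filtered_expt[OF assms(2)], of N]
 by (simp add: ev1_expt flip: expt_add_commuting[OF assms(3)])

section \<open>The Baker-Campbell-Hausdorff theorem by a recursion through brackets\<close>

section \<open>The Baker--Campbell--Hausdorff theorem\<close>

text \<open>The exponents \<open>z\<close> with \<open>e\<^sup>z = e\<^sup>t\<^sup>x e\<^sup>t\<^sup>y\<close> are obtained as the solution of a differential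
 equation, whose recursion only involves brackets.\<close>

definition ad :: "'a::ring => 'a => 'a" where
 "ad z w = z * w - w * z"

text \<open>Left multiplication by \<open>z\<close> is the sum of \<open>ad z\<close> and right
  multiplication by \<open>z\<close>, two commuting operators; this is their binomial
  theorem.\<close>

lemma ad_power_binomial:
 fixes z w :: "'a::ring_1"
 shows "z ^ n * w = (\<Sum>k\<le>n. of_nat (n choose k) * ((ad z ^^ k) w * z ^ (n - k)))"
proof (induction n)
 case (Suc n)
 let ?a = "%k. (ad z ^^ k) w"
 have za: "z * (of_nat m * (?a k * u)) = of_nat m * (?a (Suc k) * u) + of_nat m * (?a k * (z * u))" for k m u
 proof -
  have "z * (of_nat m * (?a k * u)) = of_nat m * (z * ?a k * u)"
   by (metis mult.assoc mult_of_nat_commute)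
  also have "z * ?a k = ?a (Suc k) + ?a k * z" by (simp add: ad_def)
  finally show ?thesis by (simp add: algebra_simps)
 qed
 have "z ^ Suc n * w = (\<Sum>k\<le>n. of_nat (n choose k) * (?a (Suc k) * z ^ (n - k))) +
   (\<Sum>k\<le>n. of_nat (n choose k) * (?a k * z ^ (Suc n - k)))"
  by (simp add: Suc mult.assoc sum_distrib_left za sum.distrib Suc_diff_le)
 also have "(\<Sum>k\<le>n. of_nat (n choose k) * (?a k * z ^ (Suc n - k))) =
   (\<Sum>k\<le>Suc n. of_nat (n choose k) * (?a k * z ^ (Suc n - k)))"
  by (simp add: binomial_eq_0)
 also have "... = w * z ^ Suc n + (\<Sum>k\<le>n. of_nat (n choose Suc k) * (?a (Suc k) * z ^ (n - k)))"
  by (subst sum.atMost_Suc_shift) simp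
 finally show ?case
  by (subst sum.atMost_Suc_shift) (simp add: sum.distrib algebra_simps binomial_eq_0)
qed simp

text \<open>The derivative is a sum of words z^i z' z^(n-i), in which the left powers are moved to
  the right at the price of brackets. The binomial coefficients come from Pascal's rule in the
  induction.\<close>

lemma fps_deriv_power_ad:
 fixes z :: "'a::ring_1 fps"
 shows "fps_deriv (z ^ Suc n) =
  (\<Sum>k\<le>n. of_nat (Suc n choose Suc k) * ((ad z ^^ k) (fps_deriv z) * z ^ (n - k)))"
proof (induction n)
 case (Suc n)
 let ?w = "fps_deriv z"
 let ?a = "%k. (ad z ^^ k) ?w"
 have za: "z * (of_nat m * (?a k * u)) = of_nat m * (?a (Suc k) * u) + of_nat m * (?a k * (z * u))" for k m u
 proof -
  have "z * (of_nat m * (?a k * u)) = of_nat m * (z * ?a k * u)"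
   by (metis mult.assoc mult_of_nat_commute)
  also have "z * ?a k = ?a (Suc k) + ?a k * z" by (simp add: ad_def)
  finally show ?thesis by (simp add: algebra_simps)
 qed
 have "fps_deriv (z ^ Suc (Suc n)) = z * fps_deriv (z ^ Suc n) + ?w * z ^ Suc n"
  by (subst power_Suc) (simp only: fps_deriv_mult)
 also have "z * fps_deriv (z ^ Suc n) = (\<Sum>k\<le>n. of_nat (Suc n choose Suc k) * (?a (Suc k) * z ^ (n - k))) +
   (\<Sum>k\<le>n. of_nat (Suc n choose Suc k) * (?a k * z ^ (Suc n - k)))"
  unfolding Suc sum_distrib_left za sum.distrib
  by (simp add: Suc_diff_le del: binomial_Suc_Suc)
 also have "(\<Sum>k\<le>n. of_nat (Suc n choose Suc k) * (?a k * z ^ (Suc n - k))) =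
   (\<Sum>k\<le>Suc n. of_nat (Suc n choose Suc k) * (?a k * z ^ (Suc n - k)))"
  by (simp add: binomial_eq_0)
 also have "... = of_nat (Suc n) * (?w * z ^ Suc n) +
   (\<Sum>k\<le>n. of_nat (Suc n choose Suc (Suc k)) * (?a (Suc k) * z ^ (n - k)))"
  by (subst sum.atMost_Suc_shift) (simp del: binomial_Suc_Suc power_Suc add: choose_one)
 finally show ?case
  by (subst sum.atMost_Suc_shift)
   (simp add: sum.distrib algebra_simps binomial_Suc_Suc[of "Suc n"] choose_one binomial_eq_0 del: binomial_Suc_Suc power_Suc)
qed simp

text \<open>The operator (e^A - 1) / A with A = \<open>ad z\<close>, applied to \<open>w\<close>. It
  appears in the derivative of the exponential; when \<open>z\<close> has no constant term, the
  summands with j > n vanish in degree n.\<close>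

definition dexp :: "'a::real_algebra_1 fps => 'a fps => 'a fps" where
 "dexp z w = Abs_fps (%n. \<Sum>j\<le>n. (1 / fact (Suc j)) *\<^sub>R ((ad z ^^ j) w) $ n)"

lemma ad_fps_prefix:
 fixes z :: "'a::real_algebra_1 fps"
 assumes "z $ 0 = 0"
 shows "n < j ==> ((ad z ^^ j) w) $ n = 0"
proof (induction j arbitrary: n)
 case (Suc j)
 have "z $ i * ((ad z ^^ j) w) $ (n - i) = 0" "((ad z ^^ j) w) $ i * z $ (n - i) = 0" if "i <= n" for i
 proof -
  show "z $ i * ((ad z ^^ j) w) $ (n - i) = 0"
   using Suc that assms by (cases i) auto
  show "((ad z ^^ j) w) $ i * z $ (n - i) = 0"
   using Suc.IH[of i] Suc.prems that assms by (cases "i < j") auto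
 qed
 then show ?case by (simp add: ad_def[of z "(ad z ^^ j) w"] fps_mult_nth)
qed simp

text \<open>In \<open>fps_deriv_power_ad\<close> the coefficient C(k+1, j+1) / (k+1)! equals 1 /
  ((j+1)! (k-j)!), so with l = k - j the double sum factors into the two series.\<close>

lemma fps_deriv_fexp:
 fixes z :: "'a::real_algebra_1 fps"
 assumes z: "z $ 0 = 0"
 shows "fps_deriv (fexp z) = dexp z (fps_deriv z) * fexp z"
proof (rule fps_ext)
 fix n
 let ?a = "%j. (ad z ^^ j) (fps_deriv z)"
 let ?f = "%j l. (1 / (fact (Suc j) * fact l)) *\<^sub>R (?a j * z ^ l) $ n"
 have "fps_deriv (fexp z) $ n = (\<Sum>k\<le>Suc n. (1 / fact k) *\<^sub>R fps_deriv (z ^ k) $ n)"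
  by (simp only: fps_deriv_scaleR fexp_nth[OF z order.refl] scaleR_sum_right scaleR_scaleR mult.commute)
 also have "... = (\<Sum>k\<le>n. (1 / fact (Suc k)) *\<^sub>R fps_deriv (z ^ Suc k) $ n)"
  by (subst sum.atMost_Suc_shift) simp
 also have "... = (\<Sum>k\<le>n. \<Sum>j\<le>k. ?f j (k - j))"
 proof (intro sum.cong refl)
  fix k
  have "(1 / fact (Suc k)) *\<^sub>R (of_nat (Suc k choose Suc j) * u) $ n = (1 / (fact (Suc j) * fact (k - j))) *\<^sub>R u $ n"
   if "j <= k" for j and u :: "'a fps"
  proof -
   have "(of_nat (Suc k choose Suc j) * u) $ n = real (Suc k choose Suc j) *\<^sub>R u $ n"
    by (simp only: fps_of_nat[symmetric] fps_mult_left_const_nth of_nat_scaleR)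
   moreover have "real (Suc k choose Suc j) = fact (Suc k) / (fact (Suc j) * fact (k - j))"
    using binomial_fact[of "Suc j" "Suc k", where ?'a = real] that by simp
   ultimately show ?thesis by (simp del: fact_Suc binomial_Suc_Suc)
  qed
  then show "(1 / fact (Suc k)) *\<^sub>R fps_deriv (z ^ Suc k) $ n = (\<Sum>j\<le>k. ?f j (k - j))"
   unfolding fps_deriv_power_ad fps_sum_nth scaleR_sum_right by (intro sum.cong) auto
 qed
 also have "... = (\<Sum>(j, l)\<in>{(j, l). j + l <= n}. ?f j l)"
  by (rule sum.triangle_reindex_eq[symmetric])
 \<comment> \<open>The triangle is completed to a square: \<open>ad z\<close> and multiplication by
   \<open>z\<close> both raise the order, so the added terms vanish in degree
   \<open>n\<close>.\<close>
 also have "... = (\<Sum>(j, l)\<in>{..n} \<times> {..n}. ?f j l)"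
 proof (rule sum.mono_neutral_left)
  have "(?a j * z ^ l) $ n = 0" if "n < j + l" for j l
  proof -
   have "?a j $ i * (z ^ l) $ (n - i) = 0" if "i <= n" for i
    using ad_fps_prefix[OF z, of i j] fps_power_prefix[OF z, of "n - i" l] that \<open>n < j + l\<close>
    by (cases "i < j") auto
   then show ?thesis by (simp add: fps_mult_nth)
  qed
  then show "\<forall>p\<in>{..n} \<times> {..n} - {(j, l). j + l <= n}. (case p of (j, l) => ?f j l) = 0"
   by clarsimp (metis not_le)
 qed auto
 also have "... = (\<Sum>i=0..n. \<Sum>j\<le>n. \<Sum>l\<le>n. ((1 / fact (Suc j)) *\<^sub>R ?a j $ i) * ((1 / fact l) *\<^sub>R (z ^ l) $ (n - i)))"
 proof -
  have "(\<Sum>(j, l)\<in>{..n} \<times> {..n}. ?f j l) = (\<Sum>j\<le>n. \<Sum>l\<le>n. \<Sum>i=0..n. ((1 / fact (Suc j)) *\<^sub>R ?a j $ i) * ((1 / fact l) *\<^sub>R (z ^ l) $ (n - i)))"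
   unfolding sum.cartesian_product[symmetric] fps_mult_nth scaleR_sum_right by (simp add: mult.commute)
  also have "... = (\<Sum>j\<le>n. \<Sum>i=0..n. \<Sum>l\<le>n. ((1 / fact (Suc j)) *\<^sub>R ?a j $ i) * ((1 / fact l) *\<^sub>R (z ^ l) $ (n - i)))"
   by (intro sum.cong refl sum.swap)
  also have "... = (\<Sum>i=0..n. \<Sum>j\<le>n. \<Sum>l\<le>n. ((1 / fact (Suc j)) *\<^sub>R ?a j $ i) * ((1 / fact l) *\<^sub>R (z ^ l) $ (n - i)))"
   by (rule sum.swap)
  finally show ?thesis .
 qed
 also have "... = (\<Sum>i=0..n. dexp z (fps_deriv z) $ i * fexp z $ (n - i))"
 proof (rule sum.cong[OF refl])
  fix i assume i: "i \<in> {0..n}"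
  have "dexp z (fps_deriv z) $ i = (\<Sum>j\<le>n. (1 / fact (Suc j)) *\<^sub>R ?a j $ i)"
   unfolding dexp_def fps_nth_Abs_fps
   by (rule sum.mono_neutral_left) (use i ad_fps_prefix[OF z] in auto)
  then show "(\<Sum>j\<le>n. \<Sum>l\<le>n. ((1 / fact (Suc j)) *\<^sub>R ?a j $ i) * ((1 / fact l) *\<^sub>R (z ^ l) $ (n - i))) =
    dexp z (fps_deriv z) $ i * fexp z $ (n - i)"
   by (simp only: fexp_nth[OF z, of "n - i" n, OF diff_le_self] sum_product)
 qed
 finally show "fps_deriv (fexp z) $ n = (dexp z (fps_deriv z) * fexp z) $ n" by (simp only: fps_mult_nth)
qed

text \<open>The coefficients of P = x + e^(x t) y e^(-x t), for which F = e^(x t) e^(y t) satisfies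
  F' = P F; the conjugation is expanded in powers of \<open>ad x\<close>.\<close>

definition bch_rhs :: "'a::real_algebra_1 => 'a => nat => 'a" where
 "bch_rhs x y n = (if n = 0 then x else 0) + (1 / fact n) *\<^sub>R (ad x ^^ n) y"

lemma fps_deriv_expt_mult:
 "fps_deriv (expt x * expt y) = Abs_fps (bch_rhs x y) * (expt x * expt y)"
proof -
 let ?Y = "Abs_fps (%n. (1 / fact n) *\<^sub>R (ad x ^^ n) y)"
 have "expt x * fps_const y = ?Y * expt x"
 proof (rule fps_ext)
  fix n
  have "(expt x * fps_const y) $ n = (\<Sum>k\<le>n. (1 / fact n) *\<^sub>R (of_nat (n choose k) * ((ad x ^^ k) y * x ^ (n - k))))"
   by (simp add: ad_power_binomial scaleR_sum_right)
  also have "... = (\<Sum>k\<le>n. ((1 / fact k) *\<^sub>R (ad x ^^ k) y) * ((1 / fact (n - k)) *\<^sub>R x ^ (n - k)))"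
   by (intro sum.cong refl) (simp add: of_nat_scaleR binomial_fact field_simps)
  finally show "(expt x * fps_const y) $ n = (?Y * expt x) $ n"
   by (simp add: fps_mult_nth atLeast0AtMost)
 qed
 moreover have "Abs_fps (bch_rhs x y) = fps_const x + ?Y"
  by (rule fps_ext) (simp add: bch_rhs_def)
 ultimately show ?thesis
  by (simp add: fps_deriv_expt mult.assoc[symmetric] distrib_right add.commute)
qed

text \<open>The coefficients of \<open>(ad z)\<^sup>j z'\<close>, for a power series \<open>z\<close> without constant term.\<close>

primrec ad_coeff :: "(nat => 'a::real_algebra_1) => nat => nat => 'a" where
 "ad_coeff zs 0 n = real (Suc n) *\<^sub>R zs (Suc n)"
| "ad_coeff zs (Suc j) n = (\<Sum>i=1..n. ad (zs i) (ad_coeff zs j (n - i)))"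

lemma ad_coeff_fps:
 assumes "zs 0 = 0"
 shows "((ad (Abs_fps zs) ^^ j) (fps_deriv (Abs_fps zs))) $ n = ad_coeff zs j n"
proof (induction j arbitrary: n)
 case 0
 then show ?case by (simp add: fps_deriv_scaleR del: of_nat_Suc fps_deriv_nth)
next
 case (Suc j)
 let ?w = "(ad (Abs_fps zs) ^^ j) (fps_deriv (Abs_fps zs))"
 have "(?w * Abs_fps zs) $ n = (\<Sum>i=0..n. ?w $ (n - i) * zs i)"
  unfolding fps_mult_nth
  by (rule sum.reindex_bij_witness[of _ "%i. n - i" "%i. n - i"]) auto
 then have "((ad (Abs_fps zs) ^^ Suc j) (fps_deriv (Abs_fps zs))) $ n = (\<Sum>i=0..n. ad (zs i) (ad_coeff zs j (n - i)))"
  by (simp add: ad_def[of "Abs_fps zs"]) (simp add: fps_mult_nth ad_def Suc sum_subtractf)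
 also have "... = ad_coeff zs (Suc j) n"
  using assms by (simp add: sum.atLeast_Suc_atMost ad_def)
 finally show ?case .
qed

text \<open>The equation \<open>dexp z z' = P\<close> in degree \<open>n\<close>, solved for
  coefficient \<open>n + 1\<close> of z: the summand j = 0 is that coefficient times n + 1, and the
  others involve earlier coefficients.\<close>

definition bch_next :: "'a::real_algebra_1 => 'a => (nat => 'a) => nat => 'a" where
 "bch_next x y zs n = (1 / real (Suc n)) *\<^sub>R
   (bch_rhs x y n - (\<Sum>j\<in>{1..n}. (1 / fact (Suc j)) *\<^sub>R ad_coeff zs j n))"

lemma ad_coeff_local:
 assumes "!!k. k <= Suc n ==> zs k = zs' k"
 shows "ad_coeff zs j n = ad_coeff zs' j n"
 using assms
proof (induction j arbitrary: n)
 case (Suc j)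
 have "ad (zs i) (ad_coeff zs j (n - i)) = ad (zs' i) (ad_coeff zs' j (n - i))" if "i \<in> {1..n}" for i
  using Suc.IH[of "n - i"] Suc.prems that by simp
 then show ?case by simp
qed simp

text \<open>For j >= 1 every summand contains a bracket with some \<open>zs i\<close>, i >= 1, which
  lowers the index of the inner coefficient; so \<open>zs (Suc n)\<close> does not occur.\<close>

lemma bch_next_local:
 assumes "!!k. k <= n ==> zs k = zs' k"
 shows "bch_next x y zs n = bch_next x y zs' n"
proof -
 have "ad_coeff zs j n = ad_coeff zs' j n" if "j \<in> {1..n}" for j
 proof (cases j)
  case (Suc l)
  have "ad (zs i) (ad_coeff zs l (n - i)) = ad (zs' i) (ad_coeff zs' l (n - i))" if "i \<in> {1..n}" for i
  proof -
   have "ad_coeff zs l (n - i) = ad_coeff zs' l (n - i)"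
    by (rule ad_coeff_local) (use assms that in auto)
   then show ?thesis using assms that by simp
  qed
  then show ?thesis by (simp add: Suc)
 qed (use that in simp)
 then show ?thesis by (simp add: bch_next_def)
qed

text \<open>The auxiliary function \<open>s n\<close> is correct up to index \<open>n\<close> and is
  updated at the next index; the diagonal is the solution.\<close>

lemma course_of_values:
 fixes \<Phi> :: "(nat => 'a::zero) => nat => 'a"
 assumes "!!zs zs' n. (!!k. k <= n ==> zs k = zs' k) ==> \<Phi> zs n = \<Phi> zs' n"
 shows "EX zs. zs 0 = 0 & (ALL n. zs (Suc n) = \<Phi> zs n)"
proof -
 define s where "s = rec_nat (%_. 0) (%n f. f(Suc n := \<Phi> f n))"
 have s: "s 0 = (%_. 0)" "s (Suc n) = (s n)(Suc n := \<Phi> (s n) n)" for n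
  by (simp_all add: s_def)
 have st: "s m k = s k k" if "k <= m" for m k
  using that
 proof (induction m)
  case (Suc m)
  then show ?case by (cases "k = Suc m") (simp_all add: s(2))
 qed simp
 show ?thesis
 proof (intro exI conjI allI)
  show "s 0 0 = 0" by (simp add: s)
  fix n
  have "\<Phi> (s n) n = \<Phi> (%k. s k k) n" by (rule assms) (rule st)
  then show "s (Suc n) (Suc n) = \<Phi> (%k. s k k) n" by (simp add: s(2))
 qed
qed

definition bch_seq :: "'a::real_algebra_1 => 'a => (nat => 'a) => bool" where
 "bch_seq x y zs \<longleftrightarrow> zs 0 = 0 & (ALL n. zs (Suc n) = bch_next x y zs n)"

lemma bch_seq_exists: "EX zs. bch_seq x y zs"
 unfolding bch_seq_def by (rule course_of_values) (rule bch_next_local)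

text \<open>The recursion was made so that \<open>dexp z z'\<close> is the factor P in the equation
  of the product of exponentials; uniqueness of solutions does the rest.\<close>

lemma fexp_bch:
 assumes "bch_seq x y zs"
 shows "fexp (Abs_fps zs) = expt x * expt y"
proof (rule fps_ode_unique)
 let ?z = "Abs_fps zs"
 have z0: "zs 0 = 0" using assms by (simp add: bch_seq_def)
 show "fps_deriv (expt x * expt y) = Abs_fps (bch_rhs x y) * (expt x * expt y)"
  by (rule fps_deriv_expt_mult)
 have "dexp ?z (fps_deriv ?z) = Abs_fps (bch_rhs x y)"
 proof (rule fps_ext)
  fix n
  have "dexp ?z (fps_deriv ?z) $ n = (\<Sum>j\<le>n. (1 / fact (Suc j)) *\<^sub>R ad_coeff zs j n)"
   by (simp add: dexp_def ad_coeff_fps[where zs = zs, OF z0] del: fact_Suc)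
  also have "... = real (Suc n) *\<^sub>R zs (Suc n) + (\<Sum>j\<in>{1..n}. (1 / fact (Suc j)) *\<^sub>R ad_coeff zs j n)"
   by (simp add: sum.atLeast_Suc_atMost flip: atLeast0AtMost)
  also have "... = bch_rhs x y n"
   using assms by (simp add: bch_seq_def bch_next_def del: of_nat_Suc)
  finally show "dexp ?z (fps_deriv ?z) $ n = Abs_fps (bch_rhs x y) $ n" by simp
 qed
 then show "fps_deriv (fexp ?z) = Abs_fps (bch_rhs x y) * fexp ?z"
  using fps_deriv_fexp[of ?z] z0 by simp
 show "fexp ?z $ 0 = (expt x * expt y) $ 0" by (simp add: fexp_def)
qed

lemma (in filtration) expN_bch:
 assumes "bch_seq x y zs" "!!n. 1 <= n ==> n <= N ==> zs n \<in> J n" "x \<in> J 1" "y \<in> J 1"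
 shows "expN N (\<Sum>n\<le>N. zs n) - expN N x * expN N y \<in> J (Suc N)"
proof -
 have z0: "zs 0 = 0" using assms by (simp add: bch_seq_def)
 have "filtered_fps N (Abs_fps zs)"
  unfolding filtered_fps_def
 proof (intro allI impI)
  fix n assume "n <= N" then show "Abs_fps zs $ n \<in> J n" by (cases n) (use assms(2) z0 zero in auto)
 qed
 then have "ev1 N (expt x * expt y) - expN N (\<Sum>n\<le>N. zs n) \<in> J (Suc N)"
  using ev1_fexp[of N "Abs_fps zs"] z0 fexp_bch[OF assms(1)] by (simp add: ev1_def)
 from cong_trans[OF cong_sym[OF this]] show ?thesis
  using ev1_mult[OF filtered_expt[OF assms(3)] filtered_expt[OF assms(4)], of N] by (simp add: ev1_expt)
qed

text \<open>Applied to the graph of a morphism of filtered Lie algebras.\<close>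

locale lie_relation =
 fixes L :: "nat => ('a::real_algebra_1 \<times> 'b::real_algebra_1) set"
 assumes zero: "(0, 0) \<in> L n"
  and add: "(x, x') \<in> L n ==> (y, y') \<in> L n ==> (x + y, x' + y') \<in> L n"
  and scale: "(x, x') \<in> L n ==> (c *\<^sub>R x, c *\<^sub>R x') \<in> L n"
  and bracket: "(x, x') \<in> L m ==> (y, y') \<in> L n ==> (ad x y, ad x' y') \<in> L (m + n)"
  and anti: "L (Suc n) <= L n"
begin

lemma sum: "(!!i. i \<in> S ==> (f i, f' i) \<in> L n) ==> (sum f S, sum f' S) \<in> L n"
 by (induction S rule: infinite_finite_induct) (auto simp: zero add)

lemma diff: "(x, x') \<in> L n ==> (y, y') \<in> L n ==> (x - y, x' - y') \<in> L n"
 using add[of x x' n "(- 1) *\<^sub>R y" "(- 1) *\<^sub>R y'"] scale[of y y' n "- 1"] by simp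

lemma mono: "m <= n ==> p \<in> L n ==> p \<in> L m"
 by (induction rule: dec_induct) (use anti in auto)

text \<open>The recursion consists of real scalars, sums and brackets, under which \<open>L\<close>
  is closed, and the total degree of its brackets is the index.\<close>

lemma bch_seq_related:
 assumes x: "(x, x') \<in> L 1" and y: "(y, y') \<in> L 1" and zs: "bch_seq x y zs" "bch_seq x' y' zs'"
 shows "(zs n, zs' n) \<in> L n"
proof (induction n rule: less_induct)
 case (less n)
 show ?case
 proof (cases n)
  case 0
  then show ?thesis using zs zero by (simp add: bch_seq_def)
 next
  case (Suc m)
  \<comment> \<open>For j = 0 the coefficient \<open>zs (Suc k)\<close> must already be covered by
    the induction, hence k < m; a bracket lowers the index, which allows k = m for j > 0.\<close>
  have ac: "(ad_coeff zs j k, ad_coeff zs' j k) \<in> L (Suc k)" if "k < m \<or> j > 0 & k <= m" for j k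
   using that
  proof (induction j arbitrary: k)
   case 0
   then show ?case using less[of "Suc k"] Suc by (simp add: scale del: of_nat_Suc)
  next
   case (Suc j)
   have "(ad (zs i) (ad_coeff zs j (k - i)), ad (zs' i) (ad_coeff zs' j (k - i))) \<in> L (Suc k)"
    if "i \<in> {1..k}" for i
   proof -
    have "(zs i, zs' i) \<in> L i" using less[of i] that Suc.prems \<open>n = Suc m\<close> by auto
    moreover have "(ad_coeff zs j (k - i), ad_coeff zs' j (k - i)) \<in> L (Suc (k - i))"
     by (rule Suc.IH) (use that Suc.prems in auto)
    ultimately have "(ad (zs i) (ad_coeff zs j (k - i)), ad (zs' i) (ad_coeff zs' j (k - i))) \<in> L (i + Suc (k - i))"
     by (rule bracket)
    then show ?thesis using that by simp
   qed
   then show ?case unfolding ad_coeff.simps by (rule sum)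
  qed
  have "((ad x ^^ k) y, (ad x' ^^ k) y') \<in> L (Suc k)" for k
   by (induction k) (use y bracket[OF x] in auto)
  then have "((1 / fact m) *\<^sub>R (ad x ^^ m) y, (1 / fact m) *\<^sub>R (ad x' ^^ m) y') \<in> L (Suc m)" by (rule scale)
  then have "(bch_rhs x y m, bch_rhs x' y' m) \<in> L (Suc m)"
   unfolding bch_rhs_def by (intro add) (use x zero in auto)
  moreover have "((\<Sum>j\<in>{1..m}. (1 / fact (Suc j)) *\<^sub>R ad_coeff zs j m),
    (\<Sum>j\<in>{1..m}. (1 / fact (Suc j)) *\<^sub>R ad_coeff zs' j m)) \<in> L (Suc m)"
   by (intro sum scale ac) auto
  ultimately show ?thesis
   using zs by (simp add: Suc bch_seq_def bch_next_def diff scale del: of_nat_Suc)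
 qed
qed

end

text \<open>The partial sums of the two related solutions are the exponents. Only their relation and
  the two congruences are exported, so no formula for them is ever needed.\<close>

theorem bch_related:
 fixes L :: "nat => ('a::real_algebra_1 \<times> 'b::real_algebra_1) set"
 assumes "lie_relation L" "filtration J" "filtration J'"
  and sub: "!!n. 1 <= n ==> n <= N ==> L n <= J n \<times> J' n" and N: "1 <= N"
  and x: "(x, x') \<in> L 1" and y: "(y, y') \<in> L 1"
 obtains z z' where "(z, z') \<in> L 1" "expN N z - expN N x * expN N y \<in> J (Suc N)"
  "expN N z' - expN N x' * expN N y' \<in> J' (Suc N)"
proof -
 interpret L: lie_relation L by fact
 interpret J: filtration J by fact
 interpret J': filtration J' by fact
 obtain zs zs' where zs: "bch_seq x y zs" "bch_seq x' y' zs'" using bch_seq_exists by meson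
 note r = L.bch_seq_related[OF x y zs]
 have "zs n \<in> J n" "zs' n \<in> J' n" if "1 <= n" "n <= N" for n using r[of n] sub[OF that] by auto
 moreover have "x \<in> J 1" "y \<in> J 1" "x' \<in> J' 1" "y' \<in> J' 1" using sub[of 1] N x y by auto
 moreover have "((\<Sum>n\<le>N. zs n), (\<Sum>n\<le>N. zs' n)) \<in> L 1"
 proof (rule L.sum)
  fix n show "(zs n, zs' n) \<in> L 1"
   by (cases n) (use zs L.zero L.mono[OF _ r, of 1 n] in "auto simp: bch_seq_def")
 qed
 ultimately show ?thesis using that J.expN_bch[OF zs(1), of N] J'.expN_bch[OF zs(2), of N] by simp
qed

unbundle no fps_syntax

section \<open>An operator algebra as a type\<close>

section \<open>Linear operators on functions\<close>

text \<open>A group algebra is given by a carrier set and is not an instance of an algebra class.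
  This type hosts it, so that \<open>filtration\<close>, \<open>expN\<close> and formal power series
  apply.\<close>

typedef 'k op = "{T :: ('k => complex) => ('k => complex).
  (ALL f g. T (%x. f x + g x) = (%x. T f x + T g x)) & (ALL c f. T (%x. c * f x) = (%x. c * T f x))}"
 by (rule exI[of _ "%f. f"]) simp

setup_lifting type_definition_op

instantiation op :: (type) real_algebra_1
begin

lift_definition zero_op :: "'a op" is "%f x. 0" by simp
lift_definition one_op :: "'a op" is "%f. f" by simp
lift_definition plus_op :: "'a op => 'a op => 'a op" is "%S T f x. S f x + T f x"
 by (auto simp: algebra_simps)
lift_definition minus_op :: "'a op => 'a op => 'a op" is "%S T f x. S f x - T f x"
 by (auto simp: algebra_simps)
lift_definition uminus_op :: "'a op => 'a op" is "%S f x. - S f x"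
 by (auto simp: algebra_simps)
lift_definition times_op :: "'a op => 'a op => 'a op" is "%S T f. S (T f)"
 by auto
lift_definition scaleR_op :: "real => 'a op => 'a op" is "%r S f x. of_real r * S f x"
 by (auto simp: algebra_simps)

instance
proof
 fix a b c :: "'a op" and r s :: real
 show "a + b + c = a + (b + c)" by transfer (simp (no_asm) add: add.assoc)
 show "a + b = b + a" by transfer (simp (no_asm) add: add.commute)
 show "0 + a = a" "- a + a = 0" "a - b = a + - b" by (transfer, simp (no_asm))+
 show "r *\<^sub>R (a + b) = r *\<^sub>R a + r *\<^sub>R b" by transfer (simp (no_asm) add: algebra_simps)
 show "(r + s) *\<^sub>R a = r *\<^sub>R a + s *\<^sub>R a" by transfer (simp (no_asm) add: algebra_simps)
 show "r *\<^sub>R s *\<^sub>R a = (r * s) *\<^sub>R a" "1 *\<^sub>R a = a" by (transfer, simp (no_asm) add: mult.assoc)+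
 show "a * b * c = a * (b * c)" "1 * a = a" "a * 1 = a" by (transfer, simp (no_asm))+
 show "(a + b) * c = a * c + b * c" by transfer (simp (no_asm))
 show "a * (b + c) = a * b + a * c" by transfer auto
 show "r *\<^sub>R a * b = r *\<^sub>R (a * b)" by transfer (simp (no_asm))
 show "a * r *\<^sub>R b = r *\<^sub>R (a * b)" by transfer auto
 show "(0 :: 'a op) ~= 1" by transfer (metis zero_neq_one)
qed

end

section \<open>The group algebra and the powers of its augmentation ideal\<close>

section \<open>Group algebras\<close>

definition galg :: "('g, 'm) monoid_scheme => ('g \<Rightarrow>\<^sub>0 complex) set" where
 "galg G = {p. pkeys p <= carrier G}"

lemma group_hopf_simps [simp]:
 "carrier (group_hopf G) = galg G"
 "monoid.mult (group_hopf G) = pm_conv (monoid.mult G)"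
 "monoid.one (group_hopf G) = pm_unit \<one>\<^bsub>G\<^esub>"
 "ring.zero (group_hopf G) = 0" "ring.add (group_hopf G) = (+)"
 "module.smult (group_hopf G) = pm_scale"
 "counit (group_hopf G) p = pm_pair p (%_. 1)"
 "comult (group_hopf G) = lin_ext (tensor_pow (group_alg G) 2) (%g. pure_tensor (group_alg G) [pm_unit g, pm_unit g])"
 by (simp_all add: group_hopf_def group_alg_def module.extend_def hopf.fields_def lin_ext_CC galg_def)

lemma free_space_group_hopf: "free_space (group_hopf G) (carrier G)"
 by standard (simp_all add: galg_def)

lemma free_space_group_alg: "free_space (group_alg G) (carrier G)"
 by standard (simp_all add: group_alg_def)

abbreviation gmul :: "('g, 'm) monoid_scheme => ('g \<Rightarrow>\<^sub>0 complex) => ('g \<Rightarrow>\<^sub>0 complex) => ('g \<Rightarrow>\<^sub>0 complex)" where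
 "gmul G \<equiv> pm_conv (monoid.mult G)"

lemma galg_simps:
 "0 \<in> galg G" "p \<in> galg G ==> q \<in> galg G ==> p + q \<in> galg G" "p \<in> galg G ==> q \<in> galg G ==> p - q \<in> galg G"
 "p \<in> galg G ==> pm_scale c p \<in> galg G" "g \<in> carrier G ==> pm_unit g \<in> galg G"
 using keys_add[of p q] keys_diff_subset[of p q] keys_pm_scale[of c p] by (auto simp: galg_def)

lemma galg_sum: "(!!i. i \<in> S ==> f i \<in> galg G) ==> sum f S \<in> galg G"
 by (induction S rule: infinite_finite_induct) (auto simp: galg_simps)

lemma galg_bind: "(!!g. g \<in> carrier G ==> F g \<in> galg G') ==> p \<in> galg G ==> pm_bind p F \<in> galg G'"
 unfolding galg_def mem_Collect_eq by (rule keys_pm_bind) auto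

lemma pm_pair_cong_galg: "p \<in> galg G ==> (!!g. g \<in> carrier G ==> F g = F' g) ==> pm_pair p F = pm_pair p F'"
 by (rule pm_pair_cong) (auto simp: galg_def)

lemma galg_induct [consumes 1, case_names zero add]:
 assumes "p \<in> galg G" "P 0"
  and "!!p g c. p \<in> galg G ==> P p ==> g \<in> carrier G ==> P (p + pm_scale c (pm_unit g))"
 shows "P p"
 using pm_induct[of p "carrier G" P] assms by (auto simp: galg_def)

context group
begin

abbreviation IG where "IG \<equiv> aug_power G"
abbreviation AG where "AG \<equiv> galg G"

lemma gmul_closed: "p \<in> AG ==> q \<in> AG ==> gmul G p q \<in> AG"
 unfolding galg_def mem_Collect_eq by (rule keys_pm_conv) auto

lemma gmul_assoc:
 assumes "p \<in> AG" "q \<in> AG" "r \<in> AG"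
 shows "gmul G (gmul G p q) r = gmul G p (gmul G q r)"
proof (rule pm_pair_eqI, simp)
 fix F
 show "pm_pair p (%k. pm_pair q (%ka. pm_pair r (%b. F (k \<otimes> ka \<otimes> b)))) =
   pm_pair p (%a. pm_pair q (%aa. pm_pair r (%b. F (a \<otimes> (aa \<otimes> b)))))"
  by (intro pm_pair_cong_galg[OF assms(1)] pm_pair_cong_galg[OF assms(2)] pm_pair_cong_galg[OF assms(3)])
   (simp add: m_assoc)
qed

lemma gmul_one: "p \<in> AG ==> gmul G (pm_unit \<one>) p = p" "p \<in> AG ==> gmul G p (pm_unit \<one>) = p"
 by (rule pm_pair_eqI, simp, rule pm_pair_cong_galg, assumption, simp)+

lemma one_galg: "pm_unit \<one> \<in> AG"
 by (rule galg_simps) simp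

lemma calg_group_hopf: "calg (group_hopf G)"
proof -
 interpret F: free_space "group_hopf G" "carrier G" by (rule free_space_group_hopf)
 show ?thesis
 proof (intro calg.intro calg_axioms.intro)
  show "vspace (group_hopf G)" by (rule F.vspace_axioms)
  show "ring (group_hopf G)"
   by (rule ringI[OF F.abelian_group_axioms monoidI])
    (use gmul_closed gmul_assoc gmul_one one_galg in
     \<open>auto simp: galg_def pm_conv_add_left pm_conv_add_right\<close>)
 qed (simp_all add: pm_conv_scale_left pm_conv_scale_right)
qed

text \<open>The group algebra acts by right translations; this embeds it into a type that is an
 algebra.\<close>

definition rtrans :: "'a => 'a => 'a" where
 "rtrans x g = (if x \<in> carrier G then x \<otimes> g else x)"

definition emb :: "('a \<Rightarrow>\<^sub>0 complex) => 'a op" where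
 "emb p = Abs_op (%f x. pm_pair p (%g. f (rtrans x g)))"

lemma Rep_emb: "Rep_op (emb p) = (%f x. pm_pair p (%g. f (rtrans x g)))"
 unfolding emb_def by (rule Abs_op_inverse) (auto simp: pm_pair_add_right pm_pair_mult_right)

lemma emb_add: "emb (p + q) = emb p + emb q"
 by (rule Rep_op_inject[THEN iffD1]) (simp add: Rep_emb plus_op.rep_eq)

lemma emb_diff: "emb (p - q) = emb p - emb q"
 by (rule Rep_op_inject[THEN iffD1]) (simp add: Rep_emb minus_op.rep_eq)

lemma emb_zero [simp]: "emb 0 = 0"
 by (rule Rep_op_inject[THEN iffD1]) (simp add: Rep_emb zero_op.rep_eq)

lemma emb_scale: "emb (pm_scale (of_real r) p) = r *\<^sub>R emb p"
 by (rule Rep_op_inject[THEN iffD1]) (simp add: Rep_emb scaleR_op.rep_eq)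

lemma emb_sum: "emb (sum f S) = (\<Sum>i\<in>S. emb (f i))"
 by (induction S rule: infinite_finite_induct) (auto simp: emb_add)

lemma emb_one [simp]: "emb (pm_unit \<one>) = 1"
proof -
 have "rtrans x \<one> = x" for x by (simp add: rtrans_def)
 then show ?thesis by (intro Rep_op_inject[THEN iffD1]) (simp add: Rep_emb one_op.rep_eq)
qed

text \<open>With (R_a f)(x) = f(x a) one has R_a R_b = R_(ab), so right translations preserve the
  order of products.\<close>

lemma emb_mult:
 assumes p: "p \<in> AG" and q: "q \<in> AG"
 shows "emb (gmul G p q) = emb p * emb q"
proof (rule Rep_op_inject[THEN iffD1], intro ext)
 fix f x
 have "pm_pair p (%a. pm_pair q (%b. f (rtrans x (a \<otimes> b)))) = pm_pair p (%a. pm_pair q (%b. f (rtrans (rtrans x a) b)))"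
  by (intro pm_pair_cong_galg[OF p] pm_pair_cong_galg[OF q]) (simp add: rtrans_def m_assoc)
 then show "Rep_op (emb (gmul G p q)) f x = Rep_op (emb p * emb q) f x"
  by (simp add: Rep_emb times_op.rep_eq)
qed

text \<open>Applied to \<open>F\<close> and evaluated at the unit of the group, the operator returns
  the pairing with \<open>F\<close>.\<close>

lemma emb_inj:
 assumes "p \<in> AG" "q \<in> AG" "emb p = emb q"
 shows "p = q"
proof (rule pm_pair_eqI)
 fix F
 have "pm_pair r F = Rep_op (emb r) F \<one>" if "r \<in> AG" for r
  unfolding Rep_emb by (rule pm_pair_cong_galg[OF that]) (simp add: rtrans_def)
 then show "pm_pair p F = pm_pair q F" using assms by simp
qed

primrec gpow :: "('a \<Rightarrow>\<^sub>0 complex) => nat => ('a \<Rightarrow>\<^sub>0 complex)" where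
 "gpow p 0 = pm_unit \<one>"
| "gpow p (Suc k) = gmul G p (gpow p k)"

lemma gpow_closed: "p \<in> AG ==> gpow p k \<in> AG"
 by (induction k) (auto simp: gmul_closed galg_simps)

lemma emb_gpow: "p \<in> AG ==> emb (gpow p k) = emb p ^ k"
 by (induction k) (auto simp: emb_mult gpow_closed)

definition gexp :: "nat => ('a \<Rightarrow>\<^sub>0 complex) => ('a \<Rightarrow>\<^sub>0 complex)" where
 "gexp N p = (\<Sum>k\<le>N. pm_scale (of_real (1 / fact k)) (gpow p k))"

definition glog :: "nat => ('a \<Rightarrow>\<^sub>0 complex) => ('a \<Rightarrow>\<^sub>0 complex)" where
 "glog N p = (\<Sum>k\<le>N. pm_scale (of_real (fps_nth (fps_ln 1) k)) (gpow p k))"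

lemma gexp_closed: "p \<in> AG ==> gexp N p \<in> AG"
 unfolding gexp_def by (intro galg_sum galg_simps gpow_closed)

lemma glog_closed: "p \<in> AG ==> glog N p \<in> AG"
 unfolding glog_def by (intro galg_sum galg_simps gpow_closed)

lemma emb_gexp: "p \<in> AG ==> emb (gexp N p) = expN N (emb p)"
 by (simp only: gexp_def expN_def emb_sum emb_scale emb_gpow)

lemma emb_glog: "p \<in> AG ==> emb (glog N p) = logN N (emb p)"
 by (simp only: glog_def logN_def emb_sum emb_scale emb_gpow)

subsection \<open>The augmentation filtration\<close>

lemma aug_ideal_iff: "p \<in> aug_ideal G \<longleftrightarrow> p \<in> AG & pm_pair p (%_. 1) = 0"
 by (simp add: aug_ideal_def)

lemma aug_ideal_mult:
 assumes "p \<in> aug_ideal G" "q \<in> AG"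
 shows "gmul G p q \<in> aug_ideal G" "gmul G q p \<in> aug_ideal G"
proof -
 have "pm_pair p (%a. pm_pair q (%b. 1)) = pm_pair p (%_. 1) * pm_pair q (%_. 1)"
  "pm_pair q (%a. pm_pair p (%b. 1)) = pm_pair q (%_. 1) * pm_pair p (%_. 1)"
  using pm_pair_mult_right[of p "pm_pair q (%_. 1)" "%_. 1"] pm_pair_mult_right[of q "pm_pair p (%_. 1)" "%_. 1"]
  by simp_all
 then show "gmul G p q \<in> aug_ideal G" "gmul G q p \<in> aug_ideal G"
  using assms by (auto simp: aug_ideal_iff gmul_closed)
qed

lemma aug_power_0: "IG 0 = AG"
 by simp

lemma aug_power_Suc_prod: "x \<in> IG n ==> y \<in> aug_ideal G ==> gmul G x y \<in> IG (Suc n)"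
 using ideal_prod.prod[of x "IG n" y "aug_ideal G" "group_hopf G"] by simp

lemma aug_power_Suc_add: "x \<in> IG (Suc n) ==> y \<in> IG (Suc n) ==> x + y \<in> IG (Suc n)"
 using ideal_prod.sum[of x "group_hopf G" "IG n" "aug_ideal G" y] by simp

lemma aug_power_Suc_induct [consumes 1, case_names prod sum]:
 assumes "x \<in> IG (Suc n)"
  and "!!x y. x \<in> IG n ==> y \<in> aug_ideal G ==> P (gmul G x y)"
  and "!!x y. x \<in> IG (Suc n) ==> y \<in> IG (Suc n) ==> P x ==> P y ==> P (x + y)"
 shows "P x"
proof -
 have "x \<in> ideal_prod (group_hopf G) (IG n) (aug_ideal G)" using assms(1) by simp
 then show ?thesis
  by (induction rule: ideal_prod.induct) (use assms(2,3) in auto)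
qed

declare aug_power.simps [simp del]

text \<open>Proved in one induction because the closure properties of one power use several of those
  of the preceding power; \<open>ideal_prod\<close> itself provides only products and sums.\<close>

lemma aug_power_facts:
 "IG n <= AG & 0 \<in> IG n & (\<forall>x\<in>IG n. \<forall>y\<in>IG n. x + y \<in> IG n) &
  (\<forall>x\<in>IG n. ALL c. pm_scale c x \<in> IG n) &
  (\<forall>x\<in>IG n. \<forall>p\<in>AG. gmul G p x \<in> IG n & gmul G x p \<in> IG n)"
proof (induction n)
 case 0
 show ?case by (auto simp: aug_power_0 galg_simps gmul_closed)
next
 case (Suc n)
 have aug: "y \<in> AG" if "y \<in> aug_ideal G" for y using that by (simp add: aug_ideal_iff)
 have 1: "x \<in> AG" if "x \<in> IG (Suc n)" for x
  using that by (induction rule: aug_power_Suc_induct) (use Suc aug in "auto intro!: gmul_closed galg_simps")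
 have 2: "0 \<in> IG (Suc n)"
  using aug_power_Suc_prod[of 0 n 0] Suc by (simp add: aug_ideal_iff galg_simps)
 have 3: "pm_scale c x \<in> IG (Suc n)" if "x \<in> IG (Suc n)" for x c
  using that
 proof (induction rule: aug_power_Suc_induct)
  case (prod x y)
  then have "gmul G (pm_scale c x) y \<in> IG (Suc n)" using Suc by (intro aug_power_Suc_prod) auto
  then show ?case by (simp add: pm_conv_scale_left)
 qed (simp add: aug_power_Suc_add)
 have 4: "gmul G p x \<in> IG (Suc n) & gmul G x p \<in> IG (Suc n)"
  if "x \<in> IG (Suc n)" "p \<in> AG" for x p
  using that(1)
 proof (induction rule: aug_power_Suc_induct)
  case (prod x y)
  have xg: "x \<in> AG" using Suc prod by auto
  have "gmul G (gmul G p x) y \<in> IG (Suc n)" using Suc prod that by (intro aug_power_Suc_prod) auto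
  moreover have "gmul G x (gmul G y p) \<in> IG (Suc n)"
   using Suc prod that by (intro aug_power_Suc_prod aug_ideal_mult) auto
  ultimately show ?case using xg aug[OF prod(2)] that(2) by (simp add: gmul_assoc)
 qed (simp add: pm_conv_add_left pm_conv_add_right aug_power_Suc_add)
 show ?case using 1 2 3 4 aug_power_Suc_add by blast
qed

lemma aug_power_galg: "x \<in> IG n ==> x \<in> AG"
 and aug_power_zero: "0 \<in> IG n"
 and aug_power_add: "x \<in> IG n ==> y \<in> IG n ==> x + y \<in> IG n"
 and aug_power_scale: "x \<in> IG n ==> pm_scale c x \<in> IG n"
 and aug_power_lmult: "x \<in> IG n ==> p \<in> AG ==> gmul G p x \<in> IG n"
 and aug_power_rmult: "x \<in> IG n ==> p \<in> AG ==> gmul G x p \<in> IG n"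
 using aug_power_facts[of n] by blast+

lemma aug_power_diff: "x \<in> IG n ==> y \<in> IG n ==> x - y \<in> IG n"
 using aug_power_add[of x n "pm_scale (- 1) y"] aug_power_scale[of y n "-1"] by (simp add: pm_scale_minus_one)

lemma aug_power_sum: "(!!i. i \<in> S ==> f i \<in> IG n) ==> sum f S \<in> IG n"
 by (induction S rule: infinite_finite_induct) (auto simp: aug_power_zero aug_power_add)

lemma subspace_aug_power: "subspace (group_hopf G) (IG n)"
 using aug_power_facts[of n] unfolding subspace_def by auto

lemma aug_power_Suc_subset: "IG (Suc n) <= IG n"
proof
 fix x assume "x \<in> IG (Suc n)"
 then show "x \<in> IG n"
  by (induction rule: aug_power_Suc_induct) (auto simp: aug_power_rmult aug_ideal_iff aug_power_add)
qed

lemma aug_power_mono: "m <= n ==> x \<in> IG n ==> x \<in> IG m"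
 by (induction rule: dec_induct) (use aug_power_Suc_subset in auto)

lemma aug_power_mult: "x \<in> IG m ==> y \<in> IG n ==> gmul G x y \<in> IG (m + n)"
proof (induction n arbitrary: y)
 case 0
 then show ?case by (simp add: aug_power_0 aug_power_rmult)
next
 case (Suc n)
 from Suc.prems(2) show ?case
 proof (induction rule: aug_power_Suc_induct)
  case (prod y z)
  have "gmul G (gmul G x y) z \<in> IG (Suc (m + n))"
   using prod Suc by (intro aug_power_Suc_prod) auto
  then show ?case
   using gmul_assoc[OF aug_power_galg[OF Suc.prems(1)] aug_power_galg[OF prod(1)], of z] prod(2)
   by (simp add: aug_ideal_iff)
 qed (simp add: pm_conv_add_right aug_power_add)
qed

lemma aug_power_1: "IG 1 = aug_ideal G"
proof (intro Set.set_eqI iffI)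
 fix x assume "x \<in> IG 1"
 then have "x \<in> IG (Suc 0)" by simp
 then show "x \<in> aug_ideal G"
  by (induction rule: aug_power_Suc_induct) (auto simp: aug_power_0 aug_ideal_mult, auto simp: aug_ideal_iff galg_simps)
next
 fix x assume x: "x \<in> aug_ideal G"
 have "gmul G (pm_unit \<one>) x \<in> IG (Suc 0)"
  by (rule aug_power_Suc_prod[OF _ x]) (simp add: aug_power_0 one_galg)
 then show "x \<in> IG 1" using x by (simp add: aug_ideal_iff gmul_one)
qed

lemma unit_minus_one: "g \<in> carrier G ==> pm_unit g - pm_unit \<one> \<in> IG 1"
 by (simp only: aug_power_1 aug_ideal_iff) (simp add: galg_simps one_galg)

text \<open>The elements g - 1 span the augmentation ideal, since an element minus its augmentation
  times 1 is a combination of them.\<close>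

lemma aug_ideal_span:
 assumes y: "y \<in> IG 1" and S: "subspace (group_hopf G) S"
  and g: "!!g. g \<in> carrier G ==> pm_unit g - pm_unit \<one> \<in> S"
 shows "y \<in> S"
proof -
 have "z - pm_scale (pm_pair z (%_. 1)) (pm_unit \<one>) \<in> S" if "z \<in> AG" for z
  using that
 proof (induction rule: galg_induct)
  case zero
  then show ?case using subspaceD(2)[OF S] by simp
 next
  case (add p h c)
  have "pm_scale c (pm_unit h - pm_unit \<one>) \<in> S" using subspaceD(4)[OF S g[OF add(2)], of c] by simp
  from subspaceD(3)[OF S add(3) this]
  have "p - pm_scale (pm_pair p (%_. 1)) (pm_unit \<one>) + pm_scale c (pm_unit h - pm_unit \<one>) \<in> S" by simp
  moreover have "p - pm_scale (pm_pair p (%_. 1)) (pm_unit \<one>) + pm_scale c (pm_unit h - pm_unit \<one>) =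
    p + pm_scale c (pm_unit h) - pm_scale (pm_pair (p + pm_scale c (pm_unit h)) (%_. 1)) (pm_unit \<one>)"
   by (rule pm_pair_eqI) (simp add: algebra_simps del: map_single)
  ultimately show ?case by (simp only:)
 qed
 from this[of y] show ?thesis using y by (simp add: aug_power_1[simplified] aug_ideal_iff)
qed

lemma filtration_emb: "filtration (%n. emb ` IG n)"
proof
 fix n m x y c
 show "0 \<in> emb ` IG n" using aug_power_zero by force
 show "1 \<in> emb ` IG 0" using emb_one one_galg aug_power_0 by (metis image_eqI)
 show "emb ` IG (Suc n) <= emb ` IG n" using aug_power_Suc_subset by auto
 assume x: "x \<in> emb ` IG n"
 then show "c *\<^sub>R x \<in> emb ` IG n"
  using aug_power_scale by (auto simp flip: emb_scale)
 show "x + y \<in> emb ` IG n" if "y \<in> emb ` IG n"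
  using x that aug_power_add by (auto simp flip: emb_add)
 show "x * y \<in> emb ` IG (n + m)" if "y \<in> emb ` IG m"
  using x that aug_power_mult by (auto simp flip: emb_mult[OF aug_power_galg aug_power_galg])
qed

lemma emb_in_iff: "p \<in> AG ==> emb p \<in> emb ` IG n \<longleftrightarrow> p \<in> IG n"
 using emb_inj aug_power_galg by blast

lemma emb_diff_iff: "p \<in> AG ==> q \<in> AG ==> emb p - emb q \<in> emb ` IG n \<longleftrightarrow> p - q \<in> IG n"
 using emb_in_iff[of "p - q"] by (simp add: emb_diff galg_simps)

sublocale J: filtration "%n. emb ` IG n"
 by (rule filtration_emb)

lemma gexp_cong:
 assumes "x \<in> IG 1" "y \<in> IG 1" "x - y \<in> IG m"
 shows "gexp N x - gexp N y \<in> IG m"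
 using J.expN_cong[of "emb x" "emb y" m N] assms aug_power_galg
 by (simp add: emb_gexp[symmetric] gexp_closed emb_diff_iff)

lemma gexp_inj:
 assumes "x \<in> IG 1" "y \<in> IG 1" "gexp N x - gexp N y \<in> IG (Suc N)"
 shows "x - y \<in> IG (Suc N)"
 using J.expN_inj[of "emb x" "emb y" N] assms aug_power_galg
 by (simp add: emb_gexp[symmetric] gexp_closed emb_diff_iff)

lemma gexp_glog:
 assumes u: "u \<in> IG 1"
 shows "gexp N (glog N u) - (pm_unit \<one> + u) \<in> IG (Suc N)"
proof -
 have ug: "u \<in> AG" by (rule aug_power_galg[OF u])
 have "expN N (logN N (emb u)) - (1 + emb u) \<in> emb ` IG (Suc N)"
  by (rule J.exp_log) (use u in auto)
 then have "emb (gexp N (glog N u)) - emb (pm_unit \<one> + u) \<in> emb ` IG (Suc N)"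
  using ug by (simp add: emb_gexp emb_glog glog_closed emb_add)
 then show ?thesis using ug by (simp add: emb_diff_iff gexp_closed glog_closed galg_simps one_galg)
qed

lemma glog_in: "u \<in> IG 1 ==> glog N u \<in> IG 1"
 using J.logN_in[of "emb u" N] emb_glog[of u N] emb_in_iff[of "glog N u" 1] aug_power_galg[of u 1]
 by (simp add: glog_closed)

lemma gexp_add_commuting:
 assumes "x \<in> IG 1" "y \<in> IG 1" "gmul G x y = gmul G y x"
 shows "gexp N (x + y) - gmul G (gexp N x) (gexp N y) \<in> IG (Suc N)"
proof -
 have g: "x \<in> AG" "y \<in> AG" using assms aug_power_galg by auto
 have "emb x * emb y = emb y * emb x" using g assms(3) by (simp flip: emb_mult)
 then have "expN N (emb x + emb y) - expN N (emb x) * expN N (emb y) \<in> emb ` IG (Suc N)"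
  by (intro J.expN_add_commuting) (use assms in auto)
 then have "emb (gexp N (x + y)) - emb (gmul G (gexp N x) (gexp N y)) \<in> emb ` IG (Suc N)"
  using g by (simp add: emb_gexp emb_mult gexp_closed emb_add galg_simps)
 then show ?thesis using g by (simp add: emb_diff_iff gexp_closed gmul_closed galg_simps)
qed

text \<open>The added terms are powers of \<open>u\<close> beyond the \<open>M\<close>-th. Truncated
  logarithms of growing order thus form a compatible sequence, that is, an element of the
  completion.\<close>

lemma glog_mono_cong:
 assumes "u \<in> IG 1" "M <= N"
 shows "glog N u - glog M u \<in> IG (Suc M)"
proof -
 have gp: "gpow u k \<in> IG k" for k
  using J.power[of "emb u" k] assms(1) emb_gpow[of u k] aug_power_galg[OF assms(1)]
   emb_in_iff[of "gpow u k" k] by (simp add: gpow_closed)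
 have "{..N} = {..M} \<union> {Suc M..N}" using assms(2) by auto
 then have "glog N u - glog M u = (\<Sum>k\<in>{Suc M..N}. pm_scale (of_real (fps_nth (fps_ln 1) k)) (gpow u k))"
  unfolding glog_def by (simp add: sum.union_disjoint ivl_disj_int)
 also have "... \<in> IG (Suc M)"
  by (intro aug_power_sum aug_power_scale aug_power_mono[OF _ gp]) auto
 finally show ?thesis .
qed

lemma gexp_1_cong:
 assumes "u \<in> IG 1" "1 <= N"
 shows "gexp N u - pm_unit \<one> - u \<in> IG 2"
proof -
 have gp: "gpow u k \<in> IG k" for k
  using J.power[of "emb u" k] assms(1) emb_gpow[of u k] aug_power_galg[OF assms(1)]
   emb_in_iff[of "gpow u k" k] by (simp add: gpow_closed)
 have "{..N} = {0, 1} \<union> {2..N}" using assms by auto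
 then have "gexp N u = pm_unit \<one> + u + (\<Sum>k\<in>{2..N}. pm_scale (of_real (1 / fact k)) (gpow u k))"
  using gmul_one(2)[OF aug_power_galg[OF assms(1)]] by (simp add: gexp_def sum.union_disjoint)
 then have "gexp N u - pm_unit \<one> - u = (\<Sum>k\<in>{2..N}. pm_scale (of_real (1 / fact k)) (gpow u k))" by simp
 also have "... \<in> IG 2"
  by (intro aug_power_sum aug_power_scale aug_power_mono[OF _ gp]) auto
 finally show ?thesis .
qed

lemma gexp_mono_cong:
 assumes "u \<in> IG 1" "M <= N"
 shows "gexp N u - gexp M u \<in> IG (Suc M)"
proof -
 have gp: "gpow u k \<in> IG k" for k
  using J.power[of "emb u" k] assms(1) emb_gpow[of u k] aug_power_galg[OF assms(1)]
   emb_in_iff[of "gpow u k" k] by (simp add: gpow_closed)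
 have "{..N} = {..M} \<union> {Suc M..N}" using assms(2) by auto
 then have "gexp N u - gexp M u = (\<Sum>k\<in>{Suc M..N}. pm_scale (of_real (1 / fact k)) (gpow u k))"
  unfolding gexp_def by (simp add: sum.union_disjoint ivl_disj_int)
 also have "... \<in> IG (Suc M)"
  by (intro aug_power_sum aug_power_scale aug_power_mono[OF _ gp]) auto
 finally show ?thesis .
qed

lemma cong_gmul:
 assumes "x - x' \<in> IG n" "y - y' \<in> IG n" "x' \<in> AG" "y \<in> AG"
 shows "gmul G x y - gmul G x' y' \<in> IG n"
proof -
 have "gmul G (x - x') y + gmul G x' (y - y') \<in> IG n"
  by (intro aug_power_add aug_power_rmult aug_power_lmult assms)
 then show ?thesis by (simp add: pm_conv_diff_left pm_conv_diff_right)
qed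

lemma cong_trans: "x - y \<in> IG n ==> y - z \<in> IG n ==> x - z \<in> IG n"
 using aug_power_add[of "x - y" n "y - z"] by simp

lemma cong_sym: "x - y \<in> IG n ==> y - x \<in> IG n"
 using aug_power_scale[of "x - y" n "-1"] by (simp only: pm_scale_minus_one) simp

end

section \<open>Functoriality, and C[G x G] as the tensor square\<close>

section \<open>Functoriality and the square of the group\<close>

definition pm_map :: "('k => 'l) => ('k \<Rightarrow>\<^sub>0 complex) => ('l \<Rightarrow>\<^sub>0 complex)" where
 "pm_map \<phi> p = pm_bind p (%k. pm_unit (\<phi> k))"

lemma pm_pair_map [simp]: "pm_pair (pm_map \<phi> p) F = pm_pair p (%k. F (\<phi> k))"
 by (simp add: pm_map_def)

lemma pm_map_add [simp]: "pm_map \<phi> (p + q) = pm_map \<phi> p + pm_map \<phi> q"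
 and pm_map_diff [simp]: "pm_map \<phi> (p - q) = pm_map \<phi> p - pm_map \<phi> q"
 and pm_map_scale [simp]: "pm_map \<phi> (pm_scale c p) = pm_scale c (pm_map \<phi> p)"
 and pm_map_unit [simp]: "pm_map \<phi> (pm_unit k) = pm_unit (\<phi> k)"
 and pm_map_zero [simp]: "pm_map \<phi> 0 = 0"
 by (simp_all add: pm_map_def)

lemma pm_map_sum: "pm_map \<phi> (sum f S) = (\<Sum>i\<in>S. pm_map \<phi> (f i))"
 by (induction S rule: infinite_finite_induct) auto

locale galg_hom = G: group G + H: group H for G :: "('a, 'm) monoid_scheme" and H :: "('b, 'n) monoid_scheme" +
 fixes \<phi> :: "'a => 'b"
 assumes hom: "\<phi> \<in> hom G H"
begin

lemma map_closed: "p \<in> galg G ==> pm_map \<phi> p \<in> galg H"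
 unfolding pm_map_def using hom by (intro galg_bind[of G] galg_simps) (auto simp: hom_def)

lemma hom_one: "\<phi> \<one>\<^bsub>G\<^esub> = \<one>\<^bsub>H\<^esub>"
 using hom G.group_axioms H.group_axioms by (metis group_hom.hom_one group_hom.intro group_hom_axioms.intro)

lemma map_mult:
 assumes "p \<in> galg G" "q \<in> galg G"
 shows "pm_map \<phi> (gmul G p q) = gmul H (pm_map \<phi> p) (pm_map \<phi> q)"
proof (rule pm_pair_eqI, simp)
 fix F
 show "pm_pair p (%a. pm_pair q (%b. F (\<phi> (a \<otimes>\<^bsub>G\<^esub> b)))) = pm_pair p (%k. pm_pair q (%ka. F (\<phi> k \<otimes>\<^bsub>H\<^esub> \<phi> ka)))"
  using hom by (intro pm_pair_cong_galg[OF assms(1)] pm_pair_cong_galg[OF assms(2)]) (simp add: hom_def)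
qed

lemma map_aug_power: "x \<in> aug_power G n ==> pm_map \<phi> x \<in> aug_power H n"
proof (induction n arbitrary: x)
 case 0
 then show ?case by (simp add: G.aug_power_0 H.aug_power_0 map_closed)
next
 case (Suc n)
 from Suc.prems show ?case
 proof (induction rule: G.aug_power_Suc_induct)
  case (prod x y)
  then have "pm_map \<phi> y \<in> aug_ideal H" by (simp add: G.aug_ideal_iff H.aug_ideal_iff map_closed)
  then show ?case
   using prod Suc G.aug_power_galg[OF prod(1)]
   by (simp add: map_mult G.aug_ideal_iff H.aug_power_Suc_prod)
 qed (simp add: H.aug_power_add)
qed

lemma map_gpow: "p \<in> galg G ==> pm_map \<phi> (G.gpow p k) = H.gpow (pm_map \<phi> p) k"
 by (induction k) (simp_all add: hom_one map_mult G.gpow_closed)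

lemma map_gexp: "p \<in> galg G ==> pm_map \<phi> (G.gexp N p) = H.gexp N (pm_map \<phi> p)"
 by (simp only: G.gexp_def H.gexp_def pm_map_sum pm_map_scale map_gpow)

lemma map_glog: "p \<in> galg G ==> pm_map \<phi> (G.glog N p) = H.glog N (pm_map \<phi> p)"
 by (simp only: G.glog_def H.glog_def pm_map_sum pm_map_scale map_gpow)

end

text \<open>The group algebra of the square replaces the tensor square of the group algebra: the
  coproduct is induced by a homomorphism of groups, and the tensor filtration becomes the powers of
  one augmentation ideal.\<close>

locale group_square = group
begin

abbreviation GG where "GG \<equiv> G \<times>\<times> G"

lemma group_GG: "group GG"
 by (rule DirProd_group[OF group_axioms group_axioms])

sublocale GG: group GG by (rule group_GG)

lemma GG_simps: "(a, b) \<otimes>\<^bsub>GG\<^esub> (c, d) = (a \<otimes> c, b \<otimes> d)" "\<one>\<^bsub>GG\<^esub> = (\<one>, \<one>)" "carrier GG = carrier G \<times> carrier G"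
 by (simp_all add: DirProd_def)

sublocale dg: galg_hom G GG "%g. (g, g)"
 by unfold_locales (auto simp: hom_def GG_simps)

sublocale inl: galg_hom G GG "%g. (g, \<one>)"
 by unfold_locales (auto simp: hom_def GG_simps)

sublocale inr: galg_hom G GG "%g. (\<one>, g)"
 by unfold_locales (auto simp: hom_def GG_simps)

text \<open>Read in the tensor square, \<open>diag\<close> is the coproduct, \<open>left p\<close>
  is p tensor 1, \<open>right p\<close> is 1 tensor p, and \<open>kron p q\<close> is p tensor
  q.\<close>

definition diag where "diag p = pm_map (%g. (g, g)) p"
definition left where "left p = pm_map (%g. (g, \<one>)) p"
definition right where "right p = pm_map (%g. (\<one>, g)) p"
definition kron where "kron p q = gmul GG (left p) (right q)"

lemma pm_pair_kron:
 assumes "p \<in> AG" "q \<in> AG"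
 shows "pm_pair (kron p q) F = pm_pair p (%a. pm_pair q (%b. F (a, b)))"
 unfolding kron_def left_def right_def pm_pair_conv pm_pair_map
 by (intro pm_pair_cong_galg[OF assms(1)] pm_pair_cong_galg[OF assms(2)]) (simp add: GG_simps)

lemma left_closed: "p \<in> AG ==> left p \<in> galg GG"
 and right_closed: "p \<in> AG ==> right p \<in> galg GG"
 and diag_closed: "p \<in> AG ==> diag p \<in> galg GG"
 by (simp_all add: left_def right_def diag_def inl.map_closed inr.map_closed dg.map_closed)

lemma kron_closed: "p \<in> AG ==> q \<in> AG ==> kron p q \<in> galg GG"
 unfolding kron_def by (intro GG.gmul_closed left_closed right_closed)

lemma kron_aug_power: "p \<in> IG i ==> q \<in> IG j ==> kron p q \<in> aug_power GG (i + j)"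
 unfolding kron_def left_def right_def by (intro GG.aug_power_mult inl.map_aug_power inr.map_aug_power)

lemma left_right_commute:
 assumes "p \<in> AG" "q \<in> AG"
 shows "gmul GG (left p) (right q) = gmul GG (right q) (left p)"
proof (rule pm_pair_eqI)
 fix F
 have "pm_pair (gmul GG (right q) (left p)) F = pm_pair q (%b. pm_pair p (%a. F (a, b)))"
  unfolding left_def right_def pm_pair_conv pm_pair_map
  by (intro pm_pair_cong_galg[OF assms(1)] pm_pair_cong_galg[OF assms(2)]) (simp add: GG_simps)
 then show "pm_pair (gmul GG (left p) (right q)) F = pm_pair (gmul GG (right q) (left p)) F"
  using pm_pair_kron[OF assms, of F] by (simp add: kron_def pm_pair_commute[of p])
qed

lemma kron_mult:
 assumes "p \<in> AG" "q \<in> AG" "p' \<in> AG" "q' \<in> AG"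
 shows "gmul GG (kron p q) (kron p' q') = kron (gmul G p p') (gmul G q q')"
proof -
 note c = left_closed right_closed GG.gmul_closed
 have "gmul GG (kron p q) (kron p' q') = gmul GG (left p) (gmul GG (gmul GG (right q) (left p')) (right q'))"
  using assms by (simp add: kron_def GG.gmul_assoc c)
 also have "... = gmul GG (gmul GG (left p) (left p')) (gmul GG (right q) (right q'))"
  using assms by (simp add: left_right_commute[symmetric] GG.gmul_assoc c)
 also have "... = kron (gmul G p p') (gmul G q q')"
  using assms unfolding kron_def left_def right_def by (simp add: inl.map_mult inr.map_mult)
 finally show ?thesis .
qed

lemma kron_add_left: "kron (p + p') q = kron p q + kron p' q"
 and kron_add_right: "kron p (q + q') = kron p q + kron p q'"
 and kron_diff_left: "kron (p - p') q = kron p q - kron p' q"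
 and kron_diff_right: "kron p (q - q') = kron p q - kron p q'"
 and kron_scale_left: "kron (pm_scale c p) q = pm_scale c (kron p q)"
 and kron_scale_right: "kron p (pm_scale c q) = pm_scale c (kron p q)"
 by (simp_all add: kron_def left_def right_def pm_conv_add_left pm_conv_add_right pm_conv_diff_left
   pm_conv_diff_right pm_conv_scale_left pm_conv_scale_right)

lemma kron_unit: "a \<in> carrier G ==> b \<in> carrier G ==> kron (pm_unit a) (pm_unit b) = pm_unit (a, b)"
 by (simp add: kron_def left_def right_def pm_conv_unit GG_simps)

text \<open>As (a, b) - 1 = (a - 1) tensor b + 1 tensor (b - 1), multiplication by the augmentation
  ideal raises the degree of one of the two factors. The arbitrary subspace \<open>S\<close> makes
  this usable as an induction principle.\<close>

lemma aug_power_GG_subset: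
 assumes "subspace (group_hopf GG) S"
  and "!!i u v. i <= m ==> u \<in> IG i ==> v \<in> IG (m - i) ==> kron u v \<in> S"
 shows "aug_power GG m <= S"
 using assms
proof (induction m arbitrary: S)
 case 0
 show ?case
 proof
  fix x assume "x \<in> aug_power GG 0"
  then have "x \<in> galg GG" by (simp add: GG.aug_power_0)
  then show "x \<in> S"
  proof (induction rule: galg_induct)
   case zero then show ?case using subspaceD(2)[OF 0(1)] by simp
  next
   case (add p k c)
   obtain a b where k: "k = (a, b)" "a \<in> carrier G" "b \<in> carrier G" using add(2) by (auto simp: GG_simps)
   have "pm_unit k \<in> S"
    using 0(2)[of 0 "pm_unit a" "pm_unit b"] k by (simp add: kron_unit aug_power_0 galg_simps)
   then show ?case using subspaceD(3)[OF 0(1) add(3)] subspaceD(4)[OF 0(1), of "pm_unit k" c] by simp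
  qed
 qed
next
 case (Suc m)
 note S = Suc.prems(1)
 \<comment> \<open>The elements that the augmentation ideal multiplies into \<open>S\<close>: the
   induction hypothesis for \<open>m\<close> is applied to this subspace.\<close>
 define S' where "S' = {x \<in> galg GG. \<forall>y\<in>aug_power GG 1. gmul GG x y \<in> S}"
 have "aug_power GG m <= S'"
 proof (rule Suc.IH)
  show "subspace (group_hopf GG) S'"
   using subspaceD(2)[OF S] subspaceD(3)[OF S] subspaceD(4)[OF S]
   by (auto simp: subspace_def S'_def pm_conv_add_left pm_conv_scale_left galg_simps)
  fix i u v assume i: "i <= m" and u: "u \<in> IG i" and v: "v \<in> IG (m - i)"
  have ug: "u \<in> AG" "v \<in> AG" using u v aug_power_galg by auto
  have "gmul GG (kron u v) y \<in> S" if y: "y \<in> aug_power GG 1" for y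
  proof -
   have "y \<in> {y \<in> galg GG. gmul GG (kron u v) y \<in> S}"
   proof (rule GG.aug_ideal_span[OF y])
    show "subspace (group_hopf GG) {y \<in> galg GG. gmul GG (kron u v) y \<in> S}"
     using subspaceD(2)[OF S] subspaceD(3)[OF S] subspaceD(4)[OF S]
     by (auto simp: subspace_def pm_conv_add_right pm_conv_scale_right galg_simps)
    fix g assume g: "g \<in> carrier GG"
    then obtain a b where ab: "g = (a, b)" "a \<in> carrier G" "b \<in> carrier G" by (auto simp: GG_simps)
    have gg: "pm_unit a \<in> AG" "pm_unit b \<in> AG" "pm_unit \<one> \<in> AG" using ab by (auto intro: galg_simps)
    have e: "pm_unit g - pm_unit \<one>\<^bsub>GG\<^esub> = kron (pm_unit a - pm_unit \<one>) (pm_unit b) + kron (pm_unit \<one>) (pm_unit b - pm_unit \<one>)"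
     using ab by (simp add: kron_diff_left kron_diff_right kron_unit GG_simps)
    have "gmul GG (kron u v) (pm_unit g - pm_unit \<one>\<^bsub>GG\<^esub>) =
      kron (gmul G u (pm_unit a - pm_unit \<one>)) (gmul G v (pm_unit b)) +
      kron (gmul G u (pm_unit \<one>)) (gmul G v (pm_unit b - pm_unit \<one>))"
     unfolding e pm_conv_add_right using ug gg by (simp add: kron_mult galg_simps)
    also have "... \<in> S"
    proof -
     have "kron (gmul G u (pm_unit a - pm_unit \<one>)) (gmul G v (pm_unit b)) \<in> S"
      using Suc.prems(2)[of "Suc i"] i aug_power_mult[OF u unit_minus_one[OF ab(2)]] aug_power_rmult[OF v gg(2)] by simp
     moreover have "kron (gmul G u (pm_unit \<one>)) (gmul G v (pm_unit b - pm_unit \<one>)) \<in> S"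
      using Suc.prems(2)[of i] i aug_power_mult[OF v unit_minus_one[OF ab(3)]] aug_power_rmult[OF u gg(3)]
      by (simp add: Suc_diff_le)
     ultimately show ?thesis using subspaceD(3)[OF S] by simp
    qed
    finally show "pm_unit g - pm_unit \<one>\<^bsub>GG\<^esub> \<in> {y \<in> galg GG. gmul GG (kron u v) y \<in> S}"
     using g by (simp add: galg_simps)
   qed
   then show ?thesis by simp
  qed
  then show "kron u v \<in> S'" using ug by (simp add: S'_def kron_closed)
 qed
 then have p: "gmul GG x y \<in> S" if "x \<in> aug_power GG m" "y \<in> aug_ideal GG" for x y
  using that GG.aug_power_1 by (auto simp: S'_def)
 show ?case
 proof
  fix x assume "x \<in> aug_power GG (Suc m)"
  then show "x \<in> S"
   by (induction rule: GG.aug_power_Suc_induct) (use p subspaceD(3)[OF S] in auto)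
 qed
qed

end

section \<open>Finite dimensionality of the quotients by powers of the augmentation ideal\<close>

subsection \<open>Finite generation\<close>

context group
begin

text \<open>The quotient of consecutive powers is finite dimensional: for d in \<open>IG n\<close>,
  the map g -> d (g - 1) is a homomorphism to the additive group modulo \<open>IG (n + 2)\<close>,
  so generators of the group suffice.\<close>

lemma aug_power_finite_span:
 assumes gen: "finite X" "X <= carrier G" "generate G X = carrier G"
 shows "EX D. finite D & D <= IG n &
  (ALL T. subspace (group_hopf G) T & D <= T & IG (Suc n) <= T --> IG n <= T)"
proof (induction n)
 case 0
 show ?case
 proof (intro exI[of _ "{pm_unit \<one>}"] conjI allI impI)
  fix T assume T: "subspace (group_hopf G) T & {pm_unit \<one>} <= T & IG (Suc 0) <= T"
  show "IG 0 <= T"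
  proof
   fix x assume "x \<in> IG 0"
   then have "x \<in> AG" by (simp add: aug_power_0)
   then show "x \<in> T"
   proof (induction rule: galg_induct)
    case zero then show ?case using T subspaceD(2)[of "group_hopf G" T] by simp
   next
    case (add p g c)
    have "pm_unit g - pm_unit \<one> + pm_unit \<one> \<in> T"
     using T unit_minus_one[OF add(2)] subspaceD(3)[of "group_hopf G" T "pm_unit g - pm_unit \<one>" "pm_unit \<one>"] by auto
    then have "pm_unit g \<in> T" by simp
    then have "pm_scale c (pm_unit g) \<in> T" using T subspaceD(4)[of "group_hopf G" T "pm_unit g" c] by simp
    then show ?case using T add(3) subspaceD(3)[of "group_hopf G" T p "pm_scale c (pm_unit g)"] by simp
   qed
  qed
 qed (simp_all add: aug_power_0 one_galg)
next
 case (Suc n)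
 then obtain D where "finite D & D <= IG n &
  (ALL T. subspace (group_hopf G) T & D <= T & IG (Suc n) <= T --> IG n <= T)" ..
 then have D: "finite D" "D <= IG n"
  "!!T. subspace (group_hopf G) T ==> D <= T ==> IG (Suc n) <= T ==> IG n <= T" by simp_all
 let ?D = "(%(d, s). gmul G d (pm_unit s - pm_unit \<one>)) ` (D \<times> X)"
 show ?case
 proof (intro exI[of _ ?D] conjI allI impI)
  show "finite ?D" using D gen by simp
  show "?D <= IG (Suc n)"
   using D(2) gen(2) aug_power_mult[OF _ unit_minus_one, of _ n] by auto
  fix T assume T: "subspace (group_hopf G) T & ?D <= T & IG (Suc (Suc n)) <= T"
  then have TS: "subspace (group_hopf G) T" by blast
  have add: "x + y \<in> T" if "x \<in> T" "y \<in> T" for x y using subspaceD(3)[OF TS that] by simp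
  have scale: "pm_scale c x \<in> T" if "x \<in> T" for x c using subspaceD(4)[OF TS that] by simp
  \<comment> \<open>The elements that the augmentation ideal multiplies into \<open>T\<close>; the
    hypothesis on \<open>D\<close> is applied to this subspace.\<close>
  define T' where "T' = {x \<in> AG. \<forall>y\<in>IG 1. gmul G x y \<in> T}"
  have "IG n <= T'"
  proof (rule D(3))
   show "subspace (group_hopf G) T'"
    using subspaceD(2)[OF TS] subspaceD(3)[OF TS] subspaceD(4)[OF TS]
    by (auto simp: subspace_def T'_def pm_conv_add_left pm_conv_scale_left galg_simps)
   show "IG (Suc n) <= T'"
    using T aug_power_mult[of _ "Suc n" _ 1] aug_power_galg by (auto simp: T'_def)
   show "D <= T'"
   proof
    fix d assume d: "d \<in> D"
    have dn: "d \<in> IG n" using d D by auto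
    have dg: "d \<in> AG" using dn by (rule aug_power_galg)
    have gen_in: "gmul G d (pm_unit g - pm_unit \<one>) \<in> T" if "g \<in> generate G X" for g
     using that
    proof (induction rule: generate.induct)
     case one
     then show ?case using subspaceD(2)[OF TS] by simp
    next
     case (incl h)
     then show ?case using T d by auto
    next
     case (inv h)
     have h: "h \<in> carrier G" using inv gen(2) by auto
     let ?a = "pm_unit h - pm_unit \<one>" and ?b = "pm_unit (inv h) - pm_unit \<one>"
     have "gmul G d (gmul G ?a ?b) \<in> T"
      using T aug_power_mult[OF dn aug_power_mult[OF unit_minus_one[OF h] unit_minus_one[OF inv_closed[OF h]]]] by auto
     moreover have "gmul G d ?a \<in> T" using T d inv by auto
     moreover have "?b = pm_scale (- 1) (?a + gmul G ?a ?b)"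
      using h by (simp add: pm_conv_diff_left pm_conv_diff_right pm_conv_unit pm_scale_minus_one del: map_single)
     ultimately show ?case
      using scale[OF add, of "gmul G d ?a" "gmul G d (gmul G ?a ?b)" "-1"]
      by (metis pm_conv_add_right pm_conv_scale_right)
    next
     case (eng g h)
     have gh: "g \<in> carrier G" "h \<in> carrier G" using eng gen(3) by auto
     let ?a = "pm_unit g - pm_unit \<one>" and ?b = "pm_unit h - pm_unit \<one>"
     have "gmul G d (gmul G ?a ?b) \<in> T"
      using T aug_power_mult[OF dn aug_power_mult[OF unit_minus_one[OF gh(1)] unit_minus_one[OF gh(2)]]] by auto
     moreover have e: "pm_unit (g \<otimes> h) - pm_unit \<one> = gmul G ?a ?b + ?a + ?b"
      using gh by (simp add: pm_conv_diff_left pm_conv_diff_right pm_conv_unit)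
     ultimately show ?case unfolding e pm_conv_add_right by (intro add eng.IH)
    qed
    have "y \<in> {y \<in> AG. gmul G d y \<in> T}" if "y \<in> IG 1" for y
    proof (rule aug_ideal_span[OF that])
     show "subspace (group_hopf G) {y \<in> AG. gmul G d y \<in> T}"
      using subspaceD(2)[OF TS] subspaceD(3)[OF TS] subspaceD(4)[OF TS]
      by (auto simp: subspace_def pm_conv_add_right pm_conv_scale_right galg_simps)
     show "pm_unit g - pm_unit \<one> \<in> {y \<in> AG. gmul G d y \<in> T}" if "g \<in> carrier G" for g
      using that gen_in gen(3) by (simp add: galg_simps one_galg)
    qed
    then show "d \<in> T'" using dg by (simp add: T'_def)
   qed
  qed
  then have p: "gmul G x y \<in> T" if "x \<in> IG n" "y \<in> aug_ideal G" for x y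
   using that aug_power_1 by (auto simp: T'_def)
  show "IG (Suc n) <= T"
  proof
   fix x assume "x \<in> IG (Suc n)"
   then show "x \<in> T" by (induction rule: aug_power_Suc_induct) (use p add in auto)
  qed
 qed
qed

text \<open>The finite sets for the successive quotients are collected into one that spans modulo
  \<open>IG n\<close>.\<close>

lemma galg_finite_span:
 assumes gen: "finitely_generated G"
 shows "EX B. finite B & B <= AG &
  (ALL T. subspace (group_hopf G) T & B <= T & IG n <= T --> AG <= T)"
proof (induction n)
 case 0
 show ?case by (rule exI[of _ "{}"]) (auto simp: aug_power_0)
next
 case (Suc n)
 then obtain B where B0: "finite B & B <= AG &
  (ALL T. subspace (group_hopf G) T & B <= T & IG n <= T --> AG <= T)" ..
 then have B: "finite B" "B <= AG"
  "!!T. subspace (group_hopf G) T ==> B <= T ==> IG n <= T ==> AG <= T" by simp_all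
 obtain X where X: "finite X" "X <= carrier G" "generate G X = carrier G"
  using gen by (auto simp: finitely_generated_def)
 obtain D where "finite D & D <= IG n &
  (ALL T. subspace (group_hopf G) T & D <= T & IG (Suc n) <= T --> IG n <= T)"
  using aug_power_finite_span[OF X, of n] ..
 then have D: "finite D" "D <= IG n"
  "!!T. subspace (group_hopf G) T ==> D <= T ==> IG (Suc n) <= T ==> IG n <= T" by simp_all
 show ?case
 proof (intro exI[of _ "B \<union> D"] conjI allI impI)
  show "finite (B \<union> D)" using B(1) D(1) by simp
  show "B \<union> D <= AG" using B(2) D(2) aug_power_galg[of _ n] by auto
  fix T assume T: "subspace (group_hopf G) T & B \<union> D <= T & IG (Suc n) <= T"
  then have "IG n <= T" by (intro D(3)) auto
  with T show "AG <= T" by (intro B(3)) auto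
 qed
qed

end

section \<open>The completed group algebra\<close>

section \<open>The completed group algebra\<close>

definition caug :: "('g, 'm) monoid_scheme => nat => ('g \<Rightarrow>\<^sub>0 complex) => ('g \<Rightarrow>\<^sub>0 complex) set" where
 "caug G m x = aug_power G m +>\<^bsub>group_hopf G\<^esub> x"

context group
begin

lemma vspace_gh: "vspace (group_hopf G)"
 using calg_group_hopf by (simp add: calg_def)

lemma a_minus_gh: "q \<in> AG ==> p \<ominus>\<^bsub>group_hopf G\<^esub> q = p - q"
 using free_space.a_minus_free[OF free_space_group_hopf] by (simp add: galg_def)

lemma mem_caug: "x \<in> AG ==> y \<in> caug G m x \<longleftrightarrow> y \<in> AG & y - x \<in> IG m"
 unfolding caug_def using vspace.mem_coset[OF vspace_gh subspace_aug_power, of x y m] by (auto simp: a_minus_gh)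

lemma caug_eq: "x \<in> AG ==> y \<in> AG ==> caug G m x = caug G m y \<longleftrightarrow> x - y \<in> IG m"
 unfolding caug_def using vspace.coset_eq[OF vspace_gh subspace_aug_power, of x y m] by (auto simp: a_minus_gh)

lemma caug_self: "x \<in> AG ==> x \<in> caug G m x"
 by (simp add: mem_caug aug_power_zero)

lemma caug_zero_iff: "x \<in> AG ==> caug G m x = IG m \<longleftrightarrow> x \<in> IG m"
 unfolding caug_def using vspace.coset_eq_self[OF vspace_gh subspace_aug_power, of x m] by simp

abbreviation CA where "CA \<equiv> cgroup_alg G"

abbreviation addC (infixl "\<oplus>\<^sub>C" 65) where "addC \<equiv> ring.add CA"
abbreviation smultC (infixl "\<odot>\<^sub>C" 70) where "smultC \<equiv> module.smult CA"
abbreviation multC (infixl "\<otimes>\<^sub>C" 70) where "multC \<equiv> monoid.mult CA"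

lemma CA_ops:
 "ring.add CA a b = (%m. set_add (group_hopf G) (a m) (b m))"
 "module.smult CA c a = (%m. coset_map (group_hopf G) (IG m) (pm_scale c) (a m))"
 "monoid.mult CA a b = (%m. rcoset_mult (group_hopf G) (IG m) (a m) (b m))"
 "ring.zero CA = (%m. IG m)"
 "monoid.one CA = (%m. caug G m (pm_unit \<one>))"
 by (simp_all add: cgroup_alg_def completion_def caug_def)

lemma caug_id_map:
 assumes "x \<in> AG" "k <= m"
 shows "coset_map (group_hopf G) (IG k) (%x. x) (caug G m x) = caug G k x"
proof (rule coset_map_eqI[OF caug_self[OF assms(1)]])
 fix y assume "y \<in> caug G m x"
 then have "y \<in> AG" "y - x \<in> IG k" using assms aug_power_mono by (auto simp: mem_caug)
 then show "IG k +>\<^bsub>group_hopf G\<^esub> y = caug G k x"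
  using caug_eq[of y x k] assms by (simp add: caug_def)
qed

text \<open>A coset of a smaller ideal lies in exactly one coset of a larger one, so compatibility
  of the components is plain inclusion.\<close>

lemma CA_iff:
 "a \<in> carrier CA \<longleftrightarrow> (ALL m. \<exists>x\<in>AG. a m = caug G m x) & (ALL m k. k <= m --> a m <= a k)"
proof -
 have "coset_map (group_hopf G) (IG k) (%x. x) (a m) = a k \<longleftrightarrow> a m <= a k"
  if ex: "!!m. \<exists>x\<in>AG. a m = caug G m x" and "k <= m" for k m
 proof -
  obtain x where x: "x \<in> AG" "a m = caug G m x" using ex[of m] ..
  obtain y where y: "y \<in> AG" "a k = caug G k y" using ex[of k] ..
  have "caug G k x = caug G k y \<longleftrightarrow> caug G m x <= caug G k y"
  proof
   assume "caug G k x = caug G k y"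
   then show "caug G m x <= caug G k y"
    using x y aug_power_mono[OF \<open>k <= m\<close>] mem_caug[of x _ k] mem_caug[of x _ m] by blast
  next
   assume "caug G m x <= caug G k y"
   then have "x - y \<in> IG k" using caug_self[OF x(1), of m] y mem_caug[of y x k] by auto
   then show "caug G k x = caug G k y" using x y by (simp add: caug_eq)
  qed
  then show ?thesis using x y \<open>k <= m\<close> by (simp add: caug_id_map)
 qed
 then show ?thesis
  by (simp add: cgroup_alg_def completion_def flip: caug_def) (metis (no_types, lifting))
qed

lemma CA_rep:
 assumes "a \<in> carrier CA"
 shows "EX x. x \<in> a m" and "x \<in> a m ==> x \<in> AG" and "x \<in> a m ==> a m = caug G m x"
  and "x \<in> a m ==> y \<in> a m ==> x - y \<in> IG m"
  and "x \<in> a m ==> y \<in> AG ==> y - x \<in> IG m ==> y \<in> a m"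
  and "k <= m ==> x \<in> a m ==> x \<in> a k"
proof -
 have "\<exists>x\<in>AG. a m = caug G m x" using assms[unfolded CA_iff] by simp
 then obtain z where z: "z \<in> AG" "a m = caug G m z" ..
 show "EX x. x \<in> a m" using z caug_self by auto
 show g: "x \<in> AG" if "x \<in> a m" for x using that z by (simp add: mem_caug)
 show e: "a m = caug G m x" if "x \<in> a m" for x
  using that z caug_eq[of x z m] by (auto simp: mem_caug)
 show "x - y \<in> IG m" if "x \<in> a m" "y \<in> a m"
  using e[OF that(2)] g[OF that(2)] that(1) by (simp add: mem_caug)
 show "y \<in> a m" if "x \<in> a m" "y \<in> AG" "y - x \<in> IG m"
  using e[OF that(1)] g[OF that(1)] that by (simp add: mem_caug)
 have "ALL m k. k <= m --> a m <= a k" using assms[unfolded CA_iff] by simp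
 then show "x \<in> a k" if "k <= m" "x \<in> a m" using that by (meson subsetD)
qed

lemma CA_eqI:
 assumes "a \<in> carrier CA" "b \<in> carrier CA" "!!m. EX x. x \<in> a m & x \<in> b m"
 shows "a = b"
 using CA_rep(3)[OF assms(1)] CA_rep(3)[OF assms(2)] assms(3) by (metis ext)

lemma CA_I:
 assumes "!!m. r m \<in> AG" "!!m. a m = caug G m (r m)" "!!m k. k <= m ==> r m - r k \<in> IG k"
 shows "a \<in> carrier CA"
proof -
 have "a m <= a k" if "k <= m" for m k
 proof
  fix y assume "y \<in> a m"
  then have "y \<in> AG" "y - r m \<in> IG k"
   using assms(1,2) aug_power_mono[OF that] by (auto simp: mem_caug)
  then have "y \<in> AG" "y - r k \<in> IG k" using cong_trans assms(3)[OF that] by auto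
  then show "y \<in> a k" using assms(1,2) by (simp add: mem_caug)
 qed
 then show ?thesis unfolding CA_iff using assms(1,2) by blast
qed

lemma caug_add:
 "x \<in> AG ==> y \<in> AG ==> set_add (group_hopf G) (caug G m x) (caug G m y) = caug G m (x + y)"
 unfolding caug_def using vspace.set_add_coset[OF vspace_gh subspace_aug_power, of x y m] by simp

lemma caug_scale:
 "x \<in> AG ==> coset_map (group_hopf G) (IG m) (pm_scale c) (caug G m x) = caug G m (pm_scale c x)"
 unfolding caug_def using vspace.smult_coset[OF vspace_gh subspace_aug_power, of x m c] by simp

lemma caug_mult:
 assumes x: "x \<in> AG" and y: "y \<in> AG"
 shows "rcoset_mult (group_hopf G) (IG m) (caug G m x) (caug G m y) = caug G m (gmul G x y)"
proof (rule rcoset_mult_eqI[OF caug_self[OF x] caug_self[OF y]])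
 fix a b assume "a \<in> caug G m x" "b \<in> caug G m y"
 then have a: "a \<in> AG" "a - x \<in> IG m" and b: "b \<in> AG" "b - y \<in> IG m"
  using x y by (auto simp: mem_caug)
 have "gmul G a b - gmul G x y \<in> IG m" by (rule cong_gmul) (use a b x in auto)
 then show "IG m +>\<^bsub>group_hopf G\<^esub> (a \<otimes>\<^bsub>group_hopf G\<^esub> b) = caug G m (gmul G x y)"
  using caug_eq[of "gmul G a b" "gmul G x y" m] a b x y by (simp add: caug_def gmul_closed)
qed

lemma CA_op_rep:
 assumes a: "a \<in> carrier CA" and b: "b \<in> carrier CA" and x: "x \<in> a m" and y: "y \<in> b m"
 shows "(a \<oplus>\<^sub>C b) m = caug G m (x + y)" "(c \<odot>\<^sub>C a) m = caug G m (pm_scale c x)"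
  "(a \<otimes>\<^sub>C b) m = caug G m (gmul G x y)"
 using CA_rep(2)[OF a x] CA_rep(2)[OF b y]
 by (simp_all add: CA_ops CA_rep(3)[OF a x] CA_rep(3)[OF b y] caug_add caug_scale caug_mult)

lemma CA_choose:
 assumes "a \<in> carrier CA"
 shows "EX r. ALL m. r m \<in> a m & r m \<in> AG & (ALL k<=m. r m - r k \<in> IG k)"
proof -
 obtain r where r: "!!m. r m \<in> a m" using CA_rep(1)[OF assms] by metis
 then show ?thesis using CA_rep(2,4,6)[OF assms] by (intro exI[of _ r]) blast
qed

lemma CA_closed:
 assumes a: "a \<in> carrier CA" and b: "b \<in> carrier CA"
 shows "a \<oplus>\<^sub>C b \<in> carrier CA" "c \<odot>\<^sub>C a \<in> carrier CA" "a \<otimes>\<^sub>C b \<in> carrier CA"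
proof -
 obtain r where "ALL m. r m \<in> a m & r m \<in> AG & (ALL k<=m. r m - r k \<in> IG k)"
  using CA_choose[OF a] ..
 then have r: "!!m. r m \<in> a m" "!!m. r m \<in> AG" "!!m k. k <= m ==> r m - r k \<in> IG k"
  by simp_all
 obtain s where "ALL m. s m \<in> b m & s m \<in> AG & (ALL k<=m. s m - s k \<in> IG k)"
  using CA_choose[OF b] ..
 then have s: "!!m. s m \<in> b m" "!!m. s m \<in> AG" "!!m k. k <= m ==> s m - s k \<in> IG k"
  by simp_all
 note op = CA_op_rep[OF a b r(1) s(1)]
 show "a \<oplus>\<^sub>C b \<in> carrier CA"
  by (rule CA_I[OF _ op(1)]) (use r s aug_power_add[of "r _ - r _" _ "s _ - s _"] in "auto simp: galg_simps algebra_simps")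
 show "c \<odot>\<^sub>C a \<in> carrier CA"
  by (rule CA_I[OF _ op(2)]) (use r aug_power_scale[of "r _ - r _" _ c] in "auto simp: galg_simps pm_scale_diff")
 show "a \<otimes>\<^sub>C b \<in> carrier CA"
  by (rule CA_I[OF _ op(3)]) (use r s in "auto intro: gmul_closed cong_gmul")
qed

lemma CA_mem_op:
 assumes a: "a \<in> carrier CA" and b: "b \<in> carrier CA" and x: "x \<in> a m" and y: "y \<in> b m"
 shows "x + y \<in> (a \<oplus>\<^sub>C b) m" "pm_scale c x \<in> (c \<odot>\<^sub>C a) m" "gmul G x y \<in> (a \<otimes>\<^sub>C b) m"
 using CA_op_rep[OF a b x y] CA_rep(2)[OF a x] CA_rep(2)[OF b y]
 by (simp_all add: caug_self galg_simps gmul_closed)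

definition toC where "toC x = (%m. caug G m x)"

lemma to_completion_eq: "to_completion (group_hopf G) (IG) = toC"
 by (auto simp: to_completion_def toC_def caug_def)

lemma toC_closed: "x \<in> AG ==> toC x \<in> carrier CA"
 by (rule CA_I[of "%_. x"]) (auto simp: toC_def aug_power_zero)

lemma toC_mem: "x \<in> AG ==> x \<in> toC x m"
 by (simp add: toC_def caug_self)

lemma CA_zero: "\<zero>\<^bsub>CA\<^esub> = toC 0"
 using caug_zero_iff[of 0] by (auto simp: toC_def CA_ops galg_simps aug_power_zero)

lemma CA_one: "\<one>\<^bsub>CA\<^esub> = toC (pm_unit \<one>)"
 by (simp add: toC_def CA_ops)

abbreviation QA where "QA m \<equiv> quot_mod (group_hopf G) (IG m)"

lemma vspace_QA: "vspace (QA m)"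
 by (rule vspace.vspace_quot[OF vspace_gh subspace_aug_power])

lemma CA_point:
 "a \<in> carrier CA ==> a m \<in> carrier (QA m)" "(a \<oplus>\<^sub>C b) m = a m \<oplus>\<^bsub>QA m\<^esub> b m"
 "(c \<odot>\<^sub>C a) m = c \<odot>\<^bsub>QA m\<^esub> a m" "\<zero>\<^bsub>CA\<^esub> m = \<zero>\<^bsub>QA m\<^esub>"
proof -
 assume "a \<in> carrier CA"
 then obtain x where "x \<in> AG" "a m = caug G m x" unfolding CA_iff by blast
 then show "a m \<in> carrier (QA m)" by (auto simp: caug_def)
qed (simp_all add: CA_ops)

lemma vspace_CA: "vspace CA"
proof (rule vspaceI, rule abelian_groupI)
 have am: "abelian_monoid (QA m)" for m
  using vspace_QA[of m] by (simp add: vspace_def module_def abelian_group_def)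
 note P = CA_point and V = vspace_QA
 show "\<zero>\<^bsub>CA\<^esub> \<in> carrier CA" by (simp add: CA_zero toC_closed galg_simps)
 fix a assume a: "a \<in> carrier CA"
 note pa = P(1)[OF a]
 show "\<zero>\<^bsub>CA\<^esub> \<oplus>\<^sub>C a = a" by (rule ext) (simp only: P(2-) abelian_monoid.l_zero[OF am pa])
 show "1 \<odot>\<^sub>C a = a" by (rule ext) (simp only: P(2-) vspace.smult_1[OF V pa])
 show sc: "c \<odot>\<^sub>C a \<in> carrier CA" for c by (rule CA_closed(2)[OF a a])
 show add: "(c + d) \<odot>\<^sub>C a = c \<odot>\<^sub>C a \<oplus>\<^sub>C d \<odot>\<^sub>C a" for c d
  by (rule ext) (simp only: P(2-) vspace.smult_add_left[OF V pa])
 show "(c * d) \<odot>\<^sub>C a = c \<odot>\<^sub>C (d \<odot>\<^sub>C a)" for c d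
  by (rule ext) (simp only: P(2-) vspace.smult_smult[OF V pa])
 have "(- 1 + 1) \<odot>\<^sub>C a = \<zero>\<^bsub>CA\<^esub>" "1 \<odot>\<^sub>C a = a"
  by (rule ext, simp only: P(2-) vspace.smult_0[OF V pa] vspace.smult_1[OF V pa] add.left_inverse)+
 then show "\<exists>b\<in>carrier CA. b \<oplus>\<^sub>C a = \<zero>\<^bsub>CA\<^esub>"
  unfolding add by (intro bexI[of _ "(- 1) \<odot>\<^sub>C a"] sc) (simp only:)
 fix b assume b: "b \<in> carrier CA"
 note pb = P(1)[OF b]
 show "a \<oplus>\<^sub>C b \<in> carrier CA" by (rule CA_closed(1)[OF a b])
 show "a \<oplus>\<^sub>C b = b \<oplus>\<^sub>C a" by (rule ext) (simp only: P(2-) abelian_monoid.a_comm[OF am pa pb])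
 show "c \<odot>\<^sub>C (a \<oplus>\<^sub>C b) = c \<odot>\<^sub>C a \<oplus>\<^sub>C c \<odot>\<^sub>C b" for c
  by (rule ext) (simp only: P(2-) vspace.smult_add_right[OF V pa pb])
 fix d assume d: "d \<in> carrier CA"
 show "a \<oplus>\<^sub>C b \<oplus>\<^sub>C d = a \<oplus>\<^sub>C (b \<oplus>\<^sub>C d)"
  by (rule ext) (simp only: P(2-) abelian_monoid.a_assoc[OF am pa pb P(1)[OF d]])
qed

lemma CA_mem_minus:
 assumes a: "a \<in> carrier CA" and b: "b \<in> carrier CA" and x: "x \<in> a m" and y: "y \<in> b m"
 shows "x - y \<in> (a \<ominus>\<^bsub>CA\<^esub> b) m"
proof -
 interpret C: vspace CA by (rule vspace_CA)
 have "a \<ominus>\<^bsub>CA\<^esub> b = a \<oplus>\<^sub>C (- 1) \<odot>\<^sub>C b" using b by (simp add: a_minus_def C.smult_m1)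
 then show ?thesis
  using CA_mem_op(1)[OF a CA_closed(2)[OF b b] x CA_mem_op(2)[OF b b y y, of "- 1"]]
  by (simp only: pm_scale_minus_one) simp
qed

lemma CA_minus_closed: "a \<in> carrier CA ==> b \<in> carrier CA ==> a \<ominus>\<^bsub>CA\<^esub> b \<in> carrier CA"
 using vspace_CA by (simp add: vspace_def module_def abelian_group.minus_closed)

abbreviation CF where "CF \<equiv> cgroup_fil G"

lemma CF_iff: "a \<in> CF n \<longleftrightarrow> a \<in> carrier CA & a n = IG n"
 by (simp add: cgroup_fil_def completion_fil_def cgroup_alg_def)

lemma CF_mem: "a \<in> CF n ==> n <= m ==> x \<in> a m ==> x \<in> IG n"
 using CA_rep(6)[of a n m x] by (auto simp: CF_iff)

lemma CF_I: "a \<in> carrier CA ==> n <= m ==> x \<in> a m ==> x \<in> IG n ==> a \<in> CF n"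
proof -
 assume a: "a \<in> carrier CA" "n <= m" "x \<in> a m" "x \<in> IG n"
 have "x \<in> a n" by (rule CA_rep(6)[OF a(1-3)])
 then show "a \<in> CF n"
  using CA_rep(3)[OF a(1), of x n] caug_zero_iff[of x n] a aug_power_galg by (simp add: CF_iff)
qed

lemma CF_0: "CF 0 = carrier CA"
proof (intro Set.set_eqI iffI)
 fix a assume a: "a \<in> carrier CA"
 obtain x where "x \<in> a 0" using CA_rep(1)[OF a] by blast
 then show "a \<in> CF 0" using CF_I[OF a, of 0 0 x] CA_rep(2)[OF a] by (auto simp: aug_power_0)
qed (simp add: CF_iff)

lemma toC_CF: "x \<in> IG n ==> toC x \<in> CF n"
 using CF_I[OF toC_closed order.refl toC_mem] aug_power_galg by blast

lemma subspace_CF: "subspace CA (CF n)"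
proof -
 have "(%a. a n) \<in> linear_maps CA (QA n)" by (rule linI) (simp_all only: CA_point)
 moreover have "CF n = {a \<in> carrier CA. a n = \<zero>\<^bsub>QA n\<^esub>}" unfolding quot_mod_simps by (auto simp only: CF_iff)
 ultimately show ?thesis using subspace_kernel[OF vspace_CA vspace_QA] by (simp only:)
qed

lemma CF_anti: "m <= n ==> CF n <= CF m"
proof
 fix a assume mn: "m <= n" and a: "a \<in> CF n"
 then have ac: "a \<in> carrier CA" by (simp add: CF_iff)
 obtain x where x: "x \<in> a n" using CA_rep(1)[OF ac] by blast
 show "a \<in> CF m" by (rule CF_I[OF ac mn x aug_power_mono[OF mn CF_mem[OF a order.refl x]]])
qed

lemma vspace_ga: "vspace (group_alg G)"
proof -
 interpret F: free_space "group_alg G" "carrier G" by (rule free_space_group_alg)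
 show ?thesis by (rule F.vspace_axioms)
qed

lemma carrier_ga: "carrier (group_alg G) = AG"
 by (simp add: group_alg_def galg_def)

lemma galg_linear_eqI:
 assumes W: "vspace W" and f: "f \<in> linear_maps (group_hopf G) W" and g: "g \<in> linear_maps (group_hopf G) W"
  and eq: "!!k. k \<in> carrier G ==> f (pm_unit k) = g (pm_unit k)" and p: "p \<in> AG"
 shows "f p = g p"
 using free_linear_eqI[OF free_space_group_hopf W f g eq] p by simp

lemma toC_linear: "toC \<in> linear_maps (group_alg G) CA"
 by (rule linI)
  (simp_all add: carrier_ga toC_closed, simp_all add: toC_def CA_ops caug_add caug_scale group_alg_def)

lemma toC_linear': "toC \<in> linear_maps (group_hopf G) CA"
 using toC_linear by (simp add: linear_maps_def group_alg_def galg_def)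

end

section \<open>Primitive elements of the completion, tested in C[G x G]\<close>

subsection \<open>Primitive elements\<close>

lemma subspace_tensor_fil:
 fixes V :: "(complex, 'a, 'm) module_scheme"
 assumes V: "vspace V" and F: "!!i. F i <= carrier V"
 shows "subspace (tensor_pow V 2) (tensor_fil V F m)"
proof -
 let ?K = "\<Union>i\<le>m. F i \<times> F (m - i)" and ?\<phi> = "%(u, v). pure_tensor V [u, v]"
 \<comment> \<open>Only the carrier of this record enters: it makes the free vector space on
   \<open>?K\<close> available as \<open>group_alg M\<close>, and the filtration step is the image
   of a linear map on it.\<close>
 define M :: "('a \<times> 'a) monoid" where "M = undefined\<lparr>carrier := ?K\<rparr>"
 let ?U = "group_alg M"
 have M: "carrier M = ?K" by (simp add: M_def)
 have fs: "free_space ?U ?K" using free_space_group_alg[of M] unfolding M .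
 have c: "?\<phi> k \<in> carrier (tensor_pow V 2)" if "k \<in> ?K" for k
  using that subsetD[OF F] by (auto intro!: pure_tensor_carrier)
 note T = vspace_tensor_pow[OF V, of 2]
 have "vspace ?U"
 proof -
  interpret free_space ?U ?K by (rule fs)
  show ?thesis by (rule vspace_axioms)
 qed
 from subspace_image[OF this T lin_ext_linear_maps[OF fs T]] c
 have "subspace (tensor_pow V 2) (lin_ext (tensor_pow V 2) ?\<phi> ` carrier ?U)" .
 moreover have "carrier ?U = {P. pkeys P <= ?K}" unfolding M[symmetric] by (simp add: group_alg_def)
 ultimately show ?thesis unfolding tensor_fil_def by (simp only: image_Collect)
qed

lemma pure_in_tensor_fil:
 assumes V: "vspace V" and F: "!!i. F i <= carrier V" and "i <= m" "u \<in> F i" "v \<in> F (m - i)"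
 shows "pure_tensor V [u, v] \<in> tensor_fil V F m"
proof -
 interpret T: vspace "tensor_pow V 2" by (rule vspace_tensor_pow[OF V])
 have "pure_tensor V [u, v] \<in> carrier (tensor_pow V 2)"
  using assms subsetD[OF F] by (auto intro!: pure_tensor_carrier)
 then have "lin_ext (tensor_pow V 2) (%(u, v). pure_tensor V [u, v]) (pm_unit (u, v)) = pure_tensor V [u, v]"
  by simp
 then show ?thesis unfolding tensor_fil_def using assms by (auto intro!: exI[of _ "pm_unit (u, v)"])
qed

context group_square
begin

text \<open>Primitivity of a representative modulo the \<open>m\<close>-th power, with C[G x G] as
  the tensor square.\<close>

definition prim :: "nat => ('a \<Rightarrow>\<^sub>0 complex) => bool" where
 "prim m x \<longleftrightarrow> diag x - left x - right x \<in> aug_power GG m"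

abbreviation CT where "CT \<equiv> tensor_pow CA 2"
abbreviation FT where "FT \<equiv> tensor_fil CA CF"

lemma vspace_CT: "vspace CT"
 by (rule vspace_tensor_pow[OF vspace_CA])

lemma subspace_FT: "subspace CT (FT m)"
 by (rule subspace_tensor_fil[OF vspace_CA]) (auto simp: CF_iff)

lemma pure_FT: "i <= m ==> u \<in> CF i ==> v \<in> CF (m - i) ==> pure_tensor CA [u, v] \<in> FT m"
 by (rule pure_in_tensor_fil[OF vspace_CA]) (auto simp: CF_iff)

lemma CT_pure_closed: "u \<in> carrier CA ==> v \<in> carrier CA ==> pure_tensor CA [u, v] \<in> carrier CT"
 by (rule pure_tensor_carrier) auto

text \<open>The canonical map from C[G x G] to the tensor square of the completion. It compares
  \<open>prim\<close> with the topological definition of primitive elements.\<close>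

definition mu where "mu = lin_ext CT (%(g, h). pure_tensor CA [toC (pm_unit g), toC (pm_unit h)])"

lemma mu_gen: "k \<in> carrier GG ==> (case k of (g, h) => pure_tensor CA [toC (pm_unit g), toC (pm_unit h)]) \<in> carrier CT"
 by (auto simp: GG_simps intro!: CT_pure_closed toC_closed galg_simps)

lemma mu_linear: "mu \<in> linear_maps (group_hopf GG) CT"
 unfolding mu_def by (rule lin_ext_linear_maps[OF free_space_group_hopf vspace_CT mu_gen])

lemma kron_linear:
 assumes "q \<in> AG"
 shows "(%p. kron p q) \<in> linear_maps (group_hopf G) (group_hopf GG)"
  and "(%p. kron q p) \<in> linear_maps (group_hopf G) (group_hopf GG)"
 by (rule linI;
   simp add: kron_closed assms kron_add_left kron_add_right kron_scale_left kron_scale_right)+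

lemma mu_unit: "g \<in> carrier G ==> h \<in> carrier G ==>
  mu (pm_unit (g, h)) = pure_tensor CA [toC (pm_unit g), toC (pm_unit h)]"
 unfolding mu_def using vspace.lin_ext_unit[OF vspace_CT, of "%(g, h). pure_tensor CA [toC (pm_unit g), toC (pm_unit h)]" "(g, h)"]
  mu_gen[of "(g, h)"] by (simp add: GG_simps)

lemma mu_kron:
 assumes x: "x \<in> AG" and y: "y \<in> AG"
 shows "mu (kron x y) = pure_tensor CA [toC x, toC y]"
proof (rule galg_linear_eqI[OF vspace_CT _ _ _ x])
 show "(%x. mu (kron x y)) \<in> linear_maps (group_hopf G) CT"
  by (rule lin_comp[OF kron_linear(1)[OF y] mu_linear])
 show "(%x. pure_tensor CA [toC x, toC y]) \<in> linear_maps (group_hopf G) CT"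
  by (rule lin_comp[OF toC_linear' pure2_linear(1)[OF vspace_CA toC_closed[OF y]]])
 fix g assume g: "g \<in> carrier G"
 then have gg: "pm_unit g \<in> AG" by (rule galg_simps)
 show "mu (kron (pm_unit g) y) = pure_tensor CA [toC (pm_unit g), toC y]"
 proof (rule galg_linear_eqI[OF vspace_CT _ _ _ y])
  show "(%y. mu (kron (pm_unit g) y)) \<in> linear_maps (group_hopf G) CT"
   by (rule lin_comp[OF kron_linear(2)[OF gg] mu_linear])
  show "(%y. pure_tensor CA [toC (pm_unit g), toC y]) \<in> linear_maps (group_hopf G) CT"
   by (rule lin_comp[OF toC_linear' pure2_linear(2)[OF vspace_CA toC_closed[OF gg]]])
 qed (simp add: g kron_unit mu_unit)
qed

lemma diag_linear: "diag \<in> linear_maps (group_hopf G) (group_hopf GG)"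
 by (rule linI) (simp_all add: diag_closed, simp_all add: diag_def)

lemma comult_group_linear: "comult (group_hopf G) \<in> linear_maps (group_hopf G) (tensor_pow (group_alg G) 2)"
 unfolding group_hopf_simps
 by (rule lin_ext_linear_maps[OF free_space_group_hopf vspace_tensor_pow[OF vspace_ga]])
  (auto intro!: pure_tensor_carrier simp: carrier_ga galg_simps)

lemma comult_group_unit:
 "g \<in> carrier G ==> comult (group_hopf G) (pm_unit g) = pure_tensor (group_alg G) [pm_unit g, pm_unit g]"
 unfolding group_hopf_simps
 by (rule vspace.lin_ext_unit[OF vspace_tensor_pow[OF vspace_ga]])
  (auto intro!: pure_tensor_carrier simp: carrier_ga galg_simps)

lemma toC_comult:
 assumes "x \<in> AG"
 shows "tensor_map CA 2 toC (comult (group_hopf G) x) = mu (diag x)"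
proof (rule galg_linear_eqI[OF vspace_CT _ _ _ assms])
 note tm = tensor_map_linear[OF vspace_ga vspace_CA toC_linear, of 2]
 show "(%x. tensor_map CA 2 toC (comult (group_hopf G) x)) \<in> linear_maps (group_hopf G) CT"
  by (rule lin_comp[OF comult_group_linear tm])
 show "(%x. mu (diag x)) \<in> linear_maps (group_hopf G) CT"
  by (rule lin_comp[OF diag_linear mu_linear])
 fix g assume g: "g \<in> carrier G"
 have "tensor_map CA 2 toC (pure_tensor (group_alg G) [pm_unit g, pm_unit g]) =
   pure_tensor CA (map toC [pm_unit g, pm_unit g])"
  by (rule tensor_map_pure[OF vspace_ga vspace_CA toC_linear]) (use g in "auto simp: carrier_ga galg_simps")
 then show "tensor_map CA 2 toC (comult (group_hopf G) (pm_unit g)) = mu (diag (pm_unit g))"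
  using g by (simp add: comult_group_unit mu_unit diag_def del: group_hopf_simps)
qed

lemma mu_aug_power: "x \<in> aug_power GG m ==> mu x \<in> FT m"
proof -
 assume x: "x \<in> aug_power GG m"
 have "aug_power GG m <= {x \<in> galg GG. mu x \<in> FT m}"
 proof (rule aug_power_GG_subset)
  show "subspace (group_hopf GG) {x \<in> galg GG. mu x \<in> FT m}"
   using linD[OF mu_linear] lin_zero[OF mu_linear GG.vspace_gh vspace_CT] subspaceD(2,3,4)[OF subspace_FT]
   by (auto simp: subspace_def galg_simps)
  fix i u v assume "i <= m" "u \<in> IG i" "v \<in> IG (m - i)"
  then show "kron u v \<in> {x \<in> galg GG. mu x \<in> FT m}"
   using aug_power_galg by (simp add: kron_closed mu_kron pure_FT toC_CF)
 qed
 with x show ?thesis by auto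
qed

definition rep where "rep m a = (SOME x. x \<in> a m)" for a :: "nat => ('a \<Rightarrow>\<^sub>0 complex) set"

abbreviation QG where "QG m \<equiv> quot_mod (group_hopf GG) (aug_power GG m)"

text \<open>A retraction for \<open>mu\<close> modulo the \<open>m\<close>-th power, computed on
  representatives modulo \<open>IG m\<close>. Its existence shows that no element outside the
  \<open>m\<close>-th power is sent into \<open>FT m\<close> by \<open>mu\<close>.\<close>

definition nu where
 "nu m = tensor_lift (QG m) (%xs. caug GG m (kron (rep m (xs ! 0)) (rep m (xs ! 1))))"

lemma vspace_QG: "vspace (QG m)"
 by (rule vspace.vspace_quot[OF GG.vspace_gh GG.subspace_aug_power])

lemma rep_mem: "a \<in> carrier CA ==> rep m a \<in> a m"
 unfolding rep_def by (rule someI_ex) (rule CA_rep(1))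

lemma caug_kron_rep:
 assumes a: "a \<in> carrier CA" and b: "b \<in> carrier CA" and x: "x \<in> a m" and y: "y \<in> b m"
 shows "caug GG m (kron (rep m a) (rep m b)) = caug GG m (kron x y)"
proof -
 note ra = rep_mem[OF a, of m] and rb = rep_mem[OF b, of m]
 note g = CA_rep(2)[OF a ra] CA_rep(2)[OF b rb] CA_rep(2)[OF a x] CA_rep(2)[OF b y]
 have "kron (rep m a - x) (rep m b) \<in> aug_power GG (m + 0)"
  by (rule kron_aug_power[OF CA_rep(4)[OF a ra x]]) (use g in "simp add: aug_power_0")
 moreover have "kron x (rep m b - y) \<in> aug_power GG (0 + m)"
  by (rule kron_aug_power[OF _ CA_rep(4)[OF b rb y]]) (use g in "simp add: aug_power_0")
 ultimately have "kron (rep m a - x) (rep m b) + kron x (rep m b - y) \<in> aug_power GG m"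
  by (simp add: GG.aug_power_add)
 then have "kron (rep m a) (rep m b) - kron x y \<in> aug_power GG m"
  by (simp add: kron_diff_left kron_diff_right)
 then show ?thesis using g by (simp add: GG.caug_eq kron_closed)
qed

lemma QG_ops:
 "x \<in> galg GG ==> caug GG m x \<in> carrier (QG m)"
 "x \<in> galg GG ==> y \<in> galg GG ==> caug GG m x \<oplus>\<^bsub>QG m\<^esub> caug GG m y = caug GG m (x + y)"
 "x \<in> galg GG ==> c \<odot>\<^bsub>QG m\<^esub> caug GG m x = caug GG m (pm_scale c x)"
 "\<zero>\<^bsub>QG m\<^esub> = aug_power GG m"
 unfolding quot_mod_simps caug_def group_hopf_simps
 using GG.caug_add[of x y m] GG.caug_scale[of x m c] unfolding caug_def by blast+

lemma multilin_nu:
 "multilin CA (QG m) 2 (%xs. caug GG m (kron (rep m (xs ! 0)) (rep m (xs ! 1))))"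
proof (rule multilin_2I[OF vspace_QG, where f = "%a b. caug GG m (kron (rep m a) (rep m b))"])
 fix a b assume a: "a \<in> carrier CA" and b: "b \<in> carrier CA"
 note ra = rep_mem[OF a, of m] and rb = rep_mem[OF b, of m]
 note ga = CA_rep(2)[OF a ra] CA_rep(2)[OF b rb]
 show "caug GG m (kron (rep m a) (rep m b)) \<in> carrier (QG m)" by (intro QG_ops kron_closed ga)
 fix c
 show "caug GG m (kron (rep m (c \<odot>\<^sub>C a)) (rep m b)) = c \<odot>\<^bsub>QG m\<^esub> caug GG m (kron (rep m a) (rep m b))"
  using caug_kron_rep[OF CA_closed(2)[OF a a] b CA_mem_op(2)[OF a a ra ra, of c] rb] ga
  by (simp only: kron_scale_left QG_ops(3) kron_closed)
 show "caug GG m (kron (rep m a) (rep m (c \<odot>\<^sub>C b))) = c \<odot>\<^bsub>QG m\<^esub> caug GG m (kron (rep m a) (rep m b))"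
  using caug_kron_rep[OF a CA_closed(2)[OF b b] ra CA_mem_op(2)[OF b b rb rb, of c]] ga
  by (simp only: kron_scale_right QG_ops(3) kron_closed)
 fix d assume d: "d \<in> carrier CA"
 note rd = rep_mem[OF d, of m]
 note gd = CA_rep(2)[OF d rd]
 show "caug GG m (kron (rep m a) (rep m (b \<oplus>\<^sub>C d))) =
   caug GG m (kron (rep m a) (rep m b)) \<oplus>\<^bsub>QG m\<^esub> caug GG m (kron (rep m a) (rep m d))"
  using caug_kron_rep[OF a CA_closed(1)[OF b d] ra CA_mem_op(1)[OF b d rb rd]] ga gd
  by (simp only: kron_add_right QG_ops(2) kron_closed)
next
 fix a d b assume a: "a \<in> carrier CA" and d: "d \<in> carrier CA" and b: "b \<in> carrier CA"
 note ra = rep_mem[OF a, of m] and rb = rep_mem[OF b, of m] and rd = rep_mem[OF d, of m]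
 note ga = CA_rep(2)[OF a ra] CA_rep(2)[OF b rb] CA_rep(2)[OF d rd]
 show "caug GG m (kron (rep m (a \<oplus>\<^sub>C d)) (rep m b)) =
   caug GG m (kron (rep m a) (rep m b)) \<oplus>\<^bsub>QG m\<^esub> caug GG m (kron (rep m d) (rep m b))"
  using caug_kron_rep[OF CA_closed(1)[OF a d] b CA_mem_op(1)[OF a d ra rd] rb] ga
  by (simp only: kron_add_left QG_ops(2) kron_closed)
qed

lemma nu_linear: "nu m \<in> linear_maps CT (QG m)"
 unfolding nu_def by (rule tensor_lift_linear[OF vspace_CA vspace_QG multilin_nu])

lemma nu_pure:
 assumes a: "a \<in> carrier CA" and b: "b \<in> carrier CA" and "x \<in> a m" "y \<in> b m"
 shows "nu m (pure_tensor CA [a, b]) = caug GG m (kron x y)"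
 unfolding nu_def
 using tensor_lift_pure[OF vspace_CA vspace_QG multilin_nu, of "[a, b]" m] caug_kron_rep[OF assms] a b by simp

lemma nu_mu:
 assumes "x \<in> galg GG"
 shows "nu m (mu x) = caug GG m x"
proof (rule GG.galg_linear_eqI[OF vspace_QG _ _ _ assms])
 show "(%x. nu m (mu x)) \<in> linear_maps (group_hopf GG) (QG m)"
  by (rule lin_comp[OF mu_linear nu_linear])
 show "caug GG m \<in> linear_maps (group_hopf GG) (QG m)"
  using vspace.coset_linear[OF GG.vspace_gh GG.subspace_aug_power, of m] by (simp add: caug_def[abs_def])
 fix k assume "k \<in> carrier GG"
 then obtain g h where k: "k = (g, h)" "g \<in> carrier G" "h \<in> carrier G" by (auto simp: GG_simps)
 then have u: "pm_unit g \<in> AG" "pm_unit h \<in> AG" by (auto intro: galg_simps)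
 show "nu m (mu (pm_unit k)) = caug GG m (pm_unit k)"
  using nu_pure[OF toC_closed[OF u(1)] toC_closed[OF u(2)] toC_mem[OF u(1)] toC_mem[OF u(2)]] k
  by (simp add: mu_unit kron_unit)
qed

text \<open>Elements of \<open>CF i\<close> and \<open>CF (m - i)\<close> have representatives
  modulo \<open>IG m\<close> that lie in \<open>IG i\<close> and \<open>IG (m - i)\<close>, and the
  degrees add up to \<open>m\<close>.\<close>

lemma nu_FT:
 assumes "t \<in> FT m"
 shows "nu m t = aug_power GG m"
proof -
 interpret Q: vspace "QG m" by (rule vspace_QG)
 let ?\<phi> = "%(u, v). pure_tensor CA [u, v]"
 obtain P where P: "pkeys P <= (\<Union>i\<le>m. CF i \<times> CF (m - i))" "t = lin_ext CT ?\<phi> P"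
  using assms by (auto simp: tensor_fil_def)
 have cl: "?\<phi> k \<in> carrier CT" if "k \<in> pkeys P" for k
  using that P by (auto intro!: CT_pure_closed simp: CF_iff)
 have z: "nu m (?\<phi> k) = aug_power GG m" if k: "k \<in> pkeys P" for k
 proof -
  obtain i u v where i: "k = (u, v)" "i <= m" "u \<in> CF i" "v \<in> CF (m - i)" using k P(1) by blast
  then have c: "u \<in> carrier CA" "v \<in> carrier CA" by (auto simp: CF_iff)
  obtain x y where xy: "x \<in> u m" "y \<in> v m" using CA_rep(1) c by metis
  have "kron x y \<in> aug_power GG (i + (m - i))"
   by (rule kron_aug_power[OF CF_mem[OF i(3) i(2) xy(1)] CF_mem[OF i(4) _ xy(2)]]) simp
  then show ?thesis
   using nu_pure[OF c xy] i CA_rep(2)[OF c(1) xy(1)] CA_rep(2)[OF c(2) xy(2)]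
   by (simp add: GG.caug_zero_iff kron_closed)
 qed
 have "nu m t = lin_ext (QG m) (%k. nu m (?\<phi> k)) P"
  unfolding P(2) by (rule lin_lin_ext[OF nu_linear vspace_CT vspace_QG cl])
 also have "... = lin_ext (QG m) (%k. \<zero>\<^bsub>QG m\<^esub>) P"
  by (rule Q.lin_ext_cong) (use z Q.M.zero_closed in "simp_all only: QG_ops(4)")
 also have "... = \<zero>\<^bsub>QG m\<^esub>"
  unfolding lin_ext_def Q.smult_zero_right by (rule Q.M.finsum_zero)
 finally show ?thesis by (simp only: QG_ops(4))
qed

lemma mu_FT_iff: "x \<in> galg GG ==> mu x \<in> FT m \<longleftrightarrow> x \<in> aug_power GG m"
 using nu_FT[of "mu x" m] nu_mu[of x m] GG.caug_zero_iff[of x m] mu_aug_power[of x m] by auto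

lemma kron_one: "x \<in> AG ==> kron x (pm_unit \<one>) = left x" "x \<in> AG ==> kron (pm_unit \<one>) x = right x"
 by (rule pm_pair_eqI, simp add: pm_pair_kron one_galg, simp add: left_def right_def)+

text \<open>Since \<open>a\<close> and \<open>toC x\<close> differ by an element of
  \<open>CF m\<close>, both sides can be computed modulo \<open>FT m\<close> from
  \<open>toC x\<close>. They then lie in the image of \<open>mu\<close>, where
  \<open>mu_FT_iff\<close> decides membership.\<close>

lemma prim_iff:
 assumes a: "a \<in> carrier CA" and x: "x \<in> a m"
 shows "cgroup_comult G a m = (pure_ctensor CA CF a \<one>\<^bsub>CA\<^esub> \<oplus>\<^bsub>ctensor CA CF\<^esub> pure_ctensor CA CF \<one>\<^bsub>CA\<^esub> a) m
  \<longleftrightarrow> prim m x"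
proof -
 interpret T: vspace CT by (rule vspace_CT)
 have xg: "x \<in> AG" by (rule CA_rep(2)[OF a x])
 have og: "\<one>\<^bsub>CA\<^esub> \<in> carrier CA" by (simp add: CA_one toC_closed one_galg)
 have mc: "mu y \<in> carrier CT" if "y \<in> galg GG" for y using linD(1)[OF mu_linear] that by simp
 let ?p = "pure_tensor CA [a, \<one>\<^bsub>CA\<^esub>]" and ?q = "pure_tensor CA [\<one>\<^bsub>CA\<^esub>, a]"
 have pq: "?p \<in> carrier CT" "?q \<in> carrier CT" using a og by (auto intro: CT_pure_closed)
 have "cgroup_comult G a m = coset_map CT (FT m) (%x. tensor_map CA 2 toC (comult (group_hopf G) x)) (a m)"
  by (simp only: cgroup_comult_def to_completion_eq)
 also have "... = FT m +>\<^bsub>CT\<^esub> mu (diag x)"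
 proof (rule coset_map_eqI[OF x])
  fix y assume y: "y \<in> a m"
  then have yg: "y \<in> AG" by (rule CA_rep(2)[OF a])
  have "diag (y - x) \<in> aug_power GG m"
   unfolding diag_def by (rule dg.map_aug_power[OF CA_rep(4)[OF a y x]])
  then have "mu (diag y) \<ominus>\<^bsub>CT\<^esub> mu (diag x) \<in> FT m"
   using mu_aug_power[of "diag (y - x)"] lin_minus[OF lin_comp[OF diag_linear mu_linear] vspace_gh vspace_CT, of y x]
    xg yg by (simp add: a_minus_gh)
  then have "FT m +>\<^bsub>CT\<^esub> mu (diag y) = FT m +>\<^bsub>CT\<^esub> mu (diag x)"
   using T.coset_eq[OF subspace_FT mc mc] xg yg by (simp add: diag_closed)
  then show "FT m +>\<^bsub>CT\<^esub> tensor_map CA 2 toC (comult (group_hopf G) y) = FT m +>\<^bsub>CT\<^esub> mu (diag x)"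
   by (simp only: toC_comult[OF yg])
 qed
 finally have L: "cgroup_comult G a m = FT m +>\<^bsub>CT\<^esub> mu (diag x)" .
 have "(pure_ctensor CA CF a \<one>\<^bsub>CA\<^esub> \<oplus>\<^bsub>ctensor CA CF\<^esub> pure_ctensor CA CF \<one>\<^bsub>CA\<^esub> a) m = FT m +>\<^bsub>CT\<^esub> (?p \<oplus>\<^bsub>CT\<^esub> ?q)"
  unfolding ctensor_def completion_def pure_ctensor_def to_completion_def
  using T.set_add_coset[OF subspace_FT pq] by simp
 moreover have d: "mu (left x) \<in> carrier CT" "mu (right x) \<in> carrier CT" "mu (diag x) \<in> carrier CT"
  using xg by (auto intro!: mc left_closed right_closed diag_closed)
 moreover have near: "?p \<ominus>\<^bsub>CT\<^esub> mu (left x) \<in> FT m" "?q \<ominus>\<^bsub>CT\<^esub> mu (right x) \<in> FT m"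
 proof -
  have ax: "a \<ominus>\<^bsub>CA\<^esub> toC x \<in> CF m"
   by (rule CF_I[OF CA_minus_closed[OF a toC_closed[OF xg]] order.refl
     CA_mem_minus[OF a toC_closed[OF xg] x toC_mem[OF xg]]]) (simp add: aug_power_zero)
  have one0: "\<one>\<^bsub>CA\<^esub> \<in> CF 0" using og by (simp add: CF_0)
  have "mu (left x) = pure_tensor CA [toC x, \<one>\<^bsub>CA\<^esub>]" "mu (right x) = pure_tensor CA [\<one>\<^bsub>CA\<^esub>, toC x]"
   using mu_kron[OF xg one_galg] mu_kron[OF one_galg xg] by (simp_all only: kron_one[OF xg] CA_one)
  then show "?p \<ominus>\<^bsub>CT\<^esub> mu (left x) \<in> FT m" "?q \<ominus>\<^bsub>CT\<^esub> mu (right x) \<in> FT m"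
   using lin_minus[OF pure2_linear(1)[OF vspace_CA og] vspace_CA vspace_CT a toC_closed[OF xg]]
    lin_minus[OF pure2_linear(2)[OF vspace_CA og] vspace_CA vspace_CT a toC_closed[OF xg]]
    pure_FT[OF order.refl ax, of "\<one>\<^bsub>CA\<^esub>"] pure_FT[OF le0 one0, of "a \<ominus>\<^bsub>CA\<^esub> toC x" m] ax one0 by simp_all
 qed
 moreover have "FT m +>\<^bsub>CT\<^esub> (?p \<oplus>\<^bsub>CT\<^esub> ?q) = FT m +>\<^bsub>CT\<^esub> (mu (left x) \<oplus>\<^bsub>CT\<^esub> mu (right x))"
  using T.coset_eq[OF subspace_FT, of "?p \<oplus>\<^bsub>CT\<^esub> ?q" "mu (left x) \<oplus>\<^bsub>CT\<^esub> mu (right x)" m]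
   T.minus_add_distrib[OF pq d(1,2)] subspaceD(3)[OF subspace_FT near] pq d by simp
 moreover have "mu (diag x) \<ominus>\<^bsub>CT\<^esub> (mu (left x) \<oplus>\<^bsub>CT\<^esub> mu (right x)) = mu (diag x - left x - right x)"
 proof -
  have lr: "left x + right x \<in> galg GG" using xg by (intro galg_simps left_closed right_closed)
  have "mu (left x + right x) = mu (left x) \<oplus>\<^bsub>CT\<^esub> mu (right x)"
   using linD(2)[OF mu_linear, of "left x" "right x"] xg by (simp add: left_closed right_closed)
  then show ?thesis
   using lin_minus[OF mu_linear GG.vspace_gh vspace_CT, of "diag x" "left x + right x"] lr xg
   by (simp add: GG.a_minus_gh diag_closed diff_diff_eq)
 qed
 ultimately show ?thesis
  unfolding L
  using T.coset_eq[OF subspace_FT d(3), of "mu (left x) \<oplus>\<^bsub>CT\<^esub> mu (right x)" m]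
   mu_FT_iff[of "diag x - left x - right x" m] xg
  by (simp add: prim_def galg_simps diag_closed left_closed right_closed)
qed

abbreviation LG where "LG \<equiv> lie_group_alg G"

lemma LG_carrier_iff: "a \<in> carrier LG \<longleftrightarrow> a \<in> carrier CA & (ALL m. \<forall>x\<in>a m. prim m x)"
proof (cases "a \<in> carrier CA")
 case True
 have "cgroup_comult G a = pure_ctensor CA CF a \<one>\<^bsub>CA\<^esub> \<oplus>\<^bsub>ctensor CA CF\<^esub> pure_ctensor CA CF \<one>\<^bsub>CA\<^esub> a \<longleftrightarrow>
   (ALL m. \<forall>x\<in>a m. prim m x)"
  unfolding fun_eq_iff using prim_iff[OF True] CA_rep(1)[OF True] by blast
 then show ?thesis using True by (simp add: lie_group_alg_def Let_def)
qed (simp add: lie_group_alg_def Let_def)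

end

section \<open>The Malcev Lie algebra of the group and its dilation\<close>

section \<open>The Malcev Lie algebra of a group\<close>

lemma vspace_cong_fields:
 assumes "vspace V" "carrier W = carrier V" "ring.add W = ring.add V" "ring.zero W = ring.zero V"
  "module.smult W = module.smult V"
 shows "vspace W"
 by (rule vspace_transport[of V "%x. x"]) (simp_all add: assms linear_maps_def bij_betw_def)

context group_square
begin

lemma LG_ops:
 "ring.add LG = ring.add CA" "module.smult LG = module.smult CA" "ring.zero LG = ring.zero CA"
 "monoid.mult LG a b = a \<otimes>\<^sub>C b \<ominus>\<^bsub>CA\<^esub> b \<otimes>\<^sub>C a" "lfil LG n = carrier LG \<inter> CF n"
 by (simp_all add: lie_group_alg_def Let_def)

lemma LG_CA: "a \<in> carrier LG ==> a \<in> carrier CA"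
 by (simp add: LG_carrier_iff)

lemma prim_cong:
 assumes "prim m x" "y - x \<in> IG m" "x \<in> AG" "y \<in> AG"
 shows "prim m y"
proof -
 let ?d = "y - x"
 have "diag ?d \<in> aug_power GG m" "left ?d \<in> aug_power GG m" "right ?d \<in> aug_power GG m"
  unfolding diag_def left_def right_def
  using assms(2) by (rule dg.map_aug_power inl.map_aug_power inr.map_aug_power)+
 then have "diag ?d - left ?d - right ?d \<in> aug_power GG m" by (intro GG.aug_power_diff)
 moreover have "diag ?d - left ?d - right ?d = (diag y - left y - right y) - (diag x - left x - right x)"
  by (simp add: diag_def left_def right_def)
 ultimately show ?thesis
  using GG.aug_power_add[of "(diag y - left y - right y) - (diag x - left x - right x)" m "diag x - left x - right x"] assms(1)
  by (simp add: prim_def)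
qed

lemma LG_I:
 assumes "a \<in> carrier CA" "!!m. \<exists>x\<in>a m. prim m x"
 shows "a \<in> carrier LG"
 unfolding LG_carrier_iff
proof (intro conjI allI ballI assms(1))
 fix m y assume y: "y \<in> a m"
 obtain x where x: "x \<in> a m" "prim m x" using assms(2) by blast
 show "prim m y"
  by (rule prim_cong[OF x(2) CA_rep(4)[OF assms(1) y x(1)] CA_rep(2)[OF assms(1) x(1)] CA_rep(2)[OF assms(1) y]])
qed

lemma LG_choose: "a \<in> carrier LG ==> EX x. x \<in> a m & x \<in> AG & prim m x"
 using CA_rep(1,2)[OF LG_CA] LG_carrier_iff by blast

lemma prim_add: "prim m x ==> prim m y ==> prim m (x + y)"
proof -
 assume "prim m x" "prim m y"
 then have "(diag x - left x - right x) + (diag y - left y - right y) \<in> aug_power GG m"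
  unfolding prim_def by (rule GG.aug_power_add)
 then show ?thesis by (simp add: prim_def diag_def left_def right_def algebra_simps)
qed

lemma prim_scale: "prim m x ==> prim m (pm_scale c x)"
proof -
 assume "prim m x"
 then have "pm_scale c (diag x - left x - right x) \<in> aug_power GG m"
  unfolding prim_def by (rule GG.aug_power_scale)
 then show ?thesis by (simp add: prim_def diag_def left_def right_def pm_scale_diff)
qed

lemma prim_zero: "prim m 0"
 by (simp add: prim_def diag_def left_def right_def GG.aug_power_zero)

text \<open>The two embeddings into C[G x G] commute, so the cross terms of the bracket of
  \<open>left x + right x\<close> with \<open>left y + right y\<close> cancel.\<close>

lemma prim_bracket:
 assumes x: "prim m x" "x \<in> AG" and y: "prim m y" "y \<in> AG"
 shows "prim m (gmul G x y - gmul G y x)"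
proof -
 have lr: "left x + right x \<in> galg GG" "left y + right y \<in> galg GG"
  using x y by (auto intro!: galg_simps left_closed right_closed)
 have dx: "diag x - (left x + right x) \<in> aug_power GG m" and dy: "diag y - (left y + right y) \<in> aug_power GG m"
  using x y by (simp_all add: prim_def diff_diff_eq)
 have 1: "gmul GG (diag x) (diag y) - gmul GG (left x + right x) (left y + right y) \<in> aug_power GG m"
  by (rule GG.cong_gmul[OF dx dy lr(1) diag_closed[OF y(2)]])
 have 2: "gmul GG (diag y) (diag x) - gmul GG (left y + right y) (left x + right x) \<in> aug_power GG m"
  by (rule GG.cong_gmul[OF dy dx lr(2) diag_closed[OF x(2)]])
 have "diag (gmul G x y - gmul G y x) - left (gmul G x y - gmul G y x) - right (gmul G x y - gmul G y x) =
  (gmul GG (diag x) (diag y) - gmul GG (left x + right x) (left y + right y)) -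
  (gmul GG (diag y) (diag x) - gmul GG (left y + right y) (left x + right x))"
  using x y left_right_commute[OF x(2) y(2)] left_right_commute[OF y(2) x(2)]
  unfolding diag_def left_def right_def
  by (simp add: dg.map_mult inl.map_mult inr.map_mult pm_conv_add_left pm_conv_add_right algebra_simps)
 then show ?thesis unfolding prim_def using GG.aug_power_diff[OF 1 2] by simp
qed

lemma LG_mem_bracket:
 assumes "a \<in> carrier CA" "b \<in> carrier CA" "x \<in> a m" "y \<in> b m"
 shows "gmul G x y - gmul G y x \<in> (a \<otimes>\<^bsub>LG\<^esub> b) m"
 unfolding LG_ops
 by (rule CA_mem_minus[OF CA_closed(3)[OF assms(1,2)] CA_closed(3)[OF assms(2,1)]
    CA_mem_op(3)[OF assms] CA_mem_op(3)[OF assms(2,1,4,3)]])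

lemma CA_bracket_closed: "a \<in> carrier CA ==> b \<in> carrier CA ==> a \<otimes>\<^bsub>LG\<^esub> b \<in> carrier CA"
 unfolding LG_ops by (intro CA_minus_closed CA_closed)

lemma LG_closed:
 assumes a: "a \<in> carrier LG" and b: "b \<in> carrier LG"
 shows "a \<oplus>\<^sub>C b \<in> carrier LG" "c \<odot>\<^sub>C a \<in> carrier LG" "a \<otimes>\<^bsub>LG\<^esub> b \<in> carrier LG"
proof -
 note ac = LG_CA[OF a] LG_CA[OF b]
 have ex: "EX x y. x \<in> a m & x \<in> AG & prim m x & y \<in> b m & y \<in> AG & prim m y" for m
  using LG_choose[OF a, of m] LG_choose[OF b, of m] by blast
 show "a \<oplus>\<^sub>C b \<in> carrier LG"
  by (rule LG_I[OF CA_closed(1)[OF ac]]) (use ex CA_mem_op(1)[OF ac] prim_add in meson)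
 show "c \<odot>\<^sub>C a \<in> carrier LG"
  by (rule LG_I[OF CA_closed(2)[OF ac]]) (use ex CA_mem_op(2)[OF ac] prim_scale in meson)
 show "a \<otimes>\<^bsub>LG\<^esub> b \<in> carrier LG"
  by (rule LG_I[OF CA_bracket_closed[OF ac]]) (use ex LG_mem_bracket[OF ac] prim_bracket in meson)
qed

lemma LG_zero: "\<zero>\<^bsub>CA\<^esub> \<in> carrier LG"
 unfolding CA_zero
 by (rule LG_I[OF toC_closed]) (use toC_mem[OF galg_simps(1)] prim_zero galg_simps(1) in auto)

lemma subspace_LG: "subspace CA (carrier LG)"
 using LG_CA LG_zero LG_closed by (auto simp: subspace_def)

lemma vspace_LG: "vspace LG"
 by (rule vspace_cong_fields[OF vspace.vspace_subspace[OF vspace_CA subspace_LG]]) (simp_all add: LG_ops)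

lemma a_minus_LG: "b \<in> carrier LG ==> a \<ominus>\<^bsub>LG\<^esub> b = a \<ominus>\<^bsub>CA\<^esub> b"
proof -
 assume b: "b \<in> carrier LG"
 interpret C: vspace CA by (rule vspace_CA)
 interpret L: vspace LG by (rule vspace_LG)
 show ?thesis
  using L.smult_m1[OF b] C.smult_m1[OF LG_CA[OF b]] by (simp add: a_minus_def LG_ops)
qed

lemma subspace_lfil: "subspace LG (lfil LG n)"
 using subspaceD[OF subspace_CF] LG_zero LG_closed by (auto simp: subspace_def LG_ops)

lemma lfil_anti: "m <= n ==> lfil LG n <= lfil LG m"
 using CF_anti by (auto simp: LG_ops)

lemma lfil_bracket:
 assumes a: "a \<in> lfil LG m" and b: "b \<in> lfil LG n"
 shows "a \<otimes>\<^bsub>LG\<^esub> b \<in> lfil LG (m + n)"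
proof -
 have c: "a \<in> carrier LG" "b \<in> carrier LG" "a \<in> CF m" "b \<in> CF n" using a b by (auto simp: LG_ops)
 note ac = LG_CA[OF c(1)] LG_CA[OF c(2)]
 obtain x y where xy: "x \<in> a (m + n)" "y \<in> b (m + n)" using CA_rep(1) ac by metis
 have "x \<in> IG m" "y \<in> IG n" using CF_mem[OF c(3) _ xy(1)] CF_mem[OF c(4) _ xy(2)] by simp_all
 then have "gmul G x y - gmul G y x \<in> IG (m + n)"
  using aug_power_mult[of x m y n] aug_power_mult[of y n x m] by (simp add: aug_power_diff add.commute)
 then have "a \<otimes>\<^bsub>LG\<^esub> b \<in> CF (m + n)"
  using CF_I[OF CA_bracket_closed[OF ac] order.refl LG_mem_bracket[OF ac xy]] by simp
 then show ?thesis using LG_closed(3)[OF c(1,2)] by (simp add: LG_ops(5))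
qed

abbreviation lgr where "lgr \<equiv> lgr_comp LG"

lemma vspace_lgr: "vspace (lgr n)"
proof -
 interpret L: vspace LG by (rule vspace_LG)
 show ?thesis unfolding lgr_comp_def
  by (rule vspace.vspace_quot[OF L.vspace_subspace[OF subspace_lfil]
     subspace_carrier_update[OF subspace_lfil lfil_anti]]) simp
qed

definition lcos where "lcos n a = lfil LG (Suc n) +>\<^bsub>LG\<^esub> a"

lemma carrier_lgr: "carrier (lgr n) = lcos n ` lfil LG n"
 by (auto simp: lgr_comp_def lcos_def)

lemma lcos_linear: "lcos n \<in> linear_maps (LG\<lparr>carrier := lfil LG n\<rparr>) (lgr n)"
proof -
 interpret L: vspace LG by (rule vspace_LG)
 have "(%x. lfil LG (Suc n) +>\<^bsub>LG\<lparr>carrier := lfil LG n\<rparr>\<^esub> x) \<in> linear_maps (LG\<lparr>carrier := lfil LG n\<rparr>) (lgr n)"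
  unfolding lgr_comp_def
  by (rule vspace.coset_linear[OF L.vspace_subspace[OF subspace_lfil]
     subspace_carrier_update[OF subspace_lfil lfil_anti]]) simp
 then show ?thesis by (simp add: lcos_def[abs_def])
qed

lemma lcos_scale: "a \<in> lfil LG n ==> c \<odot>\<^bsub>lgr n\<^esub> lcos n a = lcos n (c \<odot>\<^sub>C a)"
 using linD(3)[OF lcos_linear, of a n c] by (simp add: LG_ops)

lemma lcos_bracket:
 assumes x: "x \<in> lfil LG i" and y: "y \<in> lfil LG j"
 shows "rcoset_mult LG (lfil LG (Suc (i + j))) (lcos i x) (lcos j y) = lcos (i + j) (x \<otimes>\<^bsub>LG\<^esub> y)"
proof -
 interpret L: vspace LG by (rule vspace_LG)
 have xl: "x \<in> carrier LG" "x \<in> CF i" and yl: "y \<in> carrier LG" "y \<in> CF j" using x y by (auto simp: LG_ops)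
 show ?thesis
 proof (rule rcoset_mult_eqI)
  show "x \<in> lcos i x" "y \<in> lcos j y"
   unfolding lcos_def using L.coset_self[OF subspace_lfil] xl yl by auto
  fix a b assume "a \<in> lcos i x" "b \<in> lcos j y"
  then have a: "a \<in> carrier LG" "a \<ominus>\<^bsub>LG\<^esub> x \<in> lfil LG (Suc i)" and b: "b \<in> carrier LG" "b \<ominus>\<^bsub>LG\<^esub> y \<in> lfil LG (Suc j)"
   unfolding lcos_def using L.mem_coset[OF subspace_lfil xl(1)] L.mem_coset[OF subspace_lfil yl(1)] by auto
  let ?N = "Suc (i + j)"
  note c = LG_CA[OF a(1)] LG_CA[OF xl(1)] LG_CA[OF b(1)] LG_CA[OF yl(1)]
  obtain p q where pq: "p \<in> a ?N" "q \<in> x ?N" using CA_rep(1) c by metis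
  obtain r s where rs: "r \<in> b ?N" "s \<in> y ?N" using CA_rep(1) c by metis
  have d: "p - q \<in> IG (Suc i)" "r - s \<in> IG (Suc j)"
   using CF_mem[of _ "Suc i" ?N] CF_mem[of _ "Suc j" ?N] a b
    CA_mem_minus[OF c(1,2) pq] CA_mem_minus[OF c(3,4) rs] by (auto simp: LG_ops(5) a_minus_LG xl yl)
  have q: "q \<in> IG i" and s: "s \<in> IG j" using CF_mem[OF xl(2) _ pq(2)] CF_mem[OF yl(2) _ rs(2)] by simp_all
  have r: "r \<in> IG j"
   using aug_power_add[OF aug_power_mono[of j "Suc j", OF _ d(2)] s] by simp
  \<comment> \<open>Bilinearity: [p, r] - [q, s] = [p - q, r] + [q, r - s], where each bracket has
    one factor that lies one step deeper.\<close>
  have "gmul G (p - q) r + gmul G q (r - s) - gmul G r (p - q) - gmul G (r - s) q \<in> IG ?N"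
   using aug_power_mult[OF d(1) r] aug_power_mult[OF q d(2)] aug_power_mult[OF r d(1)] aug_power_mult[OF d(2) q]
   by (intro aug_power_diff aug_power_add) (simp_all add: add.commute)
  then have "(gmul G p r - gmul G r p) - (gmul G q s - gmul G s q) \<in> IG ?N"
   by (simp add: pm_conv_diff_left pm_conv_diff_right algebra_simps)
  moreover have "(gmul G p r - gmul G r p) - (gmul G q s - gmul G s q) \<in> (a \<otimes>\<^bsub>LG\<^esub> b \<ominus>\<^bsub>CA\<^esub> x \<otimes>\<^bsub>LG\<^esub> y) ?N"
   by (rule CA_mem_minus[OF CA_bracket_closed[OF c(1,3)] CA_bracket_closed[OF c(2,4)]
      LG_mem_bracket[OF c(1,3) pq(1) rs(1)] LG_mem_bracket[OF c(2,4) pq(2) rs(2)]])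
  ultimately have "a \<otimes>\<^bsub>LG\<^esub> b \<ominus>\<^bsub>CA\<^esub> x \<otimes>\<^bsub>LG\<^esub> y \<in> CF ?N"
   using CF_I[OF CA_minus_closed[OF CA_bracket_closed[OF c(1,3)] CA_bracket_closed[OF c(2,4)]] order.refl] by blast
  moreover have "a \<otimes>\<^bsub>LG\<^esub> b \<in> carrier LG" "x \<otimes>\<^bsub>LG\<^esub> y \<in> carrier LG" using a b xl yl LG_closed(3) by auto
  ultimately have "a \<otimes>\<^bsub>LG\<^esub> b \<ominus>\<^bsub>LG\<^esub> x \<otimes>\<^bsub>LG\<^esub> y \<in> lfil LG ?N"
   using L.M.minus_closed[of "a \<otimes>\<^bsub>LG\<^esub> b" "x \<otimes>\<^bsub>LG\<^esub> y"] by (simp add: LG_ops(5) a_minus_LG)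
  then show "lfil LG ?N +>\<^bsub>LG\<^esub> (a \<otimes>\<^bsub>LG\<^esub> b) = lcos (i + j) (x \<otimes>\<^bsub>LG\<^esub> y)"
   unfolding lcos_def using L.coset_eq[OF subspace_lfil] LG_closed(3) a b xl yl by simp
 qed
qed

lemma bracket_scale:
 assumes a: "a \<in> carrier LG" and b: "b \<in> carrier LG"
 shows "(c \<odot>\<^sub>C a) \<otimes>\<^bsub>LG\<^esub> (d \<odot>\<^sub>C b) = (c * d) \<odot>\<^sub>C (a \<otimes>\<^bsub>LG\<^esub> b)"
proof -
 note ac = LG_CA[OF a] LG_CA[OF b]
 note sc = CA_closed(2)[OF ac(1) ac(1)] CA_closed(2)[OF ac(2) ac(2)]
 note br = CA_bracket_closed[OF ac]
 show ?thesis
 proof (rule CA_eqI[OF CA_bracket_closed[OF sc] CA_closed(2)[OF br br]])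
  fix m
  obtain x y where xy: "x \<in> a m" "y \<in> b m" using CA_rep(1) ac by metis
  note s = CA_mem_op(2)[OF ac(1) ac(1) xy(1) xy(1), of c] CA_mem_op(2)[OF ac(2) ac(2) xy(2) xy(2), of d]
  have "gmul G (pm_scale c x) (pm_scale d y) - gmul G (pm_scale d y) (pm_scale c x) =
    pm_scale (c * d) (gmul G x y - gmul G y x)"
   by (simp add: pm_conv_scale_left pm_conv_scale_right pm_scale_diff mult.commute)
  then show "EX x. x \<in> ((c \<odot>\<^sub>C a) \<otimes>\<^bsub>LG\<^esub> (d \<odot>\<^sub>C b)) m & x \<in> ((c * d) \<odot>\<^sub>C (a \<otimes>\<^bsub>LG\<^esub> b)) m"
   using LG_mem_bracket[OF sc s] CA_mem_op(2)[OF br br LG_mem_bracket[OF ac xy] LG_mem_bracket[OF ac xy], of "c * d"]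
   by metis
 qed
qed

definition lscale where "lscale \<xi> = (\<lambda>n\<in>{1..}. (2 ^ n) \<odot>\<^bsub>lgr n\<^esub> \<xi> n)"

abbreviation cgrL where "cgrL \<equiv> cgr LG"

lemma cgr_ops:
 "carrier cgrL = (\<Pi>\<^sub>E n\<in>{1..}. carrier (lgr n))"
 "monoid.mult cgrL = (%\<xi> \<eta>. \<lambda>n\<in>{1..}. \<Oplus>\<^bsub>lgr n\<^esub>i\<in>{1..<n}. rcoset_mult LG (lfil LG (Suc n)) (\<xi> i) (\<eta> (n - i)))"
 "ring.add cgrL = (%\<xi> \<eta>. \<lambda>n\<in>{1..}. \<xi> n \<oplus>\<^bsub>lgr n\<^esub> \<eta> n)"
 "module.smult cgrL = (%c \<xi>. \<lambda>n\<in>{1..}. c \<odot>\<^bsub>lgr n\<^esub> \<xi> n)"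
 "lfil cgrL n = {\<xi> \<in> (\<Pi>\<^sub>E n\<in>{1..}. carrier (lgr n)). \<forall>i\<in>{1..<n}. \<xi> i = \<zero>\<^bsub>lgr i\<^esub>}"
 by (simp_all add: cgr_def Let_def)

lemma lscale_closed: "\<xi> \<in> carrier cgrL ==> lscale \<xi> \<in> carrier cgrL"
 using vspace.smult_in[OF vspace_lgr] by (auto simp: cgr_ops(1) lscale_def PiE_iff)

lemma lscale_add:
 assumes "\<xi> \<in> carrier cgrL" "\<eta> \<in> carrier cgrL"
 shows "lscale (\<xi> \<oplus>\<^bsub>cgrL\<^esub> \<eta>) = lscale \<xi> \<oplus>\<^bsub>cgrL\<^esub> lscale \<eta>"
 unfolding lscale_def cgr_ops
 by (rule restrict_ext) (use assms vspace.smult_add_right[OF vspace_lgr] in "simp add: cgr_ops(1) PiE_iff")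

lemma lscale_scale:
 assumes "\<xi> \<in> carrier cgrL"
 shows "lscale (c \<odot>\<^bsub>cgrL\<^esub> \<xi>) = c \<odot>\<^bsub>cgrL\<^esub> lscale \<xi>"
 unfolding lscale_def cgr_ops
 by (rule restrict_ext) (use assms vspace.smult_smult[OF vspace_lgr] in "simp add: cgr_ops(1) PiE_iff mult.commute")

text \<open>Degree n of a bracket collects brackets of degrees i and n - i, which acquire the factor
  2^i 2^(n-i) = 2^n.\<close>

lemma lscale_bracket:
 assumes "\<xi> \<in> carrier cgrL" "\<eta> \<in> carrier cgrL"
 shows "lscale (\<xi> \<otimes>\<^bsub>cgrL\<^esub> \<eta>) = lscale \<xi> \<otimes>\<^bsub>cgrL\<^esub> lscale \<eta>"
 unfolding lscale_def cgr_ops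
proof (rule restrict_ext)
 fix n :: nat assume n: "n \<in> {1..}"
 interpret Q: vspace "lgr n" by (rule vspace_lgr)
 let ?m = "%X Y. rcoset_mult LG (lfil LG (Suc n)) X Y"
 have e: "?m (\<xi> i) (\<eta> (n - i)) \<in> carrier (lgr n) &
   (2 ^ n) \<odot>\<^bsub>lgr n\<^esub> ?m (\<xi> i) (\<eta> (n - i)) = ?m ((2 ^ i) \<odot>\<^bsub>lgr i\<^esub> \<xi> i) ((2 ^ (n - i)) \<odot>\<^bsub>lgr (n - i)\<^esub> \<eta> (n - i))"
  if i: "i \<in> {1..<n}" for i
 proof -
  obtain x y where xy: "x \<in> lfil LG i" "\<xi> i = lcos i x" "y \<in> lfil LG (n - i)" "\<eta> (n - i) = lcos (n - i) y"
   using assms i by (force simp: cgr_ops(1) PiE_iff carrier_lgr)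
  have c: "x \<in> carrier LG" "y \<in> carrier LG" using xy by (auto simp: LG_ops)
  have sx: "(2 ^ i) \<odot>\<^sub>C x \<in> lfil LG i" "(2 ^ (n - i)) \<odot>\<^sub>C y \<in> lfil LG (n - i)"
   using subspaceD(4)[OF subspace_lfil] xy by (auto simp: LG_ops(2))
  have nn: "i + (n - i) = n" using i by simp
  have b: "x \<otimes>\<^bsub>LG\<^esub> y \<in> lfil LG n" using lfil_bracket[OF xy(1,3)] nn by simp
  have pw: "(2::complex) ^ i * 2 ^ (n - i) = 2 ^ n" by (simp add: nn flip: power_add)
  show ?thesis
   unfolding xy(2,4) lcos_scale[OF xy(1)] lcos_scale[OF xy(3)]
    lcos_bracket[OF xy(1,3), unfolded nn] lcos_bracket[OF sx, unfolded nn] lcos_scale[OF b] bracket_scale[OF c] pw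
   using b by (simp add: carrier_lgr)
 qed
 have "(2 ^ n) \<odot>\<^bsub>lgr n\<^esub> (\<Oplus>\<^bsub>lgr n\<^esub>i\<in>{1..<n}. ?m (\<xi> i) (\<eta> (n - i))) =
   (\<Oplus>\<^bsub>lgr n\<^esub>i\<in>{1..<n}. (2 ^ n) \<odot>\<^bsub>lgr n\<^esub> ?m (\<xi> i) (\<eta> (n - i)))"
  by (rule Q.finsum_smult) (use e in blast)
 also have "... = (\<Oplus>\<^bsub>lgr n\<^esub>i\<in>{1..<n}. ?m ((\<lambda>n\<in>{1..}. (2 ^ n) \<odot>\<^bsub>lgr n\<^esub> \<xi> n) i) ((\<lambda>n\<in>{1..}. (2 ^ n) \<odot>\<^bsub>lgr n\<^esub> \<eta> n) (n - i)))"
 proof (rule Q.add.finprod_cong'[OF refl])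
  have e': "?m ((\<lambda>n\<in>{1..}. (2 ^ n) \<odot>\<^bsub>lgr n\<^esub> \<xi> n) i) ((\<lambda>n\<in>{1..}. (2 ^ n) \<odot>\<^bsub>lgr n\<^esub> \<eta> n) (n - i)) =
    (2 ^ n) \<odot>\<^bsub>lgr n\<^esub> ?m (\<xi> i) (\<eta> (n - i))" if "i \<in> {1..<n}" for i
   using e[OF that] that by (simp add: Suc_le_eq)
  show "(%i. ?m ((\<lambda>n\<in>{1..}. (2 ^ n) \<odot>\<^bsub>lgr n\<^esub> \<xi> n) i) ((\<lambda>n\<in>{1..}. (2 ^ n) \<odot>\<^bsub>lgr n\<^esub> \<eta> n) (n - i))) \<in> {1..<n} \<rightarrow> carrier (lgr n)"
  proof (rule Pi_I)
   fix i assume i: "i \<in> {1..<n}"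
   have "(2 ^ n) \<odot>\<^bsub>lgr n\<^esub> ?m (\<xi> i) (\<eta> (n - i)) \<in> carrier (lgr n)"
    by (rule Q.smult_in) (use e[OF i] in blast)
   then show "?m ((\<lambda>n\<in>{1..}. (2 ^ n) \<odot>\<^bsub>lgr n\<^esub> \<xi> n) i) ((\<lambda>n\<in>{1..}. (2 ^ n) \<odot>\<^bsub>lgr n\<^esub> \<eta> n) (n - i)) \<in> carrier (lgr n)"
    by (simp only: e'[OF i])
  qed
  show "(2 ^ n) \<odot>\<^bsub>lgr n\<^esub> ?m (\<xi> i) (\<eta> (n - i)) =
   ?m ((\<lambda>n\<in>{1..}. (2 ^ n) \<odot>\<^bsub>lgr n\<^esub> \<xi> n) i) ((\<lambda>n\<in>{1..}. (2 ^ n) \<odot>\<^bsub>lgr n\<^esub> \<eta> n) (n - i))" if "i \<in> {1..<n}" for i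
   using e'[OF that] by (rule sym)
 qed
 finally show "(2 ^ n) \<odot>\<^bsub>lgr n\<^esub> (\<lambda>n\<in>{1..}. \<Oplus>\<^bsub>lgr n\<^esub>i\<in>{1..<n}. rcoset_mult LG (lfil LG (Suc n)) (\<xi> i) (\<eta> (n - i))) n =
   (\<Oplus>\<^bsub>lgr n\<^esub>i\<in>{1..<n}. ?m ((\<lambda>n\<in>{1..}. (2 ^ n) \<odot>\<^bsub>lgr n\<^esub> \<xi> n) i) ((\<lambda>n\<in>{1..}. (2 ^ n) \<odot>\<^bsub>lgr n\<^esub> \<eta> n) (n - i)))"
  using n by simp
qed

lemma lscale_lfil: "\<xi> \<in> lfil cgrL n ==> lscale \<xi> \<in> lfil cgrL n"
proof -
 assume \<xi>: "\<xi> \<in> lfil cgrL n"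
 have "lscale \<xi> i = \<zero>\<^bsub>lgr i\<^esub>" if "i \<in> {1..<n}" for i
  using \<xi> that vspace.smult_zero_right[OF vspace_lgr, of i] by (simp add: lscale_def cgr_ops(5) del: One_nat_def)
 then show ?thesis using \<xi> lscale_closed[of \<xi>] by (simp add: cgr_ops(1,5))
qed

lemma lscale_decomp:
 assumes \<xi>: "\<xi> \<in> carrier cgrL"
 obtains \<eta> where "\<eta> \<in> lfil cgrL 2" "lscale \<xi> = 2 \<odot>\<^bsub>cgrL\<^esub> \<xi> \<oplus>\<^bsub>cgrL\<^esub> \<eta>"
proof
 let ?\<eta> = "\<lambda>n\<in>{1..}. (2 ^ n - 2) \<odot>\<^bsub>lgr n\<^esub> \<xi> n"
 have c: "\<xi> n \<in> carrier (lgr n)" if "1 <= n" for n using \<xi> that by (auto simp: cgr_ops(1) PiE_iff)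
 show "?\<eta> \<in> lfil cgrL 2"
 proof -
  have "?\<eta> i = \<zero>\<^bsub>lgr i\<^esub>" if "i \<in> {1..<2}" for i
  proof -
   have "i = 1" using that by auto
   then show ?thesis using vspace.smult_0[OF vspace_lgr c[of 1]] by simp
  qed
  moreover have "?\<eta> \<in> (\<Pi>\<^sub>E n\<in>{1..}. carrier (lgr n))"
   using c vspace.smult_in[OF vspace_lgr] by (simp add: PiE_iff)
  ultimately show ?thesis unfolding cgr_ops(5) by blast
 qed
 have "(2 ^ n) \<odot>\<^bsub>lgr n\<^esub> \<xi> n = 2 \<odot>\<^bsub>lgr n\<^esub> \<xi> n \<oplus>\<^bsub>lgr n\<^esub> (2 ^ n - 2) \<odot>\<^bsub>lgr n\<^esub> \<xi> n" if "1 <= n" for n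
  using vspace.smult_add_left[OF vspace_lgr c[OF that], of 2 "2 ^ n - 2"] by simp
 then show "lscale \<xi> = 2 \<odot>\<^bsub>cgrL\<^esub> \<xi> \<oplus>\<^bsub>cgrL\<^esub> ?\<eta>"
  unfolding lscale_def cgr_ops by (intro restrict_ext) simp
qed

text \<open>Of the action on graded pieces only degree 1 is recorded, in the last clause: sigma is
  multiplication by 2 up to elements of \<open>CF 2\<close>. The higher degrees on the group algebra
  are recovered in \<open>DD_power\<close>.\<close>

definition dilation :: "((nat => ('a \<Rightarrow>\<^sub>0 complex) set) => (nat => ('a \<Rightarrow>\<^sub>0 complex) set)) => bool" where
 "dilation \<sigma> \<longleftrightarrow> (\<forall>a\<in>carrier LG. \<sigma> a \<in> carrier LG) &
   (\<forall>a\<in>carrier LG. \<forall>b\<in>carrier LG. \<sigma> (a \<oplus>\<^sub>C b) = \<sigma> a \<oplus>\<^sub>C \<sigma> b) &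
   (\<forall>a\<in>carrier LG. ALL c. \<sigma> (c \<odot>\<^sub>C a) = c \<odot>\<^sub>C \<sigma> a) &
   (\<forall>a\<in>carrier LG. \<forall>b\<in>carrier LG. \<sigma> (a \<otimes>\<^bsub>LG\<^esub> b) = \<sigma> a \<otimes>\<^bsub>LG\<^esub> \<sigma> b) &
   (ALL n. \<forall>a\<in>carrier LG. a \<in> CF n --> \<sigma> a \<in> CF n) &
   (\<forall>a\<in>carrier LG. \<exists>b\<in>carrier LG. b \<in> CF 2 & \<sigma> a = 2 \<odot>\<^sub>C a \<oplus>\<^sub>C b)"

lemma dilation_exists:
 assumes "filtered_formal_group G"
 shows "EX \<sigma>. dilation \<sigma>"
proof -
 obtain f where f: "f \<in> mla_iso LG cgrL"
  using assms by (auto simp: filtered_formal_group_def filtered_formal_mla_def)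
 have bij: "bij_betw f (carrier LG) (carrier cgrL)" and lin: "f \<in> linear_maps LG cgrL"
  and br: "!!x y. x \<in> carrier LG ==> y \<in> carrier LG ==> f (x \<otimes>\<^bsub>LG\<^esub> y) = f x \<otimes>\<^bsub>cgrL\<^esub> f y"
  and fil: "!!n. 1 <= n ==> f ` lfil LG n = lfil cgrL n"
  using f by (auto simp: mla_iso_def)
 have inj: "inj_on f (carrier LG)" using bij by (simp add: bij_betw_def)
 have fc: "f a \<in> carrier cgrL" if "a \<in> carrier LG" for a using linD(1)[OF lin that] .
 define \<sigma> where "\<sigma> a = inv_into (carrier LG) f (lscale (f a))" for a
 have im: "lscale (f a) \<in> f ` carrier LG" if "a \<in> carrier LG" for a
  using lscale_closed[OF fc[OF that]] bij by (simp add: bij_betw_def)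
 have \<sigma>c: "\<sigma> a \<in> carrier LG" if "a \<in> carrier LG" for a
  unfolding \<sigma>_def by (rule inv_into_into[OF im[OF that]])
 have f\<sigma>: "f (\<sigma> a) = lscale (f a)" if "a \<in> carrier LG" for a
  unfolding \<sigma>_def by (rule f_inv_into_f[OF im[OF that]])
 have fadd: "f (a \<oplus>\<^sub>C b) = f a \<oplus>\<^bsub>cgrL\<^esub> f b" if "a \<in> carrier LG" "b \<in> carrier LG" for a b
  using linD(2)[OF lin that] by (simp add: LG_ops)
 have fscale: "f (c \<odot>\<^sub>C a) = c \<odot>\<^bsub>cgrL\<^esub> f a" if "a \<in> carrier LG" for c a
  using linD(3)[OF lin that] by (simp add: LG_ops)
 have "dilation \<sigma>" unfolding dilation_def
 proof (intro conjI ballI allI impI)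
  fix a assume a: "a \<in> carrier LG"
  show "\<sigma> a \<in> carrier LG" by (rule \<sigma>c[OF a])
  show "\<sigma> (c \<odot>\<^sub>C a) = c \<odot>\<^sub>C \<sigma> a" for c
  proof (rule inj_onD[OF inj])
   show "f (\<sigma> (c \<odot>\<^sub>C a)) = f (c \<odot>\<^sub>C \<sigma> a)"
    using a \<sigma>c[OF a] LG_closed(2)[OF a a] by (simp add: f\<sigma> fscale lscale_scale fc)
  qed (use a \<sigma>c LG_closed(2) in auto)
  show "\<sigma> a \<in> CF n" if "a \<in> CF n" for n
  proof (cases "n = 0")
   case True
   then show ?thesis using \<sigma>c[OF a] LG_CA by (simp add: CF_0)
  next
   case False
   have "f a \<in> lfil cgrL n" using fil[of n] False a that by (auto simp: LG_ops(5))
   then have "f (\<sigma> a) \<in> f ` lfil LG n" using fil[of n] False lscale_lfil f\<sigma>[OF a] by simp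
   then have "\<sigma> a \<in> lfil LG n"
    using inj_onD[OF inj _ \<sigma>c[OF a]] by (auto simp: LG_ops(5))
   then show ?thesis by (simp add: LG_ops(5))
  qed
  obtain \<eta> where \<eta>: "\<eta> \<in> lfil cgrL 2" "lscale (f a) = 2 \<odot>\<^bsub>cgrL\<^esub> f a \<oplus>\<^bsub>cgrL\<^esub> \<eta>"
   using lscale_decomp[OF fc[OF a]] by blast
  obtain b where b: "b \<in> lfil LG 2" "\<eta> = f b" using \<eta>(1) fil[of 2] by auto
  have bl: "b \<in> carrier LG" "b \<in> CF 2" using b(1) by (auto simp: LG_ops(5))
  have "f (\<sigma> a) = f (2 \<odot>\<^sub>C a \<oplus>\<^sub>C b)"
   using \<eta>(2) b(2) by (simp add: f\<sigma>[OF a] fadd[OF LG_closed(2)[OF a a] bl(1)] fscale[OF a])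
  then have "\<sigma> a = 2 \<odot>\<^sub>C a \<oplus>\<^sub>C b"
   by (rule inj_onD[OF inj _ \<sigma>c[OF a] LG_closed(1)[OF LG_closed(2)[OF a a] bl(1)]])
  then show "\<exists>b\<in>carrier LG. b \<in> CF 2 & \<sigma> a = 2 \<odot>\<^sub>C a \<oplus>\<^sub>C b" using bl by blast
  fix b assume b: "b \<in> carrier LG"
  show "\<sigma> (a \<oplus>\<^sub>C b) = \<sigma> a \<oplus>\<^sub>C \<sigma> b"
  proof (rule inj_onD[OF inj])
   show "f (\<sigma> (a \<oplus>\<^sub>C b)) = f (\<sigma> a \<oplus>\<^sub>C \<sigma> b)"
    using a b \<sigma>c LG_closed(1) by (simp add: f\<sigma> fadd lscale_add fc)
  qed (use a b \<sigma>c LG_closed(1) in auto)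
  show "\<sigma> (a \<otimes>\<^bsub>LG\<^esub> b) = \<sigma> a \<otimes>\<^bsub>LG\<^esub> \<sigma> b"
  proof (rule inj_onD[OF inj])
   show "f (\<sigma> (a \<otimes>\<^bsub>LG\<^esub> b)) = f (\<sigma> a \<otimes>\<^bsub>LG\<^esub> \<sigma> b)"
    using f\<sigma>[OF LG_closed(3)[OF a b]] br[OF a b] br[OF \<sigma>c[OF a] \<sigma>c[OF b]] lscale_bracket[OF fc[OF a] fc[OF b]]
    by (simp only: f\<sigma>[OF a] f\<sigma>[OF b])
  qed (use a b \<sigma>c LG_closed(3) in auto)
 qed
 then show ?thesis by (rule exI[of dilation \<sigma>])
qed

section \<open>Logarithms of group elements and their dilated exponentials\<close>

subsection \<open>Logarithms of group elements\<close>

definition glogP where "glogP g = (%m. caug G m (glog m (pm_unit g - pm_unit \<one>)))"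

text \<open>From (g, g) = (g, 1)(1, g), where the factors have commuting logarithms,
  \<open>diag\<close> and \<open>left\<close> plus \<open>right\<close> of the logarithm have the
  same exponential; \<open>gexp_inj\<close> makes them congruent.\<close>

lemma prim_glog:
 assumes g: "g \<in> carrier G"
 shows "prim m (glog m (pm_unit g - pm_unit \<one>))"
proof -
 let ?u = "pm_unit g - pm_unit \<one>"
 have u: "?u \<in> IG 1" by (rule unit_minus_one[OF g])
 have ug: "?u \<in> AG" by (rule aug_power_galg[OF u])
 let ?l = "glog m ?u"
 have l: "?l \<in> IG 1" by (rule glog_in[OF u])
 have lg: "?l \<in> AG" by (rule aug_power_galg[OF l])
 have in1: "diag ?u \<in> aug_power GG 1" "left ?u \<in> aug_power GG 1" "right ?u \<in> aug_power GG 1"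
  "diag ?l \<in> aug_power GG 1" "left ?l \<in> aug_power GG 1" "right ?l \<in> aug_power GG 1"
  unfolding diag_def left_def right_def
  by (rule dg.map_aug_power[OF u] inl.map_aug_power[OF u] inr.map_aug_power[OF u]
    dg.map_aug_power[OF l] inl.map_aug_power[OF l] inr.map_aug_power[OF l])+
 have gl: "diag ?l = GG.glog m (diag ?u)" "left ?l = GG.glog m (left ?u)" "right ?l = GG.glog m (right ?u)"
  unfolding diag_def left_def right_def using ug by (simp_all only: dg.map_glog inl.map_glog inr.map_glog)
 have un: "pm_unit \<one>\<^bsub>GG\<^esub> + diag ?u = pm_unit (g, g)" "pm_unit \<one>\<^bsub>GG\<^esub> + left ?u = pm_unit (g, \<one>)"
  "pm_unit \<one>\<^bsub>GG\<^esub> + right ?u = pm_unit (\<one>, g)"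
  by (simp_all add: diag_def left_def right_def GG_simps)
 note e = GG.gexp_glog[OF in1(1), of m, folded gl, unfolded un] GG.gexp_glog[OF in1(2), of m, folded gl, unfolded un]
  GG.gexp_glog[OF in1(3), of m, folded gl, unfolded un]
 have "GG.gexp m (left ?l + right ?l) - gmul GG (GG.gexp m (left ?l)) (GG.gexp m (right ?l)) \<in> aug_power GG (Suc m)"
  by (rule GG.gexp_add_commuting[OF in1(5,6) left_right_commute[OF lg lg]])
 moreover have "gmul GG (GG.gexp m (left ?l)) (GG.gexp m (right ?l)) - gmul GG (pm_unit (g, \<one>)) (pm_unit (\<one>, g)) \<in> aug_power GG (Suc m)"
  by (rule GG.cong_gmul[OF e(2,3)]) (use g lg in "auto intro!: galg_simps GG.gexp_closed right_closed simp: GG_simps")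
 moreover have "gmul GG (pm_unit (g, \<one>)) (pm_unit (\<one>, g)) = pm_unit (g, g)"
  using g by (simp add: pm_conv_unit GG_simps)
 ultimately have "GG.gexp m (left ?l + right ?l) - pm_unit (g, g) \<in> aug_power GG (Suc m)"
  using GG.cong_trans by metis
 then have "GG.gexp m (diag ?l) - GG.gexp m (left ?l + right ?l) \<in> aug_power GG (Suc m)"
  using GG.cong_trans[OF e(1) GG.cong_sym] by blast
 then have "diag ?l - (left ?l + right ?l) \<in> aug_power GG (Suc m)"
  by (rule GG.gexp_inj[OF in1(4) GG.aug_power_add[OF in1(5,6)]])
 then show ?thesis
  using GG.aug_power_mono[of m "Suc m"] by (simp add: prim_def diff_diff_eq)
qed

lemma glogP_closed:
 assumes g: "g \<in> carrier G"
 shows "glogP g \<in> carrier LG"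
proof (rule LG_I)
 let ?u = "pm_unit g - pm_unit \<one>"
 have u: "?u \<in> IG 1" by (rule unit_minus_one[OF g])
 have lg: "glog m ?u \<in> AG" for m by (rule aug_power_galg[OF glog_in[OF u]])
 show "glogP g \<in> carrier CA"
  by (rule CA_I[of "%m. glog m ?u", OF lg])
   (auto simp: glogP_def intro: aug_power_mono[OF _ glog_mono_cong[OF u]])
 show "\<exists>x\<in>glogP g m. prim m x" for m
  unfolding glogP_def using caug_self[OF lg] prim_glog[OF g] by blast
qed

text \<open>The component of index \<open>Suc N\<close> is used because \<open>gexp N\<close>
  determines, and is determined by, its argument modulo \<open>IG (Suc N)\<close>.\<close>

lemma glogP_mem:
 assumes g: "g \<in> carrier G" and x: "x \<in> glogP g (Suc N)"
 shows "x \<in> IG 1" "gexp N x - pm_unit g \<in> IG (Suc N)"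
  "1 <= N ==> x - (pm_unit g - pm_unit \<one>) \<in> IG 2"
proof -
 let ?u = "pm_unit g - pm_unit \<one>"
 have u: "?u \<in> IG 1" by (rule unit_minus_one[OF g])
 have lg: "glog m ?u \<in> AG" for m by (rule aug_power_galg[OF glog_in[OF u]])
 have xl: "x - glog (Suc N) ?u \<in> IG (Suc N)" using x lg by (simp add: glogP_def mem_caug)
 moreover have "glog (Suc N) ?u - glog N ?u \<in> IG (Suc N)" by (rule glog_mono_cong[OF u]) simp
 ultimately have xN: "x - glog N ?u \<in> IG (Suc N)" by (rule cong_trans)
 have "x - glog N ?u + glog N ?u \<in> IG 1"
  by (rule aug_power_add[OF aug_power_mono[OF _ xN] glog_in[OF u]]) simp
 then show x1: "x \<in> IG 1" by simp
 have "gexp N x - gexp N (glog N ?u) \<in> IG (Suc N)" by (rule gexp_cong[OF x1 glog_in[OF u] xN])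
 from cong_trans[OF this gexp_glog[OF u]] show "gexp N x - pm_unit g \<in> IG (Suc N)" by simp
 assume N: "1 <= N"
 have "glog 1 ?u = ?u" using gmul_one(2)[OF aug_power_galg[OF u]] by (simp add: glog_def fps_ln_nth)
 then have "glog N ?u - ?u \<in> IG 2" using glog_mono_cong[OF u N] by (simp add: numeral_2_eq_2)
 moreover have "x - glog N ?u \<in> IG 2" by (rule aug_power_mono[OF _ xN]) (use N in simp)
 ultimately show "x - ?u \<in> IG 2" using cong_trans by blast
qed

text \<open>The element exp(sigma(log g)), truncated at order \<open>N\<close>. By
  \<open>dil_eqI\<close> the choice of the representative matters only modulo
  \<open>IG (Suc N)\<close>.\<close>

definition dil where
 "dil \<sigma> N g = gexp N (rep (Suc N) (\<sigma> (glogP g)))"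

lemma dilationD:
 assumes "dilation \<sigma>"
 shows "a \<in> carrier LG ==> \<sigma> a \<in> carrier LG"
  "a \<in> carrier LG ==> b \<in> carrier LG ==> \<sigma> (a \<oplus>\<^sub>C b) = \<sigma> a \<oplus>\<^sub>C \<sigma> b"
  "a \<in> carrier LG ==> \<sigma> (c \<odot>\<^sub>C a) = c \<odot>\<^sub>C \<sigma> a"
  "a \<in> carrier LG ==> b \<in> carrier LG ==> \<sigma> (a \<otimes>\<^bsub>LG\<^esub> b) = \<sigma> a \<otimes>\<^bsub>LG\<^esub> \<sigma> b"
  "a \<in> carrier LG ==> a \<in> CF n ==> \<sigma> a \<in> CF n"
  "a \<in> carrier LG ==> \<exists>b\<in>carrier LG. b \<in> CF 2 & \<sigma> a = 2 \<odot>\<^sub>C a \<oplus>\<^sub>C b"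
 using assms unfolding dilation_def by blast+

lemma CF_1_LG:
 assumes "a \<in> carrier CA" "x \<in> a (Suc N)" "x \<in> IG 1"
 shows "a \<in> CF 1"
 by (rule CF_I[OF assms(1) _ assms(2,3)]) simp

lemma glogP_CF_1: "g \<in> carrier G ==> glogP g \<in> CF 1"
 using CA_rep(1)[OF LG_CA[OF glogP_closed]] CF_1_LG[OF LG_CA[OF glogP_closed]] glogP_mem(1) by metis

lemma dil_rep:
 assumes \<sigma>: "dilation \<sigma>" and g: "g \<in> carrier G"
 shows "rep m (\<sigma> (glogP g)) \<in> \<sigma> (glogP g) m" "rep m (\<sigma> (glogP g)) \<in> AG"
  "1 <= m ==> rep m (\<sigma> (glogP g)) \<in> IG 1" "prim m (rep m (\<sigma> (glogP g)))"
proof -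
 have L: "\<sigma> (glogP g) \<in> carrier LG" by (rule dilationD(1)[OF \<sigma> glogP_closed[OF g]])
 show r: "rep m (\<sigma> (glogP g)) \<in> \<sigma> (glogP g) m" by (rule rep_mem[OF LG_CA[OF L]])
 show "rep m (\<sigma> (glogP g)) \<in> AG" by (rule CA_rep(2)[OF LG_CA[OF L] r])
 show "prim m (rep m (\<sigma> (glogP g)))" using L r by (simp add: LG_carrier_iff)
 have "\<sigma> (glogP g) \<in> CF 1" by (rule dilationD(5)[OF \<sigma> glogP_closed[OF g] glogP_CF_1[OF g]])
 then show "rep m (\<sigma> (glogP g)) \<in> IG 1" if "1 <= m" using CF_mem[of "\<sigma> (glogP g)" 1 m] that r by blast
qed

lemma dil_closed: "dilation \<sigma> ==> g \<in> carrier G ==> dil \<sigma> N g \<in> AG"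
 unfolding dil_def by (intro gexp_closed dil_rep)

lemma dil_eqI:
 assumes \<sigma>: "dilation \<sigma>" and g: "g \<in> carrier G" and q: "q \<in> \<sigma> (glogP g) (Suc N)"
 shows "gexp N q - dil \<sigma> N g \<in> IG (Suc N)"
proof -
 have L: "\<sigma> (glogP g) \<in> carrier LG" by (rule dilationD(1)[OF \<sigma> glogP_closed[OF g]])
 have "\<sigma> (glogP g) \<in> CF 1" by (rule dilationD(5)[OF \<sigma> glogP_closed[OF g] glogP_CF_1[OF g]])
 then have q1: "q \<in> IG 1" using CF_mem[of "\<sigma> (glogP g)" 1 "Suc N" q] q by simp
 show ?thesis unfolding dil_def
  by (rule gexp_cong[OF q1 dil_rep(3)[OF \<sigma> g] CA_rep(4)[OF LG_CA[OF L] q dil_rep(1)[OF \<sigma> g]]]) simp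
qed

lemma dil_mono:
 assumes \<sigma>: "dilation \<sigma>" and g: "g \<in> carrier G" and "M <= N"
 shows "dil \<sigma> N g - dil \<sigma> M g \<in> IG (Suc M)"
proof -
 have L: "\<sigma> (glogP g) \<in> carrier CA" by (rule LG_CA[OF dilationD(1)[OF \<sigma> glogP_closed[OF g]]])
 let ?q = "rep (Suc N) (\<sigma> (glogP g))"
 have q1: "?q \<in> IG 1" by (rule dil_rep(3)[OF \<sigma> g]) simp
 have "?q \<in> \<sigma> (glogP g) (Suc M)" by (rule CA_rep(6)[OF L _ dil_rep(1)[OF \<sigma> g]]) (use assms in simp)
 from cong_trans[OF gexp_mono_cong[OF q1 \<open>M <= N\<close>] dil_eqI[OF \<sigma> g this]]
 show ?thesis by (simp add: dil_def)
qed

text \<open>The exponential of a primitive element is group-like, and sigma(log g) is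
  primitive.\<close>

lemma dil_diag:
 assumes \<sigma>: "dilation \<sigma>" and g: "g \<in> carrier G"
 shows "diag (dil \<sigma> N g) - kron (dil \<sigma> N g) (dil \<sigma> N g) \<in> aug_power GG (Suc N)"
proof -
 let ?q = "rep (Suc N) (\<sigma> (glogP g))"
 have q1: "?q \<in> IG 1" by (rule dil_rep(3)[OF \<sigma> g]) simp
 have qg: "?q \<in> AG" by (rule aug_power_galg[OF q1])
 have in1: "diag ?q \<in> aug_power GG 1" "left ?q \<in> aug_power GG 1" "right ?q \<in> aug_power GG 1"
  unfolding diag_def left_def right_def
  by (rule dg.map_aug_power[OF q1] inl.map_aug_power[OF q1] inr.map_aug_power[OF q1])+
 have "diag ?q - (left ?q + right ?q) \<in> aug_power GG (Suc N)"
  using dil_rep(4)[OF \<sigma> g, of "Suc N"] by (simp add: prim_def diff_diff_eq)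
 from GG.gexp_cong[OF in1(1) GG.aug_power_add[OF in1(2,3)] this, of N]
  GG.gexp_add_commuting[OF in1(2,3) left_right_commute[OF qg qg], of N]
 have "GG.gexp N (diag ?q) - gmul GG (GG.gexp N (left ?q)) (GG.gexp N (right ?q)) \<in> aug_power GG (Suc N)"
  by (rule GG.cong_trans)
 then show ?thesis
  unfolding kron_def dil_def diag_def left_def right_def
  by (simp add: dg.map_gexp[OF qg] inl.map_gexp[OF qg] inr.map_gexp[OF qg])
qed

text \<open>To first order exp(sigma(log g)) - 1 is sigma(log g), this is 2 log g, and log g is g -
  1, each time modulo \<open>IG 2\<close>.\<close>

lemma dil_minus_one:
 assumes \<sigma>: "dilation \<sigma>" and g: "g \<in> carrier G" and N: "1 <= N"
 shows "dil \<sigma> N g - pm_unit \<one> - pm_scale 2 (pm_unit g - pm_unit \<one>) \<in> IG 2"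
proof -
 let ?q = "rep (Suc N) (\<sigma> (glogP g))" and ?u = "pm_unit g - pm_unit \<one>"
 have q1: "?q \<in> IG 1" by (rule dil_rep(3)[OF \<sigma> g]) simp
 have P: "glogP g \<in> carrier LG" by (rule glogP_closed[OF g])
 obtain b where b: "b \<in> carrier LG" "b \<in> CF 2" "\<sigma> (glogP g) = 2 \<odot>\<^sub>C glogP g \<oplus>\<^sub>C b"
  using dilationD(6)[OF \<sigma> P] by blast
 obtain x where x: "x \<in> glogP g (Suc N)" using CA_rep(1)[OF LG_CA[OF P]] by blast
 obtain y where y: "y \<in> b (Suc N)" using CA_rep(1)[OF LG_CA[OF b(1)]] by blast
 have y2: "y \<in> IG 2" by (rule CF_mem[OF b(2) _ y]) (use N in simp)
 have "pm_scale 2 x + y \<in> \<sigma> (glogP g) (Suc N)"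
  unfolding b(3)
  by (rule CA_mem_op(1)[OF CA_closed(2)[OF LG_CA[OF P] LG_CA[OF P]] LG_CA[OF b(1)] CA_mem_op(2)[OF LG_CA[OF P] LG_CA[OF P] x x] y])
 then have "?q - (pm_scale 2 x + y) \<in> IG (Suc N)"
  by (rule CA_rep(4)[OF LG_CA[OF dilationD(1)[OF \<sigma> P]] dil_rep(1)[OF \<sigma> g]])
 then have 1: "?q - (pm_scale 2 x + y) \<in> IG 2" by (rule aug_power_mono[rotated]) (use N in simp)
 have 2: "pm_scale 2 (x - ?u) \<in> IG 2" by (rule aug_power_scale[OF glogP_mem(3)[OF g x N]])
 have 3: "gexp N ?q - pm_unit \<one> - ?q \<in> IG 2" by (rule gexp_1_cong[OF q1 N])
 have "(gexp N ?q - pm_unit \<one> - ?q) + (?q - (pm_scale 2 x + y)) + y + pm_scale 2 (x - ?u) \<in> IG 2"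
  by (intro aug_power_add 1 2 3 y2)
 then show ?thesis by (simp add: dil_def pm_scale_diff algebra_simps del: map_single)
qed

lemma dil_minus_one_in:
 assumes \<sigma>: "dilation \<sigma>" and g: "g \<in> carrier G" and N: "1 <= N"
 shows "dil \<sigma> N g - pm_unit \<one> \<in> IG 1"
proof -
 have "dil \<sigma> N g - pm_unit \<one> - pm_scale 2 (pm_unit g - pm_unit \<one>) + pm_scale 2 (pm_unit g - pm_unit \<one>) \<in> IG 1"
  by (rule aug_power_add[OF aug_power_mono[OF _ dil_minus_one[OF assms]] aug_power_scale[OF unit_minus_one[OF g]]]) simp
 then show ?thesis by (simp only: diff_add_cancel)
qed

lemma dil_one:
 assumes \<sigma>: "dilation \<sigma>"
 shows "dil \<sigma> N \<one> - pm_unit \<one> \<in> IG (Suc N)"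
proof -
 have gp: "gpow 0 k = (if k = 0 then pm_unit \<one> else 0)" for k by (cases k) auto
 have gl: "glog m 0 = 0" for m
  unfolding glog_def by (rule sum.neutral) (auto simp: gp)
 have ge: "gexp N 0 = pm_unit \<one>"
  unfolding gexp_def by (subst sum.mono_neutral_right[of _ "{0}"]) (auto simp: gp)
 have P: "glogP \<one> = toC 0" by (auto simp: glogP_def toC_def gl)
 have z: "toC 0 = 0 \<odot>\<^sub>C toC 0"
  using vspace.smult_0[OF vspace_CA toC_closed[OF galg_simps(1)]] by (simp add: CA_zero)
 have t: "toC 0 \<in> carrier LG" using LG_zero by (simp add: CA_zero)
 have "\<sigma> (toC 0) = 0 \<odot>\<^sub>C \<sigma> (toC 0)"
  by (subst z, subst dilationD(3)[OF \<sigma> t]) simp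
 also have "... = toC 0"
  using vspace.smult_0[OF vspace_CA LG_CA[OF dilationD(1)[OF \<sigma> t]]] by (simp add: CA_zero)
 finally have "0 \<in> \<sigma> (glogP \<one>) (Suc N)" using toC_mem[OF galg_simps(1)] by (simp add: P)
 from cong_sym[OF dil_eqI[OF \<sigma> one_closed this]] show ?thesis by (simp add: ge)
qed

lemma emb_ad: "p \<in> AG ==> q \<in> AG ==> ad (emb p) (emb q) = emb (gmul G p q - gmul G q p)"
 by (simp add: ad_def emb_diff emb_mult)

text \<open>\<open>bch_related\<close> for the graph of sigma yields an element c of the Lie algebra
  with exp(c) congruent to g h and exp(sigma(c)) congruent to the product of the two dilated
  elements. Injectivity of the exponential gives c = log(g h) modulo \<open>CF (Suc N)\<close>, a
  step that sigma preserves.\<close>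

theorem dil_mult:
 assumes \<sigma>: "dilation \<sigma>" and N: "1 <= N" and g: "g \<in> carrier G" and h: "h \<in> carrier G"
 shows "dil \<sigma> N (g \<otimes> h) - gmul G (dil \<sigma> N g) (dil \<sigma> N h) \<in> IG (Suc N)"
proof -
 let ?R = "%c p q. c \<in> carrier LG & p \<in> c (Suc N) & q \<in> \<sigma> c (Suc N)"
 \<comment> \<open>The graph of sigma on \<open>CF n\<close>, seen through representatives modulo
   \<open>IG (Suc N)\<close> in the operator algebra.\<close>
 define L where "L n = {(emb p, emb q) | p q c. c \<in> CF n & ?R c p q}" for n
 have L_I: "(emb p, emb q) \<in> L n" if "cc \<in> CF n" "?R cc p q" for cc p q n
  using that unfolding L_def by blast
 define LL where "LL x x' n p q c \<longleftrightarrow> x = emb p & x' = emb q & c \<in> CF n & ?R c p q & c \<in> carrier CA &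
   \<sigma> c \<in> carrier LG & \<sigma> c \<in> carrier CA & p \<in> AG & q \<in> AG" for x x' n p q c
 have L_E: "EX p q c. LL x x' n p q c" if "(x, x') \<in> L n" for x x' n
 proof -
  have "EX p q c. x = emb p & x' = emb q & c \<in> CF n & ?R c p q" using that unfolding L_def by simp
  then obtain p q c where c: "x = emb p & x' = emb q & c \<in> CF n & ?R c p q" by (elim exE)
  moreover have "\<sigma> c \<in> carrier LG" using c dilationD(1)[OF \<sigma>] by simp
  ultimately have "LL x x' n p q c"
   unfolding LL_def using LG_CA[of c] LG_CA[of "\<sigma> c"] CA_rep(2)[of c p "Suc N"] CA_rep(2)[of "\<sigma> c" q "Suc N"] by simp
  then show ?thesis by (intro exI)
 qed
 have L_D: "x = emb p" "x' = emb q" "c \<in> CF n" "?R c p q" "c \<in> carrier CA" "\<sigma> c \<in> carrier LG" "\<sigma> c \<in> carrier CA"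
  "p \<in> AG" "q \<in> AG" if "LL x x' n p q c" for x x' n p q c
  using that unfolding LL_def by simp_all
 let ?J = "%n. emb ` IG n"
 have rel: "lie_relation L"
 proof
  fix n
  have "toC 0 \<in> CF n" "toC 0 \<in> carrier LG" using toC_CF aug_power_zero LG_zero by (auto simp: CA_zero)
  moreover have "0 \<in> \<sigma> (toC 0) (Suc N)"
  proof -
   have t: "toC 0 \<in> carrier LG" using LG_zero by (simp add: CA_zero)
   have "toC 0 = 0 \<odot>\<^sub>C toC 0"
    using vspace.smult_0[OF vspace_CA toC_closed[OF galg_simps(1)]] by (simp add: CA_zero)
   then have "\<sigma> (toC 0) = 0 \<odot>\<^sub>C \<sigma> (toC 0)" by (metis dilationD(3)[OF \<sigma> t])
   also have "... = toC 0"
    using vspace.smult_0[OF vspace_CA LG_CA[OF dilationD(1)[OF \<sigma> t]]] by (simp add: CA_zero)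
   finally show ?thesis using toC_mem[OF galg_simps(1)] by simp
  qed
  ultimately have "(emb 0, emb 0) \<in> L n" using toC_mem[OF galg_simps(1)] by (intro L_I[of "toC 0"]) auto
  then show "(0, 0) \<in> L n" by simp
  show "L (Suc n) <= L n" unfolding L_def using CF_anti[of n "Suc n"] by fastforce
  fix x x' assume "(x, x') \<in> L n"
  from L_E[OF this] obtain p q c where "LL x x' n p q c" by (elim exE)
  note c = L_D[OF this]
  then have cL: "c \<in> carrier LG" "p \<in> c (Suc N)" "q \<in> \<sigma> c (Suc N)" by auto
  fix r :: real
  have "pm_scale (of_real r) q \<in> \<sigma> (of_real r \<odot>\<^sub>C c) (Suc N)"
   using CA_mem_op(2)[OF c(7) c(7) cL(3) cL(3), of "of_real r"] by (simp add: dilationD(3)[OF \<sigma> cL(1)])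
  then have "(emb (pm_scale (of_real r) p), emb (pm_scale (of_real r) q)) \<in> L n"
   using subspaceD(4)[OF subspace_CF c(3)] LG_closed(2)[OF cL(1) cL(1)] CA_mem_op(2)[OF c(5) c(5) cL(2) cL(2)]
   by (intro L_I[of "of_real r \<odot>\<^sub>C c"]) auto
  then show "(r *\<^sub>R x, r *\<^sub>R x') \<in> L n" by (simp add: c emb_scale)
 next
  fix x x' y y' m n assume "(x, x') \<in> L m" "(y, y') \<in> L n"
  from L_E[OF this(1)] L_E[OF this(2)] obtain p q c r s d
   where lc: "LL x x' m p q c" and ld: "LL y y' n r s d" by (elim exE)
  note c = L_D[OF lc] and d = L_D[OF ld]
  then have cL: "c \<in> carrier LG" "p \<in> c (Suc N)" "q \<in> \<sigma> c (Suc N)" and dL: "d \<in> carrier LG" "r \<in> d (Suc N)" "s \<in> \<sigma> d (Suc N)"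
   by auto
  have "c \<in> lfil LG m" "d \<in> lfil LG n" using c d cL dL by (simp_all add: LG_ops(5))
  then have "c \<otimes>\<^bsub>LG\<^esub> d \<in> CF (m + n)" "c \<otimes>\<^bsub>LG\<^esub> d \<in> carrier LG"
   using lfil_bracket by (auto simp: LG_ops(5))
  moreover have "gmul G q s - gmul G s q \<in> \<sigma> (c \<otimes>\<^bsub>LG\<^esub> d) (Suc N)"
   using LG_mem_bracket[OF c(7) d(7) cL(3) dL(3)] by (simp add: dilationD(4)[OF \<sigma> cL(1) dL(1)])
  ultimately have "(emb (gmul G p r - gmul G r p), emb (gmul G q s - gmul G s q)) \<in> L (m + n)"
   using LG_mem_bracket[OF c(5) d(5) cL(2) dL(2)] by (intro L_I[of "c \<otimes>\<^bsub>LG\<^esub> d"]) auto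
  then show "(ad x y, ad x' y') \<in> L (m + n)" using c d by (simp add: emb_ad)
  assume "(y, y') \<in> L m"
  from L_E[OF this] obtain r s d where "LL y y' m r s d" by (elim exE)
  note d = L_D[OF this]
  then have dL: "d \<in> carrier LG" "r \<in> d (Suc N)" "s \<in> \<sigma> d (Suc N)" by auto
  have "q + s \<in> \<sigma> (c \<oplus>\<^sub>C d) (Suc N)"
   using CA_mem_op(1)[OF c(7) d(7) cL(3) dL(3)] by (simp add: dilationD(2)[OF \<sigma> cL(1) dL(1)])
  then have "(emb (p + r), emb (q + s)) \<in> L m"
   using subspaceD(3)[OF subspace_CF c(3) d(3)] LG_closed(1)[OF cL(1) dL(1)] CA_mem_op(1)[OF c(5) d(5) cL(2) dL(2)]
   by (intro L_I[of "c \<oplus>\<^sub>C d"]) auto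
  then show "(x + y, x' + y') \<in> L m" by (simp add: c d emb_add)
 qed
 have sub: "L n <= ?J n \<times> ?J n" if "1 <= n" "n <= N" for n
 proof
  fix z assume "z \<in> L n"
  then obtain x x' where z: "z = (x, x')" "(x, x') \<in> L n" by (cases z) auto
  from L_E[OF z(2)] obtain p q c where "LL x x' n p q c" by (elim exE)
  note c = L_D[OF this]
  have "\<sigma> c \<in> CF n" using c dilationD(5)[OF \<sigma>] by blast
  then have "p \<in> IG n" "q \<in> IG n"
   using c CF_mem[of c n "Suc N" p] CF_mem[of "\<sigma> c" n "Suc N" q] that by auto
  then show "z \<in> ?J n \<times> ?J n" using z c by auto
 qed
 define rg rh where "rg = rep (Suc N) (glogP g)" and "rh = rep (Suc N) (glogP h)"
 define qg qh where "qg = rep (Suc N) (\<sigma> (glogP g))" and "qh = rep (Suc N) (\<sigma> (glogP h))"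
 have Pg: "glogP g \<in> carrier LG" and Ph: "glogP h \<in> carrier LG" using g h glogP_closed by auto
 have r: "rg \<in> glogP g (Suc N)" "rh \<in> glogP h (Suc N)"
  unfolding rg_def rh_def using rep_mem LG_CA Pg Ph by auto
 have r1: "rg \<in> IG 1" "rh \<in> IG 1" using glogP_mem(1) r g h by auto
 have q1: "qg \<in> IG 1" "qh \<in> IG 1" unfolding qg_def qh_def using dil_rep(3)[OF \<sigma>] g h by simp_all
 have xy: "(emb rg, emb qg) \<in> L 1" "(emb rh, emb qh) \<in> L 1"
  unfolding qg_def qh_def
  by (rule L_I[OF glogP_CF_1[OF g]], use Pg r dil_rep(1)[OF \<sigma> g] in simp)
   (rule L_I[OF glogP_CF_1[OF h]], use Ph r dil_rep(1)[OF \<sigma> h] in simp)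
 obtain z z' where z: "(z, z') \<in> L 1" "expN N z - expN N (emb rg) * expN N (emb rh) \<in> ?J (Suc N)"
  "expN N z' - expN N (emb qg) * expN N (emb qh) \<in> ?J (Suc N)"
  by (rule bch_related[OF rel filtration_emb filtration_emb sub N xy])
 from L_E[OF z(1)] obtain p q c where "LL z z' 1 p q c" by (elim exE)
 note c = L_D[OF this]
 then have cL: "c \<in> carrier LG" "p \<in> c (Suc N)" "q \<in> \<sigma> c (Suc N)" by auto
 note gal = aug_power_galg[OF r1(1)] aug_power_galg[OF r1(2)] aug_power_galg[OF q1(1)] aug_power_galg[OF q1(2)]
 have zp: "gexp N p - gmul G (gexp N rg) (gexp N rh) \<in> IG (Suc N)"
  "gexp N q - gmul G (gexp N qg) (gexp N qh) \<in> IG (Suc N)"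
  using z(2,3) gal c(8,9) by (simp_all add: c emb_gexp[symmetric] emb_mult[symmetric] gexp_closed emb_diff_iff gmul_closed)
 have "gmul G (gexp N rg) (gexp N rh) - gmul G (pm_unit g) (pm_unit h) \<in> IG (Suc N)"
  by (rule cong_gmul[OF glogP_mem(2)[OF g r(1)] glogP_mem(2)[OF h r(2)]])
   (use g gal in "auto intro: galg_simps gexp_closed")
 from cong_trans[OF zp(1) this] have pe: "gexp N p - pm_unit (g \<otimes> h) \<in> IG (Suc N)"
  using g h by (simp add: pm_conv_unit)
 have gh: "g \<otimes> h \<in> carrier G" using g h by simp
 have Pgh: "glogP (g \<otimes> h) \<in> carrier LG" by (rule glogP_closed[OF gh])
 define w where "w = rep (Suc N) (glogP (g \<otimes> h))"
 have w: "w \<in> glogP (g \<otimes> h) (Suc N)" unfolding w_def by (rule rep_mem[OF LG_CA[OF Pgh]])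
 have p1: "p \<in> IG 1" by (rule CF_mem[OF c(3) _ cL(2)]) simp
 \<comment> \<open>Both \<open>p\<close> and \<open>w\<close> have an exponential congruent to g
   h.\<close>
 have "p - w \<in> IG (Suc N)"
  by (rule gexp_inj[OF p1 glogP_mem(1)[OF gh w] cong_trans[OF pe cong_sym[OF glogP_mem(2)[OF gh w]]]])
 moreover have "p - w \<in> (c \<ominus>\<^bsub>CA\<^esub> glogP (g \<otimes> h)) (Suc N)"
  by (rule CA_mem_minus[OF c(5) LG_CA[OF Pgh] cL(2) w])
 ultimately have dCF: "c \<ominus>\<^bsub>CA\<^esub> glogP (g \<otimes> h) \<in> CF (Suc N)"
  using CF_I[OF CA_minus_closed[OF c(5) LG_CA[OF Pgh]] order.refl] by blast
 interpret C: vspace CA by (rule vspace_CA)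
 interpret Lv: vspace LG by (rule vspace_LG)
 have dL: "c \<ominus>\<^bsub>CA\<^esub> glogP (g \<otimes> h) \<in> carrier LG"
  using Lv.M.minus_closed[OF cL(1) Pgh] by (simp add: a_minus_LG[OF Pgh])
 have "c = (c \<ominus>\<^bsub>CA\<^esub> glogP (g \<otimes> h)) \<oplus>\<^sub>C glogP (g \<otimes> h)"
  using C.add_minus_cancel[OF c(5) LG_CA[OF Pgh]] by simp
 then have \<sigma>c: "\<sigma> c = \<sigma> (c \<ominus>\<^bsub>CA\<^esub> glogP (g \<otimes> h)) \<oplus>\<^sub>C \<sigma> (glogP (g \<otimes> h))"
  using dilationD(2)[OF \<sigma> dL Pgh] by simp
 have \<sigma>d: "\<sigma> (c \<ominus>\<^bsub>CA\<^esub> glogP (g \<otimes> h)) \<in> CF (Suc N)" by (rule dilationD(5)[OF \<sigma> dL dCF])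
 then have \<sigma>dc: "\<sigma> (c \<ominus>\<^bsub>CA\<^esub> glogP (g \<otimes> h)) \<in> carrier CA" by (simp add: CF_iff)
 obtain e where e: "e \<in> \<sigma> (c \<ominus>\<^bsub>CA\<^esub> glogP (g \<otimes> h)) (Suc N)" using CA_rep(1)[OF \<sigma>dc] by blast
 let ?v = "rep (Suc N) (\<sigma> (glogP (g \<otimes> h)))"
 have v: "?v \<in> \<sigma> (glogP (g \<otimes> h)) (Suc N)" by (rule dil_rep(1)[OF \<sigma> gh])
 have "e + ?v \<in> \<sigma> c (Suc N)"
  unfolding \<sigma>c by (rule CA_mem_op(1)[OF \<sigma>dc LG_CA[OF dilationD(1)[OF \<sigma> Pgh]] e v])
 then have "q - (e + ?v) \<in> IG (Suc N)" by (rule CA_rep(4)[OF c(7) cL(3)])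
 from aug_power_add[OF this CF_mem[OF \<sigma>d order.refl e]] have "q - ?v \<in> IG (Suc N)" by simp
 moreover have "q \<in> IG 1"
  by (rule CF_mem[OF dilationD(5)[OF \<sigma> cL(1) c(3)] _ cL(3)]) simp
 ultimately have "gexp N q - dil \<sigma> N (g \<otimes> h) \<in> IG (Suc N)"
  unfolding dil_def by (intro gexp_cong dil_rep(3)[OF \<sigma> gh]) auto
 from cong_trans[OF cong_sym[OF this] zp(2)] show ?thesis by (simp add: dil_def qg_def qh_def)
qed

end

section \<open>The restricted dual: product, translates, finite dimensional steps\<close>

section \<open>The restricted dual\<close>

lemma tensor_rel_cong_le:
 assumes "carrier V = carrier W" "ring.add V = ring.add W" "module.smult V = module.smult W"
 shows "tensor_rel V n <= tensor_rel W n"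
proof
 fix p assume "p \<in> tensor_rel V n"
 then show "p \<in> tensor_rel W n"
 proof (induction rule: tensor_rel.induct)
  case (additivity x y xs ys)
  then show ?case using tensor_rel.additivity[of x W y xs ys n] by (simp only: assms)
 next
  case (homogeneity x xs ys c)
  then show ?case using tensor_rel.homogeneity[of x W xs ys n c] by (simp only: assms)
 qed (intro tensor_rel.intros; assumption)+
qed

text \<open>Coproducts are defined with the tensor powers of the underlying algebra records
  \<open>dual_alg\<close> and \<open>gr_alg\<close>, whereas the Hopf axioms speak of those of the
  extended records. This identifies the two.\<close>

lemma tensor_cong_fields:
 assumes "carrier V = carrier W" "ring.add V = ring.add W" "module.smult V = module.smult W"
  "monoid.mult V = monoid.mult W" "monoid.one V = monoid.one W"
 shows "tensor_pow V n = tensor_pow W n" "pure_tensor V = pure_tensor W"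
proof -
 have r: "tensor_rel V k = tensor_rel W k" for k
  by (rule equalityI; rule tensor_rel_cong_le) (simp_all add: assms)
 have f: "free_tensor V k = free_tensor W k" for k by (simp add: free_tensor_def assms)
 show "tensor_pow V n = tensor_pow W n" by (simp only: tensor_pow_def r f)
 show "pure_tensor V = pure_tensor W" by (intro ext) (simp only: pure_tensor_def r f)
qed

context group_square
begin

abbreviation H where "H \<equiv> dual_hopf G"

abbreviation addH (infixl "\<oplus>\<^sub>H" 65) where "addH \<equiv> ring.add H"
abbreviation smultH (infixl "\<odot>\<^sub>H" 70) where "smultH \<equiv> module.smult H"
abbreviation multH (infixl "\<otimes>\<^sub>H" 70) where "multH \<equiv> monoid.mult H"

text \<open>The shift by one makes this agree with the step \<open>n\<close> of the coradical
  filtration, as shown in \<open>hopf_fil_H\<close>.\<close>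

definition Ofil where "Ofil n = {\<alpha> \<in> carrier H. \<forall>x\<in>IG (Suc n). \<alpha> x = 0}"

lemma H_carrier: "\<alpha> \<in> carrier H \<longleftrightarrow> \<alpha> \<in> linear_maps (group_hopf G) CC & \<alpha> \<in> extensional (AG) &
  (EX n. \<forall>x\<in>IG (Suc n). \<alpha> x = 0)"
 by (simp add: dual_hopf_def dual_alg_def module.extend_def Let_def)

lemma H_ops:
 "ring.zero H = (\<lambda>x\<in>AG. 0)" "ring.add H = (%\<alpha> \<beta>. \<lambda>x\<in>AG. \<alpha> x + \<beta> x)"
 "module.smult H = (%c \<alpha>. \<lambda>x\<in>AG. c * \<alpha> x)" "monoid.one H = (\<lambda>x\<in>AG. pm_pair x (%_. 1))"
 "counit H \<alpha> = \<alpha> (pm_unit \<one>)"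
 "monoid.mult H = (%\<alpha> \<beta>. \<lambda>x\<in>AG. tensor_lift CC (%xs. \<alpha> (xs ! 0) * \<beta> (xs ! 1)) (comult (group_hopf G) x))"
 by (simp_all add: dual_hopf_def dual_alg_def module.extend_def hopf.fields_def Let_def)
  (simp add: restrict_def cong: if_cong)

lemma H_fields: "carrier H = carrier (dual_alg G)" "ring.add H = ring.add (dual_alg G)"
 "module.smult H = module.smult (dual_alg G)" "monoid.mult H = monoid.mult (dual_alg G)"
 "monoid.one H = monoid.one (dual_alg G)"
 by (simp_all add: dual_hopf_def module.extend_def Let_def)

lemma form_linear: "\<alpha> \<in> carrier H ==> \<alpha> \<in> linear_maps (group_hopf G) CC"
 by (simp add: H_carrier)

lemma form_add: "\<alpha> \<in> carrier H ==> x \<in> AG ==> y \<in> AG ==> \<alpha> (x + y) = \<alpha> x + \<alpha> y"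
 using linD(2)[OF form_linear, of \<alpha> x y] by simp

lemma form_scale: "\<alpha> \<in> carrier H ==> x \<in> AG ==> \<alpha> (pm_scale c x) = c * \<alpha> x"
 using linD(3)[OF form_linear, of \<alpha> x c] by simp

lemma form_diff: "\<alpha> \<in> carrier H ==> x \<in> AG ==> y \<in> AG ==> \<alpha> (x - y) = \<alpha> x - \<alpha> y"
 using lin_minus[OF form_linear vspace_gh vspace_CC, of \<alpha> x y] by (simp add: a_minus_gh)

lemma form_zero: "\<alpha> \<in> carrier H ==> \<alpha> 0 = 0"
 using lin_zero[OF form_linear vspace_gh vspace_CC] by simp

lemma form_pair: "\<alpha> \<in> carrier H ==> x \<in> AG ==> \<alpha> x = pm_pair x (%g. \<alpha> (pm_unit g))"
 by (rule galg_linear_eqI[OF vspace_CC form_linear]) (auto intro: linI)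

lemma form_eqI:
 assumes "\<alpha> \<in> carrier H" "\<beta> \<in> carrier H" "!!g. g \<in> carrier G ==> \<alpha> (pm_unit g) = \<beta> (pm_unit g)"
 shows "\<alpha> = \<beta>"
proof (rule extensionalityI[of _ "AG"])
 show "\<alpha> x = \<beta> x" if "x \<in> AG" for x
  by (rule galg_linear_eqI[OF vspace_CC form_linear form_linear _ that]) (use assms in auto)
qed (use assms in "auto simp: H_carrier")

lemma form_I:
 assumes "\<alpha> \<in> extensional (AG)"
  and "!!x y. x \<in> AG ==> y \<in> AG ==> \<alpha> (x + y) = \<alpha> x + \<alpha> y"
  and "!!c x. x \<in> AG ==> \<alpha> (pm_scale c x) = c * \<alpha> x"
  and "!!x. x \<in> IG (Suc n) ==> \<alpha> x = 0"
 shows "\<alpha> \<in> Ofil n"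
proof -
 have "\<alpha> \<in> linear_maps (group_hopf G) CC" using assms by (auto intro!: linI)
 then show ?thesis unfolding Ofil_def H_carrier using assms(1,4) by blast
qed

lemma O_carrier: "\<alpha> \<in> Ofil n ==> \<alpha> \<in> carrier H"
 and O_kill: "\<alpha> \<in> Ofil n ==> x \<in> IG (Suc n) ==> \<alpha> x = 0"
 by (auto simp: Ofil_def)

lemma O_mono: "m <= n ==> \<alpha> \<in> Ofil m ==> \<alpha> \<in> Ofil n"
 using aug_power_mono[of "Suc m" "Suc n"] by (auto simp: Ofil_def)

lemma O_exhaust: "\<alpha> \<in> carrier H ==> EX n. \<alpha> \<in> Ofil n"
 by (auto simp: Ofil_def H_carrier)

lemma O_exhaust2: "\<alpha> \<in> carrier H ==> \<beta> \<in> carrier H ==> EX n. \<alpha> \<in> Ofil n & \<beta> \<in> Ofil n"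
 by (meson O_exhaust O_mono max.cobounded1 max.cobounded2)

lemma O_add: "\<alpha> \<in> Ofil n ==> \<beta> \<in> Ofil n ==> \<alpha> \<oplus>\<^sub>H \<beta> \<in> Ofil n"
 unfolding H_ops by (rule form_I) (auto simp: galg_simps form_add form_scale O_carrier O_kill aug_power_galg algebra_simps)

lemma O_scale: "\<alpha> \<in> Ofil n ==> c \<odot>\<^sub>H \<alpha> \<in> Ofil n"
 unfolding H_ops by (rule form_I) (auto simp: galg_simps form_add form_scale O_carrier O_kill aug_power_galg algebra_simps)

lemma O_zero: "\<zero>\<^bsub>H\<^esub> \<in> Ofil n"
 unfolding H_ops by (rule form_I) (auto simp: galg_simps aug_power_galg)

lemma O_one: "\<one>\<^bsub>H\<^esub> \<in> Ofil 0"
 unfolding H_ops by (rule form_I) (auto simp: galg_simps aug_power_galg aug_power_1[simplified] aug_ideal_iff)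

lemma H_vals:
 "x \<in> AG ==> \<zero>\<^bsub>H\<^esub> x = 0" "x \<in> AG ==> (\<alpha> \<oplus>\<^sub>H \<beta>) x = \<alpha> x + \<beta> x"
 "x \<in> AG ==> (c \<odot>\<^sub>H \<alpha>) x = c * \<alpha> x" "x \<in> AG ==> \<one>\<^bsub>H\<^esub> x = pm_pair x (%_. 1)"
 by (simp_all add: H_ops)

lemma H_closed:
 "\<alpha> \<in> carrier H ==> \<beta> \<in> carrier H ==> \<alpha> \<oplus>\<^sub>H \<beta> \<in> carrier H"
 "\<alpha> \<in> carrier H ==> c \<odot>\<^sub>H \<alpha> \<in> carrier H" "\<zero>\<^bsub>H\<^esub> \<in> carrier H" "\<one>\<^bsub>H\<^esub> \<in> carrier H"
 using O_exhaust2 O_exhaust O_add O_scale O_zero O_one O_carrier by meson+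

lemma unit_galg: "g \<in> carrier G ==> pm_unit g \<in> AG"
 by (rule galg_simps)

lemma vspace_H: "vspace H"
proof (rule vspaceI, rule abelian_groupI)
 note v = H_vals[OF unit_galg]
 fix \<alpha> assume a: "\<alpha> \<in> carrier H"
 show "\<zero>\<^bsub>H\<^esub> \<oplus>\<^sub>H \<alpha> = \<alpha>" by (rule form_eqI) (use a in "auto simp: v intro: H_closed")
 show "\<exists>\<beta>\<in>carrier H. \<beta> \<oplus>\<^sub>H \<alpha> = \<zero>\<^bsub>H\<^esub>"
  by (rule bexI[of _ "(- 1) \<odot>\<^sub>H \<alpha>"], rule form_eqI) (use a in "auto simp: v intro: H_closed")
 show "1 \<odot>\<^sub>H \<alpha> = \<alpha>" by (rule form_eqI) (use a in "auto simp: v intro: H_closed")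
 show "(c + d) \<odot>\<^sub>H \<alpha> = c \<odot>\<^sub>H \<alpha> \<oplus>\<^sub>H d \<odot>\<^sub>H \<alpha>" for c d
  by (rule form_eqI) (use a in "auto simp: v algebra_simps intro: H_closed")
 show "(c * d) \<odot>\<^sub>H \<alpha> = c \<odot>\<^sub>H (d \<odot>\<^sub>H \<alpha>)" for c d
  by (rule form_eqI) (use a in "auto simp: v algebra_simps intro: H_closed")
 fix \<beta> assume b: "\<beta> \<in> carrier H"
 show "\<alpha> \<oplus>\<^sub>H \<beta> = \<beta> \<oplus>\<^sub>H \<alpha>"
  by (rule form_eqI) (use a b in "auto simp: v algebra_simps intro: H_closed")
 show "c \<odot>\<^sub>H (\<alpha> \<oplus>\<^sub>H \<beta>) = c \<odot>\<^sub>H \<alpha> \<oplus>\<^sub>H c \<odot>\<^sub>H \<beta>" for c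
  by (rule form_eqI) (use a b in "auto simp: v algebra_simps intro: H_closed")
 fix \<gamma> assume "\<gamma> \<in> carrier H"
 then show "\<alpha> \<oplus>\<^sub>H \<beta> \<oplus>\<^sub>H \<gamma> = \<alpha> \<oplus>\<^sub>H (\<beta> \<oplus>\<^sub>H \<gamma>)"
  by (intro form_eqI) (use a b in "auto simp: v algebra_simps intro: H_closed")
qed (auto intro: H_closed)

sublocale Hv: vspace H by (rule vspace_H)

lemma subspace_O: "subspace H (Ofil n)"
 by (auto simp: subspace_def O_carrier O_zero O_add O_scale)

lemma H_minus_val: "\<alpha> \<in> carrier H ==> \<beta> \<in> carrier H ==> x \<in> AG ==> (\<alpha> \<ominus>\<^bsub>H\<^esub> \<beta>) x = \<alpha> x - \<beta> x"
 using H_vals(2)[of x \<alpha> "(- 1) \<odot>\<^sub>H \<beta>"] H_vals(3)[of x "-1" \<beta>] by (simp add: a_minus_def flip: Hv.smult_m1)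

definition evl :: "('a \<Rightarrow>\<^sub>0 complex) => (('a \<Rightarrow>\<^sub>0 complex) => complex) => complex" where
 "evl x \<alpha> = \<alpha> x"

lemma evl_linear: "x \<in> AG ==> evl x \<in> linear_maps H CC"
 by (rule linI) (simp_all add: evl_def H_vals)

lemma H_finsum_val: "x \<in> AG ==> f \<in> S \<rightarrow> carrier H ==> (finsum H f S) x = (\<Sum>i\<in>S. f i x)"
 using lin_finsum[OF evl_linear vspace_H vspace_CC, of x f S] by (simp add: evl_def finsum_CC)

subsection \<open>The product\<close>

text \<open>The tensor product of the forms, as a form on C[G x G].\<close>

definition pair2 where "pair2 \<alpha> \<beta> y = pm_pair y (%(g, h). \<alpha> (pm_unit g) * \<beta> (pm_unit h))"

lemma pair2_kron: "\<alpha> \<in> carrier H ==> \<beta> \<in> carrier H ==> u \<in> AG ==> v \<in> AG ==> pair2 \<alpha> \<beta> (kron u v) = \<alpha> u * \<beta> v"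
 unfolding pair2_def by (simp add: pm_pair_kron pm_pair_mult_right pm_pair_mult_right' form_pair[of \<alpha> u] form_pair[of \<beta> v])

text \<open>In a tensor u tensor v of total degree i + j + 1 either u has degree above i or v has
  degree above j, so one of the forms vanishes; \<open>aug_power_GG_subset\<close> reduces to this
  case.\<close>

lemma pair2_kill:
 assumes a: "\<alpha> \<in> Ofil i" and b: "\<beta> \<in> Ofil j" and y: "y \<in> aug_power GG (Suc (i + j))"
 shows "pair2 \<alpha> \<beta> y = 0"
proof -
 have "aug_power GG (Suc (i + j)) <= {y \<in> galg GG. pair2 \<alpha> \<beta> y = 0}"
 proof (rule aug_power_GG_subset)
  show "subspace (group_hopf GG) {y \<in> galg GG. pair2 \<alpha> \<beta> y = 0}"
   by (auto simp: subspace_def galg_simps pair2_def)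
  fix k u v assume k: "k <= Suc (i + j)" "u \<in> IG k" "v \<in> IG (Suc (i + j) - k)"
  have "\<alpha> u = 0 \<or> \<beta> v = 0"
  proof (cases "Suc i <= k")
   case True
   then show ?thesis using O_kill[OF a] aug_power_mono k(2) by blast
  next
   case False
   then have "Suc j <= Suc (i + j) - k" by simp
   then show ?thesis using O_kill[OF b] aug_power_mono k(3) by blast
  qed
  then show "kron u v \<in> {y \<in> galg GG. pair2 \<alpha> \<beta> y = 0}"
   using k aug_power_galg a b O_carrier by (auto simp: kron_closed pair2_kron)
 qed
 with y show ?thesis by blast
qed

lemma H_mult_val:
 assumes a: "\<alpha> \<in> carrier H" and b: "\<beta> \<in> carrier H" and x: "x \<in> AG"
 shows "(\<alpha> \<otimes>\<^sub>H \<beta>) x = pair2 \<alpha> \<beta> (diag x)"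
proof -
 have lin: "\<alpha> \<in> linear_maps (group_alg G) CC" "\<beta> \<in> linear_maps (group_alg G) CC"
  using form_linear a b by (simp_all add: linear_maps_def group_alg_def galg_def)
 note D = linD[OF lin(1)] linD[OF lin(2)]
 have m: "multilin (group_alg G) CC 2 (%xs. \<alpha> (xs ! 0) * \<beta> (xs ! 1))"
  by (rule multilin_2I[OF vspace_CC, where f = "%x y. \<alpha> x * \<beta> y"]) (simp_all add: D algebra_simps)
 note tl = tensor_lift_linear[OF vspace_ga vspace_CC m]
 have "tensor_lift CC (%xs. \<alpha> (xs ! 0) * \<beta> (xs ! 1)) (comult (group_hopf G) x) = pair2 \<alpha> \<beta> (diag x)"
 proof (rule galg_linear_eqI[OF vspace_CC lin_comp[OF comult_group_linear tl] _ _ x])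
  show "(%x. pair2 \<alpha> \<beta> (diag x)) \<in> linear_maps (group_hopf G) CC"
   by (rule linI) (simp_all add: pair2_def diag_def)
  fix g assume g: "g \<in> carrier G"
  then show "tensor_lift CC (%xs. \<alpha> (xs ! 0) * \<beta> (xs ! 1)) (comult (group_hopf G) (pm_unit g)) = pair2 \<alpha> \<beta> (diag (pm_unit g))"
   using tensor_lift_pure[OF vspace_ga vspace_CC m, of "[pm_unit g, pm_unit g]"]
   by (simp add: comult_group_unit carrier_ga unit_galg pair2_def diag_def del: group_hopf_simps(8))
 qed
 then show ?thesis using x by (simp add: H_ops)
qed

text \<open>Group elements are group-like, so the convolution product is pointwise on them. Together
  with \<open>form_eqI\<close> this reduces the algebra axioms to identities of complex
  numbers.\<close>

lemma H_mult_unit: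
 "\<alpha> \<in> carrier H ==> \<beta> \<in> carrier H ==> g \<in> carrier G ==> (\<alpha> \<otimes>\<^sub>H \<beta>) (pm_unit g) = \<alpha> (pm_unit g) * \<beta> (pm_unit g)"
 by (simp add: H_mult_val unit_galg pair2_def diag_def)

lemma O_mult:
 assumes a: "\<alpha> \<in> Ofil i" and b: "\<beta> \<in> Ofil j"
 shows "\<alpha> \<otimes>\<^sub>H \<beta> \<in> Ofil (i + j)"
proof -
 note ab = O_carrier[OF a] O_carrier[OF b]
 show ?thesis
 proof (rule form_I)
  show "\<alpha> \<otimes>\<^sub>H \<beta> \<in> extensional (AG)" by (simp add: H_ops)
  show "(\<alpha> \<otimes>\<^sub>H \<beta>) x = 0" if "x \<in> IG (Suc (i + j))" for x
   using pair2_kill[OF a b] dg.map_aug_power[OF that] aug_power_galg[OF that] by (simp add: H_mult_val ab diag_def)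
 qed (simp_all add: H_mult_val ab galg_simps pair2_def diag_def)
qed

lemma H_mult_closed: "\<alpha> \<in> carrier H ==> \<beta> \<in> carrier H ==> \<alpha> \<otimes>\<^sub>H \<beta> \<in> carrier H"
 using O_exhaust O_mult O_carrier by meson

lemma calg_H: "calg H"
proof (intro calg.intro calg_axioms.intro)
 note v = H_vals[OF unit_galg] H_mult_unit and c = H_closed H_mult_closed
 show "ring H"
 proof (rule ringI[OF Hv.abelian_group_axioms monoidI])
  fix \<alpha> \<beta> \<gamma> assume a: "\<alpha> \<in> carrier H" and b: "\<beta> \<in> carrier H" and d: "\<gamma> \<in> carrier H"
  show "\<alpha> \<otimes>\<^sub>H \<beta> \<otimes>\<^sub>H \<gamma> = \<alpha> \<otimes>\<^sub>H (\<beta> \<otimes>\<^sub>H \<gamma>)"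
   by (rule form_eqI) (simp_all add: a b d v c)
  show "(\<alpha> \<oplus>\<^sub>H \<beta>) \<otimes>\<^sub>H \<gamma> = \<alpha> \<otimes>\<^sub>H \<gamma> \<oplus>\<^sub>H \<beta> \<otimes>\<^sub>H \<gamma>"
   "\<gamma> \<otimes>\<^sub>H (\<alpha> \<oplus>\<^sub>H \<beta>) = \<gamma> \<otimes>\<^sub>H \<alpha> \<oplus>\<^sub>H \<gamma> \<otimes>\<^sub>H \<beta>"
   by (rule form_eqI; simp add: a b d v c algebra_simps)+
 next
  fix \<alpha> assume a: "\<alpha> \<in> carrier H"
  show "\<one>\<^bsub>H\<^esub> \<otimes>\<^sub>H \<alpha> = \<alpha>" "\<alpha> \<otimes>\<^sub>H \<one>\<^bsub>H\<^esub> = \<alpha>" by (rule form_eqI; simp add: a v c)+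
 qed (simp_all add: c)
 fix \<alpha> \<beta> k assume a: "\<alpha> \<in> carrier H" and b: "\<beta> \<in> carrier H"
 show "(k \<odot>\<^sub>H \<alpha>) \<otimes>\<^sub>H \<beta> = k \<odot>\<^sub>H (\<alpha> \<otimes>\<^sub>H \<beta>)" "\<alpha> \<otimes>\<^sub>H (k \<odot>\<^sub>H \<beta>) = k \<odot>\<^sub>H (\<alpha> \<otimes>\<^sub>H \<beta>)"
  by (rule form_eqI; simp add: a b v c)+
qed (rule vspace_H)

subsection \<open>Translates\<close>

text \<open>Slices of the function (x, y) -> alpha(x y): right translates become first tensor
  factors of the coproduct, and the reproducing formula is applied to left translates.\<close>

definition rtr where "rtr \<alpha> h = (\<lambda>x\<in>AG. \<alpha> (gmul G x h))"
definition ltr where "ltr \<alpha> h = (\<lambda>x\<in>AG. \<alpha> (gmul G h x))"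

lemma rtr_O: "\<alpha> \<in> Ofil n ==> h \<in> AG ==> rtr \<alpha> h \<in> Ofil n"
 unfolding rtr_def
 by (rule form_I) (auto simp: galg_simps pm_conv_add_left pm_conv_scale_left form_add form_scale O_carrier gmul_closed
  aug_power_galg O_kill aug_power_rmult)

lemma ltr_O: "\<alpha> \<in> Ofil n ==> h \<in> AG ==> ltr \<alpha> h \<in> Ofil n"
 unfolding ltr_def
 by (rule form_I) (auto simp: galg_simps pm_conv_add_right pm_conv_scale_right form_add form_scale O_carrier gmul_closed
  aug_power_galg O_kill aug_power_lmult)

end

locale fg_group = group_square +
 assumes fg: "finitely_generated G"
begin

text \<open>A finite set spans the group algebra modulo \<open>IG (Suc N)\<close>; the group
  elements in the supports of its members suffice to determine a form that kills
  \<open>IG (Suc N)\<close>.\<close>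

lemma O_finite_separating: "EX B. finite B & B <= carrier G &
  (\<forall>\<alpha>\<in>Ofil N. (\<forall>g\<in>B. \<alpha> (pm_unit g) = 0) --> \<alpha> = \<zero>\<^bsub>H\<^esub>)"
proof -
 obtain B where B: "finite B & B <= AG &
  (ALL T. subspace (group_hopf G) T & B <= T & IG (Suc N) <= T --> AG <= T)"
  using galg_finite_span[OF fg, of "Suc N"] ..
 let ?B = "\<Union>x\<in>B. pkeys x"
 show ?thesis
 proof (intro exI[of _ ?B] conjI ballI impI)
  show "finite ?B" using B by simp
  show "?B <= carrier G" using B by (auto simp: galg_def)
  fix \<alpha> assume a: "\<alpha> \<in> Ofil N" and z: "\<forall>g\<in>?B. \<alpha> (pm_unit g) = 0"
  have ac: "\<alpha> \<in> carrier H" by (rule O_carrier[OF a])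
  let ?T = "{x \<in> AG. \<alpha> x = 0}"
  have "subspace (group_hopf G) ?T"
   using ac by (auto simp: subspace_def galg_simps form_add form_scale form_zero)
  moreover have "B <= ?T"
  proof
   fix x assume x: "x \<in> B"
   then have xg: "x \<in> AG" using B by auto
   have "pm_pair x (%g. \<alpha> (pm_unit g)) = pm_pair x (%g. 0)" by (rule pm_pair_cong) (use x z in auto)
   then show "x \<in> ?T" using xg form_pair[OF ac xg] by simp
  qed
  moreover have "IG (Suc N) <= ?T" using O_kill[OF a] aug_power_galg by auto
  ultimately have "AG <= ?T" using B by blast
  then show "\<alpha> = \<zero>\<^bsub>H\<^esub>"
   by (intro form_eqI[OF ac H_closed(3)]) (use unit_galg in "auto simp: H_vals")
 qed
qed

text \<open>Gaussian elimination on evaluations at group elements. When the formula for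
  \<open>B\<close> fails at a further element \<open>g\<close>, the failure itself supplies a form
  that vanishes on \<open>B\<close> but not at \<open>g\<close>.\<close>

lemma O_elimination:
 assumes "finite B" "B <= carrier G"
 shows "EX n (h :: nat => 'a) b. (ALL i<n. h i \<in> carrier G & b i \<in> Ofil N) &
  (\<forall>\<alpha>\<in>Ofil N. \<forall>g\<in>B. \<alpha> (pm_unit g) = (\<Sum>i<n. \<alpha> (pm_unit (h i)) * b i (pm_unit g)))"
 using assms
proof (induction B rule: finite_induct)
 case empty
 then show ?case by (intro exI[of _ 0]) simp
next
 case (insert g B)
 then have "B <= carrier G" by simp
 from insert.IH[OF this] obtain n :: nat and h b where "(ALL i<n. h i \<in> carrier G & b i \<in> Ofil N) &
  (\<forall>\<alpha>\<in>Ofil N. \<forall>g\<in>B. \<alpha> (pm_unit g) = (\<Sum>i<n. \<alpha> (pm_unit (h i)) * b i (pm_unit g)))" by (elim exE)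
 note nb = conjunct1[OF this] conjunct2[OF this]
 have gc: "g \<in> carrier G" using insert by simp
 show ?case
 proof (cases "\<forall>\<alpha>\<in>Ofil N. \<alpha> (pm_unit g) = (\<Sum>i<n. \<alpha> (pm_unit (h i)) * b i (pm_unit g))")
  case True
  then show ?thesis using nb by (intro exI[of _ n] exI[of _ h] exI[of _ b]) auto
 next
  case False
  then obtain \<beta> where \<beta>: "\<beta> \<in> Ofil N" "\<beta> (pm_unit g) ~= (\<Sum>i<n. \<beta> (pm_unit (h i)) * b i (pm_unit g))" by blast
  \<comment> \<open>The defect of the formula for \<open>\<beta>\<close>: zero on \<open>B\<close>
    by the induction hypothesis, nonzero at \<open>g\<close> by the choice of
    \<open>\<beta>\<close>.\<close>
  define \<rho> where "\<rho> = \<beta> \<ominus>\<^bsub>H\<^esub> (\<Oplus>\<^bsub>H\<^esub>i\<in>{..<n}. \<beta> (pm_unit (h i)) \<odot>\<^sub>H b i)"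
  have bc: "b i \<in> carrier H" if "i < n" for i using nb(1) that O_carrier by blast
  have sc: "(\<Oplus>\<^bsub>H\<^esub>i\<in>{..<n}. \<beta> (pm_unit (h i)) \<odot>\<^sub>H b i) \<in> Ofil N"
   by (rule Hv.subspace_finsum[OF subspace_O]) (use nb(1) O_scale in auto)
  have \<rho>O: "\<rho> \<in> Ofil N" unfolding \<rho>_def by (rule Hv.subspace_minus[OF subspace_O \<beta>(1) sc])
  have \<rho>v: "\<rho> (pm_unit k) = \<beta> (pm_unit k) - (\<Sum>i<n. \<beta> (pm_unit (h i)) * b i (pm_unit k))" if "k \<in> carrier G" for k
  proof -
   have "(\<Oplus>\<^bsub>H\<^esub>i\<in>{..<n}. \<beta> (pm_unit (h i)) \<odot>\<^sub>H b i) (pm_unit k) = (\<Sum>i<n. (\<beta> (pm_unit (h i)) \<odot>\<^sub>H b i) (pm_unit k))"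
    by (rule H_finsum_val) (use that bc in "auto simp: unit_galg intro: H_closed")
   then show ?thesis
    unfolding \<rho>_def by (simp add: H_minus_val[OF O_carrier[OF \<beta>(1)] O_carrier[OF sc]] unit_galg that H_vals)
  qed
  define c where "c = \<rho> (pm_unit g)"
  have c: "c ~= 0" using \<beta>(2) \<rho>v[OF gc] by (simp add: c_def)
  define \<tau> where "\<tau> = (1 / c) \<odot>\<^sub>H \<rho>"
  have \<tau>O: "\<tau> \<in> Ofil N" unfolding \<tau>_def by (rule O_scale[OF \<rho>O])
  have \<tau>g: "\<tau> (pm_unit g) = 1" using c gc by (simp add: \<tau>_def H_vals unit_galg flip: c_def)
  have \<tau>B: "\<tau> (pm_unit k) = 0" if "k \<in> B" for k
  proof -
   have kc: "k \<in> carrier G" using that insert by auto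
   have "\<rho> (pm_unit k) = 0" using \<rho>v[OF kc] nb(2) \<beta>(1) that by simp
   then show ?thesis using kc by (simp add: \<tau>_def H_vals unit_galg)
  qed
  let ?h = "h(n := g)"
  \<comment> \<open>The old forms are corrected so that they vanish at \<open>g\<close>; there the
    new pair alone contributes.\<close>
  let ?b = "%i. if i = n then \<tau> else b i \<ominus>\<^bsub>H\<^esub> (b i (pm_unit g)) \<odot>\<^sub>H \<tau>"
  have b': "ALL i<Suc n. ?h i \<in> carrier G & ?b i \<in> Ofil N"
   using nb(1) gc \<tau>O Hv.subspace_minus[OF subspace_O _ O_scale[OF \<tau>O]] by (auto simp: less_Suc_eq)
  have bv: "?b i (pm_unit k) = b i (pm_unit k) - b i (pm_unit g) * \<tau> (pm_unit k)" if "i < n" "k \<in> carrier G" for i k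
   using that H_minus_val[OF bc[OF that(1)] H_closed(2)[OF O_carrier[OF \<tau>O]]] by (simp add: unit_galg H_vals)
  have "\<alpha> (pm_unit k) = (\<Sum>i<Suc n. \<alpha> (pm_unit (?h i)) * ?b i (pm_unit k))"
   if \<alpha>: "\<alpha> \<in> Ofil N" and k: "k \<in> insert g B" for \<alpha> k
  proof -
   have kc: "k \<in> carrier G" using k insert by auto
   have "(\<Sum>i<Suc n. \<alpha> (pm_unit (?h i)) * ?b i (pm_unit k)) =
    \<alpha> (pm_unit g) * \<tau> (pm_unit k) + (\<Sum>i<n. \<alpha> (pm_unit (h i)) * (b i (pm_unit k) - b i (pm_unit g) * \<tau> (pm_unit k)))"
   proof -
    have "(\<Sum>i<n. \<alpha> (pm_unit (?h i)) * ?b i (pm_unit k)) =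
      (\<Sum>i<n. \<alpha> (pm_unit (h i)) * (b i (pm_unit k) - b i (pm_unit g) * \<tau> (pm_unit k)))"
     by (rule sum.cong) (use bv kc in auto)
    then show ?thesis by (simp add: add.commute)
   qed
   also have "... = (\<Sum>i<n. \<alpha> (pm_unit (h i)) * b i (pm_unit k)) +
     (\<alpha> (pm_unit g) - (\<Sum>i<n. \<alpha> (pm_unit (h i)) * b i (pm_unit g))) * \<tau> (pm_unit k)"
    by (simp add: right_diff_distrib left_diff_distrib sum_subtractf sum_distrib_right mult.assoc)
   also have "... = \<alpha> (pm_unit k)"
   proof (cases "k = g")
    case True
    then show ?thesis by (simp add: \<tau>g)
   next
    case False
    then have "k \<in> B" using k by simp
    then show ?thesis using nb(2) \<alpha> \<tau>B by simp
   qed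
   finally show ?thesis by simp
  qed
  then show ?thesis using b' by (intro exI[of _ "Suc n"] exI[of _ ?h] exI[of _ ?b]) blast
 qed
qed

text \<open>The difference of the two sides vanishes on a separating set. Evaluations at finitely
  many group elements thus serve as coordinates on \<open>Ofil N\<close>.\<close>

lemma O_reproducing: "EX (n :: nat) h b. (ALL i<n. h i \<in> carrier G) & (ALL i<n. b i \<in> Ofil N) &
  (\<forall>\<alpha>\<in>Ofil N. \<alpha> = (\<Oplus>\<^bsub>H\<^esub>i\<in>{..<n}. \<alpha> (pm_unit (h i)) \<odot>\<^sub>H b i))"
proof -
 obtain B where B: "finite B" "B <= carrier G"
  "\<forall>\<alpha>\<in>Ofil N. (\<forall>g\<in>B. \<alpha> (pm_unit g) = 0) --> \<alpha> = \<zero>\<^bsub>H\<^esub>"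
  using O_finite_separating[of N] by (elim exE conjE) (rule that)
 from O_elimination[OF B(1,2), of N] obtain n :: nat and h b where "(ALL i<n. h i \<in> carrier G & b i \<in> Ofil N) &
  (\<forall>\<alpha>\<in>Ofil N. \<forall>g\<in>B. \<alpha> (pm_unit g) = (\<Sum>i<n. \<alpha> (pm_unit (h i)) * b i (pm_unit g)))" by (elim exE)
 note nb = conjunct1[OF this] conjunct2[OF this]
 show ?thesis
 proof (intro exI[of _ n] exI[of _ h] exI[of _ b] conjI ballI)
  show "ALL i<n. h i \<in> carrier G" "ALL i<n. b i \<in> Ofil N" using nb(1) by auto
  fix \<alpha> assume a: "\<alpha> \<in> Ofil N"
  let ?s = "\<Oplus>\<^bsub>H\<^esub>i\<in>{..<n}. \<alpha> (pm_unit (h i)) \<odot>\<^sub>H b i"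
  have s: "?s \<in> Ofil N"
   by (rule Hv.subspace_finsum[OF subspace_O]) (use nb(1) O_scale in auto)
  have sv: "?s (pm_unit g) = (\<Sum>i<n. \<alpha> (pm_unit (h i)) * b i (pm_unit g))" if "g \<in> carrier G" for g
   by (subst H_finsum_val[OF unit_galg[OF that]])
    (use that nb(1) O_carrier in "auto simp: unit_galg H_vals intro: H_closed")
  have "\<alpha> \<ominus>\<^bsub>H\<^esub> ?s = \<zero>\<^bsub>H\<^esub>"
  proof (rule B(3)[rule_format, OF Hv.subspace_minus[OF subspace_O a s]])
   fix g assume g: "g \<in> B"
   then have gc: "g \<in> carrier G" using B(2) by blast
   show "(\<alpha> \<ominus>\<^bsub>H\<^esub> ?s) (pm_unit g) = 0"
    unfolding H_minus_val[OF O_carrier[OF a] O_carrier[OF s] unit_galg[OF gc]] sv[OF gc]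
    using bspec[OF bspec[OF nb(2) a] g] by (simp only: diff_self)
  qed
  then show "\<alpha> = ?s" using Hv.minus_eq_zero_iff[OF O_carrier[OF a] O_carrier[OF s]] by simp
 qed
qed

lemma O_finite_bound:
 assumes "finite X" "X <= carrier H"
 shows "EX N. X <= Ofil N"
 using assms
proof (induction X rule: finite_induct)
 case (insert \<alpha> X)
 then obtain M N where "X <= Ofil M" "\<alpha> \<in> Ofil N" using O_exhaust by blast
 then have "insert \<alpha> X <= Ofil (max M N)" using O_mono[of M "max M N"] O_mono[of N "max M N"] by auto
 then show ?case ..
qed simp

definition EG where "EG = (%g. evl (pm_unit g)) ` carrier G"

lemma reproducing_H: "reproducing H EG"
 unfolding reproducing_def
proof (intro conjI allI impI)
 show "EG <= linear_maps H CC" by (auto simp: EG_def intro: evl_linear unit_galg)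
 fix X assume "finite X & X <= carrier H"
 then obtain N where N: "X <= Ofil N" using O_finite_bound by blast
 obtain n :: nat and h b where nb': "ALL i<n. h i \<in> carrier G" "ALL i<n. b i \<in> Ofil N"
  "\<forall>\<alpha>\<in>Ofil N. \<alpha> = (\<Oplus>\<^bsub>H\<^esub>i\<in>{..<n}. \<alpha> (pm_unit (h i)) \<odot>\<^sub>H b i)"
  using O_reproducing[of N] by (elim exE conjE) (rule that)
 note nb = nb'[rule_format]
 show "EX (I :: nat set) e b. finite I & (\<forall>i\<in>I. e i \<in> EG & b i \<in> carrier H) &
   (\<forall>v\<in>X. v = (\<Oplus>\<^bsub>H\<^esub>i\<in>I. e i v \<odot>\<^sub>H b i))"
 proof (intro exI[of _ "{..<n}"] exI[of _ "%i. evl (pm_unit (h i))"] exI[of _ b] conjI ballI)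
  fix v assume "v \<in> X"
  then show "v = (\<Oplus>\<^bsub>H\<^esub>i\<in>{..<n}. evl (pm_unit (h i)) v \<odot>\<^sub>H b i)"
   unfolding evl_def using N by (intro nb(3)) auto
 qed (use nb(1,2) O_carrier in "auto simp: EG_def")
qed

text \<open>Slotwise evaluation of a tensor of forms at elements of the group algebra. By
  \<open>evs_eqI\<close>, tuples of group elements already separate tensors.\<close>

definition evs where "evs xs = tensor_lift CC (eval_prod (map evl xs))"

lemma evl_list: "set xs <= AG ==> set (map evl xs) <= linear_maps H CC"
 using evl_linear by auto

lemma multilin_evs: "set xs <= AG ==> length xs = n ==> multilin H CC n (eval_prod (map evl xs))"
 by (rule multilin_eval_prod[OF evl_list _ vspace_H]) auto

lemma evs_linear: "set xs <= AG ==> length xs = n ==> evs xs \<in> linear_maps (tensor_pow H n) CC"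
 unfolding evs_def by (rule tensor_lift_linear[OF vspace_H vspace_CC multilin_evs])

lemma evs_pure: "set xs <= AG ==> length xs = n ==> length \<alpha>s = n ==> set \<alpha>s <= carrier H ==>
  evs xs (pure_tensor H \<alpha>s) = eval_prod (map evl xs) \<alpha>s"
 unfolding evs_def by (rule tensor_lift_pure[OF vspace_H vspace_CC multilin_evs])

lemma evs_eqI:
 assumes s: "s \<in> carrier (tensor_pow H n)" and t: "t \<in> carrier (tensor_pow H n)"
  and eq: "!!gs. length gs = n ==> set gs <= carrier G ==> evs (map pm_unit gs) s = evs (map pm_unit gs) t"
 shows "s = t"
proof -
 interpret T: vspace "tensor_pow H n" by (rule vspace_tensor_pow[OF vspace_H])
 have "s \<ominus>\<^bsub>tensor_pow H n\<^esub> t = \<zero>\<^bsub>tensor_pow H n\<^esub>"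
 proof (rule tensor_eq_zeroI[OF vspace_H reproducing_H T.M.minus_closed[OF s t]])
  fix es assume es: "length es = n" "set es <= EG"
  then have "EX gs. length gs = n & set gs <= carrier G & es = map (%g. evl (pm_unit g)) gs"
  proof (induction es arbitrary: n)
   case (Cons e es)
   then obtain gs where gs: "length gs = length es" "set gs <= carrier G" "es = map (%g. evl (pm_unit g)) gs" by auto
   obtain g where "g \<in> carrier G" "e = evl (pm_unit g)" using Cons by (auto simp: EG_def)
   then show ?case using gs Cons by (intro exI[of _ "g # gs"]) auto
  qed simp
  then obtain gs where gs: "length gs = n" "set gs <= carrier G" "es = map evl (map pm_unit gs)" by (auto simp: comp_def)
  have gg: "set (map pm_unit gs) <= AG" "length (map pm_unit gs) = n" using gs unit_galg by auto
  show "tensor_lift CC (eval_prod es) (s \<ominus>\<^bsub>tensor_pow H n\<^esub> t) = 0"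
   using lin_minus[OF evs_linear[OF gg] T.vspace_axioms vspace_CC s t] eq[OF gs(1,2)]
   unfolding evs_def gs(3) by simp
 qed
 then show ?thesis using T.minus_eq_zero_iff[OF s t] by simp
qed

section \<open>The coproduct of the restricted dual\<close>

subsection \<open>The coproduct\<close>

lemma eval_prod_2: "eval_prod [e, f] = (%xs. e (xs ! 0) * f (xs ! 1))"
 by (rule ext) (simp add: eval_prod_def numeral_2_eq_2)

lemma evs_2: "evs [x, y] = tensor_lift CC (%\<beta>s. (\<beta>s ! 0) x * (\<beta>s ! 1) y)"
 by (simp add: evs_def eval_prod_2 evl_def)

lemma H_tensor: "tensor_pow (dual_alg G) n = tensor_pow H n"
 by (rule tensor_cong_fields(1)) (simp_all add: H_fields)

lemma comult_H_eq: "comult H \<alpha> = (THE t. t \<in> carrier (tensor_pow H 2) &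
  (\<forall>x\<in>AG. \<forall>y\<in>AG. evs [x, y] t = \<alpha> (gmul G x y)))"
 unfolding H_tensor[symmetric] evs_2
 by (simp add: dual_hopf_def module.extend_def hopf.fields_def Let_def)

text \<open>With the \<open>h\<close> and \<open>b\<close> of \<open>O_reproducing\<close>, the
  tensor with terms (x -> alpha(x h_i)) tensor b_i takes the value alpha(x y) at (x, y): this is the
  reproducing formula for y -> alpha(x y). Uniqueness is \<open>evs_eqI\<close>. The last claim
  keeps both factors in the same \<open>Ofil N\<close>, so that one truncation order serves them
  all.\<close>

lemma comult_H:
 assumes a: "\<alpha> \<in> carrier H"
 shows "comult H \<alpha> \<in> carrier (tensor_pow H 2)"
  and "x \<in> AG ==> y \<in> AG ==> evs [x, y] (comult H \<alpha>) = \<alpha> (gmul G x y)"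
  and "\<alpha> \<in> Ofil N ==> EX (n :: nat) \<beta> \<gamma>. (ALL i<n. \<beta> i \<in> Ofil N & \<gamma> i \<in> Ofil N) &
    comult H \<alpha> = (\<Oplus>\<^bsub>tensor_pow H 2\<^esub>i\<in>{..<n}. pure_tensor H [\<beta> i, \<gamma> i])"
proof -
 interpret T: vspace "tensor_pow H 2" by (rule vspace_tensor_pow[OF vspace_H])
 have main: "EX t n \<beta> \<gamma>. (ALL i<(n::nat). \<beta> i \<in> Ofil N & \<gamma> i \<in> Ofil N) & t = (\<Oplus>\<^bsub>tensor_pow H 2\<^esub>i\<in>{..<n}. pure_tensor H [\<beta> i, \<gamma> i]) &
   t \<in> carrier (tensor_pow H 2) & (\<forall>x\<in>AG. \<forall>y\<in>AG. evs [x, y] t = \<alpha> (gmul G x y))" if aN: "\<alpha> \<in> Ofil N" for N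
 proof -
  obtain n :: nat and h b where nb': "ALL i<n. h i \<in> carrier G" "ALL i<n. b i \<in> Ofil N"
   "\<forall>\<alpha>\<in>Ofil N. \<alpha> = (\<Oplus>\<^bsub>H\<^esub>i\<in>{..<n}. \<alpha> (pm_unit (h i)) \<odot>\<^sub>H b i)"
   using O_reproducing[of N] by (elim exE conjE) (rule that)
  note nb = nb'[rule_format]
  let ?\<beta> = "%i. rtr \<alpha> (pm_unit (h i))"
  let ?t = "\<Oplus>\<^bsub>tensor_pow H 2\<^esub>i\<in>{..<n}. pure_tensor H [?\<beta> i, b i]"
  have \<beta>: "?\<beta> i \<in> Ofil N" if "i < n" for i by (rule rtr_O[OF aN unit_galg[OF nb(1)[OF that]]])
  have pc: "pure_tensor H [?\<beta> i, b i] \<in> carrier (tensor_pow H 2)" if "i < n" for i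
   by (rule pure_tensor_carrier) (use \<beta>[OF that] nb(2)[OF that] O_carrier in auto)
  have "evs [x, y] ?t = \<alpha> (gmul G x y)" if x: "x \<in> AG" and y: "y \<in> AG" for x y
  proof -
   have xy: "set [x, y] <= AG" "length [x, y] = 2" using x y by auto
   have "evs [x, y] ?t = (\<Sum>i<n. evs [x, y] (pure_tensor H [?\<beta> i, b i]))"
    using lin_finsum[OF evs_linear[OF xy] T.vspace_axioms vspace_CC, of "%i. pure_tensor H [?\<beta> i, b i]" "{..<n}"]
     pc by (simp add: finsum_CC)
   also have "... = (\<Sum>i<n. \<alpha> (gmul G x (pm_unit (h i))) * b i y)"
   proof (rule sum.cong[OF refl])
    fix i assume "i \<in> {..<n}"
    then have i: "i < n" by simp
    have "evs [x, y] (pure_tensor H [?\<beta> i, b i]) = eval_prod (map evl [x, y]) [?\<beta> i, b i]"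
     by (rule evs_pure[OF xy]) (use \<beta>[OF i] nb(2)[OF i] O_carrier in auto)
    then show "evs [x, y] (pure_tensor H [?\<beta> i, b i]) = \<alpha> (gmul G x (pm_unit (h i))) * b i y"
     using x by (simp add: evl_def rtr_def)
   qed
   also have "... = (\<Oplus>\<^bsub>H\<^esub>i\<in>{..<n}. ltr \<alpha> x (pm_unit (h i)) \<odot>\<^sub>H b i) y"
    by (subst H_finsum_val[OF y]) (use nb(1,2) O_carrier y in "auto simp: H_vals ltr_def unit_galg intro!: H_closed sum.cong")
   also have "... = ltr \<alpha> x y" by (simp flip: nb(3)[OF ltr_O[OF aN x]])
   finally show ?thesis using y by (simp add: ltr_def)
  qed
  moreover have "?t \<in> carrier (tensor_pow H 2)" using pc by (intro T.M.finsum_closed) auto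
  ultimately show ?thesis using \<beta> nb(2) by (intro exI[of _ ?t] exI[of _ n] exI[of _ ?\<beta>] exI[of _ b]) blast
 qed
 have unique: "s = t" if "s \<in> carrier (tensor_pow H 2)" "\<forall>x\<in>AG. \<forall>y\<in>AG. evs [x, y] s = \<alpha> (gmul G x y)"
  "t \<in> carrier (tensor_pow H 2)" "\<forall>x\<in>AG. \<forall>y\<in>AG. evs [x, y] t = \<alpha> (gmul G x y)" for s t
 proof (rule evs_eqI[OF that(1,3)])
  fix gs assume "length gs = 2" "set gs <= carrier G"
  then obtain g h where "gs = [g, h]" "g \<in> carrier G" "h \<in> carrier G" by (auto simp: length_Suc_conv numeral_2_eq_2)
  then show "evs (map pm_unit gs) s = evs (map pm_unit gs) t" using that(2,4) unit_galg by simp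
 qed
 have eq: "comult H \<alpha> = t" if "t \<in> carrier (tensor_pow H 2)" "\<forall>x\<in>AG. \<forall>y\<in>AG. evs [x, y] t = \<alpha> (gmul G x y)" for t
  unfolding comult_H_eq
 proof (rule the_equality, rule conjI[OF that])
  fix s assume "s \<in> carrier (tensor_pow H 2) & (\<forall>x\<in>AG. \<forall>y\<in>AG. evs [x, y] s = \<alpha> (gmul G x y))"
  then show "s = t" by (elim conjE) (rule unique[OF _ _ that])
 qed
 obtain M where "\<alpha> \<in> Ofil M" using O_exhaust[OF a] ..
 from main[OF this] obtain t n \<beta> \<gamma> where t: "ALL i<(n::nat). \<beta> i \<in> Ofil M & \<gamma> i \<in> Ofil M"
  "t = (\<Oplus>\<^bsub>tensor_pow H 2\<^esub>i\<in>{..<n}. pure_tensor H [\<beta> i, \<gamma> i])"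
  "t \<in> carrier (tensor_pow H 2)" "\<forall>x\<in>AG. \<forall>y\<in>AG. evs [x, y] t = \<alpha> (gmul G x y)" by (elim exE conjE)
 show "comult H \<alpha> \<in> carrier (tensor_pow H 2)" unfolding eq[OF t(3,4)] by (rule t(3))
 show "x \<in> AG ==> y \<in> AG ==> evs [x, y] (comult H \<alpha>) = \<alpha> (gmul G x y)"
  unfolding eq[OF t(3,4)] using t(4) by (simp only:)
 show "\<alpha> \<in> Ofil N ==> EX (n :: nat) \<beta> \<gamma>. (ALL i<n. \<beta> i \<in> Ofil N & \<gamma> i \<in> Ofil N) &
    comult H \<alpha> = (\<Oplus>\<^bsub>tensor_pow H 2\<^esub>i\<in>{..<n}. pure_tensor H [\<beta> i, \<gamma> i])"
 proof -
  assume "\<alpha> \<in> Ofil N"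
  from main[OF this] obtain t n \<beta> \<gamma> where t: "ALL i<(n::nat). \<beta> i \<in> Ofil N & \<gamma> i \<in> Ofil N"
   "t = (\<Oplus>\<^bsub>tensor_pow H 2\<^esub>i\<in>{..<n}. pure_tensor H [\<beta> i, \<gamma> i])"
   "t \<in> carrier (tensor_pow H 2)" "\<forall>x\<in>AG. \<forall>y\<in>AG. evs [x, y] t = \<alpha> (gmul G x y)" by (elim exE conjE)
  have "comult H \<alpha> = (\<Oplus>\<^bsub>tensor_pow H 2\<^esub>i\<in>{..<n}. pure_tensor H [\<beta> i, \<gamma> i])" unfolding eq[OF t(3,4)] by (rule t(2))
  then show ?thesis by (intro exI[of _ n] exI[of _ \<beta>] exI[of _ \<gamma>] conjI t(1))
 qed
qed

lemma list2_cases: "length gs = 2 ==> set gs <= carrier G ==> \<exists>g\<in>carrier G. \<exists>h\<in>carrier G. gs = [g, h]"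
 by (auto simp: length_Suc_conv numeral_2_eq_2)

lemma comult_H_eqI:
 assumes a: "\<alpha> \<in> carrier H" and t: "t \<in> carrier (tensor_pow H 2)"
  and eq: "!!g h. g \<in> carrier G ==> h \<in> carrier G ==> evs [pm_unit g, pm_unit h] t = \<alpha> (pm_unit (g \<otimes> h))"
 shows "comult H \<alpha> = t"
proof (rule evs_eqI[OF comult_H(1)[OF a] t])
 fix gs assume "length gs = 2" "set gs <= carrier G"
 then obtain g h where gh: "g \<in> carrier G" "h \<in> carrier G" "gs = [g, h]" using list2_cases by blast
 then show "evs (map pm_unit gs) (comult H \<alpha>) = evs (map pm_unit gs) t"
  using comult_H(2)[OF a unit_galg unit_galg, of g h] eq[OF gh(1,2)] by (simp add: pm_conv_unit)
qed

lemma comult_H_units: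
 "\<alpha> \<in> carrier H ==> g \<in> carrier G ==> h \<in> carrier G ==> evs [pm_unit g, pm_unit h] (comult H \<alpha>) = \<alpha> (pm_unit (g \<otimes> h))"
 using comult_H(2)[OF _ unit_galg unit_galg, of \<alpha> g h] by (simp add: pm_conv_unit)

lemma comult_H_linear: "comult H \<in> linear_maps H (tensor_pow H 2)"
proof (rule linI[OF comult_H(1)])
 interpret T: vspace "tensor_pow H 2" by (rule vspace_tensor_pow[OF vspace_H])
 have e: "evs [pm_unit g, pm_unit h] \<in> linear_maps (tensor_pow H 2) CC" if "g \<in> carrier G" "h \<in> carrier G" for g h
  by (rule evs_linear) (use that unit_galg in auto)
 note D = linD[OF e] and c = comult_H(1)
 fix \<alpha> assume a: "\<alpha> \<in> carrier H"
 show "comult H (k \<odot>\<^sub>H \<alpha>) = k \<odot>\<^bsub>tensor_pow H 2\<^esub> comult H \<alpha>" for k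
  by (rule comult_H_eqI[OF H_closed(2)[OF a] T.smult_in[OF c[OF a]]]) (simp add: D(3) c a comult_H_units H_vals unit_galg)
 fix \<beta> assume b: "\<beta> \<in> carrier H"
 show "comult H (\<alpha> \<oplus>\<^sub>H \<beta>) = comult H \<alpha> \<oplus>\<^bsub>tensor_pow H 2\<^esub> comult H \<beta>"
  by (rule comult_H_eqI[OF H_closed(1)[OF a b] T.M.a_closed[OF c[OF a] c[OF b]]])
   (simp add: D(2) c a b comult_H_units H_vals unit_galg)
qed

end

section \<open>Naturality of the coradical filtration\<close>

section \<open>The coradical filtration\<close>

lemma quot_lift:
 assumes V: "vspace V" and W: "vspace W" and M: "subspace V M" and f: "f \<in> linear_maps V W"
  and f0: "!!m. m \<in> M ==> f m = \<zero>\<^bsub>W\<^esub>"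
 shows "\<exists>g\<in>linear_maps (quot_mod V M) W. \<forall>x\<in>carrier V. g (M +>\<^bsub>V\<^esub> x) = f x"
proof -
 interpret V: vspace V by fact
 interpret W: vspace W by fact
 let ?g = "%X. f (SOME x. x \<in> X)"
 have g: "?g (M +>\<^bsub>V\<^esub> x) = f x" if x: "x \<in> carrier V" for x
 proof -
  have "(SOME y. y \<in> M +>\<^bsub>V\<^esub> x) \<in> M +>\<^bsub>V\<^esub> x" by (rule someI, rule V.coset_self[OF M x])
  then have y: "(SOME y. y \<in> M +>\<^bsub>V\<^esub> x) \<in> carrier V" "(SOME y. y \<in> M +>\<^bsub>V\<^esub> x) \<ominus>\<^bsub>V\<^esub> x \<in> M"
   using V.mem_coset[OF M x] by blast+
  show ?thesis
   using f0[OF y(2)] lin_minus[OF f V W y(1) x] W.minus_eq_zero_iff linD(1)[OF f] x y(1) by simp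
 qed
 have "?g \<in> linear_maps (quot_mod V M) W"
  by (rule linI) (auto simp: g linD[OF f] V.set_add_coset[OF M] V.smult_coset[OF M] simp del: o_apply)
 then show ?thesis using g by (intro bexI[of _ ?g]) auto
qed

lemma subspace_unit_line:
 assumes "vspace H" "\<one>\<^bsub>H\<^esub> \<in> carrier H"
 shows "subspace H (unit_line H)"
proof -
 interpret vspace H by fact
 have "EX c. \<zero>\<^bsub>H\<^esub> = c \<odot>\<^bsub>H\<^esub> \<one>\<^bsub>H\<^esub>" using assms(2) by (intro exI[of _ 0]) simp
 then show ?thesis
  using assms(2) by (auto simp: subspace_def unit_line_def smult_smult simp flip: smult_add_left)
qed

lemma unit_coset_linear:
 assumes "vspace H" "\<one>\<^bsub>H\<^esub> \<in> carrier H"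
 shows "vspace (quot_mod H (unit_line H))" "(%x. unit_line H +>\<^bsub>H\<^esub> x) \<in> linear_maps H (quot_mod H (unit_line H))"
 using vspace.vspace_quot vspace.coset_linear subspace_unit_line[OF assms] assms(1) by blast+

lemma hopf_fil_nat:
 "hopf_fil H (int n) = {x \<in> carrier H. tensor_map (quot_mod H (unit_line H)) (Suc n) (%x. unit_line H +>\<^bsub>H\<^esub> x)
   (iter_comult H n x) = \<zero>\<^bsub>tensor_pow (quot_mod H (unit_line H)) (Suc n)\<^esub>}"
 by (simp add: hopf_fil_def Let_def)

lemma hopf_fil_neg: "k < 0 ==> hopf_fil H k = {\<zero>\<^bsub>H\<^esub>}"
 by (simp add: hopf_fil_def)

lemma subspace_hopf_fil:
 assumes V: "vspace H" and one: "\<one>\<^bsub>H\<^esub> \<in> carrier H" and D: "comult H \<in> linear_maps H (tensor_pow H 2)"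
 shows "subspace H (hopf_fil H k)"
proof (cases "k < 0")
 case True
 interpret vspace H by fact
 show ?thesis by (auto simp: hopf_fil_neg[OF True] subspace_def)
next
 case False
 then obtain n where k: "k = int n" by (metis nonneg_int_cases not_less)
 note Q = unit_coset_linear[OF V one]
 show ?thesis
  unfolding k hopf_fil_nat
  by (rule subspace_kernel[OF V vspace_tensor_pow[OF Q(1)]
     lin_comp[OF iter_comult_linear[OF V D] tensor_map_linear[OF V Q]]])
qed

lemma comult_at_natural:
 assumes V: "vspace H" and W: "vspace K" and D: "comult H \<in> linear_maps H (tensor_pow H 2)"
  and D': "comult K \<in> linear_maps K (tensor_pow K 2)" and f: "f \<in> linear_maps H K"
  and fD: "!!x. x \<in> carrier H ==> comult K (f x) = tensor_map K 2 f (comult H x)"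
  and i: "i < n" and t: "t \<in> carrier (tensor_pow H n)"
 shows "comult_at K n i (tensor_map K n f t) = tensor_map K (Suc n) f (comult_at H n i t)"
proof (rule tensor_map_eqI[OF V vspace_tensor_pow[OF W]
   lin_comp[OF tensor_map_linear[OF V W f] comult_at_linear[OF W D' i]]
   lin_comp[OF comult_at_linear[OF V D i] tensor_map_linear[OF V W f]] _ t])
 fix xs assume xs: "length xs = n" "set xs <= carrier H"
 have xi: "xs ! i \<in> carrier H" using xs i by (metis nth_mem subsetD)
 note fxs = set_map_linear[OF f xs(2)]
 note TH = vspace_tensor_pow[OF V] and TK = vspace_tensor_pow[OF W]
 let ?\<phi> = "%ys. pure_tensor H (take i xs @ ys @ drop (Suc i) xs)"
 let ?\<psi> = "%ys. pure_tensor K (take i (map f xs) @ ys @ drop (Suc i) (map f xs))"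
 have m: "multilin H (tensor_pow H (Suc n)) 2 ?\<phi>" by (rule multilin_insert[OF V i xs])
 have m': "multilin K (tensor_pow K (Suc n)) 2 ?\<psi>" by (rule multilin_insert[OF W i _ fxs]) (simp add: xs)
 note Dx = linD(1)[OF D xi]
 have "comult_at K n i (tensor_map K n f (pure_tensor H xs)) = tensor_lift (tensor_pow K (Suc n)) ?\<psi> (comult K (map f xs ! i))"
  unfolding tensor_map_pure[OF V W f xs] by (rule comult_at_pure[OF W D' i _ fxs]) (simp add: xs)
 also have "... = tensor_lift (tensor_pow K (Suc n)) ?\<psi> (tensor_map K 2 f (comult H (xs ! i)))"
  using i xs(1) by (simp add: fD[OF xi])
 also have "... = tensor_lift (tensor_pow K (Suc n)) (%ys. ?\<psi> (map f ys)) (comult H (xs ! i))"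
  by (rule tensor_lift_map[OF V W TK m' f Dx])
 also have "... = tensor_lift (tensor_pow K (Suc n)) (%ys. tensor_map K (Suc n) f (?\<phi> ys)) (comult H (xs ! i))"
 proof (rule tensor_lift_cong[OF V TK multilin_map[OF m' f] multilin_linear_comp[OF m tensor_map_linear[OF V W f]] _ Dx])
  fix ys assume ys: "length ys = 2" "set ys <= carrier H"
  show "?\<psi> (map f ys) = tensor_map K (Suc n) f (?\<phi> ys)"
   using tensor_map_pure[OF V W f insert_list_subset[OF i xs ys]] by (simp add: take_map drop_map)
 qed
 also have "... = tensor_map K (Suc n) f (tensor_lift (tensor_pow H (Suc n)) ?\<phi> (comult H (xs ! i)))"
  by (rule tensor_lift_linear_comp[OF V TH TK m tensor_map_linear[OF V W f] Dx, symmetric])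
 also have "... = tensor_map K (Suc n) f (comult_at H n i (pure_tensor H xs))"
  by (simp only: comult_at_pure[OF V D i xs])
 finally show "comult_at K n i (tensor_map K n f (pure_tensor H xs)) = tensor_map K (Suc n) f (comult_at H n i (pure_tensor H xs))" .
qed

text \<open>A coalgebra map that preserves the unit commutes with iterated coproducts and induces a
  map of the quotients by the unit lines, so it maps the kernel of one reduced iterated coproduct
  into the other.\<close>

lemma hopf_fil_natural:
 assumes V: "vspace H" and W: "vspace K" and D: "comult H \<in> linear_maps H (tensor_pow H 2)"
  and D': "comult K \<in> linear_maps K (tensor_pow K 2)" and f: "f \<in> linear_maps H K"
  and fD: "!!x. x \<in> carrier H ==> comult K (f x) = tensor_map K 2 f (comult H x)"
  and one: "\<one>\<^bsub>H\<^esub> \<in> carrier H" "f \<one>\<^bsub>H\<^esub> = \<one>\<^bsub>K\<^esub>" and x: "x \<in> hopf_fil H k"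
 shows "f x \<in> hopf_fil K k"
proof (cases "k < 0")
 case True
 then show ?thesis using x lin_zero[OF f V W] by (simp add: hopf_fil_neg)
next
 case False
 then obtain n where k: "k = int n" by (metis nonneg_int_cases not_less)
 have oneK: "\<one>\<^bsub>K\<^esub> \<in> carrier K" using linD(1)[OF f one(1)] one(2) by simp
 note QH = unit_coset_linear[OF V one(1)] and QK = unit_coset_linear[OF W oneK]
 let ?QH = "quot_mod H (unit_line H)" and ?QK = "quot_mod K (unit_line K)"
 let ?pH = "%x. unit_line H +>\<^bsub>H\<^esub> x" and ?pK = "%x. unit_line K +>\<^bsub>K\<^esub> x"
 have xc: "x \<in> carrier H" and x0: "tensor_map ?QH (Suc n) ?pH (iter_comult H n x) = \<zero>\<^bsub>tensor_pow ?QH (Suc n)\<^esub>"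
  using x unfolding k hopf_fil_nat by auto
 have it: "iter_comult K m (f x) = tensor_map K (Suc m) f (iter_comult H m x)" for m
 proof (induction m)
  case 0
  show ?case using tensor_map_pure[OF V W f, of "[x]" 1] xc by simp
 next
  case (Suc m)
  show ?case
   using comult_at_natural[OF V W D D' f fD, of 0 "Suc m" "iter_comult H m x"] linD(1)[OF iter_comult_linear[OF V D] xc]
   by (simp add: Suc)
 qed
 have "?pK (f m) = \<zero>\<^bsub>?QK\<^esub>" if "m \<in> unit_line H" for m
 proof -
  from that obtain c where "m = c \<odot>\<^bsub>H\<^esub> \<one>\<^bsub>H\<^esub>" by (auto simp: unit_line_def)
  then have "f m = c \<odot>\<^bsub>K\<^esub> \<one>\<^bsub>K\<^esub>" using linD(3)[OF f one(1)] one(2) by simp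
  then have "f m \<in> unit_line K" by (auto simp: unit_line_def)
  then show ?thesis
   using vspace.coset_eq_self[OF W subspace_unit_line[OF W oneK]] subspaceD(1)[OF subspace_unit_line[OF W oneK]] by simp
 qed
 from quot_lift[OF V QK(1) subspace_unit_line[OF V one(1)] lin_comp[OF f QK(2)] this]
 obtain g where g: "g \<in> linear_maps ?QH ?QK" "\<forall>x\<in>carrier H. g (?pH x) = ?pK (f x)" ..
 note fx = linD(1)[OF iter_comult_linear[OF V D] xc, of n]
 have "tensor_map ?QK (Suc n) ?pK (iter_comult K n (f x)) = tensor_map ?QK (Suc n) (%x. ?pK (f x)) (iter_comult H n x)"
  unfolding it by (rule tensor_map_comp[OF V W QK(1) f QK(2) fx])
 also have "... = tensor_map ?QK (Suc n) (%x. g (?pH x)) (iter_comult H n x)"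
 proof (rule tensor_map_eqI[OF V vspace_tensor_pow[OF QK(1)] tensor_map_linear[OF V QK(1) lin_comp[OF f QK(2)]]
    tensor_map_linear[OF V QK(1) lin_comp[OF QH(2) g(1)]] _ fx])
  fix xs assume xs: "length xs = Suc n" "set xs <= carrier H"
  have "map (%x. ?pK (f x)) xs = map (%x. g (?pH x)) xs" using xs(2) g(2) by auto
  then show "tensor_map ?QK (Suc n) (%x. ?pK (f x)) (pure_tensor H xs) = tensor_map ?QK (Suc n) (%x. g (?pH x)) (pure_tensor H xs)"
   by (simp only: tensor_map_pure[OF V QK(1) lin_comp[OF f QK(2)] xs]
     tensor_map_pure[OF V QK(1) lin_comp[OF QH(2) g(1)] xs])
 qed
 also have "... = tensor_map ?QK (Suc n) g (tensor_map ?QH (Suc n) ?pH (iter_comult H n x))"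
  by (rule tensor_map_comp[OF V QH(1) QK(1) QH(2) g(1) fx, symmetric])
 also have "... = \<zero>\<^bsub>tensor_pow ?QK (Suc n)\<^esub>"
  unfolding x0 by (rule lin_zero[OF tensor_map_linear[OF QH(1) QK(1) g(1)] vspace_tensor_pow[OF QH(1)] vspace_tensor_pow[OF QK(1)]])
 finally show ?thesis using linD(1)[OF f xc] unfolding k hopf_fil_nat by simp
qed

text \<open>Different degrees have different eigenvalues.\<close>

lemma power_two_eq_iff: "(2 :: complex) ^ m = 2 ^ n \<longleftrightarrow> m = n"
proof -
 have "(2 :: complex) ^ m = of_nat (2 ^ m)" "(2 :: complex) ^ n = of_nat (2 ^ n)" by simp_all
 then show ?thesis by (simp only: of_nat_eq_iff) simp
qed

lemma (in vspace) lin_ext_sum_unit: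
 assumes "finite A" "!!i. i \<in> A ==> \<phi> (k i) \<in> carrier V"
 shows "lin_ext V \<phi> (\<Sum>i\<in>A. pm_unit (k i)) = (\<Oplus>i\<in>A. \<phi> (k i)) & pkeys (\<Sum>i\<in>A. pm_unit (k i)) <= k ` A"
 using assms
proof (induction A rule: finite_induct)
 case (insert a A)
 let ?p = "\<Sum>i\<in>A. pm_unit (k i)"
 from insert have IH: "lin_ext V \<phi> ?p = (\<Oplus>i\<in>A. \<phi> (k i))" "pkeys ?p <= k ` A" by auto
 have "lin_ext V \<phi> (pm_unit (k a) + ?p) = lin_ext V \<phi> (pm_unit (k a)) \<oplus> lin_ext V \<phi> ?p"
  by (rule lin_ext_add) (use IH(2) insert.prems in auto)
 moreover have "(%i. \<phi> (k i)) \<in> A \<rightarrow> carrier V" using insert.prems by auto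
 moreover have "pkeys (pm_unit (k a) + ?p) <= k ` insert a A"
  using Poly_Mapping.keys_add[of "pm_unit (k a)" ?p] IH(2) by auto
 ultimately show ?case using insert IH(1) by (simp add: M.finsum_insert)
qed simp

section \<open>Splitting the coradical filtration by the eigenspaces of a dilation\<close>

section \<open>Hopf algebras with a dilation\<close>

text \<open>\<open>S\<close> acts on the \<open>n\<close>-th graded piece of the coradical filtration as \<open>2\<^sup>n\<close>, so that its
 eigenspaces split the filtration.\<close>

locale hopf_dilation = calg H for H :: "('a, 'm) hopf_scheme" (structure) +
 fixes S :: "'a => 'a"
 assumes hopf: "hopf_algebra H"
  and fil_mono: "hopf_fil H (int n) <= hopf_fil H (int (Suc n))"
  and fil_exhaust: "x \<in> carrier H ==> EX n. x \<in> hopf_fil H (int n)"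
  and fil_mult: "x \<in> hopf_fil H (int i) ==> y \<in> hopf_fil H (int j) ==> x \<otimes> y \<in> hopf_fil H (int (i + j))"
  and fil_one: "\<one> \<in> hopf_fil H (int 0)"
  and S_linear: "S \<in> linear_maps H H"
  and S_top: "x \<in> hopf_fil H (int n) ==> S x \<ominus> (2 ^ n) \<odot> x \<in> hopf_fil H (int n - 1)"
  and S_mult: "x \<in> carrier H ==> y \<in> carrier H ==> S (x \<otimes> y) = S x \<otimes> S y"
  and S_comult: "x \<in> carrier H ==> comult H (S x) = tensor_map H 2 S (comult H x)"
  and S_counit: "x \<in> carrier H ==> counit H (S x) = counit H x"
begin

lemma VH: "vspace H" by (rule vspace_axioms)

lemmas comult_lin = hopf_algebra.comult_linear[OF hopf] and counit_lin = hopf_algebra.counit_linear[OF hopf]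

abbreviation F where "F n \<equiv> hopf_fil H (int n)"

lemma subspace_fil: "subspace H (hopf_fil H k)"
 by (rule subspace_hopf_fil[OF VH one_closed comult_lin])

lemmas filD = subspaceD[OF subspace_fil]

lemma F_mono: "m <= n ==> x \<in> F m ==> x \<in> F n"
 by (induction n rule: dec_induct) (use fil_mono in blast)+

lemma fil_pred: "x \<in> hopf_fil H (int n - 1) ==> x \<in> F n"
proof (cases n)
 case 0
 then show "x \<in> hopf_fil H (int n - 1) ==> x \<in> F n" using filD(2) by (simp add: hopf_fil_neg)
next
 case (Suc m)
 then show "x \<in> hopf_fil H (int n - 1) ==> x \<in> F n" using fil_mono[of m] by auto
qed

definition E where "E n = {x \<in> F n. S x = (2 ^ n) \<odot> x}"

definition D where "D k x = S x \<oplus> (- (2 ^ k)) \<odot> x"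

lemma D_linear: "D k \<in> linear_maps H H"
 unfolding D_def by (intro lin_add VH S_linear lin_scale) (rule linI; simp)

lemma D_minus: "x \<in> carrier H ==> D k x = S x \<ominus> (2 ^ k) \<odot> x"
 using smult_m1[of "(2 ^ k) \<odot> x"] by (simp add: D_def a_minus_def smult_smult)

lemma D_zero_iff: "x \<in> carrier H ==> D k x = \<zero> \<longleftrightarrow> S x = (2 ^ k) \<odot> x"
 using minus_eq_zero_iff linD(1)[OF S_linear] by (simp add: D_minus)

lemma E_F: "x \<in> E n ==> x \<in> F n" and E_carrier: "x \<in> E n ==> x \<in> carrier H"
 using filD(1) by (auto simp: E_def)

lemma subspace_E: "subspace H (E n)"
proof -
 have "E n = {x \<in> carrier H. D n x = \<zero>} \<inter> F n"
  using filD(1) D_zero_iff by (auto simp: E_def)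
 then show ?thesis
  using subspace_kernel[OF VH VH D_linear, of n] subspace_fil[of "int n"] unfolding subspace_def by auto
qed

lemmas ED = subspaceD[OF subspace_E]

lemma D_E: "x \<in> E i ==> D k x = (2 ^ i - 2 ^ k) \<odot> x"
proof -
 assume x: "x \<in> E i"
 show ?thesis unfolding D_minus[OF E_carrier[OF x]] smult_minus_left[OF E_carrier[OF x]] using x by (simp add: E_def)
qed

text \<open>The components are extended by zero beyond \<open>n\<close>, so that decompositions with
  different bounds can be compared.\<close>

definition dec where "dec x f n \<longleftrightarrow> (ALL j. f j \<in> E j) & (ALL j>n. f j = \<zero>) & x = (\<Oplus>j\<in>{..n}. f j)"

lemma E_Pi: "ALL j. f j \<in> E j ==> f \<in> X \<rightarrow> carrier H"
 using E_carrier by blast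

text \<open>On \<open>F (Suc n)\<close> the operator \<open>D (Suc n)\<close> takes values in
  \<open>F n\<close>, where it is invertible on eigenvectors. So some y in \<open>F n\<close> has
  the same image as x, and x - y is an eigenvector of degree \<open>Suc n\<close>.\<close>

lemma dec_exists: "x \<in> F n ==> EX f. dec x f n"
proof (induction n arbitrary: x)
 case 0
 have x: "x \<in> carrier H" using filD(1)[OF 0] .
 then have "x \<in> E 0"
  using S_top[OF 0] 0 minus_eq_zero_iff linD(1)[OF S_linear] by (simp add: hopf_fil_neg E_def)
 then show ?case
  using x ED(2) by (intro exI[of _ "%j. if j = 0 then x else \<zero>"]) (auto simp: dec_def)
next
 case (Suc n)
 have x: "x \<in> carrier H" using filD(1)[OF Suc.prems] .
 have "D (Suc n) x \<in> F n" using S_top[OF Suc.prems] x by (simp add: D_minus)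
 from Suc.IH[OF this] obtain z where "dec (D (Suc n) x) z n" ..
 then have z: "ALL j. z j \<in> E j" "ALL j>n. z j = \<zero>" "D (Suc n) x = (\<Oplus>j\<in>{..n}. z j)" by (auto simp: dec_def)
 \<comment> \<open>\<open>D (Suc n)\<close> is the scalar 2^j - 2^(n+1) on \<open>E j\<close> and is
   inverted componentwise. The zero denominator at j = n + 1 is harmless, because \<open>z\<close>
   vanishes there.\<close>
 define w where "w = (%j. (1 / (2 ^ j - 2 ^ Suc n) :: complex) \<odot> z j)"
 have w: "ALL j. w j \<in> E j" using z(1) ED(4) by (auto simp: w_def)
 define y where "y = (\<Oplus>j\<in>{..n}. w j)"
 have yF: "y \<in> F n"
  unfolding y_def by (rule subspace_finsum[OF subspace_fil]) (use w E_F F_mono in "metis atMost_iff")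
 have y: "y \<in> carrier H" using filD(1)[OF yF] .
 have "D (Suc n) y = (\<Oplus>j\<in>{..n}. D (Suc n) (w j))"
  unfolding y_def by (rule lin_finsum[OF D_linear VH VH E_Pi[OF w]])
 also have "... = (\<Oplus>j\<in>{..n}. z j)"
 proof (rule M.finsum_cong')
  fix j assume "j \<in> {..n}"
  then have "(2 :: complex) ^ j ~= 2 ^ Suc n" using power_two_eq_iff[of j "Suc n"] by simp
  then show "D (Suc n) (w j) = z j"
   using D_E[of "w j" j "Suc n"] w z(1) E_carrier[of "z j" j] by (simp add: smult_smult w_def)
 qed (use E_Pi[OF z(1)] in auto)
 finally have Dy: "D (Suc n) y = D (Suc n) x" using z(3) by simp
 have "x \<ominus> y \<in> E (Suc n)"
  using lin_minus[OF D_linear VH VH x y, of "Suc n"] Dy linD(1)[OF D_linear x] x y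
   subspace_minus[OF subspace_fil Suc.prems F_mono[OF _ yF, of "Suc n"]] D_zero_iff[of "x \<ominus> y" "Suc n"]
  by (simp add: E_def)
 moreover define f where "f = w(Suc n := x \<ominus> y)"
 moreover have "w j = \<zero>" if "j > n" for j using z(2) that by (simp add: w_def)
 moreover have "(\<Oplus>j\<in>{..Suc n}. f j) = x"
 proof -
  have "f \<in> {..Suc n} \<rightarrow> carrier H" using E_Pi[OF w, of UNIV] x y by (auto simp: f_def Pi_iff)
  then have "(\<Oplus>j\<in>{..Suc n}. f j) = f (Suc n) \<oplus> (\<Oplus>j\<in>{..n}. f j)" by (rule M.finsum_Suc)
  also have "(\<Oplus>j\<in>{..n}. f j) = y"
   unfolding y_def by (rule M.finsum_cong') (use E_Pi[OF w] in "auto simp: f_def")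
  finally show ?thesis using x y by (simp add: f_def add_minus_cancel)
 qed
 ultimately show ?case using w by (intro exI[of _ f]) (auto simp: dec_def)
qed

text \<open>Applying \<open>D (Suc n)\<close> removes the top summand and multiplies the others by
  nonzero scalars, which leads to the induction hypothesis.\<close>

lemma E_indep: "ALL j. f j \<in> E j ==> (\<Oplus>j\<in>{..n}. f j) = \<zero> ==> j <= n ==> f j = \<zero>"
proof (induction n arbitrary: f j)
 case 0
 then show ?case using M.finsum_0[OF E_Pi[OF 0(1)]] by simp
next
 case (Suc n)
 note fE = Suc.prems(1)
 have s: "f (Suc n) \<oplus> (\<Oplus>j\<in>{..n}. f j) = \<zero>" using M.finsum_Suc[OF E_Pi[OF fE]] Suc.prems(2) by simp
 have c: "(\<Oplus>j\<in>{..n}. f j) \<in> carrier H" by (rule M.finsum_closed[OF E_Pi[OF fE]])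
 have g: "ALL j. (2 ^ j - 2 ^ Suc n) \<odot> f j \<in> E j" using fE ED(4) by auto
 have "\<zero> = D (Suc n) (f (Suc n) \<oplus> (\<Oplus>j\<in>{..n}. f j))"
  unfolding s by (rule lin_zero[OF D_linear VH VH, symmetric])
 also have "... = D (Suc n) (f (Suc n)) \<oplus> D (Suc n) (\<Oplus>j\<in>{..n}. f j)"
  by (rule linD(2)[OF D_linear E_carrier c]) (use fE in blast)
 also have "D (Suc n) (f (Suc n)) = \<zero>"
  using D_E[of "f (Suc n)" "Suc n" "Suc n"] fE E_carrier[of "f (Suc n)" "Suc n"] by simp
 also have "D (Suc n) (\<Oplus>j\<in>{..n}. f j) = (\<Oplus>j\<in>{..n}. D (Suc n) (f j))"
  by (rule lin_finsum[OF D_linear VH VH E_Pi[OF fE]])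
 also have "... = (\<Oplus>j\<in>{..n}. (2 ^ j - 2 ^ Suc n) \<odot> f j)"
  by (rule M.finsum_cong') (use E_Pi[OF g] fE D_E[of "f _" _ "Suc n"] in auto)
 finally have "(\<Oplus>j\<in>{..n}. (2 ^ j - 2 ^ Suc n) \<odot> f j) = \<zero>"
  using M.finsum_closed[OF E_Pi[OF g]] by simp
 note IH = Suc.IH[OF g this]
 have z: "f j = \<zero>" if "j <= n" for j
 proof -
  have "(2 :: complex) ^ j - 2 ^ Suc n ~= 0" using that using power_two_eq_iff[of j "Suc n"] by simp
  moreover have "(1 / (2 ^ j - 2 ^ Suc n)) \<odot> ((2 ^ j - 2 ^ Suc n) \<odot> f j) = \<zero>" using IH[OF that] by simp
  ultimately show ?thesis using E_carrier[of "f j" j] fE by (simp add: smult_smult del: power_Suc)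
 qed
 have "(\<Oplus>j\<in>{..n}. f j) = \<zero>" by (rule M.add.finprod_one_eqI) (use z in simp)
 then have "f (Suc n) = \<zero>" using s fE E_carrier[of "f (Suc n)" "Suc n"] by simp
 then show ?case using z Suc.prems(3) le_Suc_eq by auto
qed

lemma dec_add:
 assumes "dec x f n" "dec y g n"
 shows "dec (x \<oplus> y) (%j. f j \<oplus> g j) n"
 using assms E_Pi[of f "{..n}"] E_Pi[of g "{..n}"] ED(3) unfolding dec_def by (auto simp: M.finsum_addf)

lemma dec_scale:
 assumes "dec x f n"
 shows "dec (c \<odot> x) (%j. c \<odot> f j) n"
 using assms E_Pi[of f "{..n}"] ED(4) unfolding dec_def by (auto simp: finsum_smult)

lemma dec_mono:
 assumes "dec x f m" "m <= n"
 shows "dec x f n"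
 using assms(2)
proof (induction n rule: dec_induct)
 case (step n)
 then have f: "ALL j. f j \<in> E j" "ALL j>n. f j = \<zero>" "x = (\<Oplus>j\<in>{..n}. f j)" by (auto simp: dec_def)
 have "(\<Oplus>j\<in>{..n}. f j) \<in> carrier H" by (rule M.finsum_closed[OF E_Pi[OF f(1)]])
 then show ?case using f M.finsum_Suc[OF E_Pi[OF f(1)], of n] by (simp add: dec_def)
qed (rule assms(1))

lemma dec_unique:
 assumes "dec x f m" "dec x g n"
 shows "f j = g j"
proof -
 let ?N = "max (max m n) j"
 have f: "dec x f ?N" and g: "dec x g ?N" using dec_mono assms by simp_all
 have x: "x \<in> carrier H" using f E_Pi[of f "{..?N}"] unfolding dec_def by (auto intro: M.finsum_closed)
 have d: "dec (x \<oplus> (- 1) \<odot> x) (%j. f j \<oplus> (- 1) \<odot> g j) ?N" by (rule dec_add[OF f dec_scale[OF g]])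
 have E: "ALL j. f j \<oplus> (- 1) \<odot> g j \<in> E j" using d by (simp add: dec_def)
 have "(\<Oplus>j\<in>{..?N}. f j \<oplus> (- 1) \<odot> g j) = \<zero>"
  using d x unfolding dec_def by (simp add: smult_m1 M.r_neg)
 from E_indep[OF E this, of j] have "f j \<oplus> (- 1) \<odot> g j = \<zero>" by simp
 moreover have "f j \<in> carrier H" "g j \<in> carrier H" using f g E_carrier unfolding dec_def by blast+
 ultimately show ?thesis using minus_eq_zero_iff[of "f j" "g j"] by (simp add: smult_m1 a_minus_def)
qed

definition pr where "pr i x = (SOME f. EX n. dec x f n) i"

lemma pr_eqI: "dec x f n ==> pr i x = f i"
 unfolding pr_def by (rule someI2[where a = f]) (auto intro: dec_unique)

lemma pr_dec: "x \<in> F n ==> dec x (%i. pr i x) n"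
 using dec_exists pr_eqI by (metis ext)

lemma pr_E: "x \<in> carrier H ==> pr i x \<in> E i"
 using fil_exhaust pr_dec unfolding dec_def by blast

lemma pr_carrier: "x \<in> carrier H ==> pr i x \<in> carrier H"
 using pr_E E_carrier by blast

lemma pr_sum: "x \<in> F n ==> x = (\<Oplus>i\<in>{..n}. pr i x)"
 and pr_above: "x \<in> F n ==> n < i ==> pr i x = \<zero>"
 using pr_dec unfolding dec_def by blast+

lemma fil_exhaust2: "x \<in> carrier H ==> y \<in> carrier H ==> EX n. x \<in> F n & y \<in> F n"
 by (meson fil_exhaust F_mono max.cobounded1 max.cobounded2)

lemma pr_linear: "pr i \<in> linear_maps H H"
proof (rule linI)
 fix x assume x: "x \<in> carrier H"
 then obtain n where n: "x \<in> F n" using fil_exhaust by blast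
 show "pr i (c \<odot> x) = c \<odot> pr i x" for c by (rule pr_eqI[OF dec_scale[OF pr_dec[OF n]]])
 fix y assume "y \<in> carrier H"
 with x obtain n where "x \<in> F n" "y \<in> F n" using fil_exhaust2 by blast
 then show "pr i (x \<oplus> y) = pr i x \<oplus> pr i y" by (intro pr_eqI dec_add pr_dec)
qed (rule pr_carrier)

lemma finsum_single:
 assumes "finite A" "a \<in> A" "!!i. i \<in> A ==> i ~= a ==> f i = z" and V: "vspace V" and z: "z = \<zero>\<^bsub>V\<^esub>" "f a \<in> carrier V"
 shows "finsum V f A = f a"
proof -
 interpret V: vspace V by fact
 have c: "f \<in> A \<rightarrow> carrier V" using assms by (metis Pi_I V.M.zero_closed)
 have "finsum V f A = finsum V (%j. if a = j then f j else \<zero>\<^bsub>V\<^esub>) A"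
  by (rule V.M.finsum_cong') (use assms c in auto)
 also have "... = f a" by (rule V.M.add.finprod_singleton[OF assms(2,1) c])
 finally show ?thesis .
qed

lemma pr_on_E: "x \<in> E n ==> pr i x = (if i = n then x else \<zero>)"
proof (rule pr_eqI[where n = n])
 assume x: "x \<in> E n"
 have "finsum H (%i. if i = n then x else \<zero>) {..n} = x"
  using finsum_single[OF _ _ _ VH refl, of "{..n}" n "%i. if i = n then x else \<zero>"] E_carrier[OF x] by simp
 then show "dec x (%i. if i = n then x else \<zero>) n" using x ED(2) by (auto simp: dec_def)
qed

lemma pr_S: "x \<in> carrier H ==> pr i (S x) = (2 ^ i) \<odot> pr i x"
proof -
 assume "x \<in> carrier H"
 then obtain n where n: "x \<in> F n" using fil_exhaust by blast
 note p = pr_dec[OF n, unfolded dec_def]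
 have E: "ALL j. pr j x \<in> E j" using p by blast
 have "S x = S (\<Oplus>j\<in>{..n}. pr j x)" using pr_sum[OF n] by simp
 also have "... = (\<Oplus>j\<in>{..n}. S (pr j x))"
  by (rule lin_finsum[OF S_linear VH VH E_Pi[OF E]])
 also have "... = (\<Oplus>j\<in>{..n}. (2 ^ j) \<odot> pr j x)"
  by (rule M.finsum_cong') (use E E_carrier in "auto simp: E_def")
 finally have "dec (S x) (%j. (2 ^ j) \<odot> pr j x) n" using p ED(4) by (simp add: dec_def)
 then show ?thesis by (rule pr_eqI)
qed

lemma linear_eq_on_E:
 assumes W: "vspace W" and f: "f \<in> linear_maps H W" and g: "g \<in> linear_maps H W"
  and eq: "!!i x. x \<in> E i ==> f x = g x" and x: "x \<in> carrier H"
 shows "f x = g x"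
proof -
 interpret W: vspace W by fact
 obtain n where n: "x \<in> F n" using x fil_exhaust by blast
 have E: "ALL j. pr j x \<in> E j" using pr_E[OF x] by blast
 have "f (\<Oplus>j\<in>{..n}. pr j x) = g (\<Oplus>j\<in>{..n}. pr j x)"
  unfolding lin_finsum[OF f VH W E_Pi[OF E]] lin_finsum[OF g VH W E_Pi[OF E]]
  by (rule W.M.finsum_cong') (use E eq linD(1)[OF g pr_carrier[OF x]] in auto)
 then show ?thesis using pr_sum[OF n] by simp
qed

section \<open>Total degree on the tensor square\<close>

subsection \<open>The bigrading of the tensor square\<close>

abbreviation T where "T \<equiv> tensor_pow H 2"

lemma VT: "vspace T" by (rule vspace_tensor_pow[OF VH])

sublocale T: vspace "tensor_pow H 2" by (rule VT)

lemma pure2_carrier: "x \<in> carrier H ==> y \<in> carrier H ==> pure_tensor H [x, y] \<in> carrier T"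
 by (rule pure_tensor_carrier) auto

lemmas pure2L = linD[OF pure2_linear(1)[OF VH]] and pure2R = linD[OF pure2_linear(2)[OF VH]]

lemma pure2_zero: "x \<in> carrier H ==> pure_tensor H [\<zero>, x] = \<zero>\<^bsub>T\<^esub>" "x \<in> carrier H ==> pure_tensor H [x, \<zero>] = \<zero>\<^bsub>T\<^esub>"
 by (rule lin_zero[OF pure2_linear(1)[OF VH] VH VT], assumption) (rule lin_zero[OF pure2_linear(2)[OF VH] VH VT])

text \<open>The tensor product of two different maps, which \<open>tensor_map\<close> does not
  cover.\<close>

definition tm where "tm f g = tensor_lift T (%xs. pure_tensor H [f (xs ! 0), g (xs ! 1)])"

lemma multilin_tm: "f \<in> linear_maps H H ==> g \<in> linear_maps H H ==> multilin H T 2 (%xs. pure_tensor H [f (xs ! 0), g (xs ! 1)])"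
 by (rule multilin_2I[OF VT, where f = "%x y. pure_tensor H [f x, g y]"])
  (simp_all add: pure2_carrier linD pure2L(2,3) pure2R(2,3))

lemma tm_linear: "f \<in> linear_maps H H ==> g \<in> linear_maps H H ==> tm f g \<in> linear_maps T T"
 unfolding tm_def by (rule tensor_lift_linear[OF VH VT multilin_tm])

lemma tm_pure:
 assumes "f \<in> linear_maps H H" "g \<in> linear_maps H H" "x \<in> carrier H" "y \<in> carrier H"
 shows "tm f g (pure_tensor H [x, y]) = pure_tensor H [f x, g y]"
 unfolding tm_def using tensor_lift_pure[OF VH VT multilin_tm[OF assms(1,2)], of "[x, y]"] assms(3,4) by simp

lemma list2: "length xs = 2 ==> xs = [xs ! 0, xs ! 1]"
 by (auto simp: length_Suc_conv numeral_2_eq_2)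

text \<open>The projection of the tensor square to total degree \<open>n\<close>.\<close>

definition Pi2 where "Pi2 n t = (\<Oplus>\<^bsub>T\<^esub>i\<in>{..n}. tm (pr i) (pr (n - i)) t)"

lemma Pi2_linear: "Pi2 n \<in> linear_maps T T"
 unfolding Pi2_def by (rule lin_finsum_fun[OF VT VT tm_linear[OF pr_linear pr_linear]])

lemma Pi2_pure:
 "x \<in> carrier H ==> y \<in> carrier H ==> Pi2 n (pure_tensor H [x, y]) = (\<Oplus>\<^bsub>T\<^esub>i\<in>{..n}. pure_tensor H [pr i x, pr (n - i) y])"
 unfolding Pi2_def by (rule T.M.finsum_cong') (auto simp: tm_pure pr_linear pr_carrier pure2_carrier)

text \<open>A different splitting of n exceeds i in the first factor or j in the second, and there
  the component is zero. Only the leading terms survive.\<close>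

lemma Pi2_pure_F:
 assumes "x \<in> F i" "y \<in> F j" "i + j = n"
 shows "Pi2 n (pure_tensor H [x, y]) = pure_tensor H [pr i x, pr j y]"
proof -
 have xy: "x \<in> carrier H" "y \<in> carrier H" using assms filD(1) by blast+
 have "(\<Oplus>\<^bsub>T\<^esub>i\<in>{..n}. pure_tensor H [pr i x, pr (n - i) y]) = pure_tensor H [pr i x, pr (n - i) y]"
 proof (rule finsum_single[OF _ _ _ VT refl])
  fix k assume k: "k \<in> {..n}" "k ~= i"
  then consider "i < k" | "j < n - k" using assms(3) by force
  then show "pure_tensor H [pr k x, pr (n - k) y] = \<zero>\<^bsub>T\<^esub>"
   by cases (simp_all add: pr_above[OF assms(1)] pr_above[OF assms(2)] pure2_zero pr_carrier xy)
 qed (use assms(3) xy in "auto intro: pure2_carrier pr_carrier")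
 moreover have "n - i = j" using assms(3) by simp
 ultimately show ?thesis using xy by (simp add: Pi2_pure)
qed

lemma Pi2_S:
 assumes t: "t \<in> carrier T"
 shows "Pi2 n (tensor_map H 2 S t) = (2 ^ n) \<odot>\<^bsub>T\<^esub> Pi2 n t"
proof (rule tensor_map_eqI[OF VH VT lin_comp[OF tensor_map_linear[OF VH VH S_linear] Pi2_linear]
   lin_scale[OF VT Pi2_linear] _ t])
 fix xs assume xs: "length xs = 2" "set xs <= carrier H"
 then obtain x y where xy: "xs = [x, y]" "x \<in> carrier H" "y \<in> carrier H" using list2[OF xs(1)] by (metis list.set_intros insert_subset list.set(2))
 have "Pi2 n (tensor_map H 2 S (pure_tensor H xs)) = (\<Oplus>\<^bsub>T\<^esub>i\<in>{..n}. pure_tensor H [pr i (S x), pr (n - i) (S y)])"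
  unfolding tensor_map_pure[OF VH VH S_linear xs] using Pi2_pure linD(1)[OF S_linear] xy by simp
 also have "... = (\<Oplus>\<^bsub>T\<^esub>i\<in>{..n}. (2 ^ n) \<odot>\<^bsub>T\<^esub> pure_tensor H [pr i x, pr (n - i) y])"
 proof (rule T.M.finsum_cong')
  fix i assume "i \<in> {..n}"
  then have "(2 :: complex) ^ i * 2 ^ (n - i) = 2 ^ n" by (simp flip: power_add)
  then show "pure_tensor H [pr i (S x), pr (n - i) (S y)] = (2 ^ n) \<odot>\<^bsub>T\<^esub> pure_tensor H [pr i x, pr (n - i) y]"
   using xy by (simp add: pr_S pr_carrier pure2L(3) pure2R(3) pure2_carrier T.smult_smult mult.commute)
 qed (use xy in "auto intro: pure2_carrier pr_carrier")
 also have "... = (2 ^ n) \<odot>\<^bsub>T\<^esub> Pi2 n (pure_tensor H xs)"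
  unfolding xy(1) Pi2_pure[OF xy(2,3)]
  by (rule T.finsum_smult[symmetric]) (use xy in "auto intro: pure2_carrier pr_carrier")
 finally show "Pi2 n (tensor_map H 2 S (pure_tensor H xs)) = (2 ^ n) \<odot>\<^bsub>T\<^esub> Pi2 n (pure_tensor H xs)" .
qed

text \<open>The claim is clear for a tensor of two eigenvectors and is extended by expanding first
  one factor and then the other. The bound is only a lower one, so that two tensors can share it in
  a sum.\<close>

lemma Pi2_sum: "t \<in> carrier T ==> EX M. ALL N>=M. t = (\<Oplus>\<^bsub>T\<^esub>m\<in>{..N}. Pi2 m t)"
proof -
 assume t: "t \<in> carrier T"
 define X where "X = {t \<in> carrier T. EX M. ALL N>=M. t = (\<Oplus>\<^bsub>T\<^esub>m\<in>{..N}. Pi2 m t)}"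
 note L = lin_finsum_fun[OF VT VT Pi2_linear]
 have X: "subspace T X"
  unfolding subspace_def
 proof (intro conjI ballI allI)
  show "\<zero>\<^bsub>T\<^esub> \<in> X" unfolding X_def using lin_zero[OF L VT VT, of "%m. m", symmetric] by auto
  fix s assume "s \<in> X"
  then obtain M where s: "s \<in> carrier T" "ALL N>=M. s = (\<Oplus>\<^bsub>T\<^esub>m\<in>{..N}. Pi2 m s)" by (auto simp: X_def)
  have "c \<odot>\<^bsub>T\<^esub> s = (\<Oplus>\<^bsub>T\<^esub>m\<in>{..N}. Pi2 m (c \<odot>\<^bsub>T\<^esub> s))" if "N >= M" for N c
   using linD(3)[OF L[of "%m. m" "{..N}"] s(1), of c] s(2) that by metis
  then show "c \<odot>\<^bsub>T\<^esub> s \<in> X" for c unfolding X_def using s(1) by blast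
  fix r assume "r \<in> X"
  then obtain M' where r: "r \<in> carrier T" "ALL N>=M'. r = (\<Oplus>\<^bsub>T\<^esub>m\<in>{..N}. Pi2 m r)" by (auto simp: X_def)
  have "s \<oplus>\<^bsub>T\<^esub> r = (\<Oplus>\<^bsub>T\<^esub>m\<in>{..N}. Pi2 m (s \<oplus>\<^bsub>T\<^esub> r))" if "N >= max M M'" for N
   using linD(2)[OF L[of "%m. m" "{..N}"] s(1) r(1)] s(2) r(2) that by (metis max.bounded_iff)
  then show "s \<oplus>\<^bsub>T\<^esub> r \<in> X" unfolding X_def using s(1) r(1) by blast
 qed (auto simp: X_def)
 have EE: "pure_tensor H [u, v] \<in> X" if u: "u \<in> E a" and v: "v \<in> E b" for u v a b
 proof -
  note uv = E_carrier[OF u] E_carrier[OF v]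
  have P: "Pi2 m (pure_tensor H [u, v]) = (if m = a + b then pure_tensor H [u, v] else \<zero>\<^bsub>T\<^esub>)" for m
  proof (cases "m = a + b")
   case True
   then show ?thesis using Pi2_pure_F[OF E_F[OF u] E_F[OF v], of m] u v by (simp add: pr_on_E)
  next
   case False
   then have "pure_tensor H [pr i u, pr (m - i) v] = \<zero>\<^bsub>T\<^esub>" if "i <= m" for i
    using that uv u v by (cases "i = a") (auto simp: pr_on_E pure2_zero)
   then have "(\<Oplus>\<^bsub>T\<^esub>i\<in>{..m}. pure_tensor H [pr i u, pr (m - i) v]) = \<zero>\<^bsub>T\<^esub>"
    by (intro T.M.add.finprod_one_eqI) auto
   then show ?thesis using False uv by (simp add: Pi2_pure)
  qed
  have "pure_tensor H [u, v] = (\<Oplus>\<^bsub>T\<^esub>m\<in>{..N}. Pi2 m (pure_tensor H [u, v]))" if "N >= a + b" for N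
   using finsum_single[OF _ _ _ VT refl, of "{..N}" "a + b" "%m. Pi2 m (pure_tensor H [u, v])"] that P uv
   by (simp add: pure2_carrier)
  then show ?thesis unfolding X_def using uv pure2_carrier by blast
 qed
 have EC: "pure_tensor H [u, v] \<in> X" if u: "u \<in> E a" and v: "v \<in> carrier H" for u v a
 proof -
  obtain n where n: "v \<in> F n" using v fil_exhaust by blast
  have "pure_tensor H [u, v] = (\<Oplus>\<^bsub>T\<^esub>j\<in>{..n}. pure_tensor H [u, pr j v])"
   using lin_finsum[OF pure2_linear(2)[OF VH E_carrier[OF u]] VH VT, of "%j. pr j v" "{..n}"]
    pr_sum[OF n] pr_carrier[OF v] by auto
  then show ?thesis using T.subspace_finsum[OF X, of "{..n}" "%j. pure_tensor H [u, pr j v]"] EE[OF u pr_E[OF v]] by simp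
 qed
 have CC: "pure_tensor H [u, v] \<in> X" if u: "u \<in> carrier H" and v: "v \<in> carrier H" for u v
 proof -
  obtain n where n: "u \<in> F n" using u fil_exhaust by blast
  have "pure_tensor H [u, v] = (\<Oplus>\<^bsub>T\<^esub>j\<in>{..n}. pure_tensor H [pr j u, v])"
   using lin_finsum[OF pure2_linear(1)[OF VH v] VH VT, of "%j. pr j u" "{..n}"]
    pr_sum[OF n] pr_carrier[OF u] by auto
  then show ?thesis using T.subspace_finsum[OF X, of "{..n}" "%j. pure_tensor H [pr j u, v]"] EC[OF pr_E[OF u] v] by simp
 qed
 obtain p where p: "pkeys p <= {xs. length xs = 2 & set xs <= carrier H}" "t = lin_ext T (pure_tensor H) p"
  by (rule tensor_cases[OF VH t])
 have "t \<in> X"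
  unfolding p(2) lin_ext_def
 proof (rule T.subspace_finsum[OF X])
  fix xs assume "xs \<in> pkeys p"
  then have xs: "length xs = 2" "set xs <= carrier H" using p(1) by auto
  then have "pure_tensor H [xs ! 0, xs ! 1] \<in> X" by (intro CC) auto
  then show "plookup p xs \<odot>\<^bsub>T\<^esub> pure_tensor H xs \<in> X"
   using list2[OF xs(1)] subspaceD(4)[OF X] by metis
 qed
 then show ?thesis by (simp add: X_def)
qed

text \<open>For an eigenvector of degree k, compatibility of \<open>S\<close> with the coproduct
  gives 2^m = 2^k on the component of total degree m of its coproduct; hence that component is zero
  unless m = k.\<close>

lemma Pi2_comult:
 assumes x: "x \<in> carrier H"
 shows "Pi2 n (comult H x) = comult H (pr n x)"
proof (rule linear_eq_on_E[OF VT lin_comp[OF comult_lin Pi2_linear] lin_comp[OF pr_linear comult_lin] _ x])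
 have off: "Pi2 m (comult H e) = \<zero>\<^bsub>T\<^esub>" if e: "e \<in> E k" and "k ~= m" for e k m
 proof -
  have ec: "e \<in> carrier H" using E_carrier[OF e] .
  note d = linD(1)[OF comult_lin ec]
  note pd = linD(1)[OF Pi2_linear d, of m]
  have "(2 ^ m) \<odot>\<^bsub>T\<^esub> Pi2 m (comult H e) = Pi2 m (comult H (S e))" by (simp only: Pi2_S[OF d] S_comult[OF ec])
  also have "... = (2 ^ k) \<odot>\<^bsub>T\<^esub> Pi2 m (comult H e)"
   using e linD(3)[OF comult_lin ec] linD(3)[OF Pi2_linear d] by (simp add: E_def)
  finally have "(2 ^ m - 2 ^ k) \<odot>\<^bsub>T\<^esub> Pi2 m (comult H e) = \<zero>\<^bsub>T\<^esub>" using pd by (simp add: T.smult_minus_left)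
  then have "(1 / (2 ^ m - 2 ^ k)) \<odot>\<^bsub>T\<^esub> ((2 ^ m - 2 ^ k) \<odot>\<^bsub>T\<^esub> Pi2 m (comult H e)) = \<zero>\<^bsub>T\<^esub>" by simp
  then show ?thesis using pd that(2) power_two_eq_iff[of m k] by (simp add: T.smult_smult)
 qed
 fix k e assume e: "e \<in> E k"
 note d = linD(1)[OF comult_lin E_carrier[OF e]]
 show "Pi2 n (comult H e) = comult H (pr n e)"
 proof (cases "k = n")
  case True
  obtain M where "ALL N>=M. comult H e = (\<Oplus>\<^bsub>T\<^esub>m\<in>{..N}. Pi2 m (comult H e))" using Pi2_sum[OF d] ..
  then have "comult H e = (\<Oplus>\<^bsub>T\<^esub>m\<in>{..max M n}. Pi2 m (comult H e))" by simp
  also have "... = Pi2 n (comult H e)"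
   by (rule finsum_single[OF _ _ _ VT refl]) (use off[OF e] True linD(1)[OF Pi2_linear d] in auto)
  finally show ?thesis using True e by (simp add: pr_on_E)
 next
  case False
  then show ?thesis using off[OF e] e lin_zero[OF comult_lin VH VT] by (simp add: pr_on_E)
 qed
qed

section \<open>The associated graded algebra and the candidate isomorphism\<close>

subsection \<open>The associated graded Hopf algebra\<close>

text \<open>The step below \<open>F n\<close>; for n = 0 it is the zero subspace.\<close>

abbreviation FL where "FL n \<equiv> hopf_fil H (int n - 1)"

definition cl where "cl n x = FL n +>\<^bsub>H\<^esub> x"

abbreviation HF where "HF n \<equiv> H\<lparr>carrier := F n\<rparr>"

lemma VF: "vspace (HF n)"
 by (rule vspace_subspace[OF subspace_fil])

lemma subspace_FL: "subspace (HF n) (FL n)"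
 using subspace_fil[of "int n - 1"] fil_pred by (auto simp: subspace_def)

lemma coset_HF: "FL n +>\<^bsub>HF n\<^esub> x = cl n x"
 by (simp add: cl_def a_r_coset_def r_coset_def)

lemma gr_comp_eq: "gr_comp H n = quot_mod (HF n) (FL n)"
 by (simp add: gr_comp_def)

lemma vspace_gr_comp: "vspace (gr_comp H n)"
 unfolding gr_comp_eq by (rule vspace.vspace_quot[OF VF subspace_FL])

lemma cl_linear: "cl n \<in> linear_maps (HF n) (gr_comp H n)"
 using vspace.coset_linear[OF VF subspace_FL] unfolding coset_HF gr_comp_eq .

lemma carrier_gr_comp: "X \<in> carrier (gr_comp H n) \<longleftrightarrow> (\<exists>x\<in>F n. X = cl n x)"
 unfolding gr_comp_eq quot_mod_simps coset_HF by auto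

lemma zero_gr_comp: "\<zero>\<^bsub>gr_comp H n\<^esub> = FL n"
 by (simp add: gr_comp_eq)

lemma cl_eq: "x \<in> carrier H ==> y \<in> carrier H ==> cl n x = cl n y \<longleftrightarrow> x \<ominus> y \<in> FL n"
 unfolding cl_def by (rule coset_eq[OF subspace_fil])

lemma cl_zero: "cl n \<zero> = FL n"
 unfolding cl_def by (rule coset_zero[OF subspace_fil])

lemma E_FL: "x \<in> E n ==> x \<in> FL n ==> x = \<zero>"
proof (cases n)
 case (Suc m)
 assume "x \<in> E n" "x \<in> FL n"
 then show ?thesis using pr_above[of x m n] pr_on_E[of x n n] Suc by simp
qed (simp add: hopf_fil_neg)

lemma pr_FL: "x \<in> FL n ==> pr n x = \<zero>"
proof (cases n)
 case 0
 then show "x \<in> FL n ==> pr n x = \<zero>" using lin_zero[OF pr_linear VH VH] by (simp add: hopf_fil_neg)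
next
 case (Suc m)
 then show "x \<in> FL n ==> pr n x = \<zero>" using pr_above[of x m n] by simp
qed

lemma pr_rest: "x \<in> F n ==> x \<ominus> pr n x \<in> FL n"
proof (cases n)
 case 0
 assume x: "x \<in> F n"
 have "pr 0 x = x" using pr_sum[OF x] M.finsum_0[of "%i. pr i x"] pr_carrier[OF filD(1)[OF x]] 0 by simp
 then show ?thesis using 0 filD(1)[OF x] by (simp add: hopf_fil_neg)
next
 case (Suc m)
 assume x: "x \<in> F n"
 note xc = filD(1)[OF x] and p = pr_carrier[OF filD(1)[OF x]]
 have s: "(\<Oplus>i\<in>{..m}. pr i x) \<in> F m"
  by (rule subspace_finsum[OF subspace_fil]) (use pr_E[OF xc] E_F F_mono in "metis atMost_iff")
 have "x = pr (Suc m) x \<oplus> (\<Oplus>i\<in>{..m}. pr i x)"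
  using pr_sum[OF x] M.finsum_Suc[of "%i. pr i x" m] p Suc by simp
 then have "x \<ominus> pr n x = (\<Oplus>i\<in>{..m}. pr i x)"
  using minus_add_cancel[OF filD(1)[OF s] p[of n]] M.a_comm[OF filD(1)[OF s] p[of n]] Suc by metis
 then show ?thesis using s Suc by simp
qed

lemma cl_pr: "x \<in> F n ==> cl n (pr n x) = cl n x"
 using cl_eq[of x "pr n x" n] pr_rest filD(1) pr_carrier by simp

lemma pr_cl:
 assumes x: "x \<in> carrier H" and y: "y \<in> cl n x"
 shows "y \<in> carrier H" "pr n y = pr n x"
proof -
 have y': "y \<in> carrier H" "y \<ominus> x \<in> FL n" using y mem_coset[OF subspace_fil x] unfolding cl_def by blast+
 then show "y \<in> carrier H" by simp
 have "pr n y \<ominus> pr n x = \<zero>" using lin_minus[OF pr_linear VH VH y'(1) x] pr_FL[OF y'(2)] by simp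
 then show "pr n y = pr n x" using minus_eq_zero_iff y'(1) x pr_carrier by simp
qed

abbreviation K where "K \<equiv> gr_hopf H"

lemma K_ops:
 "carrier K = {\<xi>. (ALL n. \<xi> n \<in> carrier (gr_comp H n)) & finite {n. \<xi> n ~= FL n}}"
 "monoid.mult K = (%\<xi> \<eta> n. \<Oplus>\<^bsub>gr_comp H n\<^esub>i\<in>{..n}. rcoset_mult H (FL n) (\<xi> i) (\<eta> (n - i)))"
 "monoid.one K = gr_incl H 0 (FL 0 +> \<one>)" "ring.zero K = FL"
 "ring.add K = (%\<xi> \<eta> n. \<xi> n \<oplus>\<^bsub>gr_comp H n\<^esub> \<eta> n)" "module.smult K = (%c \<xi> n. c \<odot>\<^bsub>gr_comp H n\<^esub> \<xi> n)"
 "comult K = (%\<xi>. \<Oplus>\<^bsub>tensor_pow (gr_alg H) 2\<^esub>n\<in>{n. \<xi> n ~= FL n}. gr_comult_comp H n (\<xi> n))"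
 "counit K = (%\<xi>. the_elem (counit H ` \<xi> 0))"
 by (simp_all add: gr_hopf_def gr_alg_def module.extend_def hopf.fields_def zero_gr_comp)

lemma K_tensor: "tensor_pow (gr_alg H) n = tensor_pow K n" "pure_tensor (gr_alg H) = pure_tensor K"
 by (rule tensor_cong_fields; simp add: gr_hopf_def gr_alg_def module.extend_def)+

text \<open>The isomorphism to the associated graded: the class of each eigencomponent in its own
  degree.\<close>

definition \<Phi> where "\<Phi> x = (%n. cl n (pr n x))"

lemma pr_F: "x \<in> carrier H ==> pr n x \<in> F n"
 using pr_E E_F by blast

lemma \<Phi>_closed: "x \<in> carrier H ==> \<Phi> x \<in> carrier K"
proof -
 assume x: "x \<in> carrier H"
 then obtain N where N: "x \<in> F N" using fil_exhaust by blast
 have "{n. \<Phi> x n ~= FL n} <= {..N}" using pr_above[OF N] cl_zero unfolding \<Phi>_def by force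
 then show ?thesis using x pr_F unfolding K_ops carrier_gr_comp \<Phi>_def by (auto intro: finite_subset)
qed

lemma \<Phi>_linear: "\<Phi> \<in> linear_maps H K"
proof (rule linI[OF \<Phi>_closed])
 fix x assume x: "x \<in> carrier H"
 show "\<Phi> (c \<odot> x) = c \<odot>\<^bsub>K\<^esub> \<Phi> x" for c
  using linD(3)[OF cl_linear] pr_F[OF x] linD(3)[OF pr_linear x]
  by (intro ext) (simp add: K_ops \<Phi>_def)
 fix y assume y: "y \<in> carrier H"
 show "\<Phi> (x \<oplus> y) = \<Phi> x \<oplus>\<^bsub>K\<^esub> \<Phi> y"
  using linD(2)[OF cl_linear] pr_F[OF x] pr_F[OF y] linD(2)[OF pr_linear x y]
  by (intro ext) (simp add: K_ops \<Phi>_def)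
qed

text \<open>Injectivity holds since \<open>E n\<close> meets \<open>FL n\<close> in zero. For
  surjectivity, a representative and its eigencomponent of top degree have the same class.\<close>

lemma \<Phi>_bij: "bij_betw \<Phi> (carrier H) (carrier K)"
proof (rule bij_betw_imageI)
 show "inj_on \<Phi> (carrier H)"
 proof (rule inj_onI)
  fix x y assume x: "x \<in> carrier H" and y: "y \<in> carrier H" and eq: "\<Phi> x = \<Phi> y"
  have p: "pr n x = pr n y" for n
  proof -
   have "cl n (pr n x) = cl n (pr n y)" using fun_cong[OF eq, of n] by (simp add: \<Phi>_def)
   then have "pr n x \<ominus> pr n y \<in> FL n" using cl_eq x y pr_carrier by simp
   moreover have "pr n x \<ominus> pr n y \<in> E n" by (rule subspace_minus[OF subspace_E pr_E[OF x] pr_E[OF y]])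
   ultimately show ?thesis using E_FL minus_eq_zero_iff x y pr_carrier by blast
  qed
  obtain N where "x \<in> F N" "y \<in> F N" using fil_exhaust2[OF x y] by blast
  then show "x = y" using pr_sum[of x N] pr_sum[of y N] unfolding p by simp
 qed
 have "\<exists>x\<in>carrier H. \<xi> = \<Phi> x" if \<xi>: "\<xi> \<in> carrier K" for \<xi>
 proof -
  have "ALL n. EX r. r \<in> F n & \<xi> n = cl n r" using \<xi> unfolding K_ops carrier_gr_comp by blast
  then obtain r where r: "!!n. r n \<in> F n" "!!n. \<xi> n = cl n (r n)" by metis
  have fin: "finite {n. \<xi> n ~= FL n}" using \<xi> unfolding K_ops by blast
  obtain N where N: "!!n. \<xi> n ~= FL n ==> n <= N" using finite_nat_set_iff_bounded_le[THEN iffD1, OF fin] by blast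
  define f where "f = (%n. pr n (r n))"
  have fE: "ALL n. f n \<in> E n" unfolding f_def using pr_E r(1) filD(1) by blast
  have f\<xi>: "cl n (f n) = \<xi> n" for n unfolding f_def using cl_pr[OF r(1)] r(2) by simp
  have f0: "f n = \<zero>" if "n > N" for n
  proof -
   have "\<xi> n = FL n" using N that by force
   then have "cl n (f n) = cl n \<zero>" using f\<xi> cl_zero by simp
   then have "f n \<in> FL n" using cl_eq[of "f n" \<zero> n] fE E_carrier by auto
   then show ?thesis using E_FL fE by blast
  qed
  define x where "x = (\<Oplus>n\<in>{..N}. f n)"
  have d: "dec x f N" using fE f0 by (simp add: dec_def x_def)
  have "x \<in> carrier H" unfolding x_def by (rule M.finsum_closed[OF E_Pi[OF fE]])
  moreover have "\<xi> = \<Phi> x" unfolding \<Phi>_def pr_eqI[OF d] f\<xi> ..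
  ultimately show ?thesis by blast
 qed
 then show "\<Phi> ` carrier H = carrier K" using \<Phi>_closed by blast
qed

lemma VK: "vspace K"
proof (rule vspace_transport[OF VH \<Phi>_bij \<Phi>_linear])
 show "\<zero>\<^bsub>K\<^esub> = \<Phi> \<zero>" unfolding K_ops \<Phi>_def lin_zero[OF pr_linear VH VH] cl_zero ..
qed

lemma \<Phi>_E: "x \<in> E n ==> \<Phi> x = gr_incl H n (cl n x)"
 unfolding \<Phi>_def gr_incl_def by (rule ext) (simp add: pr_on_E cl_zero zero_gr_comp)

lemma gr_incl_cl: "x \<in> F n ==> gr_incl H n (cl n x) = \<Phi> (pr n x)"
 using \<Phi>_E[OF pr_E] filD(1) cl_pr by simp

lemma fil_mult_pred:
 assumes y: "y \<in> F j" and x: "x \<in> FL i"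
 shows "x \<otimes> y \<in> FL (i + j)" "y \<otimes> x \<in> FL (j + i)"
proof -
 have "x \<otimes> y \<in> FL (i + j) & y \<otimes> x \<in> FL (j + i)"
 proof (cases i)
  case 0
  have "\<zero> \<in> FL n" for n by (rule filD(2))
  then show ?thesis using 0 x filD(1)[OF y] by (simp add: hopf_fil_neg)
 next
  case (Suc m)
  then show ?thesis using x fil_mult[OF _ y, of x m] fil_mult[OF y, of x m] by simp
 qed
 then show "x \<otimes> y \<in> FL (i + j)" "y \<otimes> x \<in> FL (j + i)" by simp_all
qed

lemma cl_mult:
 assumes x: "x \<in> F i" and y: "y \<in> F j" and n: "i + j = n"
 shows "rcoset_mult H (FL n) (cl i x) (cl j y) = cl n (x \<otimes> y)"
proof (rule rcoset_mult_eqI)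
 note xc = filD(1)[OF x] and yc = filD(1)[OF y]
 show "x \<in> cl i x" "y \<in> cl j y" unfolding cl_def using coset_self[OF subspace_fil] xc yc by simp_all
 fix a b assume a: "a \<in> cl i x" and b: "b \<in> cl j y"
 have a': "a \<in> carrier H" "a \<ominus> x \<in> FL i" and b': "b \<in> carrier H" "b \<ominus> y \<in> FL j"
  using a b mem_coset[OF subspace_fil] xc yc unfolding cl_def by blast+
 have "(b \<ominus> y) \<oplus> y \<in> F j" using filD(3)[OF fil_pred[OF b'(2)] y] .
 then have bF: "b \<in> F j" using add_minus_cancel[OF b'(1) yc] by simp
 have "(a \<ominus> x) \<otimes> b \<oplus> x \<otimes> (b \<ominus> y) = (a \<otimes> b \<ominus> x \<otimes> b) \<oplus> (x \<otimes> b \<ominus> x \<otimes> y)"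
  using a'(1) b'(1) xc yc by (simp add: a_minus_def l_distr r_distr l_minus r_minus)
 also have "... = a \<otimes> b \<ominus> x \<otimes> y" using a'(1) b'(1) xc yc by (simp add: minus_telescope)
 finally have "a \<otimes> b \<ominus> x \<otimes> y \<in> FL n"
  using filD(3)[OF fil_mult_pred(1)[OF bF a'(2)] fil_mult_pred(2)[OF x b'(2)]] n by simp
 then show "FL n +> (a \<otimes> b) = cl n (x \<otimes> y)" using cl_eq[of "a \<otimes> b" "x \<otimes> y" n] a'(1) b'(1) xc yc unfolding cl_def by simp
qed

lemma E_mult: "x \<in> E i ==> y \<in> E j ==> x \<otimes> y \<in> E (i + j)"
proof -
 assume x: "x \<in> E i" and y: "y \<in> E j"
 note xc = E_carrier[OF x] and yc = E_carrier[OF y]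
 have "S (x \<otimes> y) = ((2 ^ i) \<odot> x) \<otimes> ((2 ^ j) \<odot> y)" using S_mult[OF xc yc] x y by (simp add: E_def)
 also have "... = (2 ^ (i + j)) \<odot> (x \<otimes> y)"
  using xc yc by (simp add: smult_mult_left smult_mult_right smult_smult power_add mult.commute)
 finally show ?thesis using fil_mult[OF E_F[OF x] E_F[OF y]] by (simp add: E_def)
qed

text \<open>Both sides are linear in each variable, so eigenvectors suffice, and for them degrees
  add by \<open>E_mult\<close>.\<close>

lemma pr_mult:
 assumes x: "x \<in> carrier H" and y: "y \<in> carrier H"
 shows "pr n (x \<otimes> y) = (\<Oplus>i\<in>{..n}. pr i x \<otimes> pr (n - i) y)"
proof -
 have l: "(%x. x \<otimes> c) \<in> linear_maps H H" "(%x. c \<otimes> x) \<in> linear_maps H H" if "c \<in> carrier H" for c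
  by (rule linI; simp add: that l_distr r_distr smult_mult_left smult_mult_right)+
 have L: "(%x. \<Oplus>i\<in>{..n}. pr i x \<otimes> pr (n - i) c) \<in> linear_maps H H"
  "(%x. \<Oplus>i\<in>{..n}. pr i c \<otimes> pr (n - i) x) \<in> linear_maps H H" if "c \<in> carrier H" for c
  by (rule lin_finsum_fun[OF VH VH]; rule lin_comp[OF pr_linear]; rule l; rule pr_carrier[OF that])+
 show ?thesis
 proof (rule linear_eq_on_E[OF VH lin_comp[OF l(1)[OF y] pr_linear] L(1)[OF y] _ x])
  fix a x assume x: "x \<in> E a"
  note xc = E_carrier[OF x]
  show "pr n (x \<otimes> y) = (\<Oplus>i\<in>{..n}. pr i x \<otimes> pr (n - i) y)"
  proof (rule linear_eq_on_E[OF VH lin_comp[OF l(2)[OF xc] pr_linear] L(2)[OF xc] _ y])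
   fix b y assume y: "y \<in> E b"
   note yc = E_carrier[OF y]
   show "pr n (x \<otimes> y) = (\<Oplus>i\<in>{..n}. pr i x \<otimes> pr (n - i) y)"
   proof (cases "n = a + b")
    case True
    have "(\<Oplus>i\<in>{..n}. pr i x \<otimes> pr (n - i) y) = pr a x \<otimes> pr (n - a) y"
     by (rule finsum_single[OF _ _ _ VH refl]) (use True xc yc x y in "auto simp: pr_on_E")
    then show ?thesis using True x y E_mult[OF x y] by (simp add: pr_on_E)
   next
    case False
    have "pr i x \<otimes> pr (n - i) y = \<zero>" if "i <= n" for i
     using that False x y xc yc by (cases "i = a") (auto simp: pr_on_E)
    then have "(\<Oplus>i\<in>{..n}. pr i x \<otimes> pr (n - i) y) = \<zero>" by (intro M.add.finprod_one_eqI) auto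
    then show ?thesis using False E_mult[OF x y] by (simp add: pr_on_E)
   qed
  qed
 qed
qed

lemma \<Phi>_mult:
 assumes x: "x \<in> carrier H" and y: "y \<in> carrier H"
 shows "\<Phi> (x \<otimes> y) = \<Phi> x \<otimes>\<^bsub>K\<^esub> \<Phi> y"
proof
 fix n
 have m: "pr i x \<otimes> pr (n - i) y \<in> F n" if "i <= n" for i
  using fil_mult[OF pr_F[OF x, of i] pr_F[OF y, of "n - i"]] that by simp
 have c: "(%i. pr i x \<otimes> pr (n - i) y) \<in> {..n} \<rightarrow> carrier (HF n)" using m by auto
 have incl: "(%x. x) \<in> linear_maps (HF n) H" by (rule linI) (use filD(1) in auto)
 interpret Q: vspace "gr_comp H n" by (rule vspace_gr_comp)
 have "(\<Phi> x \<otimes>\<^bsub>K\<^esub> \<Phi> y) n = (\<Oplus>\<^bsub>gr_comp H n\<^esub>i\<in>{..n}. cl n (pr i x \<otimes> pr (n - i) y))"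
  unfolding K_ops \<Phi>_def
 proof (rule Q.M.finsum_cong')
  fix i assume "i \<in> {..n}"
  then show "rcoset_mult H (FL n) (cl i (pr i x)) (cl (n - i) (pr (n - i) y)) = cl n (pr i x \<otimes> pr (n - i) y)"
   using cl_mult[OF pr_F[OF x, of i] pr_F[OF y, of "n - i"], of n] by simp
 qed (use linD(1)[OF cl_linear] m in auto)
 also have "... = cl n (finsum (HF n) (%i. pr i x \<otimes> pr (n - i) y) {..n})"
  by (rule lin_finsum[OF cl_linear VF vspace_gr_comp c, symmetric])
 also have "finsum (HF n) (%i. pr i x \<otimes> pr (n - i) y) {..n} = pr n (x \<otimes> y)"
  unfolding pr_mult[OF x y] by (rule lin_finsum[OF incl VF VH c])
 finally show "\<Phi> (x \<otimes> y) n = (\<Phi> x \<otimes>\<^bsub>K\<^esub> \<Phi> y) n" by (simp add: \<Phi>_def)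
qed

lemma one_E: "\<one> \<in> E 0"
 using S_top[OF fil_one] fil_one minus_eq_zero_iff linD(1)[OF S_linear] by (simp add: hopf_fil_neg E_def)

lemma \<Phi>_one: "\<Phi> \<one> = \<one>\<^bsub>K\<^esub>"
 unfolding \<Phi>_E[OF one_E] K_ops cl_def ..

text \<open>The counit is invariant under \<open>S\<close> and so vanishes on eigenvectors with
  eigenvalue 2^n different from 1. In degree 0 the class is a singleton, to which
  \<open>the_elem\<close> applies.\<close>

lemma \<Phi>_counit:
 assumes x: "x \<in> carrier H"
 shows "counit K (\<Phi> x) = counit H x"
proof -
 have c: "counit H (pr n x) = 0" if "0 < n" for n
 proof -
  have "counit H (S (pr n x)) = 2 ^ n * counit H (pr n x)"
   using pr_E[OF x, of n] linD(3)[OF counit_lin pr_carrier[OF x]] by (simp add: E_def)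
  then have "(2 ^ n - 2 ^ 0) * counit H (pr n x) = 0" using S_counit[OF pr_carrier[OF x]] by (simp add: left_diff_distrib)
  then show ?thesis using that power_two_eq_iff[of n 0] by simp
 qed
 obtain N where N: "x \<in> F N" using x fil_exhaust by blast
 have "counit H x = finsum CC (%i. counit H (pr i x)) {..N}"
  using lin_finsum[OF counit_lin VH vspace_CC, of "%i. pr i x" "{..N}"] pr_carrier[OF x] pr_sum[OF N] by auto
 also have "... = counit H (pr 0 x)" by (rule finsum_single[OF _ _ _ vspace_CC]) (use c in auto)
 finally have "counit H x = counit H (pr 0 x)" .
 moreover have "\<Phi> x 0 = {pr 0 x}" using pr_carrier[OF x, of 0] by (auto simp: \<Phi>_def cl_def coset_set hopf_fil_neg)
 ultimately show ?thesis by (simp add: K_ops)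
qed

section \<open>The graded coproduct and the filtered isomorphism\<close>

subsection \<open>The coproduct of the associated graded\<close>

abbreviation TK where "TK \<equiv> tensor_pow K 2"

lemma VTK: "vspace TK" by (rule vspace_tensor_pow[OF VK])

abbreviation \<Phi>\<Phi> where "\<Phi>\<Phi> \<equiv> tensor_map K 2 \<Phi>"

lemma \<Phi>\<Phi>_linear: "\<Phi>\<Phi> \<in> linear_maps T TK"
 by (rule tensor_map_linear[OF VH VK \<Phi>_linear])

abbreviation Hpair where "Hpair \<equiv> (%((i :: nat, u), (j :: nat, v)). pure_tensor H [u, v])"
abbreviation Kpair where "Kpair \<equiv> (%((i :: nat, u), (j :: nat, v)). pure_tensor K [gr_incl H i (FL i +> u), gr_incl H j (FL j +> v)])"
abbreviation bidegree where "bidegree n \<equiv> {((i, u), (j, v)). i + j = n & u \<in> F i & v \<in> F j}"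

lemma gr_comult_comp_eq: "gr_comult_comp H n X = (THE t. \<exists>x\<in>X. EX P. pkeys P <= bidegree n &
  comult H x = lin_ext T Hpair P & t = lin_ext TK Kpair P)"
 unfolding gr_comult_comp_def K_tensor ..

text \<open>The graded coproduct uses only the leading terms of a decomposition, and
  \<open>Pi2 n\<close> extracts these from the tensor itself. The value is therefore independent of
  the decomposition \<open>P\<close>.\<close>

lemma Kpair_value:
 assumes P: "pkeys P <= bidegree n"
 shows "lin_ext TK Kpair P = \<Phi>\<Phi> (Pi2 n (lin_ext T Hpair P))"
proof -
 interpret TK: vspace TK by (rule VTK)
 have H: "Hpair k \<in> carrier T" if "k \<in> pkeys P" for k
  using that P filD(1) by (auto intro!: pure2_carrier)
 note L = lin_comp[OF Pi2_linear \<Phi>\<Phi>_linear, of n]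
 have "\<Phi>\<Phi> (Pi2 n (lin_ext T Hpair P)) = lin_ext TK (%k. \<Phi>\<Phi> (Pi2 n (Hpair k))) P"
  by (rule lin_lin_ext[OF L VT VTK H])
 also have "... = lin_ext TK Kpair P"
 proof (rule TK.lin_ext_cong)
  fix k assume k: "k \<in> pkeys P"
  show "\<Phi>\<Phi> (Pi2 n (Hpair k)) \<in> carrier TK" by (rule linD(1)[OF L H[OF k]])
  obtain i u j v where kk: "k = ((i, u), (j, v))" "i + j = n" "u \<in> F i" "v \<in> F j" using k P by auto
  have p: "set [pr i u, pr j v] <= carrier H" using pr_carrier filD(1) kk(3,4) by auto
  have "\<Phi>\<Phi> (pure_tensor H [pr i u, pr j v]) = pure_tensor K [\<Phi> (pr i u), \<Phi> (pr j v)]"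
   using tensor_map_pure[OF VH VK \<Phi>_linear _ p, of 2] by simp
  then show "\<Phi>\<Phi> (Pi2 n (Hpair k)) = Kpair k"
   using kk Pi2_pure_F[OF kk(3,4,2)] gr_incl_cl[OF kk(3)] gr_incl_cl[OF kk(4)] by (simp add: cl_def)
 qed
 finally show ?thesis ..
qed

text \<open>By \<open>Pi2_comult\<close> the coproduct of \<open>e\<close> is fixed by
  \<open>Pi2 n\<close>, which writes any tensor through eigencomponents of degrees i and n -
  i.\<close>

lemma comult_decomposition:
 assumes e: "e \<in> E n"
 shows "EX P. pkeys P <= bidegree n & comult H e = lin_ext T Hpair P"
proof -
 note ec = E_carrier[OF e]
 obtain p where p: "pkeys p <= {xs. length xs = 2 & set xs <= carrier H}" "comult H e = lin_ext T (pure_tensor H) p"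
  by (rule tensor_cases[OF VH linD(1)[OF comult_lin ec]])
 let ?k = "%xs i. ((i, pr i (xs ! 0)), (n - i, pr (n - i) (xs ! 1)))"
 let ?F = "%xs. \<Sum>i\<in>{..n}. pm_unit (?k xs i)"
 have xs: "xs ! 0 \<in> carrier H" "xs ! 1 \<in> carrier H" "xs = [xs ! 0, xs ! 1]" if "xs \<in> pkeys p" for xs
 proof -
  have "length xs = 2" "set xs <= carrier H" using that p(1) by auto
  then show "xs ! 0 \<in> carrier H" "xs ! 1 \<in> carrier H" "xs = [xs ! 0, xs ! 1]" using list2[of xs] by auto
 qed
 have F: "lin_ext T Hpair (?F xs) = (\<Oplus>\<^bsub>T\<^esub>i\<in>{..n}. Hpair (?k xs i)) & pkeys (?F xs) <= ?k xs ` {..n}"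
  if "xs \<in> pkeys p" for xs
  by (rule T.lin_ext_sum_unit) (use xs[OF that] in "auto intro!: pure2_carrier pr_carrier")
 have sub: "pkeys (?F xs) <= bidegree n" if "xs \<in> pkeys p" for xs
  using conjunct2[OF F[OF that]] pr_F[OF xs(1)[OF that]] pr_F[OF xs(2)[OF that]] by auto
 have Hc: "Hpair k \<in> carrier T" if "k \<in> bidegree n" for k
  using that filD(1) by (auto intro!: pure2_carrier)
 have pc: "pure_tensor H xs \<in> carrier T" if "xs \<in> pkeys p" for xs
  using that p(1) by (intro pure_tensor_carrier) auto
 have "comult H e = Pi2 n (comult H e)" using Pi2_comult[OF ec] e by (simp add: pr_on_E)
 also have "... = lin_ext T (%xs. Pi2 n (pure_tensor H xs)) p"
  unfolding p(2) by (rule lin_lin_ext[OF Pi2_linear VT VT pc])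
 also have "... = lin_ext T (%xs. lin_ext T Hpair (?F xs)) p"
 proof (rule T.lin_ext_cong)
  fix xs assume k: "xs \<in> pkeys p"
  show "Pi2 n (pure_tensor H xs) \<in> carrier T" by (rule linD(1)[OF Pi2_linear pc[OF k]])
  have "Pi2 n (pure_tensor H xs) = (\<Oplus>\<^bsub>T\<^esub>i\<in>{..n}. pure_tensor H [pr i (xs ! 0), pr (n - i) (xs ! 1)])"
   using Pi2_pure[OF xs(1,2)[OF k], of n] xs(3)[OF k] by metis
  then show "Pi2 n (pure_tensor H xs) = lin_ext T Hpair (?F xs)" using F[OF k] by simp
 qed
 also have "... = lin_ext T Hpair (pm_bind p ?F)"
  by (rule T.lin_ext_bind[symmetric, where K = "bidegree n"]) (use sub Hc in blast)+
 finally show ?thesis using keys_pm_bind[of p ?F "bidegree n"] sub by blast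
qed

text \<open>Independence of the representative as well: every member of the class has the component
  \<open>e\<close> in degree \<open>n\<close>. So the definite description is met by exactly one
  tensor.\<close>

lemma gr_comult_comp_E:
 assumes e: "e \<in> E n"
 shows "gr_comult_comp H n (cl n e) = \<Phi>\<Phi> (comult H e)"
 unfolding gr_comult_comp_eq
proof (rule the_equality)
 note ec = E_carrier[OF e]
 have val: "lin_ext TK Kpair P = \<Phi>\<Phi> (comult H e)"
  if x: "x \<in> cl n e" and P: "pkeys P <= bidegree n" "comult H x = lin_ext T Hpair P" for x P
  using Kpair_value[OF P(1)] Pi2_comult[OF pr_cl(1)[OF ec x]] pr_cl(2)[OF ec x] e unfolding P(2)[symmetric]
  by (simp add: pr_on_E)
 have ee: "e \<in> cl n e" unfolding cl_def by (rule coset_self[OF subspace_fil ec])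
 obtain P where P: "pkeys P <= bidegree n & comult H e = lin_ext T Hpair P"
  using comult_decomposition[OF e] ..
 show "\<exists>x\<in>cl n e. EX P. pkeys P <= bidegree n & comult H x = lin_ext T Hpair P & \<Phi>\<Phi> (comult H e) = lin_ext TK Kpair P"
  by (intro bexI[OF _ ee] exI[of _ P] conjI conjunct1[OF P] conjunct2[OF P] val[OF ee conjunct1[OF P] conjunct2[OF P], symmetric])
 fix t assume "\<exists>x\<in>cl n e. EX P. pkeys P <= bidegree n & comult H x = lin_ext T Hpair P & t = lin_ext TK Kpair P"
 then obtain x where x: "x \<in> cl n e" "EX P. pkeys P <= bidegree n & comult H x = lin_ext T Hpair P & t = lin_ext TK Kpair P" ..
 from x(2) obtain P where P: "pkeys P <= bidegree n & comult H x = lin_ext T Hpair P & t = lin_ext TK Kpair P" ..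
 show "t = \<Phi>\<Phi> (comult H e)"
  using val[OF x(1) conjunct1[OF P] conjunct1[OF conjunct2[OF P]]] conjunct2[OF conjunct2[OF P]] by (rule trans[rotated])
qed

lemma \<Phi>_comult:
 assumes x: "x \<in> carrier H"
 shows "comult K (\<Phi> x) = \<Phi>\<Phi> (comult H x)"
proof -
 interpret TK: vspace TK by (rule VTK)
 note L = lin_comp[OF comult_lin \<Phi>\<Phi>_linear]
 obtain N where N: "x \<in> F N" using x fil_exhaust by blast
 have 0: "pr n x = \<zero>" if "\<Phi> x n = FL n" for n
 proof -
  have "pr n x \<in> FL n" using that cl_eq[OF pr_carrier[OF x] M.zero_closed, of n n] pr_carrier[OF x] by (simp add: \<Phi>_def cl_zero)
  then show ?thesis using E_FL[OF pr_E[OF x]] by blast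
 qed
 have sub: "{n. \<Phi> x n ~= FL n} <= {..N}" using pr_above[OF N] cl_zero unfolding \<Phi>_def by force
 have "comult K (\<Phi> x) = (\<Oplus>\<^bsub>TK\<^esub>n\<in>{n. \<Phi> x n ~= FL n}. \<Phi>\<Phi> (comult H (pr n x)))"
  unfolding K_ops K_tensor
  by (rule TK.M.finsum_cong') (use gr_comult_comp_E[OF pr_E[OF x]] linD(1)[OF L pr_carrier[OF x]] in "auto simp: \<Phi>_def")
 also have "... = (\<Oplus>\<^bsub>TK\<^esub>n\<in>{..N}. \<Phi>\<Phi> (comult H (pr n x)))"
  by (rule TK.M.add.finprod_mono_neutral_cong_left)
   (use sub 0 lin_zero[OF L VH VTK] linD(1)[OF L pr_carrier[OF x]] in auto)
 also have "... = \<Phi>\<Phi> (comult H (\<Oplus>n\<in>{..N}. pr n x))"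
  by (rule lin_finsum[OF L VH VTK, symmetric]) (use pr_carrier[OF x] in auto)
 finally show ?thesis using pr_sum[OF N] by simp
qed

lemma comult_K_linear: "comult K \<in> linear_maps K TK"
proof -
 note L = lin_comp[OF comult_lin \<Phi>\<Phi>_linear]
 have s: "\<exists>x\<in>carrier H. \<xi> = \<Phi> x" if "\<xi> \<in> carrier K" for \<xi> using \<Phi>_bij that by (auto simp: bij_betw_def)
 show ?thesis
 proof (rule linI)
  fix \<xi> assume "\<xi> \<in> carrier K"
  then obtain x where x: "x \<in> carrier H" "\<xi> = \<Phi> x" using s by blast
  show "comult K \<xi> \<in> carrier TK" using \<Phi>_comult[OF x(1)] linD(1)[OF L x(1)] x(2) by simp
  show "comult K (c \<odot>\<^bsub>K\<^esub> \<xi>) = c \<odot>\<^bsub>TK\<^esub> comult K \<xi>" for c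
   using \<Phi>_comult[OF x(1)] linD(3)[OF L x(1), of c] \<Phi>_comult[of "c \<odot> x"] linD(3)[OF \<Phi>_linear x(1), of c] x
   by simp
  fix \<eta> assume "\<eta> \<in> carrier K"
  then obtain y where y: "y \<in> carrier H" "\<eta> = \<Phi> y" using s by blast
  show "comult K (\<xi> \<oplus>\<^bsub>K\<^esub> \<eta>) = comult K \<xi> \<oplus>\<^bsub>TK\<^esub> comult K \<eta>"
   using \<Phi>_comult[OF x(1)] \<Phi>_comult[OF y(1)] linD(2)[OF L x(1) y(1)] \<Phi>_comult[of "x \<oplus> y"]
    linD(2)[OF \<Phi>_linear x(1) y(1)] x y by simp
 qed
qed

lemma \<Phi>_hopf_iso: "\<Phi> \<in> hopf_iso H K"
 unfolding hopf_iso_def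
 using \<Phi>_bij \<Phi>_linear \<Phi>_comult \<Phi>_counit \<Phi>_mult \<Phi>_one \<Phi>_closed linD(2)[OF \<Phi>_linear]
 by (auto intro!: ring_hom_memI)

theorem filtered_formal: "filtered_formal_hopf H"
 unfolding filtered_formal_hopf_def
proof (intro conjI hopf bexI[OF _ \<Phi>_hopf_iso] allI ballI)
 fix n X assume "X \<in> carrier (gr_comp H n)"
 then obtain x where x: "x \<in> F n" "X = cl n x" unfolding carrier_gr_comp by blast
 note xc = filD(1)[OF x(1)]
 let ?M = "hopf_fil K (int n - 1)"
 have oneK: "\<one>\<^bsub>K\<^esub> \<in> carrier K" using \<Phi>_closed[OF one_closed] \<Phi>_one by simp
 have M: "subspace K ?M" by (rule subspace_hopf_fil[OF VK oneK comult_K_linear])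
 show "coset_map K ?M \<Phi> X = ?M +>\<^bsub>K\<^esub> gr_incl H n X"
 proof (rule coset_map_eqI)
  show "x \<in> X" unfolding x(2) cl_def by (rule coset_self[OF subspace_fil xc])
  fix y assume y: "y \<in> X"
  note yc = pr_cl(1)[OF xc y[unfolded x(2)]]
  have "y \<ominus> x \<in> FL n" using y mem_coset[OF subspace_fil xc] unfolding x(2) cl_def by blast
  then have "(y \<ominus> x) \<oplus> (x \<ominus> pr n x) \<in> FL n" using filD(3) pr_rest[OF x(1)] by blast
  then have l: "y \<ominus> pr n x \<in> FL n" using minus_telescope[OF yc xc pr_carrier[OF xc]] by simp
  \<comment> \<open>As a coalgebra map, \<open>\<Phi>\<close> respects the coradical filtrations;
    that of \<open>K\<close> is controlled by naturality, without being computed.\<close>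
  have "\<Phi> y \<ominus>\<^bsub>K\<^esub> \<Phi> (pr n x) \<in> ?M"
   using hopf_fil_natural[OF VH VK comult_lin comult_K_linear \<Phi>_linear \<Phi>_comult one_closed \<Phi>_one l]
    lin_minus[OF \<Phi>_linear VH VK yc pr_carrier[OF xc]] by simp
  then show "?M +>\<^bsub>K\<^esub> \<Phi> y = ?M +>\<^bsub>K\<^esub> gr_incl H n X"
   unfolding x(2) gr_incl_cl[OF x(1)]
   using vspace.coset_eq[OF VK M \<Phi>_closed[OF yc] \<Phi>_closed[OF pr_carrier[OF xc]]] by simp
 qed
qed

end

section \<open>The Hopf axioms for the restricted dual\<close>

section \<open>The restricted dual is a Hopf algebra\<close>

lemma eval_prod_append:
 "length es = length xs ==> eval_prod (es @ fs) (xs @ ys) = eval_prod es xs * eval_prod fs ys"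
 by (induction es xs rule: list_induct2) (simp_all add: mult.assoc)

context fg_group
begin

text \<open>Inversion reverses products, so the factor from the augmentation ideal moves from the
  right end to the left, where the two-sided \<open>aug_power_mult\<close> absorbs it.\<close>

lemma inv_antihom_aug_power: "x \<in> IG n ==> pm_map (%g. inv g) x \<in> IG n"
proof (induction n arbitrary: x)
 case 0
 then show ?case
  unfolding aug_power_0 pm_map_def by (intro galg_bind[of G "%g. pm_unit (inv g)" G x] unit_galg inv_closed)
next
 case (Suc n)
 from Suc.prems show ?case
 proof (induction rule: aug_power_Suc_induct)
  case (prod x y)
  have xy: "x \<in> AG" "y \<in> AG" using prod aug_power_galg by (auto simp: aug_ideal_iff)
  have "pm_map (%g. inv g) (gmul G x y) = gmul G (pm_map (%g. inv g) y) (pm_map (%g. inv g) x)"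
  proof (rule pm_pair_eqI)
   fix F
   have "pm_pair x (%a. pm_pair y (%b. F (inv (a \<otimes> b)))) = pm_pair x (%a. pm_pair y (%b. F (inv b \<otimes> inv a)))"
    by (rule pm_pair_cong_galg[OF xy(1)], rule pm_pair_cong_galg[OF xy(2)]) (simp add: inv_mult_group)
   then show "pm_pair (pm_map (%g. inv g) (gmul G x y)) F = pm_pair (gmul G (pm_map (%g. inv g) y) (pm_map (%g. inv g) x)) F"
    by (simp add: pm_pair_commute[of x y])
  qed
  moreover have "pm_map (%g. inv g) y \<in> IG 1"
   using prod(2) galg_bind[OF unit_galg[OF inv_closed] xy(2)] unfolding aug_power_1 pm_map_def[symmetric] by (simp add: aug_ideal_iff)
  ultimately show ?case using aug_power_mult[OF _ Suc.IH[OF prod(1)], of "pm_map (%g. inv g) y" 1] by simp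
 qed (simp add: aug_power_add)
qed

definition anti where "anti \<alpha> = (\<lambda>x\<in>AG. \<alpha> (pm_map (%g. inv g) x))"

lemma anti_O: "\<alpha> \<in> Ofil n ==> anti \<alpha> \<in> Ofil n"
proof -
 assume a: "\<alpha> \<in> Ofil n"
 have g: "pm_map (%g. inv g) x \<in> AG" if "x \<in> AG" for x
  using inv_antihom_aug_power[of x 0] that by (simp add: aug_power_0)
 show ?thesis
  unfolding anti_def
  by (rule form_I) (use O_kill[OF a inv_antihom_aug_power] in "simp_all add: galg_simps g form_add[OF O_carrier[OF a]] form_scale[OF O_carrier[OF a]] aug_power_galg")
qed

lemma anti_unit: "g \<in> carrier G ==> anti \<alpha> (pm_unit g) = \<alpha> (pm_unit (inv g))"
 by (simp add: anti_def unit_galg)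

lemma form_linearI:
 assumes c: "!!\<alpha>. \<alpha> \<in> carrier H ==> f \<alpha> \<in> carrier H"
  and F: "!!g. g \<in> carrier G ==> F g \<in> AG" "!!\<alpha> g. \<alpha> \<in> carrier H ==> g \<in> carrier G ==> f \<alpha> (pm_unit g) = \<alpha> (F g)"
 shows "f \<in> linear_maps H H"
proof (rule linI[OF c])
 fix \<alpha> assume a: "\<alpha> \<in> carrier H"
 show "f (k \<odot>\<^sub>H \<alpha>) = k \<odot>\<^sub>H f \<alpha>" for k
  by (rule form_eqI) (use a in "auto simp: c F H_vals unit_galg intro: H_closed")
 fix \<beta> assume b: "\<beta> \<in> carrier H"
 show "f (\<alpha> \<oplus>\<^sub>H \<beta>) = f \<alpha> \<oplus>\<^sub>H f \<beta>"
  by (rule form_eqI) (use a b in "auto simp: c F H_vals unit_galg H_closed(1) intro: H_closed")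
qed

lemma anti_linear: "anti \<in> linear_maps H H"
proof (rule form_linearI[where F = "%g. pm_unit (inv g)"])
 show "anti \<alpha> \<in> carrier H" if "\<alpha> \<in> carrier H" for \<alpha> using O_exhaust[OF that] anti_O O_carrier by blast
qed (simp_all add: unit_galg anti_unit)

text \<open>The coproduct in one slot is the transpose of multiplying two adjacent
  arguments.\<close>

lemma evs_comult_at:
 assumes t: "t \<in> carrier (tensor_pow H n)" and xs: "set xs1 <= AG" "set xs2 <= AG" "a \<in> AG" "b \<in> AG"
  and i: "length xs1 = i" and n: "n = Suc (i + length xs2)"
 shows "evs (xs1 @ [a, b] @ xs2) (comult_at H n i t) = evs (xs1 @ [gmul G a b] @ xs2) t"
proof -
 have i': "i < n" using n by simp
 let ?e = "xs1 @ [a, b] @ xs2" and ?f = "xs1 @ [gmul G a b] @ xs2"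
 have e: "set ?e <= AG" "length ?e = Suc n" and f: "set ?f <= AG" "length ?f = n"
  using xs i n gmul_closed by auto
 note D = comult_H_linear
 show ?thesis
 proof (rule tensor_map_eqI[OF vspace_H vspace_CC lin_comp[OF comult_at_linear[OF vspace_H D i'] evs_linear[OF e]] evs_linear[OF f] _ t])
  fix as assume as: "length as = n" "set as <= carrier H"
  have ai: "as ! i \<in> carrier H" using as i' by (metis nth_mem subsetD)
  note T = vspace_tensor_pow[OF vspace_H, of "Suc n"]
  note m = multilin_insert[OF vspace_H i' as]
  let ?c = "eval_prod (map evl xs1) (take i as) * eval_prod (map evl xs2) (drop (Suc i) as)"
  have "evs ?e (comult_at H n i (pure_tensor H as)) =
   tensor_lift CC (%ys. evs ?e (pure_tensor H (take i as @ ys @ drop (Suc i) as))) (comult H (as ! i))"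
   unfolding comult_at_pure[OF vspace_H D i' as]
   by (rule tensor_lift_linear_comp[OF vspace_H T vspace_CC m evs_linear[OF e] comult_H(1)[OF ai]])
  also have "... = ?c \<odot>\<^bsub>CC\<^esub> tensor_lift CC (eval_prod (map evl [a, b])) (comult H (as ! i))"
  proof (rule tensor_lift_scale[OF vspace_H vspace_CC multilin_evs multilin_linear_comp[OF m evs_linear[OF e]] _ comult_H(1)[OF ai]])
   fix ys assume ys: "length ys = 2" "set ys <= carrier H"
   then have "evs ?e (pure_tensor H (take i as @ ys @ drop (Suc i) as)) = eval_prod (map evl ?e) (take i as @ ys @ drop (Suc i) as)"
    by (intro evs_pure[OF e] insert_list_subset[OF i' as ys])
   also have "... = ?c * eval_prod (map evl [a, b]) ys"
    using i as n ys by (simp add: eval_prod_append del: append.simps list.map)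
   finally show "evs ?e (pure_tensor H (take i as @ ys @ drop (Suc i) as)) = ?c \<odot>\<^bsub>CC\<^esub> eval_prod (map evl [a, b]) ys" by simp
  qed (use xs in auto)
  also have "... = ?c * (as ! i) (gmul G a b)" using comult_H(2)[OF ai xs(3,4)] unfolding evs_def by simp
  also have "... = eval_prod (map evl ?f) (take i as @ [as ! i] @ drop (Suc i) as)"
   using i as n eval_prod_append[of "map evl xs1" "take i as" "evl (gmul G a b) # map evl xs2" "as ! i # drop (Suc i) as"] by (simp add: evl_def)
  also have "... = evs ?f (pure_tensor H as)"
   using evs_pure[OF f as] id_take_nth_drop[of i as] i' as(1) by simp
  finally show "evs ?e (comult_at H n i (pure_tensor H as)) = evs ?f (pure_tensor H as)" .
 qed
qed

text \<open>Each further coproduct acts in slot 0, so dually the products are nested to the left, as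
  in \<open>foldl\<close>.\<close>

lemma evs_iter_comult:
 assumes a: "\<alpha> \<in> carrier H"
 shows "set (x # xs) <= AG ==> length xs = n ==> evs (x # xs) (iter_comult H n \<alpha>) = \<alpha> (foldl (gmul G) x xs)"
proof (induction n arbitrary: x xs)
 case 0
 then show ?case using evs_pure[of "[x]" 1 "[\<alpha>]"] a by (simp add: evl_def)
next
 case (Suc n)
 then obtain y ys where xs: "xs = y # ys" "length ys = n" by (cases xs) auto
 show ?case
  using evs_comult_at[OF linD(1)[OF iter_comult_linear[OF vspace_H comult_H_linear] a], of "[]" ys x y 0 n] Suc.prems xs
   Suc.IH[of "gmul G x y" ys] gmul_closed by simp
qed

lemma H_lift_val:
 assumes a: "\<alpha> \<in> carrier H" and m: "multilin H H 2 \<phi>" and x: "x \<in> AG" "y \<in> AG" "z \<in> AG"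
  and val: "!!\<beta> \<gamma>. \<beta> \<in> carrier H ==> \<gamma> \<in> carrier H ==> \<phi> [\<beta>, \<gamma>] x = \<beta> y * \<gamma> z"
 shows "tensor_lift H \<phi> (comult H \<alpha>) x = \<alpha> (gmul G y z)"
proof -
 note c = comult_H(1)[OF a]
 have "evl x (tensor_lift H \<phi> (comult H \<alpha>)) = tensor_lift CC (%xs. evl x (\<phi> xs)) (comult H \<alpha>)"
  by (rule tensor_lift_linear_comp[OF vspace_H vspace_H vspace_CC m evl_linear[OF x(1)] c])
 also have "... = tensor_lift CC (eval_prod (map evl [y, z])) (comult H \<alpha>)"
 proof (rule tensor_lift_cong[OF vspace_H vspace_CC multilin_linear_comp[OF m evl_linear[OF x(1)]] multilin_evs _ c])
  fix xs assume "length xs = 2" "set xs <= carrier H"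
  then obtain \<beta> \<gamma> where "xs = [\<beta>, \<gamma>]" "\<beta> \<in> carrier H" "\<gamma> \<in> carrier H" by (auto simp: length_Suc_conv numeral_2_eq_2)
  then show "evl x (\<phi> xs) = eval_prod (map evl [y, z]) xs" using val by (simp add: evl_def)
 qed (use x in auto)
 finally show ?thesis using comult_H(2)[OF a x(2,3)] by (simp add: evs_def evl_def)
qed

lemma multilin_val_2I:
 assumes "!!\<beta> \<gamma>. \<beta> \<in> carrier H ==> \<gamma> \<in> carrier H ==> f \<beta> \<gamma> \<in> carrier H"
  and val: "!!\<beta> \<gamma> g. \<beta> \<in> carrier H ==> \<gamma> \<in> carrier H ==> g \<in> carrier G ==> f \<beta> \<gamma> (pm_unit g) = \<beta> (pm_unit (p g)) * \<gamma> (pm_unit (q g))"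
  and pq: "!!g. g \<in> carrier G ==> p g \<in> carrier G & q g \<in> carrier G"
 shows "multilin H H 2 (%xs. f (xs ! 0) (xs ! 1))"
proof (rule multilin_2I[OF vspace_H assms(1)])
 note v = H_vals[OF unit_galg] val
 fix x y z assume x: "x \<in> carrier H" and y: "y \<in> carrier H" and z: "z \<in> carrier H"
 show "f (x \<oplus>\<^sub>H y) z = f x z \<oplus>\<^sub>H f y z" "f x (y \<oplus>\<^sub>H z) = f x y \<oplus>\<^sub>H f x z"
  by (rule form_eqI; simp add: x y z v pq assms(1) H_closed algebra_simps)+
next
 note v = H_vals[OF unit_galg] val
 fix c x y assume x: "x \<in> carrier H" and y: "y \<in> carrier H"
 show "f (c \<odot>\<^sub>H x) y = c \<odot>\<^sub>H f x y" "f x (c \<odot>\<^sub>H y) = c \<odot>\<^sub>H f x y"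
  by (rule form_eqI; simp add: x y v pq assms(1) H_closed)+
qed

text \<open>Evaluation at a group element is a character of the restricted dual, hence evaluation at
  a tuple is one of the tensor power. It is computed on formal representatives.\<close>

lemma evs_mult:
 assumes s: "s \<in> carrier (tensor_pow H n)" and t: "t \<in> carrier (tensor_pow H n)"
  and gs: "length gs = n" "set gs <= carrier G"
 shows "evs (map pm_unit gs) (s \<otimes>\<^bsub>tensor_pow H n\<^esub> t) = evs (map pm_unit gs) s * evs (map pm_unit gs) t"
proof -
 interpret C: calg H by (rule calg_H)
 let ?F = "eval_prod (map evl (map pm_unit gs))"
 have g: "set (map pm_unit gs) <= AG" "length (map pm_unit gs) = n" using gs unit_galg by auto
 obtain p where p: "p \<in> carrier (free_tensor H n)" "s = tensor_class H n p" using s unfolding carrier_tensor_pow by blast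
 obtain q where q: "q \<in> carrier (free_tensor H n)" "t = tensor_class H n q" using t unfolding carrier_tensor_pow by blast
 have e: "evs (map pm_unit gs) (tensor_class H n r) = pm_pair r ?F" if "r \<in> carrier (free_tensor H n)" for r
  unfolding evs_def lin_ext_CC[symmetric] by (rule tensor_lift_class[OF vspace_H vspace_CC multilin_evs[OF g] that])
 have m: "?F (map2 (\<otimes>\<^sub>H) as bs) = ?F as * ?F bs"
  if as: "as \<in> pkeys p" and bs: "bs \<in> pkeys q" for as bs
 proof -
  have ab: "length as = n" "set as <= carrier H" "length bs = n" "set bs <= carrier H"
   using p(1) q(1) as bs unfolding carrier_free_tensor by auto
  have "(\<Prod>i<n. (as ! i \<otimes>\<^sub>H bs ! i) (pm_unit (gs ! i))) = (\<Prod>i<n. (as ! i) (pm_unit (gs ! i)) * (bs ! i) (pm_unit (gs ! i)))"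
   by (rule prod.cong[OF refl], rule H_mult_unit) (use ab gs in "auto simp: subset_iff")
  then show ?thesis using ab gs(1) by (simp add: eval_prod_def evl_def prod.distrib)
 qed
 have "pm_pair (pm_conv (map2 (\<otimes>\<^sub>H)) p q) ?F = pm_pair p (%as. pm_pair q (%bs. ?F as * ?F bs))"
  unfolding pm_pair_conv by (intro pm_pair_cong m)
 then show ?thesis
  unfolding p(2) q(2) C.tensor_class_mult[OF p(1) q(1)] e[OF p(1)] e[OF q(1)] e[OF C.tensor_conv_closed[OF p(1) q(1)]]
  by (simp add: pm_pair_mult_right pm_pair_mult_right')
qed

lemma comult_H_hom: "comult H \<in> ring_hom H (tensor_pow H 2)"
proof (rule ring_hom_memI[OF comult_H(1)])
 interpret C: calg H by (rule calg_H)
 note c = comult_H(1)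
 fix \<alpha> \<beta> assume a: "\<alpha> \<in> carrier H" and b: "\<beta> \<in> carrier H"
 show "comult H (\<alpha> \<oplus>\<^sub>H \<beta>) = comult H \<alpha> \<oplus>\<^bsub>tensor_pow H 2\<^esub> comult H \<beta>"
  by (rule linD(2)[OF comult_H_linear a b])
 show "comult H (\<alpha> \<otimes>\<^sub>H \<beta>) = comult H \<alpha> \<otimes>\<^bsub>tensor_pow H 2\<^esub> comult H \<beta>"
 proof (rule comult_H_eqI[OF H_mult_closed[OF a b] C.tensor_mult_closed[OF c[OF a] c[OF b]]])
  fix g h assume "g \<in> carrier G" "h \<in> carrier G"
  then show "evs [pm_unit g, pm_unit h] (comult H \<alpha> \<otimes>\<^bsub>tensor_pow H 2\<^esub> comult H \<beta>) = (\<alpha> \<otimes>\<^sub>H \<beta>) (pm_unit (g \<otimes> h))"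
   using evs_mult[OF c[OF a] c[OF b], of "[g, h]"] by (simp add: comult_H_units a b H_mult_unit)
 qed
next
 have p: "\<one>\<^bsub>tensor_pow H 2\<^esub> = pure_tensor H [\<one>\<^bsub>H\<^esub>, \<one>\<^bsub>H\<^esub>]"
  by (simp add: tensor_pow_def pure_tensor_def free_tensor_def numeral_2_eq_2)
 have o: "set [\<one>\<^bsub>H\<^esub>, \<one>\<^bsub>H\<^esub>] <= carrier H" "length [\<one>\<^bsub>H\<^esub>, \<one>\<^bsub>H\<^esub>] = 2" using H_closed(4) by auto
 show "comult H \<one>\<^bsub>H\<^esub> = \<one>\<^bsub>tensor_pow H 2\<^esub>"
  unfolding p
 proof (rule comult_H_eqI[OF H_closed(4) pure_tensor_carrier[OF o(2,1)]])
  fix g h assume "g \<in> carrier G" "h \<in> carrier G"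
  then show "evs [pm_unit g, pm_unit h] (pure_tensor H [\<one>\<^bsub>H\<^esub>, \<one>\<^bsub>H\<^esub>]) = \<one>\<^bsub>H\<^esub> (pm_unit (g \<otimes> h))"
   using evs_pure[of "[pm_unit g, pm_unit h]" 2, OF _ _ o(2,1)] by (simp add: evl_def H_vals unit_galg)
 qed
qed

text \<open>The common shape of the counit and antipode axioms: \<open>p\<close> and
  \<open>q\<close> are the identity, the constant 1 or inversion, and the axiom transposes an
  identity for the product of p(g) and q(g).\<close>

lemma lift_comult_eqI:
 assumes a: "\<alpha> \<in> carrier H" "\<beta> \<in> carrier H" and m: "multilin H H 2 \<phi>"
  and pq: "!!g. g \<in> carrier G ==> p g \<in> carrier G & q g \<in> carrier G & \<alpha> (pm_unit (p g \<otimes> q g)) = \<beta> (pm_unit g)"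
  and val: "!!\<gamma> \<delta> g. \<gamma> \<in> carrier H ==> \<delta> \<in> carrier H ==> g \<in> carrier G ==>
   \<phi> [\<gamma>, \<delta>] (pm_unit g) = \<gamma> (pm_unit (p g)) * \<delta> (pm_unit (q g))"
 shows "tensor_lift H \<phi> (comult H \<alpha>) = \<beta>"
proof (rule form_eqI[OF linD(1)[OF tensor_lift_linear[OF vspace_H vspace_H m] comult_H(1)[OF a(1)]] a(2)])
 fix g assume g: "g \<in> carrier G"
 then show "tensor_lift H \<phi> (comult H \<alpha>) (pm_unit g) = \<beta> (pm_unit g)"
  using H_lift_val[OF a(1) m unit_galg unit_galg unit_galg, of g "p g" "q g"] pq[OF g] val by (simp add: pm_conv_unit)
qed

lemma hopf_algebra_H: "hopf_algebra H"
proof (rule hopf_algebra.intro)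
 interpret C: calg H by (rule calg_H)
 note c1 = H_closed(2) and one = unit_galg[OF one_closed] and vu = H_vals[OF unit_galg]
 show "module CC H" using vspace_H by (simp add: vspace_def)
 show "ring H" by (rule C.ring_axioms)
 show "counit H \<in> linear_maps H CC" by (rule linI) (simp_all add: H_ops(5) H_vals one)
 show "counit H \<in> ring_hom H CC"
  by (rule ring_hom_memI) (simp_all add: H_ops(5) H_vals one H_mult_unit)
 fix \<alpha> assume a: "\<alpha> \<in> carrier H"
 show "comult_at H 2 0 (comult H \<alpha>) = comult_at H 2 1 (comult H \<alpha>)"
 proof (rule evs_eqI)
  show "comult_at H 2 0 (comult H \<alpha>) \<in> carrier (tensor_pow H 3)" "comult_at H 2 1 (comult H \<alpha>) \<in> carrier (tensor_pow H 3)"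
   using linD(1)[OF comult_at_linear[OF vspace_H comult_H_linear] comult_H(1)[OF a], of 0]
    linD(1)[OF comult_at_linear[OF vspace_H comult_H_linear] comult_H(1)[OF a], of 1] by (simp_all add: numeral_3_eq_3 numeral_2_eq_2)
  fix gs assume "length gs = 3" "set gs <= carrier G"
  then obtain g h k where g: "gs = [g, h, k]" "g \<in> carrier G" "h \<in> carrier G" "k \<in> carrier G"
   by (auto simp: length_Suc_conv numeral_3_eq_3)
  note u = unit_galg[OF g(2)] unit_galg[OF g(3)] unit_galg[OF g(4)]
  have 0: "evs [pm_unit g, pm_unit h, pm_unit k] (comult_at H 2 0 (comult H \<alpha>)) = \<alpha> (gmul G (gmul G (pm_unit g) (pm_unit h)) (pm_unit k))"
   using evs_comult_at[OF comult_H(1)[OF a], of "[]" "[pm_unit k]" "pm_unit g" "pm_unit h" 0]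
    comult_H(2)[OF a gmul_closed[OF u(1,2)] u(3)] u by simp
  have 1: "evs [pm_unit g, pm_unit h, pm_unit k] (comult_at H 2 1 (comult H \<alpha>)) = \<alpha> (gmul G (pm_unit g) (gmul G (pm_unit h) (pm_unit k)))"
   using evs_comult_at[OF comult_H(1)[OF a], of "[pm_unit g]" "[]" "pm_unit h" "pm_unit k" 1]
    comult_H(2)[OF a u(1) gmul_closed[OF u(2,3)]] u by simp
  show "evs (map pm_unit gs) (comult_at H 2 0 (comult H \<alpha>)) = evs (map pm_unit gs) (comult_at H 2 1 (comult H \<alpha>))"
   using 0 1 gmul_assoc[OF u] g(1) by simp
 qed
 have m: "multilin H H 2 (%xs. counit H (xs ! 0) \<odot>\<^sub>H xs ! 1)"
  by (rule multilin_val_2I[where f = "%x y. counit H x \<odot>\<^sub>H y" and p = "%g. \<one>" and q = "%g. g"])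
   (simp_all add: c1 vu H_ops(5))
 have m': "multilin H H 2 (%xs. counit H (xs ! 1) \<odot>\<^sub>H xs ! 0)"
  by (rule multilin_val_2I[where f = "%x y. counit H y \<odot>\<^sub>H x" and q = "%g. \<one>" and p = "%g. g"])
   (simp_all add: c1 vu H_ops(5))
 show "tensor_lift H (%xs. counit H (xs ! 0) \<odot>\<^sub>H xs ! 1) (comult H \<alpha>) = \<alpha>"
  by (rule lift_comult_eqI[OF a a m, of "%g. \<one>" "%g. g"]) (simp_all add: H_ops(5) vu)
 show "tensor_lift H (%xs. counit H (xs ! 1) \<odot>\<^sub>H xs ! 0) (comult H \<alpha>) = \<alpha>"
  by (rule lift_comult_eqI[OF a a m', of "%g. g" "%g. \<one>"]) (simp_all add: H_ops(5) vu)
next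
 interpret C: calg H by (rule calg_H)
 note one = unit_galg[OF one_closed] and vu = H_vals[OF unit_galg]
 note ac = linD(1)[OF anti_linear]
 have m1: "multilin H H 2 (%xs. anti (xs ! 0) \<otimes>\<^sub>H xs ! 1)"
  by (rule multilin_val_2I[where f = "%x y. anti x \<otimes>\<^sub>H y" and p = "%g. inv g" and q = "%g. g"])
   (simp_all add: H_mult_unit H_mult_closed ac anti_unit)
 have m2: "multilin H H 2 (%xs. xs ! 0 \<otimes>\<^sub>H anti (xs ! 1))"
  by (rule multilin_val_2I[where f = "%x y. x \<otimes>\<^sub>H anti y" and q = "%g. inv g" and p = "%g. g"])
   (simp_all add: H_mult_unit H_mult_closed ac anti_unit)
 show "\<exists>S\<in>linear_maps H H. \<forall>x\<in>carrier H.
     tensor_lift H (%xs. S (xs ! 0) \<otimes>\<^sub>H xs ! 1) (comult H x) = counit H x \<odot>\<^sub>H \<one>\<^bsub>H\<^esub> &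
     tensor_lift H (%xs. xs ! 0 \<otimes>\<^sub>H S (xs ! 1)) (comult H x) = counit H x \<odot>\<^sub>H \<one>\<^bsub>H\<^esub>"
 proof (rule bexI[OF _ anti_linear], intro ballI conjI)
  fix \<alpha> assume a: "\<alpha> \<in> carrier H"
  note e = lift_comult_eqI[OF a H_closed(2)[OF H_closed(4), of "counit H \<alpha>"]]
  show "tensor_lift H (%xs. anti (xs ! 0) \<otimes>\<^sub>H xs ! 1) (comult H \<alpha>) = counit H \<alpha> \<odot>\<^sub>H \<one>\<^bsub>H\<^esub>"
   by (rule e[OF m1, of "%g. inv g" "%g. g"]) (simp_all add: H_ops(5) vu H_mult_unit ac anti_unit)
  show "tensor_lift H (%xs. xs ! 0 \<otimes>\<^sub>H anti (xs ! 1)) (comult H \<alpha>) = counit H \<alpha> \<odot>\<^sub>H \<one>\<^bsub>H\<^esub>"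
   by (rule e[OF m2, of "%g. g" "%g. inv g"]) (simp_all add: H_ops(5) vu H_mult_unit ac anti_unit)
 qed
qed (use calg.smult_mult_left[OF calg_H] calg.smult_mult_right[OF calg_H] comult_H_linear comult_H_hom in auto)

section \<open>The coradical filtration as annihilators of powers of the augmentation ideal\<close>

subsection \<open>The coradical filtration of the restricted dual\<close>

abbreviation Q where "Q \<equiv> quot_mod H (unit_line H)"
abbreviation prj where "prj \<alpha> \<equiv> unit_line H +>\<^bsub>H\<^esub> \<alpha>"

lemmas VQ = unit_coset_linear[OF vspace_H H_closed(4)]

text \<open>Evaluation at \<open>x\<close> descends to the quotient by the unit line when
  \<open>x\<close> is in the augmentation ideal, because the unit of the dual is the
  augmentation.\<close>

definition qev where "qev x = (SOME f. f \<in> linear_maps Q CC & (\<forall>\<alpha>\<in>carrier H. f (prj \<alpha>) = \<alpha> x))"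

lemma qev: assumes x: "x \<in> aug_ideal G"
 shows "qev x \<in> linear_maps Q CC" "\<alpha> \<in> carrier H ==> qev x (prj \<alpha>) = \<alpha> x"
proof -
 have xg: "x \<in> AG" "pm_pair x (%_. 1) = 0" using x by (simp_all add: aug_ideal_iff)
 have "\<exists>g\<in>linear_maps Q CC. \<forall>\<alpha>\<in>carrier H. g (prj \<alpha>) = evl x \<alpha>"
  by (rule quot_lift[OF vspace_H vspace_CC subspace_unit_line[OF vspace_H H_closed(4)] evl_linear[OF xg(1)]])
   (use xg in "auto simp: unit_line_def evl_def H_vals")
 then have "EX g. g \<in> linear_maps Q CC & (\<forall>\<alpha>\<in>carrier H. g (prj \<alpha>) = \<alpha> x)" by (auto simp: evl_def)
 from someI_ex[OF this] show "qev x \<in> linear_maps Q CC" "\<alpha> \<in> carrier H ==> qev x (prj \<alpha>) = \<alpha> x"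
  unfolding qev_def by blast+
qed

lemma qev_tensor:
 assumes xs: "set xs <= aug_ideal G" "length xs = n" and t: "t \<in> carrier (tensor_pow H n)"
 shows "tensor_lift CC (eval_prod (map qev xs)) (tensor_map Q n prj t) = evs xs t"
proof -
 have xg: "set xs <= AG" using xs(1) by (auto simp: aug_ideal_iff)
 have m: "multilin Q CC n (eval_prod (map qev xs))"
  by (rule multilin_eval_prod[OF _ _ VQ(1)]) (use xs qev(1) in auto)
 show ?thesis
  unfolding tensor_lift_map[OF vspace_H VQ(1) vspace_CC m VQ(2) t] evs_def
 proof (rule tensor_lift_cong[OF vspace_H vspace_CC multilin_map[OF m VQ(2)] multilin_evs[OF xg xs(2)] _ t])
  fix as assume as: "length as = n" "set as <= carrier H"
  have "qev (xs ! i) (prj (as ! i)) = (as ! i) (xs ! i)" if "i < n" for i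
   by (rule qev(2)) (use that as xs in "auto simp: subset_iff")
  then show "eval_prod (map qev xs) (map prj as) = eval_prod (map evl xs) as"
   using as(1) xs(2) by (simp add: eval_prod_def evl_def)
 qed
qed

abbreviation AU where "AU \<equiv> (%g. pm_unit g - pm_unit \<one>) ` carrier G"

lemma AU_aug: "AU <= aug_ideal G"
 using unit_minus_one unfolding aug_power_1 by blast

text \<open>The reproducing formula for the unit says that the \<open>b i\<close> sum to 1.
  Subtracting alpha(1) times this from the formula for alpha replaces the evaluations at
  \<open>h i\<close> by evaluations at \<open>h i\<close> minus 1, and alpha(1) times the unit
  vanishes in the quotient.\<close>

lemma reproducing_Q: "reproducing Q (qev ` AU)"
 unfolding reproducing_def
proof (intro conjI allI impI)
 show "qev ` AU <= linear_maps Q CC" using qev(1) AU_aug by blast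
 interpret Q: vspace Q by (rule VQ(1))
 fix X assume X: "finite X & X <= carrier Q"
 have "carrier Q = prj ` carrier H" by auto
 then obtain Y where Y: "Y <= carrier H" "finite Y" "X = prj ` Y" using finite_subset_image[of X prj "carrier H"] X by auto
 obtain N where N: "Y <= Ofil N" using O_finite_bound[OF Y(2,1)] by blast
 obtain n :: nat and h b where nb: "ALL i<n. h i \<in> carrier G" "ALL i<n. b i \<in> Ofil N"
  "\<forall>\<alpha>\<in>Ofil N. \<alpha> = (\<Oplus>\<^bsub>H\<^esub>i\<in>{..<n}. \<alpha> (pm_unit (h i)) \<odot>\<^sub>H b i)"
  using O_reproducing[of N] by (elim exE conjE) (rule that)
 have hc: "h i \<in> carrier G" and bc: "b i \<in> carrier H" if "i < n" for i using nb(1,2) O_carrier that by blast+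
 let ?u = "%i. pm_unit (h i) - pm_unit \<one>"
 have val: "\<alpha> (pm_unit g) = (\<Sum>i<n. \<alpha> (pm_unit (h i)) * b i (pm_unit g))" if "\<alpha> \<in> Ofil N" "g \<in> carrier G" for \<alpha> g
 proof -
  have "(\<Oplus>\<^bsub>H\<^esub>i\<in>{..<n}. \<alpha> (pm_unit (h i)) \<odot>\<^sub>H b i) (pm_unit g) = (\<Sum>i<n. (\<alpha> (pm_unit (h i)) \<odot>\<^sub>H b i) (pm_unit g))"
   by (rule H_finsum_val[OF unit_galg[OF that(2)]]) (use bc H_closed(2) in auto)
  then show ?thesis using bspec[OF nb(3) that(1)] that(2) by (simp add: H_vals unit_galg)
 qed
 have one: "(\<Sum>i<n. b i (pm_unit g)) = 1" if "g \<in> carrier G" for g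
 proof -
  have "(\<Sum>i<n. b i (pm_unit g)) = (\<Sum>i<n. \<one>\<^bsub>H\<^esub> (pm_unit (h i)) * b i (pm_unit g))"
   by (rule sum.cong) (use hc in "simp_all add: H_vals unit_galg")
  then show ?thesis using val[OF O_mono[OF _ O_one] that] that by (simp add: H_vals unit_galg)
 qed
 have rep: "prj \<alpha> = (\<Oplus>\<^bsub>Q\<^esub>i\<in>{..<n}. qev (?u i) (prj \<alpha>) \<odot>\<^bsub>Q\<^esub> prj (b i))" if "\<alpha> \<in> Y" for \<alpha>
 proof -
  have aN: "\<alpha> \<in> Ofil N" and ac: "\<alpha> \<in> carrier H" using that N Y(1) by auto
  have ub: "(%i. \<alpha> (?u i) \<odot>\<^sub>H b i) \<in> {..<n} \<rightarrow> carrier H" using bc H_closed(2) by auto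
  let ?s = "\<Oplus>\<^bsub>H\<^esub>i\<in>{..<n}. \<alpha> (?u i) \<odot>\<^sub>H b i"
  note sc = Hv.M.finsum_closed[OF ub]
  have "\<alpha> = \<alpha> (pm_unit \<one>) \<odot>\<^sub>H \<one>\<^bsub>H\<^esub> \<oplus>\<^sub>H ?s"
  proof (rule form_eqI[OF ac H_closed(1)[OF H_closed(2)[OF H_closed(4)] sc]])
   fix g assume g: "g \<in> carrier G"
   have "?s (pm_unit g) = (\<Sum>i<n. (\<alpha> (?u i) \<odot>\<^sub>H b i) (pm_unit g))"
    by (rule H_finsum_val[OF unit_galg[OF g] ub])
   also have "... = (\<Sum>i<n. \<alpha> (pm_unit (h i)) * b i (pm_unit g)) - \<alpha> (pm_unit \<one>) * (\<Sum>i<n. b i (pm_unit g))"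
    by (simp add: H_vals unit_galg g hc form_diff[OF ac] left_diff_distrib sum_subtractf sum_distrib_left)
   finally have "?s (pm_unit g) = \<alpha> (pm_unit g) - \<alpha> (pm_unit \<one>)" using val[OF aN g] one[OF g] by simp
   then show "\<alpha> (pm_unit g) = (\<alpha> (pm_unit \<one>) \<odot>\<^sub>H \<one>\<^bsub>H\<^esub> \<oplus>\<^sub>H ?s) (pm_unit g)"
    by (simp add: H_vals unit_galg g)
  qed
  then have "prj \<alpha> = prj (\<alpha> (pm_unit \<one>) \<odot>\<^sub>H \<one>\<^bsub>H\<^esub>) \<oplus>\<^bsub>Q\<^esub> prj ?s"
   using linD(2)[OF VQ(2) H_closed(2)[OF H_closed(4)] sc] by metis
  also have "prj (\<alpha> (pm_unit \<one>) \<odot>\<^sub>H \<one>\<^bsub>H\<^esub>) = \<zero>\<^bsub>Q\<^esub>"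
   using Hv.coset_eq_self[OF subspace_unit_line[OF vspace_H H_closed(4)] H_closed(2)[OF H_closed(4)]]
   by (auto simp: unit_line_def)
  also have "prj ?s = (\<Oplus>\<^bsub>Q\<^esub>i\<in>{..<n}. prj (\<alpha> (?u i) \<odot>\<^sub>H b i))" by (rule lin_finsum[OF VQ(2) vspace_H VQ(1) ub])
  also have "... = (\<Oplus>\<^bsub>Q\<^esub>i\<in>{..<n}. qev (?u i) (prj \<alpha>) \<odot>\<^bsub>Q\<^esub> prj (b i))"
  proof (rule Q.M.finsum_cong')
   fix i assume "i \<in> {..<n}"
   then have i: "i < n" by simp
   have "?u i \<in> aug_ideal G" using AU_aug hc[OF i] by blast
   then show "prj (\<alpha> (?u i) \<odot>\<^sub>H b i) = qev (?u i) (prj \<alpha>) \<odot>\<^bsub>Q\<^esub> prj (b i)"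
    using linD(3)[OF VQ(2) bc[OF i]] qev(2)[OF _ ac] by metis
  qed (use linD(1)[OF VQ(2) bc] Q.smult_in in auto)
  also have "\<zero>\<^bsub>Q\<^esub> \<oplus>\<^bsub>Q\<^esub> (\<Oplus>\<^bsub>Q\<^esub>i\<in>{..<n}. qev (?u i) (prj \<alpha>) \<odot>\<^bsub>Q\<^esub> prj (b i)) =
   (\<Oplus>\<^bsub>Q\<^esub>i\<in>{..<n}. qev (?u i) (prj \<alpha>) \<odot>\<^bsub>Q\<^esub> prj (b i))"
  proof (rule Q.M.l_zero, rule Q.M.finsum_closed, rule Pi_I)
   fix i assume "i \<in> {..<n}"
   then show "qev (?u i) (prj \<alpha>) \<odot>\<^bsub>Q\<^esub> prj (b i) \<in> carrier Q" by (intro Q.smult_in linD(1)[OF VQ(2)] bc) simp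
  qed
  finally show ?thesis .
 qed
 show "EX (I :: nat set) e c. finite I & (\<forall>i\<in>I. e i \<in> qev ` AU & c i \<in> carrier Q) &
   (\<forall>v\<in>X. v = (\<Oplus>\<^bsub>Q\<^esub>i\<in>I. e i v \<odot>\<^bsub>Q\<^esub> c i))"
 proof (intro exI[of _ "{..<n}"] exI[of _ "%i. qev (?u i)"] exI[of _ "%i. prj (b i)"] conjI ballI)
  fix v assume "v \<in> X"
  then obtain \<alpha> where "\<alpha> \<in> Y" "v = prj \<alpha>" using Y(3) by blast
  then show "v = (\<Oplus>\<^bsub>Q\<^esub>i\<in>{..<n}. qev (?u i) v \<odot>\<^bsub>Q\<^esub> prj (b i))" using rep by blast
 next
  fix i assume "i \<in> {..<n}"
  then show "qev (?u i) \<in> qev ` AU" "prj (b i) \<in> carrier Q" using hc linD(1)[OF VQ(2) bc] by auto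
 qed simp
qed

lemma foldl_aug_power:
 "x \<in> IG k ==> set xs <= IG 1 ==> foldl (gmul G) x xs \<in> IG (k + length xs)"
proof (induction xs arbitrary: x k)
 case (Cons y ys)
 then show ?case using Cons.IH[of "gmul G x y" "Suc k"] aug_power_mult[of x k y 1] by simp
qed simp

text \<open>\<open>IG (Suc n)\<close> is spanned by products of n + 1 elements of the augmentation
  ideal. The induction absorbs the last factor into a translate of the form.\<close>

lemma kill_products:
 assumes "\<alpha> \<in> carrier H" "!!x xs. set (x # xs) <= IG 1 ==> length xs = n ==> \<alpha> (foldl (gmul G) x xs) = 0"
 shows "y \<in> IG (Suc n) ==> \<alpha> y = 0"
 using assms
proof (induction n arbitrary: \<alpha> y)
 case 0
 then show ?case using 0(3)[of y "[]"] by simp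
next
 case (Suc n)
 note a = Suc.prems(2)
 from Suc.prems(1) show ?case
 proof (induction rule: aug_power_Suc_induct)
  case (prod u v)
  have v: "v \<in> AG" "v \<in> IG 1" using prod(2) unfolding aug_power_1 by (auto simp: aug_ideal_iff)
  have "rtr \<alpha> v \<in> carrier H" using O_exhaust[OF a] rtr_O[OF _ v(1)] O_carrier by blast
  moreover have "rtr \<alpha> v (foldl (gmul G) x xs) = 0" if "set (x # xs) <= IG 1" "length xs = n" for x xs
  proof -
   have "foldl (gmul G) x xs \<in> AG" by (rule aug_power_galg[OF foldl_aug_power[of x 1]]) (use that in auto)
   then show ?thesis using Suc.prems(3)[of x "xs @ [v]"] that v(2) by (simp add: rtr_def)
  qed
  ultimately have "rtr \<alpha> v u = 0" by (rule Suc.IH[OF prod(1)])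
  then show ?case using aug_power_galg[OF prod(1)] by (simp add: rtr_def)
 next
  case (sum x y)
  then show ?case using form_add[OF a aug_power_galg aug_power_galg] by simp
 qed
qed

text \<open>Testing the reduced iterated coproduct of alpha with the forms \<open>qev x\<close>
  gives the values of alpha at products of n + 1 elements of the augmentation ideal. These tests
  separate tensors over the quotient by the unit line, and such products span
  \<open>IG (Suc n)\<close>.\<close>

lemma hopf_fil_H: "hopf_fil H (int n) = Ofil n"
proof -
 note it = linD(1)[OF iter_comult_linear[OF vspace_H comult_H_linear]]
 let ?t = "%\<alpha>. tensor_map Q (Suc n) prj (iter_comult H n \<alpha>)"
 have ev: "tensor_lift CC (eval_prod (map qev (x # xs))) (?t \<alpha>) = \<alpha> (foldl (gmul G) x xs)"
  if "set (x # xs) <= aug_ideal G" "length xs = n" "\<alpha> \<in> carrier H" for x xs \<alpha>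
  using qev_tensor[OF that(1) _ it[OF that(3)]] evs_iter_comult[OF that(3) _ that(2), of x] that(1,2) by (auto simp: aug_ideal_iff subset_iff)
 have "?t \<alpha> = \<zero>\<^bsub>tensor_pow Q (Suc n)\<^esub>" if a: "\<alpha> \<in> Ofil n" for \<alpha>
 proof (rule tensor_eq_zeroI[OF VQ(1) reproducing_Q linD(1)[OF tensor_map_linear[OF vspace_H VQ] it[OF O_carrier[OF a]]]])
  fix es assume es: "length es = Suc n" "set es <= qev ` AU"
  have "EX us. es = map qev us & set us <= AU"
   using es(2)
  proof (induction es)
   case (Cons e es)
   then obtain us u where "es = map qev us" "set us <= AU" "e = qev u" "u \<in> AU" by auto
   then show ?case by (intro exI[of _ "u # us"]) auto
  qed simp
  then obtain us where us: "es = map qev us" "set us <= AU" by blast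
  obtain x xs where x: "us = x # xs" "length xs = n" using us(1) es(1) by (cases us) auto
  have aug: "set (x # xs) <= aug_ideal G" using us(2) AU_aug x(1) by blast
  have "foldl (gmul G) x xs \<in> IG (1 + length xs)"
   by (rule foldl_aug_power) (use aug aug_power_1 in auto)
  then show "tensor_lift CC (eval_prod es) (?t \<alpha>) = 0"
   using ev[OF aug x(2) O_carrier[OF a]] O_kill[OF a] x us(1) by simp
 qed
 moreover have "\<alpha> \<in> Ofil n" if a: "\<alpha> \<in> carrier H" and z: "?t \<alpha> = \<zero>\<^bsub>tensor_pow Q (Suc n)\<^esub>" for \<alpha>
 proof -
  have "\<alpha> (foldl (gmul G) x xs) = 0" if "set (x # xs) <= IG 1" "length xs = n" for x xs
  proof -
   have x: "set (x # xs) <= aug_ideal G" using that(1) unfolding aug_power_1 .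
   have "multilin Q CC (Suc n) (eval_prod (map qev (x # xs)))"
    by (rule multilin_eval_prod[OF _ _ VQ(1)]) (use x qev(1) that(2) in auto)
   from lin_zero[OF tensor_lift_linear[OF VQ(1) vspace_CC this] vspace_tensor_pow[OF VQ(1)] vspace_CC]
   show ?thesis using ev[OF x that(2) a] z by simp
  qed
  from kill_products[OF a this] show ?thesis using a by (simp add: Ofil_def)
 qed
 ultimately show ?thesis unfolding hopf_fil_nat using O_carrier by blast
qed

end

section \<open>The dilation of the restricted dual, and the conclusion\<close>

subsection \<open>The dilation of the restricted dual\<close>

locale dilated_group = fg_group +
 fixes \<sigma>
 assumes \<sigma>: "dilation \<sigma>"
begin

text \<open>The linear extension of \<open>dil\<close> to the group algebra; for N >= 1 it is
  multiplicative modulo \<open>IG (Suc N)\<close>.\<close>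

definition DD where "DD N x = pm_bind x (dil \<sigma> N)"

lemma DD_simps [simp]: "DD N (x + y) = DD N x + DD N y" "DD N (x - y) = DD N x - DD N y"
 "DD N (pm_scale c x) = pm_scale c (DD N x)" "DD N (pm_unit g) = dil \<sigma> N g"
 by (simp_all add: DD_def)

lemma DD_galg: "x \<in> AG ==> DD N x \<in> AG"
 unfolding DD_def by (rule galg_bind[OF dil_closed[OF \<sigma>]])

lemma galg_congI:
 assumes "x \<in> AG"
  and f: "!!p q. f (p + q) = f p + f q" "!!c p. f (pm_scale c p) = pm_scale c (f p)"
  and h: "!!p q. h (p + q) = h p + h q" "!!c p. h (pm_scale c p) = pm_scale c (h p)"
  and g: "!!g. g \<in> carrier G ==> f (pm_unit g) - h (pm_unit g) \<in> IG n"
 shows "f x - h x \<in> IG n"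
 using assms(1)
proof (induction rule: galg_induct)
 case zero
 show ?case using f(2)[of 0 0] h(2)[of 0 0] aug_power_zero by simp
next
 case (add p k c)
 have "f (p + pm_scale c (pm_unit k)) - h (p + pm_scale c (pm_unit k)) = (f p - h p) + pm_scale c (f (pm_unit k) - h (pm_unit k))"
  unfolding f h by (simp add: pm_scale_diff)
 then show ?case using aug_power_add[OF add(3) aug_power_scale[OF g[OF add(2)], of c]] by simp
qed

lemma DD_mono: "M <= N ==> x \<in> AG ==> DD N x - DD M x \<in> IG (Suc M)"
 by (rule galg_congI) (simp_all add: dil_mono[OF \<sigma>])

lemma DD_mult:
 assumes N: "1 <= N" and x: "x \<in> AG" and y: "y \<in> AG"
 shows "DD N (gmul G x y) - gmul G (DD N x) (DD N y) \<in> IG (Suc N)"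
proof (rule galg_congI[OF x])
 fix a assume a: "a \<in> carrier G"
 show "DD N (gmul G (pm_unit a) y) - gmul G (DD N (pm_unit a)) (DD N y) \<in> IG (Suc N)"
  by (rule galg_congI[OF y]) (simp_all add: pm_conv_add_right pm_conv_scale_right pm_conv_unit dil_mult[OF \<sigma> N a])
qed (simp_all add: pm_conv_add_left pm_conv_scale_left)

text \<open>Degree 1 is \<open>dil_minus_one\<close>, and multiplicativity carries it to products,
  one factor 2 for each factor. The bound k <= N keeps the error of multiplicativity inside
  \<open>IG (Suc k)\<close>.\<close>

lemma DD_power:
 assumes N: "1 <= N"
 shows "k <= N ==> x \<in> IG k ==> DD N x - pm_scale (2 ^ k) x \<in> IG (Suc k)"
proof (induction k arbitrary: x)
 case 0
 have "DD N x - x \<in> IG 1"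
 proof (rule galg_congI[of x "DD N" "%x. x"])
  fix g assume g: "g \<in> carrier G"
  show "DD N (pm_unit g) - pm_unit g \<in> IG 1"
   using aug_power_diff[OF dil_minus_one_in[OF \<sigma> g N] unit_minus_one[OF g]] by simp
 qed (use 0 aug_power_0 in simp_all)
 then show ?case by (simp only: power_0 pm_scale_one One_nat_def)
next
 case (Suc k)
 have one: "DD N y - pm_scale 2 y \<in> IG 2" if "y \<in> IG 1" for y
 proof -
  let ?S = "{y \<in> AG. DD N y - pm_scale 2 y \<in> IG 2}"
  define e where "e p = DD N p - pm_scale 2 p" for p
  have e: "e (p + q) = e p + e q" "e (pm_scale c p) = pm_scale c (e p)" "e 0 = 0" for p q c
   by (simp_all add: e_def pm_scale_diff mult.commute) (simp add: DD_def)
  have "subspace (group_hopf G) ?S"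
   unfolding e_def[symmetric] by (auto simp: subspace_def galg_simps aug_power_add aug_power_scale aug_power_zero e)
  moreover have "pm_unit g - pm_unit \<one> \<in> ?S" if g: "g \<in> carrier G" for g
  proof -
   have "dil \<sigma> N \<one> - pm_unit \<one> \<in> IG 2"
    by (rule aug_power_mono[OF _ dil_one[OF \<sigma>, of N]]) (use N in simp)
   from aug_power_diff[OF dil_minus_one[OF \<sigma> g N] this] show ?thesis
    using g by (simp add: galg_simps algebra_simps)
  qed
  ultimately show ?thesis using aug_ideal_span[OF that, of ?S] by blast
 qed
 from Suc.prems(2) show ?case
 proof (induction rule: aug_power_Suc_induct)
  case (prod u v)
  have v1: "v \<in> IG 1" using prod(2) unfolding aug_power_1 .
  note ug = aug_power_galg[OF prod(1)] and vg = aug_power_galg[OF v1]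
  note uI = Suc.IH[OF _ prod(1)] and vI = one[OF v1]
  have "(DD N v - pm_scale 2 v) + pm_scale 2 v \<in> IG 1"
   by (rule aug_power_add[OF aug_power_mono[OF _ vI] aug_power_scale[OF v1]]) simp
  then have Dv: "DD N v \<in> IG 1" by simp
  let ?a = "DD N (gmul G u v) - gmul G (DD N u) (DD N v)"
  let ?b = "gmul G (DD N u - pm_scale (2 ^ k) u) (DD N v)" and ?c = "gmul G (pm_scale (2 ^ k) u) (DD N v - pm_scale 2 v)"
  have "?a \<in> IG (Suc (Suc k))"
   by (rule aug_power_mono[OF _ DD_mult[OF N ug vg]]) (use Suc.prems(1) in simp)
  moreover have "?b \<in> IG (Suc (Suc k))" using aug_power_mult[OF uI Dv] Suc.prems(1) by simp
  moreover have "?c \<in> IG (Suc (Suc k))" using aug_power_mult[OF aug_power_scale[OF prod(1)] vI] by simp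
  ultimately have "?a + (?b + ?c) \<in> IG (Suc (Suc k))" by (intro aug_power_add)
  moreover have "?a + (?b + ?c) = DD N (gmul G u v) - pm_scale (2 ^ Suc k) (gmul G u v)"
   by (simp add: pm_conv_diff_left pm_conv_diff_right pm_conv_scale_left pm_conv_scale_right mult.commute)
  ultimately show ?case by simp
 next
  case (sum x y)
  have "DD N (x + y) - pm_scale (2 ^ Suc k) (x + y) = (DD N x - pm_scale (2 ^ Suc k) x) + (DD N y - pm_scale (2 ^ Suc k) y)" by simp
  then show ?case using aug_power_add[OF sum(3,4)] by (simp only:)
 qed
qed

text \<open>The transpose of \<open>DD\<close>. A form in \<open>Ofil N\<close> sees
  \<open>DD\<close> only modulo \<open>IG (Suc N)\<close>, so by \<open>Sig_val\<close> all
  sufficiently large orders give the same value.\<close>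

definition Sig where "Sig \<alpha> = (\<lambda>x\<in>AG. \<alpha> (DD (Suc (SOME N. \<alpha> \<in> Ofil N)) x))"

lemma Sig_val:
 assumes a: "\<alpha> \<in> Ofil N" and NM: "N <= M" and x: "x \<in> AG"
 shows "Sig \<alpha> x = \<alpha> (DD M x)"
proof -
 define L where "L = (SOME N. \<alpha> \<in> Ofil N)"
 have L: "\<alpha> \<in> Ofil L" unfolding L_def by (rule someI[of _ N]) (rule a)
 have M: "\<alpha> \<in> Ofil M" by (rule O_mono[OF NM a])
 have eq: "\<alpha> (DD (max M (Suc L)) x) = \<alpha> (DD K x)" if "\<alpha> \<in> Ofil K" "K <= max M (Suc L)" for K
  using O_kill[OF that(1) DD_mono[OF that(2) x]] form_diff[OF O_carrier[OF a] DD_galg[OF x] DD_galg[OF x]] by simp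
 show ?thesis
  using eq[OF M] eq[OF O_mono[OF _ L, of "Suc L"]] x by (simp add: Sig_def flip: L_def)
qed

text \<open>The error term of \<open>DD_power\<close> lies in \<open>IG (Suc N)\<close>, which the
  form kills. This is the eigenvalue 2^N on the graded piece of degree \<open>N\<close>.\<close>

lemma Sig_top: "\<alpha> \<in> Ofil N ==> x \<in> IG N ==> Sig \<alpha> x = 2 ^ N * \<alpha> x"
proof -
 assume a: "\<alpha> \<in> Ofil N" and x: "x \<in> IG N"
 note xg = aug_power_galg[OF x] and ac = O_carrier[OF a]
 have "\<alpha> (DD (Suc N) x - pm_scale (2 ^ N) x) = 0" by (rule O_kill[OF a DD_power[OF _ _ x]]) simp_all
 then show ?thesis
  using Sig_val[OF a _ xg, of "Suc N"] form_diff[OF ac DD_galg[OF xg] galg_simps(4)[OF xg]] form_scale[OF ac xg] by simp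
qed

lemma Sig_O: assumes a: "\<alpha> \<in> Ofil N" shows "Sig \<alpha> \<in> Ofil N"
proof (rule form_I)
 note v = Sig_val[OF a le_refl] and ac = O_carrier[OF a]
 show "Sig \<alpha> \<in> extensional (AG)" by (simp add: Sig_def)
 show "Sig \<alpha> (x + y) = Sig \<alpha> x + Sig \<alpha> y" if "x \<in> AG" "y \<in> AG" for x y
  using that by (simp add: v galg_simps form_add[OF ac] DD_galg)
 show "Sig \<alpha> (pm_scale c x) = c * Sig \<alpha> x" if "x \<in> AG" for c x
  using that by (simp add: v galg_simps form_scale[OF ac] DD_galg)
 show "Sig \<alpha> x = 0" if "x \<in> IG (Suc N)" for x
  using Sig_top[OF O_mono[OF _ a] that] O_kill[OF a that] by simp
qed

lemma Sig_closed: "\<alpha> \<in> carrier H ==> Sig \<alpha> \<in> carrier H"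
 using O_exhaust Sig_O O_carrier by blast

lemma Sig_linear: "Sig \<in> linear_maps H H"
proof (rule linI[OF Sig_closed])
 fix \<alpha> assume a: "\<alpha> \<in> carrier H"
 then obtain N where N: "\<alpha> \<in> Ofil N" using O_exhaust by blast
 show "Sig (c \<odot>\<^sub>H \<alpha>) = c \<odot>\<^sub>H Sig \<alpha>" for c
  by (rule form_eqI) (use a in "simp_all add: Sig_closed H_closed H_vals unit_galg Sig_val[OF N le_refl]
   Sig_val[OF O_scale[OF N] le_refl] dil_closed[OF \<sigma>]")
 fix \<beta> assume b: "\<beta> \<in> carrier H"
 obtain N where N: "\<alpha> \<in> Ofil N" "\<beta> \<in> Ofil N" using O_exhaust2[OF a b] by blast
 show "Sig (\<alpha> \<oplus>\<^sub>H \<beta>) = Sig \<alpha> \<oplus>\<^sub>H Sig \<beta>"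
  by (rule form_eqI) (use a b in "simp_all add: Sig_closed H_closed H_vals unit_galg Sig_val[OF N(1) le_refl]
   Sig_val[OF N(2) le_refl] Sig_val[OF O_add[OF N] le_refl] dil_closed[OF \<sigma>]")
qed

text \<open>Dual to \<open>dil_diag\<close>. The order N + N is used because the product of two
  forms of \<open>Ofil N\<close> lies in \<open>Ofil (N + N)\<close>.\<close>

lemma Sig_mult:
 assumes a: "\<alpha> \<in> carrier H" and b: "\<beta> \<in> carrier H"
 shows "Sig (\<alpha> \<otimes>\<^sub>H \<beta>) = Sig \<alpha> \<otimes>\<^sub>H Sig \<beta>"
proof (rule form_eqI[OF Sig_closed[OF H_mult_closed[OF a b]] H_mult_closed[OF Sig_closed[OF a] Sig_closed[OF b]]])
 fix g assume g: "g \<in> carrier G"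
 obtain N where N: "\<alpha> \<in> Ofil N" "\<beta> \<in> Ofil N" using O_exhaust2[OF a b] by blast
 note d = dil_closed[OF \<sigma> g, of "N + N"]
 have s: "Sig \<gamma> (pm_unit g) = \<gamma> (dil \<sigma> (N + N) g)" if "\<gamma> \<in> Ofil M" "M <= N + N" for \<gamma> M
  using Sig_val[OF that unit_galg[OF g]] by simp
 have "pair2 \<alpha> \<beta> (diag (dil \<sigma> (N + N) g)) = pair2 \<alpha> \<beta> (kron (dil \<sigma> (N + N) g) (dil \<sigma> (N + N) g))"
  using pair2_kill[OF N dil_diag[OF \<sigma> g]] by (simp add: pair2_def)
 then show "Sig (\<alpha> \<otimes>\<^sub>H \<beta>) (pm_unit g) = (Sig \<alpha> \<otimes>\<^sub>H Sig \<beta>) (pm_unit g)"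
  using s[OF N(1)] s[OF N(2)] s[OF O_mult[OF N]] d by (simp add: H_mult_unit Sig_closed a b g H_mult_val pair2_kron)
qed

text \<open>Dual to \<open>dil_mult\<close>: evaluating at g and h after applying \<open>Sig\<close>
  to both factors amounts to evaluating at the two dilated elements.\<close>

lemma Sig_comult:
 assumes a: "\<alpha> \<in> carrier H"
 shows "comult H (Sig \<alpha>) = tensor_map H 2 Sig (comult H \<alpha>)"
proof (rule comult_H_eqI[OF Sig_closed[OF a] linD(1)[OF tensor_map_linear[OF vspace_H vspace_H Sig_linear] comult_H(1)[OF a]]])
 interpret T: vspace "tensor_pow H 2" by (rule vspace_tensor_pow[OF vspace_H])
 fix g h assume gh: "g \<in> carrier G" "h \<in> carrier G"
 obtain M where M: "\<alpha> \<in> Ofil M" using O_exhaust[OF a] by blast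
 \<comment> \<open>The successor ensures \<open>1 <= N\<close>, which \<open>dil_mult\<close>
   requires.\<close>
 define N where "N = Suc M"
 have N: "\<alpha> \<in> Ofil N" "1 <= N" using O_mono[OF _ M, of N] by (simp_all add: N_def)
 note ug = unit_galg[OF gh(1)] and uh = unit_galg[OF gh(2)]
 note dg = dil_closed[OF \<sigma> gh(1), of N] and dh = dil_closed[OF \<sigma> gh(2), of N]
 have e: "set [pm_unit g, pm_unit h] <= AG" "length [pm_unit g, pm_unit h] = 2"
  and d: "set [dil \<sigma> N g, dil \<sigma> N h] <= AG" "length [dil \<sigma> N g, dil \<sigma> N h] = 2" using ug uh dg dh by auto
 note L = lin_comp[OF tensor_map_linear[OF vspace_H vspace_H Sig_linear] evs_linear[OF e]]
 obtain n :: nat and \<beta> \<gamma> where bg: "ALL i<n. \<beta> i \<in> Ofil N & \<gamma> i \<in> Ofil N"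
  "comult H \<alpha> = (\<Oplus>\<^bsub>tensor_pow H 2\<^esub>i\<in>{..<n}. pure_tensor H [\<beta> i, \<gamma> i])"
  using comult_H(3)[OF a N(1)] by (elim exE conjE) (rule that)
 have pc: "(%i. pure_tensor H [\<beta> i, \<gamma> i]) \<in> {..<n} \<rightarrow> carrier (tensor_pow H 2)"
 proof (rule Pi_I)
  fix i assume "i \<in> {..<n}"
  then have "\<beta> i \<in> carrier H" "\<gamma> i \<in> carrier H" using bg(1) O_carrier by blast+
  then show "pure_tensor H [\<beta> i, \<gamma> i] \<in> carrier (tensor_pow H 2)" by (intro pure_tensor_carrier) auto
 qed
 have "evs [pm_unit g, pm_unit h] (tensor_map H 2 Sig (comult H \<alpha>)) =
   (\<Sum>i<n. evs [pm_unit g, pm_unit h] (tensor_map H 2 Sig (pure_tensor H [\<beta> i, \<gamma> i])))"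
  unfolding bg(2) using lin_finsum[OF L T.vspace_axioms vspace_CC pc] by (simp add: finsum_CC)
 also have "... = (\<Sum>i<n. evs [dil \<sigma> N g, dil \<sigma> N h] (pure_tensor H [\<beta> i, \<gamma> i]))"
 proof (rule sum.cong[OF refl])
  fix i assume "i \<in> {..<n}"
  then have O: "\<beta> i \<in> Ofil N" "\<gamma> i \<in> Ofil N" using bg(1) by auto
  have p: "length [\<beta> i, \<gamma> i] = 2" "set [\<beta> i, \<gamma> i] <= carrier H" "length (map Sig [\<beta> i, \<gamma> i]) = 2" "set (map Sig [\<beta> i, \<gamma> i]) <= carrier H"
   using O O_carrier Sig_closed by auto
  show "evs [pm_unit g, pm_unit h] (tensor_map H 2 Sig (pure_tensor H [\<beta> i, \<gamma> i])) = evs [dil \<sigma> N g, dil \<sigma> N h] (pure_tensor H [\<beta> i, \<gamma> i])"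
   unfolding tensor_map_pure[OF vspace_H vspace_H Sig_linear p(1,2)] evs_pure[OF e p(3,4)] evs_pure[OF d p(1,2)]
   using Sig_val[OF O(1) le_refl ug] Sig_val[OF O(2) le_refl uh] by (simp add: evl_def)
 qed
 also have "... = evs [dil \<sigma> N g, dil \<sigma> N h] (comult H \<alpha>)"
  unfolding bg(2) using lin_finsum[OF evs_linear[OF d] T.vspace_axioms vspace_CC pc] by (simp add: finsum_CC)
 also have "... = \<alpha> (gmul G (dil \<sigma> N g) (dil \<sigma> N h))" by (rule comult_H(2)[OF a dg dh])
 also have "... = \<alpha> (dil \<sigma> N (g \<otimes> h))"
  using O_kill[OF N(1) dil_mult[OF \<sigma> N(2) gh]] form_diff[OF a dil_closed[OF \<sigma>] gmul_closed[OF dg dh]] gh by simp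
 also have "... = Sig \<alpha> (pm_unit (g \<otimes> h))"
  using Sig_val[OF N(1) le_refl unit_galg[OF m_closed[OF gh]]] by simp
 finally show "evs [pm_unit g, pm_unit h] (tensor_map H 2 Sig (comult H \<alpha>)) = Sig \<alpha> (pm_unit (g \<otimes> h))" .
qed

lemma hopf_dilation_H: "hopf_dilation H Sig"
proof (intro hopf_dilation.intro calg_H hopf_dilation_axioms.intro hopf_algebra_H)
 show "hopf_fil H (int n) <= hopf_fil H (int (Suc n))" for n unfolding hopf_fil_H using O_mono[of n "Suc n"] by auto
 show "EX n. \<alpha> \<in> hopf_fil H (int n)" if "\<alpha> \<in> carrier H" for \<alpha> unfolding hopf_fil_H by (rule O_exhaust[OF that])
 show "\<alpha> \<otimes>\<^sub>H \<beta> \<in> hopf_fil H (int (i + j))" if "\<alpha> \<in> hopf_fil H (int i)" "\<beta> \<in> hopf_fil H (int j)" for \<alpha> \<beta> i j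
  using that unfolding hopf_fil_H by (rule O_mult)
 show "\<one>\<^bsub>H\<^esub> \<in> hopf_fil H (int 0)" unfolding hopf_fil_H by (rule O_one)
 show "Sig \<in> linear_maps H H" by (rule Sig_linear)
 show "Sig \<alpha> \<ominus>\<^bsub>H\<^esub> 2 ^ n \<odot>\<^sub>H \<alpha> \<in> hopf_fil H (int n - 1)" if "\<alpha> \<in> hopf_fil H (int n)" for \<alpha> n
 proof -
  have a: "\<alpha> \<in> Ofil n" using that unfolding hopf_fil_H .
  note s = Sig_O[OF a] and k = O_scale[OF a, of "2 ^ n"]
  have m: "Sig \<alpha> \<ominus>\<^bsub>H\<^esub> 2 ^ n \<odot>\<^sub>H \<alpha> \<in> carrier H" by (rule O_carrier[OF Hv.subspace_minus[OF subspace_O s k]])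
  have z: "(Sig \<alpha> \<ominus>\<^bsub>H\<^esub> 2 ^ n \<odot>\<^sub>H \<alpha>) x = 0" if "x \<in> IG n" for x
   using Sig_top[OF a that] aug_power_galg[OF that] by (simp add: H_minus_val O_carrier[OF s] O_carrier[OF k] H_vals)
  show ?thesis
  proof (cases n)
   \<comment> \<open>The step below degree 0 is zero, so the eigenvector equation must hold exactly;
     it does, as \<open>IG 0\<close> is the whole group algebra.\<close>
   case 0
   have "Sig \<alpha> \<ominus>\<^bsub>H\<^esub> 2 ^ n \<odot>\<^sub>H \<alpha> = \<zero>\<^bsub>H\<^esub>"
    by (rule form_eqI[OF m H_closed(3)]) (use z 0 unit_galg aug_power_0 in "simp add: H_vals")
   then show ?thesis using 0 by (simp add: hopf_fil_neg)
  next
   case (Suc k)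
   then show ?thesis using m z hopf_fil_H[of k] by (simp add: Ofil_def)
  qed
 qed
 fix \<alpha> assume a: "\<alpha> \<in> carrier H"
 show "comult H (Sig \<alpha>) = tensor_map H 2 Sig (comult H \<alpha>)" by (rule Sig_comult[OF a])
 show "Sig (\<alpha> \<otimes>\<^sub>H \<beta>) = Sig \<alpha> \<otimes>\<^sub>H Sig \<beta>" if "\<beta> \<in> carrier H" for \<beta> by (rule Sig_mult[OF a that])
 obtain N where N: "\<alpha> \<in> Ofil N" using O_exhaust[OF a] by blast
 show "counit H (Sig \<alpha>) = counit H \<alpha>"
  using O_kill[OF N dil_one[OF \<sigma>]] form_diff[OF a dil_closed[OF \<sigma> one_closed] unit_galg[OF one_closed]]
   Sig_val[OF N le_refl unit_galg[OF one_closed]] by (simp add: H_ops(5))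
qed

end

theorem propositionD18:
 fixes G :: "('g, 'm) monoid_scheme"
 assumes "group G"
  and "finitely_generated G"
  and "filtered_formal_group G"
 shows "filtered_formal_hopf (dual_hopf G)"
proof -
 interpret fg_group G
  by (intro fg_group.intro group_square.intro fg_group_axioms.intro assms)
 obtain \<sigma> where \<sigma>: "dilation \<sigma>" using dilation_exists[OF assms(3)] ..
 interpret dilated_group G \<sigma>
  by (intro dilated_group.intro fg_group_axioms dilated_group_axioms.intro \<sigma>)
 show ?thesis by (rule hopf_dilation.filtered_formal[OF hopf_dilation_H])
qed

end
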